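(* Let $K$ be a number field and let $\varinjlim X$ denote the direct limit of the directed system formed by the galois objects of $\mathscr C_K$. There is a canonical isomorphism of $\Lambda$-rings $\varinjlim X\simeq K\otimes_{O_K}W^a_{O_K}(O_{\bar K})$. In particular, $W^a_{O_K}(O_{\bar K})$ is isomorphic to the direct limit of the maximal integral models of the galois objects of $\mathscr C_K$.
   Context: $O_K$ ring of integers, $P_K$ nonzero primes, $I_K$ monoid of nonzero ideals, $N\mathfrak p=\#(O_K/\mathfrak p)$, $G_K=\mathrm{Gal}(\bar K/K)$. For a subring $A\subseteq\bar K$ containing $O_K$: $A^{I_K}$ product ring (diagonal $O_K$-algebra), $\psi_{\mathfrak a}(\xi)_{\mathfrak b}=\xi_{\mathfrak a\mathfrak b}$; $U_0(A)=A^{I_K}$, $U_{n+1}(A)=\{\xi\in U_n(A):\psi_{\mathfrak p}\xi-\xi^{N\mathfrak p}\in\mathfrak pU_n(A)\ \forall\mathfrak p\}$, $W_{O_K}(A)=\bigcap_nU_n(A)$; $W^a_{O_K}(A)$ = elements of $W_{O_K}(A)$ integral over $O_K$; $K\otimes_{O_K}W^a_{O_K}(O_{\bar K})$ is a $\Lambda$-ring via the $\psi_{\mathfrak p}$. A finite étale $\Lambda$-ring over $K$ is a finite étale $K$-algebra $X$ with pairwise commuting $K$-algebra endomorphisms $\psi_{\mathfrak p}$ ($\mathfrak p\in P_K$); $\psi_{\mathfrak a}$ is the corresponding composite for $\mathfrak a\in I_K$. An integral model is an $O_K$-subalgebra $A\subseteq X$ finite over $O_K$ with $K\otimes A=X$,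 $\psi_{\mathfrak p}(A)\subseteq A$ and $\psi_{\mathfrak p}(x)\equiv x^{N\mathfrak p}\bmod\mathfrak pA$ for all $x\in A$, $\mathfrak p\in P_K$; the maximal integral model is the largest one. $\mathscr C_K$ is the category of finite étale $\Lambda$-rings over $K$ having an integral model, with $\Lambda$-ring homomorphisms. For $X\in\mathscr C_K$, $F_K(X)=\mathrm{Hom}_K(X,\bar K)$; $X$ is galois if there is $s_0\in F_K(X)$ (a root) such that every $s\in F_K(X)$ equals $\sigma\circ s_0\circ\psi_{\mathfrak a}$ for some $\sigma\in G_K$, $\mathfrak a\in I_K$. *)

theory Defs
  imports
    "HOL-Algebra.Algebraic_Closure_Type"
    "HOL-Algebra.Chinese_Remainder"
    "HOL-Algebra.Ideal_Product"
    "HOL-Library.FuncSet"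
begin

section \<open>Number fields, ideals and norms\<close>

class number_field = field_char_0 +
  assumes finite_over_rat:
    "\<exists>B. finite B \<and> (\<forall>x. \<exists>c :: 'a \<Rightarrow> rat. x = (\<Sum>b\<in>B. of_rat (c b) * b))"

text \<open>
  Throughout, the field \<open>K\<close> is the type \<open>'k\<close>, its algebraic closure is the library type
  \<open>'k alg_closure\<close>, and the embedding of \<open>K\<close> is \<^const>\<open>to_ac\<close>. The following definition gives
  both the ring of integers of \<open>K\<close> and that of its algebraic closure.
\<close>

definition ring_of_integers :: "'a::field ring" where
  "ring_of_integers = ring_of_type_algebra\<lparr>carrier := {x. algebraic_int x}\<rparr>"

definition nz_ideals :: "'k::field set set" where
  "nz_ideals = {\<aa>. ideal \<aa> ring_of_integers \<and> \<aa> \<noteq> {0}}"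

definition nz_primes :: "'k::field set set" where
  "nz_primes = {\<pp>. primeideal \<pp> ring_of_integers \<and> \<pp> \<noteq> {0}}"

definition abs_norm :: "'k::field set \<Rightarrow> nat" where
  "abs_norm \<pp> = card (carrier (ring_of_integers Quot \<pp>))"

definition galois_group :: "('k::field alg_closure \<Rightarrow> 'k alg_closure) set" where
  "galois_group = {\<sigma> \<in> ring_iso ring_of_type_algebra ring_of_type_algebra.
     \<forall>k. \<sigma> (to_ac k) = to_ac k}"


section \<open>Rings with scalars and operators\<close>

text \<open>
  A commutative ring with a structure map \<open>scal\<close> and operators \<open>psi\<close> indexed by ideals.
  The same record serves for algebras over \<open>K\<close> and over its ring of integers; in the
  latter case only the values of \<open>scal\<close> on integers are meaningful. Values of \<open>psi\<close> at sets
  that are not nonzero primes (for ghost rings: not nonzero ideals) are irrelevant.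
\<close>

record ('k, 'u) lring = "'u ring" +
  scal :: "'k \<Rightarrow> 'u"
  psi :: "'k set \<Rightarrow> 'u \<Rightarrow> 'u"

text \<open>The ideal \<open>\<pp>A\<close> of a subring \<open>A\<close> of \<open>E\<close>.\<close>

definition ext_ideal :: "('k, 'u) lring \<Rightarrow> 'u set \<Rightarrow> 'k set \<Rightarrow> 'u set" where
  "ext_ideal E A \<pp> = genideal (E\<lparr>carrier := A\<rparr>) (scal E ` \<pp>)"

definition frobenius_lift :: "('k::field, 'u) lring \<Rightarrow> 'u set \<Rightarrow> 'k set \<Rightarrow> 'u \<Rightarrow> bool" where
  "frobenius_lift E A \<pp> x \<longleftrightarrow> psi E \<pp> x \<ominus>\<^bsub>E\<^esub> x [^]\<^bsub>E\<^esub> abs_norm \<pp> \<in> ext_ideal E A \<pp>"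

definition integral_elem :: "('k::field, 'u) lring \<Rightarrow> 'u \<Rightarrow> bool" where
  "integral_elem E x \<longleftrightarrow> (\<exists>n. \<exists>c :: nat \<Rightarrow> 'k. (\<forall>i<n. algebraic_int (c i)) \<and>
     x [^]\<^bsub>E\<^esub> n \<oplus>\<^bsub>E\<^esub> (\<Oplus>\<^bsub>E\<^esub>i\<in>{..<n}. scal E (c i) \<otimes>\<^bsub>E\<^esub> x [^]\<^bsub>E\<^esub> i) = \<zero>\<^bsub>E\<^esub>)"

text \<open>Homomorphisms of \<open>\<Lambda>\<close>-rings, linear over the scalars in \<open>S\<close>.\<close>

definition lambda_hom ::
    "'k::field set \<Rightarrow> ('k, 'u) lring \<Rightarrow> ('k, 'v) lring \<Rightarrow> ('u \<Rightarrow> 'v) set" where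
  "lambda_hom S E F = {f \<in> ring_hom E F \<inter> extensional (carrier E).
     (\<forall>k\<in>S. f (scal E k) = scal F k) \<and>
     (\<forall>\<pp>\<in>nz_primes. \<forall>x\<in>carrier E. f (psi E \<pp> x) = psi F \<pp> (f x))}"

definition lambda_iso ::
    "'k::field set \<Rightarrow> ('k, 'u) lring \<Rightarrow> ('k, 'v) lring \<Rightarrow> ('u \<Rightarrow> 'v) set" where
  "lambda_iso S E F = {f \<in> lambda_hom S E F. bij_betw f (carrier E) (carrier F)}"


section \<open>Extension of scalars from integers to the field\<close>

text \<open>
  A list of pairs stands for the formal sum of the corresponding pure tensors. The relation is
  the congruence of formal sums generated by commutativity of addition and the bilinearity and
  balancing relations. Since \<open>(- k, m)\<close> is then inverse to \<open>(k, m)\<close>, its quotient is the tensor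
  product of abelian groups over the ring of integers, not merely a monoid.
\<close>

inductive_set tensor_rel :: "('k::field, 'u) lring \<Rightarrow> (('k \<times> 'u) list \<times> ('k \<times> 'u) list) set"
  for M where
  refl: "set l \<subseteq> UNIV \<times> carrier M \<Longrightarrow> (l, l) \<in> tensor_rel M"
| sym: "(l, m) \<in> tensor_rel M \<Longrightarrow> (m, l) \<in> tensor_rel M"
| trans: "(l, m) \<in> tensor_rel M \<Longrightarrow> (m, n) \<in> tensor_rel M \<Longrightarrow> (l, n) \<in> tensor_rel M"
| append: "(l, l') \<in> tensor_rel M \<Longrightarrow> (m, m') \<in> tensor_rel M \<Longrightarrow> (l @ m, l' @ m') \<in> tensor_rel M"
| commute: "set l \<subseteq> UNIV \<times> carrier M \<Longrightarrow> set m \<subseteq> UNIV \<times> carrier M \<Longrightarrow>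
    (l @ m, m @ l) \<in> tensor_rel M"
| zero: "x \<in> carrier M \<Longrightarrow> ([(0, x)], []) \<in> tensor_rel M"
| add_left: "x \<in> carrier M \<Longrightarrow> ([(k + k', x)], [(k, x), (k', x)]) \<in> tensor_rel M"
| add_right: "x \<in> carrier M \<Longrightarrow> y \<in> carrier M \<Longrightarrow>
    ([(k, x \<oplus>\<^bsub>M\<^esub> y)], [(k, x), (k, y)]) \<in> tensor_rel M"
| balance: "x \<in> carrier M \<Longrightarrow> algebraic_int r \<Longrightarrow>
    ([(k * r, x)], [(k, scal M r \<otimes>\<^bsub>M\<^esub> x)]) \<in> tensor_rel M"

definition base_change :: "('k::field, 'u) lring \<Rightarrow> ('k, ('k \<times> 'u) list set) lring" where
  "base_change M = \<lparr>
     carrier = {l. set l \<subseteq> UNIV \<times> carrier M} // tensor_rel M,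
     monoid.mult = (\<lambda>s t. \<Union>l\<in>s. \<Union>m\<in>t.
       tensor_rel M `` {[(k * k', x \<otimes>\<^bsub>M\<^esub> y). (k, x) \<leftarrow> l, (k', y) \<leftarrow> m]}),
     one = tensor_rel M `` {[(1, \<one>\<^bsub>M\<^esub>)]},
     ring.zero = tensor_rel M `` {[]},
     add = (\<lambda>s t. \<Union>l\<in>s. \<Union>m\<in>t. tensor_rel M `` {l @ m}),
     scal = (\<lambda>k. tensor_rel M `` {[(k, \<one>\<^bsub>M\<^esub>)]}),
     psi = (\<lambda>\<pp> s. \<Union>l\<in>s. tensor_rel M `` {[(k, psi M \<pp> x). (k, x) \<leftarrow> l]})\<rparr>"

text \<open>
  The map from \<open>base_change M\<close> to a \<open>K\<close>-algebra \<open>E\<close> containing \<open>M\<close> that sends \<open>k \<otimes> x\<close> to \<open>kx\<close>.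
  All lists representing a tensor have the same value.
\<close>

definition scalar_mult_map :: "('k, 'u) lring \<Rightarrow> ('k \<times> 'u) list set \<Rightarrow> 'u" where
  "scalar_mult_map E t = the_elem
     ((\<lambda>l. foldr (\<lambda>(k, x) s. (scal E k \<otimes>\<^bsub>E\<^esub> x) \<oplus>\<^bsub>E\<^esub> s) l \<zero>\<^bsub>E\<^esub>) ` t)"


section \<open>Witt vectors\<close>

text \<open>
  The product ring of copies of \<open>A\<close> indexed by the nonzero ideals; its \<open>psi\<close> is defined for all
  nonzero ideals.
\<close>

definition ghost_ring ::
    "'k::field alg_closure set \<Rightarrow> ('k, 'k set \<Rightarrow> 'k alg_closure) lring" where
  "ghost_ring A = \<lparr>
     carrier = nz_ideals \<rightarrow>\<^sub>E A,
     monoid.mult = (\<lambda>\<xi> \<zeta>. \<lambda>\<aa>\<in>nz_ideals. \<xi> \<aa> * \<zeta> \<aa>),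
     one = (\<lambda>\<aa>\<in>nz_ideals. 1),
     ring.zero = (\<lambda>\<aa>\<in>nz_ideals. 0),
     add = (\<lambda>\<xi> \<zeta>. \<lambda>\<aa>\<in>nz_ideals. \<xi> \<aa> + \<zeta> \<aa>),
     scal = (\<lambda>k. \<lambda>\<aa>\<in>nz_ideals. to_ac k),
     psi = (\<lambda>\<aa> \<xi>. \<lambda>\<bb>\<in>nz_ideals. \<xi> (\<aa> \<cdot>\<^bsub>ring_of_integers\<^esub> \<bb>))\<rparr>"

primrec witt_approx ::
    "'k::field alg_closure set \<Rightarrow> nat \<Rightarrow> ('k set \<Rightarrow> 'k alg_closure) set" where
  "witt_approx A 0 = carrier (ghost_ring A)"
| "witt_approx A (Suc n) = {\<xi> \<in> witt_approx A n.
     \<forall>\<pp>\<in>nz_primes. frobenius_lift (ghost_ring A) (witt_approx A n) \<pp> \<xi>}"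

definition witt_vectors :: "'k::field alg_closure set \<Rightarrow> ('k set \<Rightarrow> 'k alg_closure) set" where
  "witt_vectors A = (\<Inter>n. witt_approx A n)"

definition integral_witt_ring ::
    "'k::field alg_closure set \<Rightarrow> ('k, 'k set \<Rightarrow> 'k alg_closure) lring" where
  "integral_witt_ring A =
     (ghost_ring A)\<lparr>carrier := {\<xi> \<in> witt_vectors A. integral_elem (ghost_ring A) \<xi>}\<rparr>"


section \<open>Finite \'etale \<open>\<Lambda>\<close>-rings\<close>

text \<open>
  A finite \'etale algebra is one that is isomorphic to a finite product of finite separable field
  extensions. Every such extension is isomorphic to a subfield of the algebraic closure.
\<close>

definition finite_separable_extension :: "'k::field alg_closure set \<Rightarrow> bool" where
  "finite_separable_extension L \<longleftrightarrow>
     subfield L ring_of_type_algebra \<and> range to_ac \<subseteq> L \<and>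
     ring.finite_dimension ring_of_type_algebra (range to_ac) L \<and>
     (\<forall>x\<in>L. \<exists>p :: 'k Polynomial.poly.
        coprime p (pderiv p) \<and> poly (map_poly to_ac p) x = 0)"

definition finite_etale :: "('k::field, 'u) lring \<Rightarrow> bool" where
  "finite_etale E \<longleftrightarrow> cring E \<and> scal E \<in> ring_hom ring_of_type_algebra E \<and>
     (\<exists>Ls. (\<forall>L\<in>set Ls. finite_separable_extension L) \<and>
        (\<exists>f \<in> ring_iso E (RDirProd_list (map (\<lambda>L. ring_of_type_algebra\<lparr>carrier := L\<rparr>) Ls)).
           \<forall>k. f (scal E k) = replicate (length Ls) (to_ac k)))"

definition finite_etale_lambda :: "('k::field, 'u) lring \<Rightarrow> bool" where
  "finite_etale_lambda E \<longleftrightarrow> finite_etale E \<and>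
     (\<forall>\<pp>\<in>nz_primes. psi E \<pp> \<in> ring_hom E E \<and> (\<forall>k. psi E \<pp> (scal E k) = scal E k)) \<and>
     (\<forall>\<pp>\<in>nz_primes. \<forall>\<qq>\<in>nz_primes. \<forall>x\<in>carrier E.
        psi E \<pp> (psi E \<qq> x) = psi E \<qq> (psi E \<pp> x))"

text \<open>
  The composite operator of an ideal, through a factorization into primes; it does not depend on
  the factorization, which is unique up to order.
\<close>

definition psi_ideal :: "('k::field, 'u) lring \<Rightarrow> 'k set \<Rightarrow> 'u \<Rightarrow> 'u" where
  "psi_ideal E \<aa> = foldr (psi E) (SOME ps. set ps \<subseteq> nz_primes \<and>
     foldr (ideal_prod ring_of_integers) ps (carrier ring_of_integers) = \<aa>)"

definition integral_model :: "('k::field, 'u) lring \<Rightarrow> 'u set \<Rightarrow> bool" where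
  "integral_model E A \<longleftrightarrow>
     subring A E \<and> scal E ` carrier ring_of_integers \<subseteq> A \<and>
     (\<exists>B\<subseteq>A. finite B \<and> (\<forall>x\<in>A. \<exists>c \<in> B \<rightarrow> carrier ring_of_integers.
        x = (\<Oplus>\<^bsub>E\<^esub>b\<in>B. scal E (c b) \<otimes>\<^bsub>E\<^esub> b))) \<and>
     bij_betw (scalar_mult_map E) (carrier (base_change (E\<lparr>carrier := A\<rparr>))) (carrier E) \<and>
     (\<forall>\<pp>\<in>nz_primes. psi E \<pp> ` A \<subseteq> A \<and> (\<forall>x\<in>A. frobenius_lift E A \<pp> x))"

definition maximal_integral_model :: "('k::field, 'u) lring \<Rightarrow> ('k, 'u) lring" where
  "maximal_integral_model E = E\<lparr>carrier := (GREATEST A. integral_model E A)\<rparr>"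

definition points :: "('k::field, 'u) lring \<Rightarrow> ('u \<Rightarrow> 'k alg_closure) set" where
  "points E = {s \<in> ring_hom E ring_of_type_algebra \<inter> extensional (carrier E).
     \<forall>k. s (scal E k) = to_ac k}"

definition is_root :: "('k::field, 'u) lring \<Rightarrow> ('u \<Rightarrow> 'k alg_closure) \<Rightarrow> bool" where
  "is_root E s\<^sub>0 \<longleftrightarrow> s\<^sub>0 \<in> points E \<and>
     (\<forall>s\<in>points E. \<exists>\<sigma>\<in>galois_group. \<exists>\<aa>\<in>nz_ideals. \<forall>x\<in>carrier E.
        s x = \<sigma> (s\<^sub>0 (psi_ideal E \<aa> x)))"


section \<open>The directed system of galois objects\<close>

definition limit_rel :: "'i set \<Rightarrow> ('i \<Rightarrow> 'i \<Rightarrow> bool) \<Rightarrow> ('i \<Rightarrow> ('k, 'u) lring) \<Rightarrow>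
    ('i \<Rightarrow> 'i \<Rightarrow> 'u \<Rightarrow> 'u) \<Rightarrow> (('i \<times> 'u) \<times> ('i \<times> 'u)) set" where
  "limit_rel I leq E t = {((i, x), (j, y)).
     i \<in> I \<and> x \<in> carrier (E i) \<and> j \<in> I \<and> y \<in> carrier (E j) \<and>
     (\<exists>k\<in>I. leq i k \<and> leq j k \<and> t i k x = t j k y)}"

text \<open>
  The direct limit of the \<open>E i\<close> along transition maps \<open>t i j\<close> (for \<open>leq i j\<close>), as a quotient of
  the disjoint union. Each operation is computed in a stage above its arguments; for a directed
  system every union below is a union of equal classes.
\<close>

definition direct_limit :: "'i set \<Rightarrow> ('i \<Rightarrow> 'i \<Rightarrow> bool) \<Rightarrow> ('i \<Rightarrow> ('k, 'u) lring) \<Rightarrow>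
    ('i \<Rightarrow> 'i \<Rightarrow> 'u \<Rightarrow> 'u) \<Rightarrow> ('k, ('i \<times> 'u) set) lring" where
  "direct_limit I leq E t = (let cls = (\<lambda>i x. limit_rel I leq E t `` {(i, x)}) in \<lparr>
     carrier = (SIGMA i:I. carrier (E i)) // limit_rel I leq E t,
     monoid.mult = (\<lambda>a b. \<Union>(i, x)\<in>a. \<Union>(j, y)\<in>b. \<Union>k\<in>{k\<in>I. leq i k \<and> leq j k}.
       cls k (t i k x \<otimes>\<^bsub>E k\<^esub> t j k y)),
     one = (\<Union>i\<in>I. cls i \<one>\<^bsub>E i\<^esub>),
     ring.zero = (\<Union>i\<in>I. cls i \<zero>\<^bsub>E i\<^esub>),
     add = (\<lambda>a b. \<Union>(i, x)\<in>a. \<Union>(j, y)\<in>b. \<Union>k\<in>{k\<in>I. leq i k \<and> leq j k}.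
       cls k (t i k x \<oplus>\<^bsub>E k\<^esub> t j k y)),
     scal = (\<lambda>c. \<Union>i\<in>I. cls i (scal (E i) c)),
     psi = (\<lambda>\<pp> a. \<Union>(i, x)\<in>a. cls i (psi (E i) \<pp> x))\<rparr>)"

text \<open>
  The galois objects with a root. As a root generates all points, there is at most one homomorphism
  between two objects compatible with the roots; it is the transition map. All objects
  whose underlying set lies in the type \<open>'u\<close> occur; as \<open>K\<close> is countable, every object of the
  category has an isomorphic copy in \<open>'u\<close> as soon as \<open>'u\<close> is infinite.
\<close>

type_synonym ('k, 'u) rooted = "('k, 'u) lring \<times> ('u \<Rightarrow> 'k alg_closure)"

definition galois_objects :: "('k::field, 'u) rooted set" where
  "galois_objects = {(E, s). finite_etale_lambda E \<and> (\<exists>A. integral_model E A) \<and> is_root E s}"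

definition rooted_hom :: "('k::field, 'u) rooted \<Rightarrow> ('k, 'u) rooted \<Rightarrow> ('u \<Rightarrow> 'u) set" where
  "rooted_hom P Q = {f \<in> lambda_hom UNIV (fst P) (fst Q).
     \<forall>x\<in>carrier (fst P). snd Q (f x) = snd P x}"

definition rooted_le :: "('k::field, 'u) rooted \<Rightarrow> ('k, 'u) rooted \<Rightarrow> bool" where
  "rooted_le P Q \<longleftrightarrow> rooted_hom P Q \<noteq> {}"

definition rooted_map :: "('k::field, 'u) rooted \<Rightarrow> ('k, 'u) rooted \<Rightarrow> 'u \<Rightarrow> 'u" where
  "rooted_map P Q = (THE f. f \<in> rooted_hom P Q)"

definition galois_limit :: "('k::field, (('k, 'u) rooted \<times> 'u) set) lring" where
  "galois_limit = direct_limit galois_objects rooted_le fst rooted_map"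

definition galois_inj :: "('k::field, 'u) rooted \<Rightarrow> 'u \<Rightarrow> (('k, 'u) rooted \<times> 'u) set" where
  "galois_inj P x = limit_rel galois_objects rooted_le fst rooted_map `` {(P, x)}"

definition galois_model_limit :: "('k::field, (('k, 'u) rooted \<times> 'u) set) lring" where
  "galois_model_limit =
     direct_limit galois_objects rooted_le (\<lambda>P. maximal_integral_model (fst P)) rooted_map"

end

theory Submission
  imports Defs "Jordan_Normal_Form.Schur_Decomposition" "HOL-Library.Countable_Set"
begin

text \<open>
  For a galois object \<open>X\<close> with root \<open>s\<close>, the map sending \<open>x\<close> to the family \<open>s (\<psi>\<^sub>a x)\<close> is an injective
  homomorphism of \<open>\<Lambda>\<close>-rings into the ghost ring, because the root generates all points. An integral
  model consists of integral elements satisfying the Frobenius congruences, so its image lies in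
  \<open>W\<^sup>a\<close>, and the maximal integral model is the preimage of \<open>W\<^sup>a\<close>. A morphism of rooted objects exists
  exactly when the images are contained in one another. It therefore suffices that the images form a
  directed family with union \<open>K \<otimes> W\<^sup>a\<close>.

  For this one needs that an element \<open>\<xi>\<close> of \<open>W\<^sup>a\<close> has finitely many translates under all \<open>\<psi>\<^sub>a\<close>. It has
  finitely many values. At almost all primes \<open>p\<close> distinct values are incongruent modulo \<open>p\<close>, so that \<open>\<psi>\<^sub>p\<close>
  acts on \<open>\<xi>\<close> through a map of the finite set of values. At the remaining primes the iterates of
  \<open>\<psi>\<^sub>p\<close> are eventually periodic modulo every power of \<open>p\<close>, hence eventually periodic.
  Conversely, given a finite set \<open>Z\<close> stable under the \<open>\<psi>\<^sub>p\<close> and a finite extension \<open>L\<close> of \<open>K\<close>, the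
  elements of \<open>K \<otimes> W\<^sup>a\<close> with values in \<open>L\<close> that are constant on ideals not separated by \<open>Z\<close> form a
  galois object: its points are conjugates of evaluations at ideals. As \<open>K\<close> is countable, this object
  has a copy in any infinite type.
\<close>

section \<open>Algebraic integers\<close>

text \<open>Congruences modulo pA are unwieldy in the rings at hand, which are infinite products or
  rings of integers of infinite extensions. Since p is invertible, y lies in pA exactly if \<beta> y
  lies in A for every \<beta> in the fractional ideal \<open>prime_inv p\<close>. All congruences
  take this form, so no prime above p and no localization is ever chosen. In particular the
  Frobenius defect of an element of W^a may be multiplied by \<beta> without leaving W^a, because
  the intersection over all levels absorbs the loss of one level. This drives the induction on
  powers of p at the bad primes, where \<psi>_p need not be determined by the values. The tensor
  product with K is handled as a subring of the full product over the algebraic closure: formal sums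
  are separated by their values, each having a single positive integer as denominator. Finite
  generation of the maximal integral model comes from the trace form of a finite extension of the
  rationals that contains all values.\<close>

interpretation zmod: Modules.module "\<lambda>(z::int) (x::'a::comm_ring_1). of_int z * x"
  by standard (auto simp: algebra_simps)

interpretation qvs: Vector_Spaces.vector_space "\<lambda>(q::rat) (x::'a::field_char_0). of_rat q * x"
  by standard (auto simp: algebra_simps of_rat_add of_rat_mult)

lemma zmod_span_mult_closed:
  assumes "\<And>b. b \<in> B \<Longrightarrow> x * b \<in> zmod.span C" "y \<in> zmod.span B"
  shows "x * y \<in> zmod.span C"
  using assms(2)
proof (induction rule: zmod.span_induct_alt)
  case base
  show ?case by (simp add: zmod.span_zero)
next
  case (step c b y)
  have "x * (of_int c * b + y) = of_int c * (x * b) + x * y"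
    by (simp add: algebra_simps)
  then show ?case
    using step assms(1) by (metis zmod.span_add zmod.span_scale)
qed

text \<open>The determinant trick. Expressing each \<open>x * b\<close> in the generators gives an
  integer matrix with the list of generators as an eigenvector for \<open>x\<close>; a nonzero
  generator makes this vector nonzero. So \<open>x\<close> is a root of the characteristic
  polynomial, which is monic with integer coefficients.\<close>

lemma algebraic_int_if_span_stable:
  fixes x :: "'a::field_char_0"
  assumes fin: "finite B" and nz: "\<exists>b\<in>B. b \<noteq> 0"
    and stable: "\<And>b. b \<in> B \<Longrightarrow> x * b \<in> zmod.span B"
  shows "algebraic_int x"
proof -
  obtain bs where bs: "set bs = B" "distinct bs"
    using finite_distinct_list[OF fin] by blast
  define n where "n = length bs"
  have bij: "bij_betw ((!) bs) {..<n} B"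
    using bij_betw_nth[OF bs(2)] bs(1) n_def by auto
  have "\<exists>c. x * b = (\<Sum>b'\<in>B. of_int (c b') * b')" if "b \<in> B" for b
    using stable[OF that] unfolding zmod.span_finite[OF fin] by auto
  then obtain C :: "'a \<Rightarrow> 'a \<Rightarrow> int"
    where C: "\<And>b. b \<in> B \<Longrightarrow> x * b = (\<Sum>b'\<in>B. of_int (C b b') * b')"
    by metis
  define A where "A = mat n n (\<lambda>(i, j). C (bs ! i) (bs ! j))"
  define A' where "A' = map_mat (of_int :: int \<Rightarrow> 'a) A"
  define v where "v = vec n (\<lambda>i. bs ! i)"
  have A: "A \<in> carrier_mat n n" "A' \<in> carrier_mat n n"
    by (auto simp: A_def A'_def)
  have "A' *\<^sub>v v = x \<cdot>\<^sub>v v"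
  proof (rule eq_vecI)
    fix i assume "i < dim_vec (x \<cdot>\<^sub>v v)"
    then have i: "i < n" by (simp add: v_def)
    have "(A' *\<^sub>v v) $ i = (\<Sum>j\<in>{..<n}. of_int (C (bs ! i) (bs ! j)) * bs ! j)"
      using i by (auto simp: A'_def A_def v_def scalar_prod_def atLeast0LessThan intro!: sum.cong)
    also have "\<dots> = (\<Sum>b'\<in>B. of_int (C (bs ! i) b') * b')"
      by (rule sum.reindex_bij_betw[OF bij, of "\<lambda>b'. of_int (C (bs ! i) b') * b'"])
    also have "\<dots> = x * bs ! i"
      using C[of "bs ! i"] i bs(1) n_def by auto
    finally show "(A' *\<^sub>v v) $ i = (x \<cdot>\<^sub>v v) $ i"
      using i by (simp add: v_def)
  qed (use A in \<open>auto simp: v_def\<close>)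
  moreover have "v \<noteq> 0\<^sub>v n"
  proof
    assume "v = 0\<^sub>v n"
    then have "bs ! i = 0" if "i < n" for i
      using that by (metis index_vec index_zero_vec(1) v_def)
    with nz bs(1) n_def show False by (metis in_set_conv_nth)
  qed
  moreover have "v \<in> carrier_vec n" by (simp add: v_def)
  ultimately have "eigenvalue A' x"
    unfolding eigenvalue_def eigenvector_def using A by (intro exI[of _ v]) auto
  then have "poly (char_poly A') x = 0"
    using eigenvalue_root_char_poly[OF A(2)] by blast
  moreover have "char_poly A' = map_poly of_int (char_poly A)"
    unfolding A'_def by (rule of_int_hom.char_poly_hom[OF A(1)])
  ultimately show ?thesis
    using degree_monic_char_poly[OF A(1)]
    unfolding algebraic_int_altdef_ipoly by (intro exI[of _ "char_poly A"]) auto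
qed

text \<open>The products of \<open>x ^ i\<close>, for \<open>i < n\<close>, with the old generators
  suffice, as the relation rewrites \<open>x ^ n\<close>. Its coefficients only have to act on
  \<open>B\<close>, so relations over algebraic integers are covered as well.\<close>

lemma zmod_span_adjoin:
  fixes x :: "'a::comm_ring_1"
  assumes "finite B" "1 \<in> B"
    and S: "\<And>s b. s \<in> S \<Longrightarrow> b \<in> B \<Longrightarrow> s * b \<in> zmod.span B"
    and c: "\<And>i. i < n \<Longrightarrow> c i \<in> S" and x: "x ^ n = - (\<Sum>i<n. c i * x ^ i)"
  shows "\<exists>B'. finite B' \<and> 1 \<in> B' \<and> (\<forall>s\<in>insert x S. \<forall>b\<in>B'. s * b \<in> zmod.span B')"
proof (cases "n = 0")
  case True
  \<comment> \<open>With \<open>n = 0\<close> the relation has an empty right side, so the ring is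
    trivial.\<close>
  then have "(1::'a) = 0" using x by simp
  then have "(y::'a) = 0" for y by (metis mult_1_left mult_zero_left)
  then show ?thesis
    by (intro exI[of _ "{1}"]) (metis finite.emptyI finite.insertI singletonI zmod.span_zero)
next
  case False
  define B' where "B' = (\<lambda>(i, b). x ^ i * b) ` ({..<n} \<times> B)"
  have B': "finite B'" "1 \<in> B'"
    using assms(1,2) False by (force simp: B'_def image_iff)+
  have mem: "x ^ i * y \<in> zmod.span B'" if "i < n" "y \<in> zmod.span B" for i y
    by (rule zmod_span_mult_closed[OF _ that(2)]) (use that in \<open>auto simp: B'_def intro!: zmod.span_base\<close>)
  have "s * b \<in> zmod.span B'" if s: "s \<in> insert x S" and b: "b \<in> B'" for s b
  proof -
    obtain i b' where b: "b = x ^ i * b'" "i < n" "b' \<in> B"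
      using b by (auto simp: B'_def)
    show ?thesis
    proof (cases "s \<in> S")
      case True
      then have "x ^ i * (s * b') \<in> zmod.span B'" using mem b S by blast
      then show ?thesis by (simp add: b algebra_simps)
    next
      case False
      with s have sx: "s = x" by auto
      show ?thesis
      proof (cases "Suc i < n")
        case True
        then have "x ^ Suc i * b' \<in> zmod.span B'" using mem b(3) zmod.span_base by blast
        then show ?thesis by (simp add: sx b algebra_simps)
      next
        case False
        then have n: "n = Suc i" using b by simp
        have "s * b = x ^ n * b'" by (simp add: sx b n algebra_simps)
        also have "\<dots> = - (\<Sum>i<n. x ^ i * (c i * b'))"
          unfolding x by (simp add: sum_distrib_left sum_distrib_right algebra_simps)
        also have "\<dots> \<in> zmod.span B'"
          using mem c S b(3) by (intro zmod.span_neg zmod.span_sum) auto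
        finally show ?thesis .
      qed
    qed
  qed
  with B' show ?thesis by blast
qed

lemma algebraic_int_monic_relation:
  fixes x :: "'a::field_char_0"
  assumes "algebraic_int x"
  obtains n and c :: "nat \<Rightarrow> int" where "n > 0" "x ^ n = - (\<Sum>i<n. of_int (c i) * x ^ i)"
proof -
  obtain p :: "int Polynomial.poly" where p: "poly (map_poly of_int p) x = 0" "Polynomial.lead_coeff p = 1"
    using assms unfolding algebraic_int_altdef_ipoly by blast
  define n where "n = Polynomial.degree p"
  have "0 = (\<Sum>i\<le>n. of_int (Polynomial.coeff p i) * x ^ i)"
    using p(1) by (simp add: poly_altdef n_def)
  also have "\<dots> = (\<Sum>i<n. of_int (Polynomial.coeff p i) * x ^ i) + x ^ n"
    using p(2) by (simp add: n_def flip: lessThan_Suc_atMost)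
  finally have "x ^ n = - (\<Sum>i<n. of_int (Polynomial.coeff p i) * x ^ i)"
    by (metis add.commute eq_neg_iff_add_eq_0)
  moreover have "n > 0"
  proof (rule ccontr)
    assume "\<not> n > 0"
    with calculation show False by simp
  qed
  ultimately show ?thesis using that by blast
qed

text \<open>A finitely generated group stable under several integers at once is also stable under
  their sums and products, whose integrality is then read off from this one group.\<close>

lemma algebraic_ints_common_module:
  fixes S :: "'a::field_char_0 set"
  assumes "finite S" "\<And>s. s \<in> S \<Longrightarrow> algebraic_int s"
  shows "\<exists>B. finite B \<and> 1 \<in> B \<and> (\<forall>s\<in>S. \<forall>b\<in>B. s * b \<in> zmod.span B)"
  using assms
proof (induction S)
  case empty
  show ?case by (intro exI[of _ "{1}"]) auto
next
  case (insert x S)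
  then obtain B where B: "finite B" "1 \<in> B" "\<And>s b. s \<in> S \<Longrightarrow> b \<in> B \<Longrightarrow> s * b \<in> zmod.span B"
    by auto
  have "algebraic_int x" using insert.prems by simp
  then obtain n and c :: "nat \<Rightarrow> int" where nc: "x ^ n = - (\<Sum>i<n. of_int (c i) * x ^ i)"
    by (rule algebraic_int_monic_relation)
  \<comment> \<open>The integers join \<open>S\<close> because they are the coefficients of the
    monic relation of \<open>x\<close>.\<close>
  have "s * b \<in> zmod.span B" if sb: "s \<in> S \<union> range of_int" "b \<in> B" for s b
  proof (cases "s \<in> S")
    case True
    then show ?thesis using B(3) sb(2) by simp
  next
    case False
    then obtain z where "s = of_int z" using sb(1) by blast
    then show ?thesis using zmod.span_scale[OF zmod.span_base[OF sb(2)], of z] by simp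
  qed
  then obtain B' where "finite B'" "1 \<in> B'"
      "\<forall>s\<in>insert x (S \<union> range of_int). \<forall>b\<in>B'. s * b \<in> zmod.span B'"
    using zmod_span_adjoin[OF B(1,2) _ _ nc, of "S \<union> range of_int"] by auto
  then show ?case by (intro exI[of _ B']) simp
qed

lemma algebraic_int_common_module_imp:
  fixes x :: "'a::field_char_0"
  assumes "finite B" "1 \<in> B" "\<And>b. b \<in> B \<Longrightarrow> x * b \<in> zmod.span B"
  shows "algebraic_int x"
  using assms by (intro algebraic_int_if_span_stable[OF assms(1)] bexI[of _ 1]) auto

lemma
  fixes x y :: "'a::field_char_0"
  assumes "algebraic_int x" "algebraic_int y"
  shows algebraic_int_plus [intro]: "algebraic_int (x + y)"
    and algebraic_int_times [intro]: "algebraic_int (x * y)"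
proof -
  obtain B where B: "finite B" "1 \<in> B"
    "\<And>b. b \<in> B \<Longrightarrow> x * b \<in> zmod.span B" "\<And>b. b \<in> B \<Longrightarrow> y * b \<in> zmod.span B"
    using algebraic_ints_common_module[of "{x, y}"] assms by (metis finite.emptyI finite.insertI insert_iff singletonD)
  show "algebraic_int (x + y)"
    by (rule algebraic_int_common_module_imp[OF B(1,2)])
      (simp add: B distrib_right zmod.span_add)
  show "algebraic_int (x * y)"
  proof (rule algebraic_int_common_module_imp[OF B(1,2)])
    fix b assume "b \<in> B"
    then have "x * (y * b) \<in> zmod.span B"
      using B(3,4) zmod_span_mult_closed by blast
    then show "x * y * b \<in> zmod.span B" by (simp add: mult.assoc)
  qed
qed

lemma algebraic_int_diff [intro]:
  fixes x y :: "'a::field_char_0"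
  shows "algebraic_int x \<Longrightarrow> algebraic_int y \<Longrightarrow> algebraic_int (x - y)"
  using algebraic_int_plus[of x "- y"] by simp

lemma algebraic_int_power [intro]:
  fixes x :: "'a::field_char_0"
  shows "algebraic_int x \<Longrightarrow> algebraic_int (x ^ n)"
  by (induction n) auto

lemma algebraic_int_sum [intro]:
  fixes f :: "'b \<Rightarrow> 'a::field_char_0"
  shows "(\<And>i. i \<in> I \<Longrightarrow> algebraic_int (f i)) \<Longrightarrow> algebraic_int (sum f I)"
  by (induction I rule: infinite_finite_induct) auto

lemma algebraic_int_prod [intro]:
  fixes f :: "'b \<Rightarrow> 'a::field_char_0"
  shows "(\<And>i. i \<in> I \<Longrightarrow> algebraic_int (f i)) \<Longrightarrow> algebraic_int (prod f I)"
  by (induction I rule: infinite_finite_induct) auto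

text \<open>Transitivity of integrality: a group stable under the coefficients is enlarged by powers
  of \<open>x\<close> to one stable under \<open>x\<close>.\<close>

lemma algebraic_int_monic_root:
  fixes x :: "'a::field_char_0"
  assumes c: "\<And>i. i < n \<Longrightarrow> algebraic_int (c i)" and x: "x ^ n + (\<Sum>i<n. c i * x ^ i) = 0"
  shows "algebraic_int x"
proof -
  obtain B where B: "finite B" "1 \<in> B" "\<And>s b. s \<in> c ` {..<n} \<Longrightarrow> b \<in> B \<Longrightarrow> s * b \<in> zmod.span B"
    using algebraic_ints_common_module[of "c ` {..<n}"] c by blast
  have rel: "x ^ n = - (\<Sum>i<n. c i * x ^ i)" using x by (simp add: eq_neg_iff_add_eq_0)
  obtain B' where
    "finite B'" "1 \<in> B'" "\<And>b. b \<in> B' \<Longrightarrow> x * b \<in> zmod.span B'"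
    using zmod_span_adjoin[OF B(1,2) _ _ rel, of "c ` {..<n}"] B(3) by auto
  then show ?thesis by (rule algebraic_int_common_module_imp)
qed

text \<open>Reduces to integer coefficients: products of the \<open>v b\<close> with generators of a
  group stable under all coefficients generate a stable group over the integers. Later
  \<open>v\<close> lists the values of the generators of an integral model at one ideal.\<close>

lemma algebraic_int_if_fin_gen_stable:
  fixes x :: "'a::field_char_0" and v :: "'b \<Rightarrow> 'a"
  assumes "finite B" "\<exists>b\<in>B. v b \<noteq> 0"
    and c: "\<And>b b'. b \<in> B \<Longrightarrow> b' \<in> B \<Longrightarrow> algebraic_int (c b b')" "\<And>b. b \<in> B \<Longrightarrow> x * v b = (\<Sum>b'\<in>B. c b b' * v b')"
  shows "algebraic_int x"
proof -
  define S where "S = (\<lambda>(b, b'). c b b') ` (B \<times> B)"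
  obtain M where M: "finite M" "1 \<in> M" "\<And>s b. s \<in> S \<Longrightarrow> b \<in> M \<Longrightarrow> s * b \<in> zmod.span M"
    using algebraic_ints_common_module[of S] c(1) assms(1) by (force simp: S_def)
  define N where "N = (\<lambda>(m, b). m * v b) ` (M \<times> B)"
  have mem: "y * v b \<in> zmod.span N" if "y \<in> zmod.span M" "b \<in> B" for y b
  proof -
    have "v b * y \<in> zmod.span N"
      by (rule zmod_span_mult_closed[OF _ that(1)])
        (use that in \<open>auto simp: N_def mult.commute[of "v b"] intro!: zmod.span_base\<close>)
    then show ?thesis by (simp add: mult.commute)
  qed
  show ?thesis
  proof (rule algebraic_int_if_span_stable)
    show "finite N" using M assms by (simp add: N_def)
    obtain b where "b \<in> B" "v b \<noteq> 0" using assms(2) by blast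
    moreover have "v b \<in> N" unfolding N_def
      by (rule image_eqI[of _ _ "(1, b)"]) (use M(2) \<open>b \<in> B\<close> in auto)
    ultimately show "\<exists>b\<in>N. b \<noteq> 0" by blast
    fix n assume "n \<in> N"
    then obtain m b where mb: "m \<in> M" "b \<in> B" "n = m * v b" by (auto simp: N_def)
    have "x * n = m * (x * v b)" by (simp add: mb)
    also have "\<dots> = (\<Sum>b'\<in>B. (c b b' * m) * v b')"
      using c(2)[OF mb(2)] by (simp add: sum_distrib_left algebra_simps)
    also have "\<dots> \<in> zmod.span N"
      using mb M(3) by (intro zmod.span_sum mem) (auto simp: S_def)
    finally show "x * n \<in> zmod.span N" .
  qed
qed

text \<open>The polynomial is the characteristic polynomial, which depends on the matrix only.\<close>

lemma common_polynomial_of_eigenvalues: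
  fixes c :: "'b \<Rightarrow> 'b \<Rightarrow> 'a::field"
  assumes fin: "finite B"
  obtains p where "p \<noteq> 0" "\<And>x v. \<exists>b\<in>B. v b \<noteq> 0 \<Longrightarrow> (\<And>b. b \<in> B \<Longrightarrow> x * v b = (\<Sum>b'\<in>B. c b b' * v b')) \<Longrightarrow> poly p x = 0"
proof -
  obtain bs where bs: "set bs = B" "distinct bs"
    using finite_distinct_list[OF fin] by blast
  define n where "n = length bs"
  have bij: "bij_betw ((!) bs) {..<n} B"
    using bij_betw_nth[OF bs(2)] bs(1) n_def by auto
  define A where "A = mat n n (\<lambda>(i, j). c (bs ! i) (bs ! j))"
  have A: "A \<in> carrier_mat n n" by (simp add: A_def)
  show ?thesis
  proof (rule that[of "char_poly A"])
    show "char_poly A \<noteq> 0" using degree_monic_char_poly[OF A] by auto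
    fix x and v :: "'b \<Rightarrow> 'a"
    assume nz: "\<exists>b\<in>B. v b \<noteq> 0" and ev: "\<And>b. b \<in> B \<Longrightarrow> x * v b = (\<Sum>b'\<in>B. c b b' * v b')"
    define w where "w = vec n (\<lambda>i. v (bs ! i))"
    have "A *\<^sub>v w = x \<cdot>\<^sub>v w"
    proof (rule eq_vecI)
      fix i assume "i < dim_vec (x \<cdot>\<^sub>v w)"
      then have i: "i < n" by (simp add: w_def)
      have "(A *\<^sub>v w) $ i = (\<Sum>j\<in>{..<n}. c (bs ! i) (bs ! j) * v (bs ! j))"
        using i by (auto simp: A_def w_def scalar_prod_def atLeast0LessThan intro!: sum.cong)
      also have "\<dots> = (\<Sum>b'\<in>B. c (bs ! i) b' * v b')"
        by (rule sum.reindex_bij_betw[OF bij, of "\<lambda>b'. c (bs ! i) b' * v b'"])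
      also have "\<dots> = x * v (bs ! i)"
        using ev[of "bs ! i"] i bs(1) n_def by auto
      finally show "(A *\<^sub>v w) $ i = (x \<cdot>\<^sub>v w) $ i"
        using i by (simp add: w_def)
    qed (use A in \<open>auto simp: w_def\<close>)
    moreover have "w \<noteq> 0\<^sub>v n"
    proof
      assume "w = 0\<^sub>v n"
      then have "v (bs ! i) = 0" if "i < n" for i
        using that by (metis index_vec index_zero_vec(1) w_def)
      with nz bs(1) n_def show False by (metis in_set_conv_nth)
    qed
    moreover have "w \<in> carrier_vec n" by (simp add: w_def)
    ultimately have "eigenvalue A x"
      unfolding eigenvalue_def eigenvector_def using A by (intro exI[of _ w]) auto
    then show "poly (char_poly A) x = 0" using eigenvalue_root_char_poly[OF A] by blast
  qed
qed

text \<open>Multiplying the equation of \<open>x\<close> by \<open>a ^ (d - 1)\<close>, with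
  \<open>a\<close> the leading coefficient and \<open>d\<close> the degree, gives a monic equation
  for \<open>a * x\<close>.\<close>

lemma algebraic_int_integer_multiple:
  fixes x :: "'a::field_char_0"
  assumes "algebraic x"
  obtains n :: nat where "n > 0" "algebraic_int (of_nat n * x)"
proof -
  obtain p :: "'a Polynomial.poly" where p0: "\<forall>i. Polynomial.coeff p i \<in> \<int>" "p \<noteq> 0" "poly p x = 0"
    using assms by (auto simp: algebraic_def)
  define d where "d = Polynomial.degree p"
  define a where "a = Polynomial.lead_coeff p"
  have "a \<noteq> 0" using p0 by (simp add: a_def)
  have "a \<in> \<int>" using p0 by (auto simp: a_def)
  then obtain z :: int where z: "a = of_int z" by (auto elim: Ints_cases)
  have "algebraic_int (a * x)"
  proof (cases "d = 0")
    case True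
    with p0 show ?thesis by (metis d_def degree_eq_zeroE poly_pCons poly_0 mult_zero_right add_0_right pCons_0_0)
  next
    case False
    have d: "Suc (d - 1) = d" using False by simp
    have "0 = a ^ (d - 1) * (\<Sum>i\<le>d. Polynomial.coeff p i * x ^ i)"
      using p0(3) by (simp add: poly_altdef d_def)
    also have "\<dots> = a ^ (d - 1) * (a * x ^ d) + (\<Sum>i<d. a ^ (d - 1) * (Polynomial.coeff p i * x ^ i))"
      by (simp add: d_def a_def distrib_left sum_distrib_left flip: lessThan_Suc_atMost)
    also have "a ^ (d - 1) * (a * x ^ d) = (a * x) ^ d"
      using d by (metis mult.assoc mult.commute power_Suc power_mult_distrib)
    also have "(\<Sum>i<d. a ^ (d - 1) * (Polynomial.coeff p i * x ^ i)) = (\<Sum>i<d. (a ^ (d - 1 - i) * Polynomial.coeff p i) * (a * x) ^ i)"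
    proof (rule sum.cong)
      fix i assume "i \<in> {..<d}"
      then have "a ^ (d - 1) = a ^ (d - 1 - i) * a ^ i"
        by (simp flip: power_add)
      then show "a ^ (d - 1) * (Polynomial.coeff p i * x ^ i) = (a ^ (d - 1 - i) * Polynomial.coeff p i) * (a * x) ^ i"
        by (simp add: power_mult_distrib)
    qed simp
    finally have "(a * x) ^ d + (\<Sum>i<d. (a ^ (d - 1 - i) * Polynomial.coeff p i) * (a * x) ^ i) = 0" ..
    then show ?thesis
      by (rule algebraic_int_monic_root[rotated])
        (use p0(1) \<open>a \<in> \<int>\<close> in \<open>auto intro!: int_imp_algebraic_int\<close>)
  qed
  moreover have "of_nat (nat \<bar>z\<bar>) * x = a * x \<or> of_nat (nat \<bar>z\<bar>) * x = - (a * x)"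
    unfolding z by (cases "z \<ge> 0") auto
  ultimately have "algebraic_int (of_nat (nat \<bar>z\<bar>) * x)"
    using algebraic_int_minus by metis
  with that[of "nat \<bar>z\<bar>"] \<open>a \<noteq> 0\<close> z show ?thesis by auto
qed

text \<open>The inverse of \<open>x\<close> is a root of the reflected polynomial, and a positive
  integer multiple of it is integral; that multiple is the cofactor \<open>y\<close>. This takes the
  place of the norm of an element.\<close>

lemma algebraic_int_divisor_nat:
  fixes x :: "'a::field_char_0"
  assumes "algebraic_int x" "x \<noteq> 0"
  obtains n :: nat and y where "n > 0" "algebraic_int y" "of_nat n = x * y"
proof -
  obtain p :: "'a Polynomial.poly" where p0: "\<forall>i. Polynomial.coeff p i \<in> \<int>" "p \<noteq> 0" "poly p x = 0"
    using algebraic_int_imp_algebraic[OF assms(1)] by (auto simp: algebraic_def)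
  have "algebraic (inverse x)"
    unfolding algebraic_def
  proof (intro exI conjI)
    show "\<forall>i. Polynomial.coeff (reflect_poly p) i \<in> \<int>"
      using p0(1) by (auto simp: coeff_reflect_poly)
    show "poly (reflect_poly p) (inverse x) = 0"
      using p0(3) assms(2) by (simp add: poly_reflect_poly_nz)
  qed (use p0(2) in auto)
  then obtain n where "n > 0" "algebraic_int (of_nat n * inverse x)"
    by (rule algebraic_int_integer_multiple)
  with that[of n "of_nat n * inverse x"] assms(2) show ?thesis by (simp add: field_simps)
qed

section \<open>The trace form\<close>

definition mat_trace :: "'a::comm_semiring_1 mat \<Rightarrow> 'a" where
  "mat_trace A = (\<Sum>i<dim_row A. A $$ (i, i))"

lemma mat_trace_mult_commute:
  assumes "A \<in> carrier_mat n n" "B \<in> carrier_mat n n"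
  shows "mat_trace (A * B) = mat_trace (B * A)"
proof -
  have "mat_trace (A * B) = (\<Sum>i<n. \<Sum>j<n. A $$ (i, j) * B $$ (j, i))"
    using assms by (auto simp: mat_trace_def scalar_prod_def atLeast0LessThan intro!: sum.cong)
  also have "\<dots> = (\<Sum>j<n. \<Sum>i<n. B $$ (j, i) * A $$ (i, j))"
    by (subst sum.swap) (simp add: mult.commute)
  also have "\<dots> = mat_trace (B * A)"
    using assms by (auto simp: mat_trace_def scalar_prod_def atLeast0LessThan intro!: sum.cong)
  finally show ?thesis .
qed

text \<open>Over the complex numbers the matrix is similar to a triangular one with the roots of the
  characteristic polynomial on the diagonal, and the trace is invariant under similarity.\<close>

lemma mat_trace_eigenvalues:
  fixes A :: "complex mat"
  assumes A: "A \<in> carrier_mat n n"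
  obtains es where "mat_trace A = sum_list es" "\<And>e. e \<in> set es \<Longrightarrow> eigenvalue A e"
proof -
  obtain es where es: "char_poly A = (\<Prod>e\<leftarrow>es. [:- e, 1:])"
    using char_poly_factorized[OF A] by blast
  obtain B P Q where "schur_decomposition A es = (B, P, Q)"
    by (cases "schur_decomposition A es")
  with schur_decomposition[OF A es] have wit: "similar_mat_wit A B P Q" and diag: "diag_mat B = es"
    by auto
  note W = similar_mat_witD2[OF A wit]
  have "mat_trace A = mat_trace (Q * (P * B))"
    unfolding W(3) by (rule mat_trace_mult_commute) (use W in auto)
  also have "Q * (P * B) = (Q * P) * B"
    using W by (metis assoc_mult_mat)
  also have "\<dots> = B" using W by simp
  also have "mat_trace B = sum_list es"
    using W diag by (auto simp: mat_trace_def diag_mat_def sum_list_sum_nth atLeast0LessThan)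
  finally have "mat_trace A = sum_list es" .
  moreover have "eigenvalue A e" if "e \<in> set es" for e
  proof -
    have "poly (char_poly A) e = 0"
      unfolding es poly_prod_list using that by (auto simp: prod_list_zero_iff)
    then show ?thesis using eigenvalue_root_char_poly[OF A] by blast
  qed
  ultimately show ?thesis using that by blast
qed

text \<open>
  Multiplication by an algebraic integer has algebraic integers as eigenvalues; hence its trace
  over the rationals is an integer.
\<close>

lemma rational_trace_algebraic_int:
  fixes x :: "'a::field_char_0" and B :: "'a set"
  defines "rep \<equiv> qvs.representation B"
  assumes fin: "finite B" and ind: "qvs.independent B"
    and mult: "\<And>y z. y \<in> qvs.span B \<Longrightarrow> z \<in> qvs.span B \<Longrightarrow> y * z \<in> qvs.span B"
    and one: "1 \<in> qvs.span B"
    and x: "x \<in> qvs.span B" "algebraic_int x"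
  shows "(\<Sum>b\<in>B. rep (x * b) b) \<in> \<int>"
proof -
  obtain bs where bs: "set bs = B" "distinct bs"
    using finite_distinct_list[OF fin] by blast
  define n where "n = length bs"
  have bij: "bij_betw ((!) bs) {..<n} B"
    using bij_betw_nth[OF bs(2)] bs(1) n_def by auto
  have bsB: "bs ! i \<in> B" if "i < n" for i using that bs n_def by auto
  have bsS: "bs ! i \<in> qvs.span B" if "i < n" for i using bsB[OF that] by (rule qvs.span_base)
  have inj: "bs ! i = bs ! j \<longleftrightarrow> i = j" if "i < n" "j < n" for i j
    using that bs(2) n_def by (simp add: nth_eq_iff_index_eq)
  \<comment> \<open>Multiplication by \<open>y\<close> in the basis, with its rational entries read
    as complex numbers so that the matrix can be triangularized.\<close>
  define M where "M y = mat n n (\<lambda>(i, j). of_rat (rep (y * bs ! j) (bs ! i)) :: complex)" for y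
  have M: "M y \<in> carrier_mat n n" for y by (simp add: M_def)
  have M_1: "M 1 = 1\<^sub>m n"
    by (rule eq_matI) (auto simp: M_def rep_def qvs.representation_basis[OF ind bsB] inj)
  have M_0: "M 0 = 0\<^sub>m n n"
    by (rule eq_matI) (auto simp: M_def rep_def qvs.representation_zero)
  have M_add: "M (y + z) = M y + M z" if "y \<in> qvs.span B" "z \<in> qvs.span B" for y z
  proof (rule eq_matI)
    fix i j assume "i < dim_row (M y + M z)" "j < dim_col (M y + M z)"
    then have ij: "i < n" "j < n" by (auto simp: M_def)
    then show "M (y + z) $$ (i, j) = (M y + M z) $$ (i, j)"
      using qvs.representation_add[OF ind mult[OF that(2) bsS[OF ij(2)]] mult[OF that(1) bsS[OF ij(2)]]]
      by (simp add: M_def rep_def distrib_right of_rat_add add.commute)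
  qed (auto simp: M_def)
  have M_scale: "M (of_rat q * y) = of_rat q \<cdot>\<^sub>m M y" if "y \<in> qvs.span B" for q y
  proof (rule eq_matI)
    fix i j assume "i < dim_row (of_rat q \<cdot>\<^sub>m M y)" "j < dim_col (of_rat q \<cdot>\<^sub>m M y)"
    then have ij: "i < n" "j < n" by (auto simp: M_def)
    then show "M (of_rat q * y) $$ (i, j) = (of_rat q \<cdot>\<^sub>m M y) $$ (i, j)"
      using qvs.representation_scale[OF ind mult[OF that bsS[OF ij(2)]], of q]
      by (simp add: M_def rep_def of_rat_mult mult.assoc)
  qed (auto simp: M_def)
  have M_mult: "M (y * z) = M y * M z" if yz: "y \<in> qvs.span B" "z \<in> qvs.span B" for y z
  proof (rule eq_matI)
    fix i j assume "i < dim_row (M y * M z)" "j < dim_col (M y * M z)"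
    then have ij: "i < n" "j < n" by (auto simp: M_def)
    have zb: "z * bs ! j = (\<Sum>k<n. of_rat (rep (z * bs ! j) (bs ! k)) * bs ! k)"
      using qvs.sum_representation_eq[OF ind mult[OF yz(2) bsS[OF ij(2)]] fin subset_refl]
        sum.reindex_bij_betw[OF bij, of "\<lambda>b. of_rat (rep (z * bs ! j) b) * b"]
      by (simp add: rep_def)
    have "rep (y * z * bs ! j) = rep (\<Sum>k<n. of_rat (rep (z * bs ! j) (bs ! k)) * (y * bs ! k))"
      by (subst mult.assoc, subst zb) (simp add: sum_distrib_left algebra_simps)
    also have "\<dots> = (\<lambda>b. \<Sum>k<n. rep (of_rat (rep (z * bs ! j) (bs ! k)) * (y * bs ! k)) b)"
      unfolding rep_def using yz bsS mult
      by (intro qvs.representation_sum[OF ind] qvs.span_scale) auto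
    also have "\<dots> = (\<lambda>b. \<Sum>k<n. rep (z * bs ! j) (bs ! k) * rep (y * bs ! k) b)"
      unfolding rep_def using yz bsS mult
      by (intro ext sum.cong) (auto simp: qvs.representation_scale[OF ind])
    finally have "rep (y * z * bs ! j) (bs ! i) = (\<Sum>k<n. rep (y * bs ! k) (bs ! i) * rep (z * bs ! j) (bs ! k))"
      by (simp add: mult.commute)
    then show "M (y * z) $$ (i, j) = (M y * M z) $$ (i, j)"
      using ij by (simp add: M_def scalar_prod_def of_rat_sum of_rat_mult atLeast0LessThan)
  qed (auto simp: M_def)
  obtain p :: "int Polynomial.poly" where p: "poly (map_poly of_int p) x = 0" "Polynomial.lead_coeff p = 1"
    using x(2) unfolding algebraic_int_altdef_ipoly by blast
  have alg: "algebraic_int e" if ev: "eigenvalue (M x) e" for e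
  proof -
    obtain v where v: "v \<in> carrier_vec n" "v \<noteq> 0\<^sub>v n" "M x *\<^sub>v v = e \<cdot>\<^sub>v v"
      using ev M[of x] unfolding eigenvalue_def eigenvector_def by auto
    \<comment> \<open>A polynomial in \<open>x\<close> acts on the eigenvector by the same
      polynomial in \<open>e\<close>, so the monic equation of \<open>x\<close> passes to
      \<open>e\<close>. Membership in the span is carried along because \<open>M\<close> is additive
      and multiplicative only there.\<close>
    have "poly (map_poly of_int q) x \<in> qvs.span B \<and>
      M (poly (map_poly of_int q) x) *\<^sub>v v = poly (map_poly of_int q) e \<cdot>\<^sub>v v" for q :: "int Polynomial.poly"
    proof (induction q)
      case 0
      show ?case using v M_0 by (auto simp: qvs.span_zero)
    next
      case (pCons a q)
      define y where "y = poly (map_poly of_int q) x"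
      define f where "f = poly (map_poly of_int q) e"
      have y: "y \<in> qvs.span B" and yv: "M y *\<^sub>v v = f \<cdot>\<^sub>v v" using pCons.IH by (auto simp: y_def f_def)
      have eq: "poly (map_poly of_int (pCons a q)) x = of_rat (of_int a) * 1 + x * y"
        "poly (map_poly of_int (pCons a q)) e = of_int a + e * f"
        by (simp_all add: y_def f_def of_int_hom.map_poly_pCons_hom)
      have S: "of_rat (of_int a) * 1 \<in> qvs.span B" "x * y \<in> qvs.span B"
        using one qvs.span_scale x(1) y mult by blast+
      have "M (of_rat (of_int a) * 1 + x * y) = of_int a \<cdot>\<^sub>m 1\<^sub>m n + M x * M y"
        using M_add[OF S] M_scale[OF one, of "of_int a"] M_mult[OF x(1) y] M_1 by simp
      then have "M (of_rat (of_int a) * 1 + x * y) *\<^sub>v v = (of_int a \<cdot>\<^sub>m 1\<^sub>m n) *\<^sub>v v + M x *\<^sub>v (M y *\<^sub>v v)"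
        using add_mult_distrib_mat_vec[of "of_int a \<cdot>\<^sub>m 1\<^sub>m n" n n "M x * M y" v]
          mult_carrier_mat[OF M M] assoc_mult_mat_vec[OF M M v(1)] v(1) by simp
      also have "M x *\<^sub>v (M y *\<^sub>v v) = f \<cdot>\<^sub>v (e \<cdot>\<^sub>v v)"
        using mult_mat_vec[OF M v(1)] by (simp add: yv v(3))
      also have "(of_int a \<cdot>\<^sub>m 1\<^sub>m n) *\<^sub>v v = of_int a \<cdot>\<^sub>v v"
        using v(1) by (intro eq_vecI) (auto simp: scalar_prod_def if_distrib if_distribR sum.delta cong: if_cong)
      also have "of_int a \<cdot>\<^sub>v v + f \<cdot>\<^sub>v (e \<cdot>\<^sub>v v) = (of_int a + e * f) \<cdot>\<^sub>v v"
        using v(1) by (intro eq_vecI) (auto simp: algebra_simps)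
      finally show ?case using eq S qvs.span_add by metis
    qed
    from this[of p] p(1) have "M 0 *\<^sub>v v = poly (map_poly of_int p) e \<cdot>\<^sub>v v" by simp
    moreover have "0\<^sub>m n n *\<^sub>v v = 0\<^sub>v n"
      using v(1) by (intro eq_vecI) (auto simp: scalar_prod_def)
    ultimately have z: "poly (map_poly of_int p) e \<cdot>\<^sub>v v = 0\<^sub>v n" using M_0 by simp
    obtain i where i: "i < n" "v $ i \<noteq> 0"
      using v(1,2) by (metis carrier_vecD eq_vecI index_zero_vec(1) index_zero_vec(2))
    have "poly (map_poly of_int p) e * v $ i = 0"
      using arg_cong[OF z, of "\<lambda>w. vec_index w i"] i v(1) by simp
    then show ?thesis
      using i p(2) unfolding algebraic_int_altdef_ipoly by auto
  qed
  obtain es where es: "mat_trace (M x) = sum_list es" "\<And>e. e \<in> set es \<Longrightarrow> eigenvalue (M x) e"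
    using mat_trace_eigenvalues[OF M] by blast
  have "algebraic_int (sum_list es)" using es(2) alg by (induction es) auto
  moreover have "mat_trace (M x) = of_rat (\<Sum>b\<in>B. rep (x * b) b)"
    using sum.reindex_bij_betw[OF bij, of "\<lambda>b. rep (x * b) b"]
    by (simp add: mat_trace_def M_def flip: of_rat_sum)
  ultimately have "algebraic_int (of_rat (\<Sum>b\<in>B. rep (x * b) b) :: complex)" using es(1) by simp
  then have "(of_rat (\<Sum>b\<in>B. rep (x * b) b) :: complex) \<in> \<int>"
    by (rule rational_algebraic_int_is_int) (rule Rats_of_rat)
  then obtain z where "(of_rat (\<Sum>b\<in>B. rep (x * b) b) :: complex) = of_int z" by (auto elim: Ints_cases)
  then have "(\<Sum>b\<in>B. rep (x * b) b) = of_int z"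
    by (metis of_rat_eq_iff of_rat_of_int_eq)
  then show ?thesis by simp
qed

section \<open>Finite generation and finiteness of residues\<close>

lemma common_denominator:
  fixes Q :: "rat set"
  assumes "finite Q"
  obtains d :: nat where "d > 0" "\<And>q. q \<in> Q \<Longrightarrow> of_nat d * q \<in> \<int>"
  using assms
proof (induction Q arbitrary: thesis)
  case empty
  show ?case by (rule empty[of 1]) auto
next
  case (insert q Q)
  obtain d :: nat where d: "d > 0" "\<And>q. q \<in> Q \<Longrightarrow> of_nat d * q \<in> \<int>"
    using insert.IH by blast
  obtain a b where q: "q = of_int a / of_int b" "b > 0"
    by (metis quotient_of_denom_pos quotient_of_div surj_pair)
  have bq: "of_nat (nat b) * q = of_int a" using q by simp
  have "of_nat (d * nat b) * q' \<in> \<int>" if "q' \<in> insert q Q" for q'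
  proof (cases "q' = q")
    case True
    have "of_nat (d * nat b) * q' = of_nat d * (of_nat (nat b) * q)" by (simp only: True of_nat_mult mult.assoc)
    also have "\<dots> = of_int (int d * a)" unfolding bq by simp
    finally show ?thesis by (metis Ints_of_int)
  next
    case False
    then have "of_nat d * q' \<in> \<int>" using d(2) that by auto
    then have "of_nat (nat b) * (of_nat d * q') \<in> \<int>" by (rule Ints_mult[OF Ints_of_nat])
    then show ?thesis by (simp add: mult_ac)
  qed
  then show ?case using insert.prems[of "d * nat b"] d(1) q(2) by simp
qed

text \<open>A common denominator \<open>d\<close> of the matrix of multiplication by
  \<open>x\<close> makes \<open>of_nat d * x\<close> preserve the integer span of
  \<open>B\<close>.\<close>

lemma rational_stable_integer_multiple:
  fixes x :: "'a::field_char_0"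
  assumes fin: "finite B" and "\<exists>b\<in>B. b \<noteq> 0" and stable: "\<And>b. b \<in> B \<Longrightarrow> x * b \<in> qvs.span B"
  obtains d :: nat where "d > 0" "algebraic_int (of_nat d * x)"
proof -
  have "\<exists>u. x * b = (\<Sum>b'\<in>B. of_rat (u b') * b')" if "b \<in> B" for b
    using stable[OF that] unfolding qvs.span_finite[OF fin] by auto
  then obtain u where u: "\<And>b. b \<in> B \<Longrightarrow> x * b = (\<Sum>b'\<in>B. of_rat (u b b') * b')" by metis
  obtain d :: nat where d: "d > 0" "\<And>q. q \<in> (\<lambda>(b, b'). u b b') ` (B \<times> B) \<Longrightarrow> of_nat d * q \<in> \<int>"
    by (rule common_denominator[of "(\<lambda>(b, b'). u b b') ` (B \<times> B)"]) (use fin in auto)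
  have "algebraic_int (of_nat d * x)"
  proof (rule algebraic_int_if_span_stable[OF assms(1,2)])
    fix b assume b: "b \<in> B"
    have "of_nat d * x * b = (\<Sum>b'\<in>B. of_rat (of_nat d * u b b') * b')"
      by (simp add: mult.assoc u[OF b] sum_distrib_left of_rat_mult)
    also have "\<dots> \<in> zmod.span B"
    proof (rule zmod.span_sum)
      fix b' assume b': "b' \<in> B"
      have "of_nat d * u b b' \<in> \<int>" using d(2) b b' by auto
      then obtain z where "of_nat d * u b b' = of_int z" by (auto elim: Ints_cases)
      then show "of_rat (of_nat d * u b b') * b' \<in> zmod.span B"
        using zmod.span_scale[OF zmod.span_base[OF b'], of z] by simp
    qed
    finally show "of_nat d * x * b \<in> zmod.span B" .
  qed
  with d(1) that show ?thesis by blast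
qed

text \<open>
  The coordinates are the traces against a basis; they detect \<open>x \<noteq> 0\<close> because the
  trace of \<open>x * inverse x\<close> is the degree, which does not vanish in characteristic zero.
\<close>

lemma integral_coordinates:
  fixes L :: "'a::field_char_0 set"
  assumes L: "L = qvs.span B0" "finite B0" and one: "1 \<in> L"
    and mult: "\<And>x y. x \<in> L \<Longrightarrow> y \<in> L \<Longrightarrow> x * y \<in> L"
    and inv: "\<And>x. x \<in> L \<Longrightarrow> inverse x \<in> L"
  obtains C :: "('a \<Rightarrow> int) set" where "finite C"
    "\<And>c x y. c \<in> C \<Longrightarrow> x \<in> L \<Longrightarrow> y \<in> L \<Longrightarrow> algebraic_int x \<Longrightarrow> algebraic_int y \<Longrightarrow> c (x + y) = c x + c y"
    "\<And>x. x \<in> L \<Longrightarrow> algebraic_int x \<Longrightarrow> (\<And>c. c \<in> C \<Longrightarrow> c x = 0) \<Longrightarrow> x = 0"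
proof -
  obtain B where B: "B \<subseteq> L" "qvs.independent B" "L \<subseteq> qvs.span B"
    using qvs.maximal_independent_subset[of L] by blast
  have fin: "finite B"
    using qvs.independent_span_bound[OF L(2) B(2)] B(1) L(1) by auto
  have LB: "L = qvs.span B"
    using B L(1) by (metis qvs.span_mono qvs.span_span subset_antisym)
  have bL: "b \<in> L" if "b \<in> B" for b using that B(1) by auto
  define rep where "rep = qvs.representation B"
  define tr where "tr x = (\<Sum>b\<in>B. rep (x * b) b)" for x
  have tr_add: "tr (x + y) = tr x + tr y" if "x \<in> L" "y \<in> L" for x y
    unfolding tr_def rep_def sum.distrib[symmetric]
  proof (rule sum.cong)
    fix b assume b: "b \<in> B"
    have "x * b \<in> qvs.span B" "y * b \<in> qvs.span B" using that bL[OF b] mult LB by auto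
    then show "qvs.representation B ((x + y) * b) b = qvs.representation B (x * b) b + qvs.representation B (y * b) b"
      by (simp add: distrib_right qvs.representation_add[OF B(2)])
  qed simp
  have tr_scale: "tr (of_rat q * x) = q * tr x" if "x \<in> L" for q x
    unfolding tr_def rep_def sum_distrib_left
  proof (rule sum.cong)
    fix b assume b: "b \<in> B"
    have "x * b \<in> qvs.span B" using that bL[OF b] mult LB by auto
    then show "qvs.representation B (of_rat q * x * b) b = q * qvs.representation B (x * b) b"
      by (simp add: mult.assoc qvs.representation_scale[OF B(2)])
  qed simp
  have LQ: "of_rat q * x \<in> L" if "x \<in> L" for q x using that LB qvs.span_scale by auto
  have L0: "0 \<in> L" using LB qvs.span_zero by auto
  have tr_sum: "tr (\<Sum>b\<in>A. of_rat (q b) * f b) = (\<Sum>b\<in>A. q b * tr (f b)) \<and> (\<Sum>b\<in>A. of_rat (q b) * f b) \<in> L"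
    if "finite A" "\<And>b. b \<in> A \<Longrightarrow> f b \<in> L" for A :: "'a set" and q f
    using that
  proof (induction A)
    case empty
    have "tr 0 = 0" using tr_scale[OF one, of 0] by simp
    then show ?case using L0 by simp
  next
    case (insert a A)
    then show ?case
      using tr_add[OF LQ] tr_scale LQ qvs.span_add LB by (auto simp: qvs.span_add)
  qed
  have tr_int: "tr x \<in> \<int>" if "x \<in> L" "algebraic_int x" for x
    using rational_trace_algebraic_int[OF fin B(2) _ _ _ that(2)] mult one that(1) LB
    by (simp add: tr_def rep_def)
  have tr_1: "tr 1 = of_nat (card B)"
    by (simp add: tr_def rep_def qvs.representation_basis[OF B(2)])
  have B_nz: "\<exists>b\<in>B. b \<noteq> 0"
  proof (rule ccontr)
    assume "\<not> ?thesis"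
    then have "B \<subseteq> {0}" by auto
    then have "qvs.span B \<subseteq> {0}" by (metis qvs.span_mono qvs.span_insert_0 qvs.span_empty)
    then show False using one LB by auto
  qed
  have "\<exists>d::nat. d > 0 \<and> algebraic_int (of_nat d * b)" if b: "b \<in> B" for b
  proof -
    have "b * b' \<in> qvs.span B" if "b' \<in> B" for b' using bL[OF that] bL[OF b] mult LB by auto
    from rational_stable_integer_multiple[OF fin B_nz this] show ?thesis by metis
  qed
  then obtain d :: "'a \<Rightarrow> nat" where d: "\<And>b. b \<in> B \<Longrightarrow> d b > 0" "\<And>b. b \<in> B \<Longrightarrow> algebraic_int (of_nat (d b) * b)"
    by metis
  \<comment> \<open>The trace of \<open>x\<close> against an integral multiple of \<open>b\<close>.
    It is an integer for integral \<open>x\<close> in \<open>L\<close>; the floor merely gives it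
    the type \<open>int\<close>.\<close>
  define c where "c b x = \<lfloor>tr (x * (of_nat (d b) * b))\<rfloor>" for b x
  have dbL: "of_nat (d b) * b \<in> L" if "b \<in> B" for b
    using LQ[OF bL[OF that], of "of_nat (d b)"] by simp
  have c: "of_int (c b x) = tr (x * (of_nat (d b) * b))" if "b \<in> B" "x \<in> L" "algebraic_int x" for b x
  proof -
    have "tr (x * (of_nat (d b) * b)) \<in> \<int>"
      using that d dbL mult by (intro tr_int) auto
    then show ?thesis by (auto simp: c_def elim!: Ints_cases)
  qed
  have Ladd: "x + y \<in> L" if "x \<in> L" "y \<in> L" for x y using that LB qvs.span_add by auto
  show ?thesis
  proof (rule that[of "c ` B"])
    show "finite (c ` B)" using fin by simp
    show "c' (x + y) = c' x + c' y" if xy: "c' \<in> c ` B" "x \<in> L" "y \<in> L" "algebraic_int x" "algebraic_int y" for c' x y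
    proof -
      obtain b where b: "b \<in> B" "c' = c b" using xy(1) by auto
      have "(of_int (c b (x + y)) :: rat) = tr (x * (of_nat (d b) * b) + y * (of_nat (d b) * b))"
        using c[OF b(1) Ladd[OF xy(2,3)]] xy by (simp add: distrib_right algebraic_int_plus)
      also have "\<dots> = of_int (c b x + c b y)"
        using tr_add[OF mult mult] xy dbL[OF b(1)] c[OF b(1)] by simp
      finally show ?thesis using b by (simp only: of_int_eq_iff)
    qed
    show "x = 0" if x: "x \<in> L" "algebraic_int x" "\<And>c'. c' \<in> c ` B \<Longrightarrow> c' x = 0" for x
    proof (rule ccontr)
      assume nz: "x \<noteq> 0"
      have z: "tr (x * b) = 0" if b: "b \<in> B" for b
      proof -
        have "0 = tr (x * (of_nat (d b) * b))" using c[OF b x(1,2)] x(3)[of "c b"] b by simp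
        also have "\<dots> = tr (of_rat (of_nat (d b)) * (x * b))" by (simp add: mult_ac)
        also have "\<dots> = of_nat (d b) * tr (x * b)" using x(1) bL[OF b] mult by (subst tr_scale) auto
        finally show ?thesis using d(1)[OF b] by simp
      qed
      \<comment> \<open>Expanding \<open>inverse x\<close> in the basis writes the trace of 1, which
        is the number of basis elements, as a combination of the vanishing traces of
        \<open>x * b\<close>.\<close>
      define q where "q = rep (inverse x)"
      have "inverse x = (\<Sum>b\<in>B. of_rat (q b) * b)"
        using qvs.sum_representation_eq[OF B(2) _ fin subset_refl, of "inverse x"] inv[OF x(1)] LB by (simp add: q_def rep_def)
      then have "1 = x * (\<Sum>b\<in>B. of_rat (q b) * b)" using right_inverse[OF nz] by simp
      also have "\<dots> = (\<Sum>b\<in>B. of_rat (q b) * (x * b))" by (simp add: sum_distrib_left mult_ac)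
      finally have "tr 1 = (\<Sum>b\<in>B. q b * tr (x * b))"
        using tr_sum[OF fin, of "\<lambda>b. x * b" q] x(1) bL mult by simp
      then have "card B = 0" using z tr_1 by simp
      then show False using fin B_nz by auto
    qed
  qed
qed

text \<open>As for subgroups of a free abelian group of finite rank: the values of one coordinate
  are the multiples of a least positive value \<open>g\<close>, and subtracting a multiple of an
  element of value \<open>g\<close> leads into the kernel, where fewer coordinates suffice. The
  operations are abstract because the lemma is applied both to numbers and to elements of a ring
  given as a record. Hence generation is expressed through all closed sets \<open>H\<close>, and
  identities are obtained by comparing coordinates.\<close>

lemma finitely_generated_by_coordinates:
  fixes C :: "('b \<Rightarrow> int) set"
  assumes "finite C" "z \<in> M"
    and "\<And>x y. x \<in> M \<Longrightarrow> y \<in> M \<Longrightarrow> pl x y \<in> M" "\<And>x. x \<in> M \<Longrightarrow> neg x \<in> M"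
    and "\<And>c. c \<in> C \<Longrightarrow> c z = 0"
    and "\<And>c x y. c \<in> C \<Longrightarrow> x \<in> M \<Longrightarrow> y \<in> M \<Longrightarrow> c (pl x y) = c x + c y"
    and "\<And>c x. c \<in> C \<Longrightarrow> x \<in> M \<Longrightarrow> c (neg x) = - c x"
    and "\<And>x y. x \<in> M \<Longrightarrow> y \<in> M \<Longrightarrow> (\<And>c. c \<in> C \<Longrightarrow> c x = c y) \<Longrightarrow> x = y"
  shows "\<exists>B\<subseteq>M. finite B \<and> (\<forall>H. z \<in> H \<longrightarrow> B \<subseteq> H \<longrightarrow> (\<forall>x\<in>H. \<forall>y\<in>H. pl x y \<in> H) \<longrightarrow>
    (\<forall>x\<in>H. neg x \<in> H) \<longrightarrow> M \<subseteq> H)"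
  using assms
proof (induction C arbitrary: M)
  case empty
  then have "M \<subseteq> {z}" by auto
  then show ?case by (intro exI[of _ "{}"]) auto
next
  case (insert c C)
  note M = insert.prems
  have cpl: "c (pl x y) = c x + c y" if "x \<in> M" "y \<in> M" for x y using M(5)[of c x y] that by simp
  have cneg: "c (neg x) = - c x" if "x \<in> M" for x using M(6)[of c x] that by simp
  define M' where "M' = {x\<in>M. c x = 0}"
  have "\<exists>B\<subseteq>M'. finite B \<and> (\<forall>H. z \<in> H \<longrightarrow> B \<subseteq> H \<longrightarrow> (\<forall>x\<in>H. \<forall>y\<in>H. pl x y \<in> H) \<longrightarrow>
    (\<forall>x\<in>H. neg x \<in> H) \<longrightarrow> M' \<subseteq> H)"
  proof (rule insert.IH)
    show "x = y" if "x \<in> M'" "y \<in> M'" "\<And>c. c \<in> C \<Longrightarrow> c x = c y" for x y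
      using that by (intro M(7)) (auto simp: M'_def)
    show "pl x y \<in> M'" if "x \<in> M'" "y \<in> M'" for x y
      using that M(2)[of x y] M(5)[of c x y] by (simp add: M'_def)
    show "neg x \<in> M'" if "x \<in> M'" for x
      using that M(3)[of x] M(6)[of c x] by (simp add: M'_def)
  qed (use M(1,4,5,6) in \<open>simp_all add: M'_def\<close>)
  then obtain B' where B': "B' \<subseteq> M'" "finite B'"
    "\<And>H. z \<in> H \<Longrightarrow> B' \<subseteq> H \<Longrightarrow> (\<forall>x\<in>H. \<forall>y\<in>H. pl x y \<in> H) \<Longrightarrow> (\<forall>x\<in>H. neg x \<in> H) \<Longrightarrow> M' \<subseteq> H"
    by metis
  show ?case
  proof (cases "\<exists>x\<in>M. c x > 0")
    case False
    have "c x = 0" if "x \<in> M" for x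
    proof -
      have "\<not> c x > 0" "\<not> c (neg x) > 0" using False that M(3)[OF that] by auto
      then show ?thesis using M(6)[of c x] that by simp
    qed
    then have "M' = M" by (auto simp: M'_def)
    then show ?thesis using B' by blast
  next
    case True
    define g where "g = (LEAST k. k > 0 \<and> (\<exists>x\<in>M. c x = int k))"
    have "\<exists>k. k > 0 \<and> (\<exists>x\<in>M. c x = int k)"
      using True by (metis pos_int_cases)
    then have "g > 0 \<and> (\<exists>x\<in>M. c x = int g)" unfolding g_def by (rule LeastI_ex)
    then obtain m where m: "g > 0" "m \<in> M" "c m = int g" by blast
    have least: "g \<le> k" if "k > 0" "x \<in> M" "c x = int k" for k x
      unfolding g_def by (rule Least_le) (use that in blast)
    have mults: "\<exists>y\<in>M \<inter> H. c y = int g * k"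
      if H: "z \<in> H" "m \<in> H" "\<forall>x\<in>H. \<forall>y\<in>H. pl x y \<in> H" "\<forall>x\<in>H. neg x \<in> H" for H and k :: int
    proof (induction k rule: int_induct[of _ 0])
      case base
      show ?case using H(1) M(1) M(4)[of c] by (intro bexI[of _ z]) auto
    next
      case (step1 i)
      then obtain y where "y \<in> M \<inter> H" "c y = int g * i" by blast
      then show ?case using H m M(2) cpl by (intro bexI[of _ "pl y m"]) (auto simp: algebra_simps)
    next
      case (step2 i)
      then obtain y where "y \<in> M \<inter> H" "c y = int g * i" by blast
      then show ?case using H m M(2,3) cpl cneg by (intro bexI[of _ "pl y (neg m)"]) (auto simp: algebra_simps)
    qed
    have gen: "M \<subseteq> H" if H: "z \<in> H" "insert m B' \<subseteq> H" "\<forall>x\<in>H. \<forall>y\<in>H. pl x y \<in> H" "\<forall>x\<in>H. neg x \<in> H" for H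
    proof
      fix x assume x: "x \<in> M"
      have sub: "\<exists>y\<in>M \<inter> H'. c (pl x (neg y)) = c x - int g * k"
        if h: "z \<in> H'" "m \<in> H'" "\<forall>x\<in>H'. \<forall>y\<in>H'. pl x y \<in> H'" "\<forall>x\<in>H'. neg x \<in> H'" for H' k
      proof -
        obtain y where "y \<in> M \<inter> H'" "c y = int g * k" using mults[OF h] by blast
        then show ?thesis using x M(3) cpl cneg by (intro bexI[of _ y]) auto
      qed
      \<comment> \<open>Division with remainder: the difference has a value between 0 and
        \<open>g - 1\<close>, hence 0 by minimality of \<open>g\<close>.\<close>
      obtain y where y: "y \<in> M" "y \<in> H" "c (pl x (neg y)) = c x - int g * (c x div int g)"
        using sub[of H "c x div int g"] H by blast
      then have "c (pl x (neg y)) = c x mod int g" by (simp add: minus_mult_div_eq_mod)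
      moreover have "c x mod int g < int g" "c x mod int g \<ge> 0" using m(1) by auto
      moreover have "pl x (neg y) \<in> M" using x y M(2,3) by blast
      ultimately have "c (pl x (neg y)) = 0"
        using least[of "nat (c x mod int g)" "pl x (neg y)"] by (metis int_nat_eq linorder_not_le nat_0_iff nat_less_iff zero_less_nat_eq order_le_less)
      then have "pl x (neg y) \<in> M'" using \<open>pl x (neg y) \<in> M\<close> by (simp add: M'_def)
      then have h: "pl x (neg y) \<in> H" using B'(3)[of H] H by blast
      have "x = pl (pl x (neg y)) y"
      proof (rule M(7))
        fix c' assume c': "c' \<in> insert c C"
        note xy = M(2)[OF x M(3)[OF y(1)]]
        show "c' x = c' (pl (pl x (neg y)) y)"
          using M(5)[OF c' xy y(1)] M(5)[OF c' x M(3)[OF y(1)]] M(6)[OF c' y(1)] by simp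
      qed (use x y M(2,3) in auto)
      then show "x \<in> H" using h y(2) H(3) by metis
    qed
    show ?thesis
      by (rule exI[of _ "insert m B'"]) (use B'(1,2) m(2) gen in \<open>auto simp: M'_def\<close>)
  qed
qed

lemma subgroup_of_integers_finitely_generated:
  fixes L :: "'a::field_char_0 set"
  assumes L: "L = qvs.span B0" "finite B0" "1 \<in> L"
    "\<And>x y. x \<in> L \<Longrightarrow> y \<in> L \<Longrightarrow> x * y \<in> L" "\<And>x. x \<in> L \<Longrightarrow> inverse x \<in> L"
    and M: "M \<subseteq> L" "\<And>x. x \<in> M \<Longrightarrow> algebraic_int x" "0 \<in> M" "\<And>x y. x \<in> M \<Longrightarrow> y \<in> M \<Longrightarrow> x - y \<in> M"
  shows "\<exists>B\<subseteq>M. finite B \<and> M \<subseteq> zmod.span B"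
proof -
  obtain C :: "('a \<Rightarrow> int) set" where C: "finite C"
    "\<And>c x y. c \<in> C \<Longrightarrow> x \<in> L \<Longrightarrow> y \<in> L \<Longrightarrow> algebraic_int x \<Longrightarrow> algebraic_int y \<Longrightarrow> c (x + y) = c x + c y"
    "\<And>x. x \<in> L \<Longrightarrow> algebraic_int x \<Longrightarrow> (\<And>c. c \<in> C \<Longrightarrow> c x = 0) \<Longrightarrow> x = 0"
    using integral_coordinates[OF L] by blast
  have ng: "- x \<in> M" if "x \<in> M" for x using M(4)[OF M(3) that] by simp
  have add: "x + y \<in> M" if "x \<in> M" "y \<in> M" for x y using M(4)[OF that(1) ng[OF that(2)]] by simp
  have cadd: "c (x + y) = c x + c y" if "c \<in> C" "x \<in> M" "y \<in> M" for c x y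
    by (intro C(2)) (use that M in auto)
  have c0: "c 0 = 0" if "c \<in> C" for c using cadd[OF that M(3) M(3)] by simp
  have cneg: "c (- x) = - c x" if "c \<in> C" "x \<in> M" for c x
    using cadd[OF that(1,2) ng[OF that(2)]] c0[OF that(1)] by simp
  have inj: "x = y" if xy: "x \<in> M" "y \<in> M" and eq: "\<And>c. c \<in> C \<Longrightarrow> c x = c y" for x y
  proof -
    have "c (x - y) = 0" if "c \<in> C" for c
      using cadd[OF that xy(1) ng[OF xy(2)]] cneg[OF that xy(2)] eq[OF that] by simp
    moreover have "x - y \<in> M" using xy M(4) by blast
    ultimately have "x - y = 0" using C(3)[of "x - y"] M(1,2) by blast
    then show ?thesis by simp
  qed
  have "\<exists>B\<subseteq>M. finite B \<and> (\<forall>H. 0 \<in> H \<longrightarrow> B \<subseteq> H \<longrightarrow>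
      (\<forall>x\<in>H. \<forall>y\<in>H. x + y \<in> H) \<longrightarrow> (\<forall>x\<in>H. - x \<in> H) \<longrightarrow> M \<subseteq> H)"
    by (rule finitely_generated_by_coordinates[where C = C])
      (fact C(1) M(3) add ng c0 cadd cneg inj)+
  then obtain B where B: "B \<subseteq> M \<and> finite B \<and> (\<forall>H. 0 \<in> H \<longrightarrow> B \<subseteq> H \<longrightarrow>
      (\<forall>x\<in>H. \<forall>y\<in>H. x + y \<in> H) \<longrightarrow> (\<forall>x\<in>H. - x \<in> H) \<longrightarrow> M \<subseteq> H)"
    by (elim exE)
  have "M \<subseteq> zmod.span B"
    using B[THEN conjunct2, THEN conjunct2, rule_format, of "zmod.span B"]
    by (simp add: zmod.span_zero zmod.span_add zmod.span_neg zmod.span_superset)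
  with B show ?thesis by blast
qed

section \<open>Ideals of the ring of integers\<close>

definition alg_ints :: "'a::field set" where
  "alg_ints = {x. algebraic_int x}"

lemma alg_ints_closed [simp, intro]:
  fixes x y :: "'a::field_char_0"
  shows "0 \<in> alg_ints" "(1::'a) \<in> alg_ints" "of_nat n \<in> (alg_ints :: 'a set)" "of_int z \<in> (alg_ints :: 'a set)"
    "x \<in> alg_ints \<Longrightarrow> y \<in> alg_ints \<Longrightarrow> x + y \<in> alg_ints"
    "x \<in> alg_ints \<Longrightarrow> y \<in> alg_ints \<Longrightarrow> x - y \<in> alg_ints"
    "x \<in> alg_ints \<Longrightarrow> y \<in> alg_ints \<Longrightarrow> x * y \<in> alg_ints"
    "x \<in> alg_ints \<Longrightarrow> - x \<in> alg_ints" "x \<in> alg_ints \<Longrightarrow> x ^ n \<in> alg_ints"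
  by (auto simp: alg_ints_def)

lemma alg_ints_sum: "(\<And>i. i \<in> I \<Longrightarrow> f i \<in> alg_ints) \<Longrightarrow> sum f I \<in> (alg_ints :: 'a::field_char_0 set)"
  by (auto simp: alg_ints_def)

lemma ring_of_integers_simps [simp]:
  "carrier ring_of_integers = alg_ints"
  "x \<otimes>\<^bsub>ring_of_integers\<^esub> y = x * y" "x \<oplus>\<^bsub>ring_of_integers\<^esub> y = x + y"
  "\<zero>\<^bsub>ring_of_integers\<^esub> = 0" "\<one>\<^bsub>ring_of_integers\<^esub> = 1"
  by (simp_all add: ring_of_integers_def ring_of_type_algebra_def alg_ints_def)

lemma cring_ring_of_integers: "cring (ring_of_integers :: 'a::field_char_0 ring)"
proof (rule cringI)
  show "abelian_group (ring_of_integers :: 'a ring)"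
  proof (rule abelian_groupI)
    show "\<exists>y\<in>carrier ring_of_integers. y \<oplus>\<^bsub>ring_of_integers\<^esub> x = \<zero>\<^bsub>ring_of_integers\<^esub>"
      if "x \<in> carrier ring_of_integers" for x :: 'a
      using that by (intro bexI[of _ "- x"]) auto
  qed (auto simp: algebra_simps)
  show "Group.comm_monoid (ring_of_integers :: 'a ring)"
    by (rule comm_monoidI) (auto simp: algebra_simps)
qed (auto simp: algebra_simps)

lemma ring_of_integers_minus [simp]:
  fixes x y :: "'a::field_char_0"
  assumes "x \<in> alg_ints" "y \<in> alg_ints"
  shows "\<ominus>\<^bsub>ring_of_integers\<^esub> y = - y" "x \<ominus>\<^bsub>ring_of_integers\<^esub> y = x - y"
proof -
  interpret cring "ring_of_integers :: 'a ring" by (rule cring_ring_of_integers)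
  show *: "\<ominus>\<^bsub>ring_of_integers\<^esub> y = - y"
    by (rule minus_equality) (use assms in auto)
  show "x \<ominus>\<^bsub>ring_of_integers\<^esub> y = x - y"
    unfolding a_minus_def * by simp
qed

lemma ring_of_integers_pow [simp]: "x [^]\<^bsub>ring_of_integers\<^esub> (n::nat) = x ^ n"
  by (induction n) (auto simp: nat_pow_def mult.commute)

text \<open>Ideals as plain sets closed under the field operations, so that computations avoid the
  ring record; \<open>ideal_iff_int_ideal\<close> makes the link. Closure under negation comes from
  multiplication by -1.\<close>

definition int_ideal :: "'a::field set \<Rightarrow> bool" where
  "int_ideal I \<longleftrightarrow> I \<subseteq> alg_ints \<and> 0 \<in> I \<and> (\<forall>x\<in>I. \<forall>y\<in>I. x + y \<in> I) \<and> (\<forall>r\<in>alg_ints. \<forall>x\<in>I. r * x \<in> I)"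

lemma int_idealD:
  assumes "int_ideal I"
  shows "x \<in> I \<Longrightarrow> x \<in> alg_ints" "0 \<in> I" "x \<in> I \<Longrightarrow> y \<in> I \<Longrightarrow> x + y \<in> I"
    "r \<in> alg_ints \<Longrightarrow> x \<in> I \<Longrightarrow> r * x \<in> I" "r \<in> alg_ints \<Longrightarrow> x \<in> I \<Longrightarrow> x * r \<in> I"
  using assms unfolding int_ideal_def by (auto simp: mult.commute)

lemma int_ideal_uminus: "int_ideal I \<Longrightarrow> x \<in> I \<Longrightarrow> - x \<in> (I :: 'a::field_char_0 set)"
  using int_idealD(4)[of I "- 1" x] by auto

lemma int_ideal_minus: "int_ideal I \<Longrightarrow> x \<in> I \<Longrightarrow> y \<in> I \<Longrightarrow> x - y \<in> (I :: 'a::field_char_0 set)"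
  using int_idealD(3)[of I x "- y"] int_ideal_uminus[of I y] by auto

lemma ideal_iff_int_ideal:
  "ideal I ring_of_integers \<longleftrightarrow> int_ideal (I :: 'a::field_char_0 set)"
proof
  interpret cring "ring_of_integers :: 'a ring" by (rule cring_ring_of_integers)
  assume "ideal I ring_of_integers"
  then interpret I: ideal I "ring_of_integers :: 'a ring" .
  show "int_ideal I"
    unfolding int_ideal_def using I.Icarr I.I_l_closed I.zero_closed I.a_closed by auto
next
  interpret cring "ring_of_integers :: 'a ring" by (rule cring_ring_of_integers)
  assume I: "int_ideal I"
  have inv: "inv\<^bsub>add_monoid ring_of_integers\<^esub> x = - x" if "x \<in> I" for x
    using ring_of_integers_minus(1)[of x x] int_idealD(1)[OF I that] by (simp add: a_inv_def)
  show "ideal I ring_of_integers"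
  proof (rule idealI)
    show "subgroup I (add_monoid ring_of_integers)"
      using I inv int_idealD[OF I] int_ideal_uminus[OF I] by unfold_locales auto
  qed (use I ring_axioms in \<open>auto dest: int_idealD\<close>)
qed

lemma int_ideal_alg_ints: "int_ideal (alg_ints :: 'a::field_char_0 set)"
  by (auto simp: int_ideal_def)

lemma int_ideal_eq_alg_ints: "int_ideal I \<Longrightarrow> 1 \<in> I \<Longrightarrow> I = (alg_ints :: 'a::field_char_0 set)"
  using int_idealD(1,4)[of I] by (metis mult_1_right subset_antisym subsetI)

abbreviation idl_prod :: "'a::field set \<Rightarrow> 'a set \<Rightarrow> 'a set" (infixl "\<odot>" 70) where
  "I \<odot> J \<equiv> ideal_prod ring_of_integers I J"

lemma idl_prod:
  fixes I J :: "'a::field_char_0 set"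
  assumes "int_ideal I" "int_ideal J"
  shows int_ideal_idl_prod: "int_ideal (I \<odot> J)" and idl_prod_commute: "I \<odot> J = J \<odot> I"
    and idl_prod_unit: "alg_ints \<odot> I = I" and idl_prod_subset: "I \<odot> J \<subseteq> I \<inter> J"
proof -
  interpret cring "ring_of_integers :: 'a ring" by (rule cring_ring_of_integers)
  have I: "ideal I ring_of_integers" "ideal J ring_of_integers" "ideal alg_ints (ring_of_integers :: 'a ring)"
    using assms int_ideal_alg_ints by (auto simp: ideal_iff_int_ideal)
  show "int_ideal (I \<odot> J)" using ideal_prod_is_ideal[OF I(1,2)] by (simp add: ideal_iff_int_ideal)
  show "I \<odot> J = J \<odot> I" using ideal_prod_commute[OF I(1,2)] .
  show "alg_ints \<odot> I = I" using ideal_prod_commute[OF I(3,1)] ideal_prod_one[OF I(1)] by simp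
  show "I \<odot> J \<subseteq> I \<inter> J" using ideal_prod_inter[OF I(1,2)] .
qed

lemma idl_prod_assoc:
  fixes I J :: "'a::field_char_0 set"
  assumes "int_ideal I" "int_ideal J" "int_ideal H"
  shows "(I \<odot> J) \<odot> H = I \<odot> (J \<odot> H)"
proof -
  interpret cring "ring_of_integers :: 'a ring" by (rule cring_ring_of_integers)
  show ?thesis using ideal_prod_assoc assms by (simp add: ideal_iff_int_ideal)
qed

lemma idl_prod_mem: "x \<in> I \<Longrightarrow> y \<in> J \<Longrightarrow> x * y \<in> I \<odot> J"
  using ideal_prod.prod[of x I y J ring_of_integers] by simp

lemma idl_prod_add: "s \<in> I \<odot> J \<Longrightarrow> t \<in> I \<odot> J \<Longrightarrow> s + t \<in> I \<odot> J"
  using ideal_prod.sum[of s ring_of_integers I J t] by simp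

lemma idl_prod_leI:
  assumes "int_ideal H" "\<And>x y. x \<in> I \<Longrightarrow> y \<in> J \<Longrightarrow> x * y \<in> H"
  shows "I \<odot> J \<subseteq> H"
proof
  fix s assume "s \<in> I \<odot> J"
  then show "s \<in> H"
    by (induction rule: ideal_prod.induct) (use assms in \<open>auto dest: int_idealD\<close>)
qed

lemma idl_prod_mono: "I \<subseteq> I' \<Longrightarrow> J \<subseteq> J' \<Longrightarrow> I \<odot> J \<subseteq> I' \<odot> J'"
proof
  fix s assume "I \<subseteq> I'" "J \<subseteq> J'" "s \<in> I \<odot> J"
  from this(3,1,2) show "s \<in> I' \<odot> J'"
    by (induction rule: ideal_prod.induct) (auto intro: idl_prod_mem idl_prod_add)
qed

definition int_prime :: "'a::field set \<Rightarrow> bool" where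
  "int_prime P \<longleftrightarrow> int_ideal P \<and> P \<noteq> {0} \<and> 1 \<notin> P \<and>
    (\<forall>x\<in>alg_ints. \<forall>y\<in>alg_ints. x * y \<in> P \<longrightarrow> x \<in> P \<or> y \<in> P)"

lemma nz_primes_iff: "(P :: 'a::field_char_0 set) \<in> nz_primes \<longleftrightarrow> int_prime P"
proof
  interpret R: cring "ring_of_integers :: 'a ring" by (rule cring_ring_of_integers)
  {
    assume P: "P \<in> nz_primes"
    then interpret P: primeideal P "ring_of_integers :: 'a ring" by (simp add: nz_primes_def)
    have I: "int_ideal P" using P.is_ideal by (simp add: ideal_iff_int_ideal)
    then have "1 \<notin> P" using P.I_notcarr int_ideal_eq_alg_ints by fastforce
    then show "int_prime P" using I P P.I_prime by (auto simp: int_prime_def nz_primes_def)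
  next
    assume P: "int_prime P"
    then have "primeideal P ring_of_integers"
      by (intro primeidealI R.is_cring) (auto simp: int_prime_def ideal_iff_int_ideal)
    then show "P \<in> nz_primes" using P by (auto simp: nz_primes_def int_prime_def)
  }
qed

lemma nz_ideals_iff: "(I :: 'a::field_char_0 set) \<in> nz_ideals \<longleftrightarrow> int_ideal I \<and> I \<noteq> {0}"
  by (auto simp: nz_ideals_def ideal_iff_int_ideal)

lemma int_primeD:
  assumes "int_prime P"
  shows "int_ideal P" "P \<noteq> {0}" "1 \<notin> P" "x \<in> alg_ints \<Longrightarrow> y \<in> alg_ints \<Longrightarrow> x * y \<in> P \<Longrightarrow> x \<in> P \<or> y \<in> P"
  using assms by (auto simp: int_prime_def)

lemma nz_ideals_prod:
  fixes I J :: "'a::field_char_0 set"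
  assumes "I \<in> nz_ideals" "J \<in> nz_ideals"
  shows "I \<odot> J \<in> nz_ideals"
proof -
  obtain x y where "x \<in> I" "x \<noteq> 0" "y \<in> J" "y \<noteq> 0"
    using assms int_idealD(2) unfolding nz_ideals_iff by blast
  then have "x * y \<in> I \<odot> J" "x * y \<noteq> 0" by (auto intro: idl_prod_mem)
  then show ?thesis using assms int_ideal_idl_prod by (auto simp: nz_ideals_iff)
qed

section \<open>The arithmetic of ideals in a number field\<close>

lemma number_field_finite_span:
  "\<exists>B. finite B \<and> (UNIV :: 'k::number_field set) = qvs.span B"
proof -
  obtain B :: "'k set" where B: "finite B" "\<And>x. \<exists>c :: 'k \<Rightarrow> rat. x = (\<Sum>b\<in>B. of_rat (c b) * b)"
    using finite_over_rat by blast
  have "x \<in> qvs.span B" for x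
    using B(2)[of x] unfolding qvs.span_finite[OF B(1)] by auto
  with B(1) show ?thesis by auto
qed

lemma int_ideal_finitely_generated:
  fixes I :: "'k::number_field set"
  assumes "int_ideal I"
  obtains B where "B \<subseteq> I" "finite B" "I \<subseteq> zmod.span B"
proof -
  obtain B0 :: "'k set" where B0: "finite B0" "UNIV = qvs.span B0"
    using number_field_finite_span by blast
  have "\<exists>B\<subseteq>I. finite B \<and> I \<subseteq> zmod.span B"
    by (rule subgroup_of_integers_finitely_generated[OF B0(2,1)])
      (use assms int_idealD[OF assms] int_ideal_minus[OF assms] in \<open>auto simp: alg_ints_def\<close>)
  then show ?thesis using that by (elim exE conjE)
qed

lemma number_field_integer_multiple:
  fixes x :: "'k::number_field"
  obtains n :: nat where "n > 0" "of_nat n * x \<in> alg_ints"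
proof -
  obtain B0 :: "'k set" where B0: "finite B0" "UNIV = qvs.span B0"
    using number_field_finite_span by blast
  have "finite (insert 1 B0)" "\<exists>b\<in>insert 1 B0. b \<noteq> 0" using B0(1) by auto
  moreover have "x * b \<in> qvs.span (insert 1 B0)" for b
    using qvs.span_mono[of B0 "insert 1 B0"] B0(2) by auto
  ultimately obtain d :: nat where "d > 0" "algebraic_int (of_nat d * x)"
    by (rule rational_stable_integer_multiple)
  then show ?thesis using that by (simp add: alg_ints_def)
qed

lemma nz_ideal_contains_nat:
  fixes I :: "'k::field_char_0 set"
  assumes "int_ideal I" "I \<noteq> {0}"
  obtains n :: nat where "n > 0" "of_nat n \<in> I"
proof -
  obtain x where x: "x \<in> I" "x \<noteq> 0" using assms int_idealD(2) by blast
  then have "algebraic_int x" using assms int_idealD(1) by (auto simp: alg_ints_def)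
  then obtain n y where "n > 0" "algebraic_int y" "of_nat n = x * y"
    using x(2) by (rule algebraic_int_divisor_nat)
  then show ?thesis
    using that[of n] int_idealD(5)[OF assms(1), of y x] x(1) by (auto simp: alg_ints_def)
qed

lemma finite_residues_span:
  fixes B :: "'a::field_char_0 set"
  assumes "n > 0" and B: "B \<subseteq> alg_ints" "finite B"
  shows "\<exists>S. finite S \<and> S \<subseteq> alg_ints \<and> (\<forall>x\<in>zmod.span B. \<exists>s\<in>S. \<exists>y\<in>alg_ints. x - s = of_nat n * y)"
proof -
  define S where "S = (\<lambda>c. \<Sum>b\<in>B. of_int (c b) * b) ` (B \<rightarrow>\<^sub>E {0..<int n})"
  show ?thesis
  proof (intro exI[of _ S] conjI ballI)
    show "finite S" using B(2) by (auto simp: S_def intro!: finite_PiE)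
    show "S \<subseteq> alg_ints" using B(1) by (auto simp: S_def intro!: alg_ints_sum)
    fix x assume "x \<in> zmod.span B"
    then obtain c where c: "x = (\<Sum>b\<in>B. of_int (c b) * b)"
      unfolding zmod.span_finite[OF B(2)] by auto
    define s where "s = (\<Sum>b\<in>B. of_int ((\<lambda>b\<in>B. c b mod int n) b) * b)"
    define y where "y = (\<Sum>b\<in>B. of_int (c b div int n) * b)"
    have "s \<in> S" unfolding S_def s_def using assms(1) by (intro imageI) auto
    moreover have "y \<in> alg_ints" unfolding y_def using B(1) by (auto intro!: alg_ints_sum)
    moreover have "x = s + of_nat n * y"
    proof -
      have "of_int (c b) * b = of_int (c b mod int n) * b + of_nat n * (of_int (c b div int n) * b)" for b
      proof -
        have "(of_int (c b) :: 'a) = of_int (c b mod int n + int n * (c b div int n))" by simp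
        also have "\<dots> = of_int (c b mod int n) + of_nat n * of_int (c b div int n)"
          by (simp only: of_int_add of_int_mult of_int_of_nat_eq)
        finally show ?thesis by (simp add: algebra_simps)
      qed
      then have "x = (\<Sum>b\<in>B. of_int (c b mod int n) * b + of_nat n * (of_int (c b div int n) * b))"
        unfolding c by (intro sum.cong) auto
      also have "\<dots> = s + of_nat n * y"
        by (simp add: s_def y_def sum.distrib sum_distrib_left)
      finally show ?thesis .
    qed
    ultimately show "\<exists>s\<in>S. \<exists>y\<in>alg_ints. x - s = of_nat n * y" by (metis add_diff_cancel_left')
  qed
qed

lemma finite_residues_nat:
  assumes "n > 0"
  shows "\<exists>S :: 'k::number_field set. finite S \<and> S \<subseteq> alg_ints \<and> (\<forall>x\<in>alg_ints. \<exists>s\<in>S. \<exists>y\<in>alg_ints. x - s = of_nat n * y)"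
proof -
  obtain B :: "'k set" where B: "B \<subseteq> alg_ints" "finite B" "alg_ints \<subseteq> zmod.span B"
    by (rule int_ideal_finitely_generated[OF int_ideal_alg_ints])
  obtain S :: "'k set" where "finite S" "S \<subseteq> alg_ints" "\<forall>x\<in>zmod.span B. \<exists>s\<in>S. \<exists>y\<in>alg_ints. x - s = of_nat n * y"
    using finite_residues_span[OF assms B(1,2)] by (elim exE conjE)
  then show ?thesis using B(3) by (intro exI[of _ S]) auto
qed

lemma finite_residues:
  fixes I :: "'k::number_field set"
  assumes "int_ideal I" "I \<noteq> {0}"
  obtains S where "finite S" "S \<subseteq> alg_ints" "\<And>x. x \<in> alg_ints \<Longrightarrow> \<exists>s\<in>S. x - s \<in> I"
proof -
  obtain n :: nat where n: "n > 0" "of_nat n \<in> I" using nz_ideal_contains_nat[OF assms] .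
  obtain S :: "'k set" where "finite S" "S \<subseteq> alg_ints" "\<forall>x\<in>alg_ints. \<exists>s\<in>S. \<exists>y\<in>alg_ints. x - s = of_nat n * y"
    using finite_residues_nat[OF n(1)] by blast
  then show ?thesis using that int_idealD(5)[OF assms(1) _ n(2)] by metis
qed

text \<open>An ideal containing \<open>I\<close> is a union of residue classes modulo
  \<open>I\<close>, so it is determined by the representatives in \<open>S\<close> that it
  contains.\<close>

lemma finite_ideals_above:
  fixes I :: "'k::number_field set"
  assumes "int_ideal I" "I \<noteq> {0}"
  shows "finite {J. int_ideal J \<and> I \<subseteq> J}"
proof -
  obtain S where S: "finite S" "S \<subseteq> alg_ints" "\<And>x. x \<in> alg_ints \<Longrightarrow> \<exists>s\<in>S. x - s \<in> I"
    using finite_residues[OF assms] by blast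
  have sub: "J \<subseteq> J'" if J: "int_ideal J" "I \<subseteq> J" "int_ideal J'" "I \<subseteq> J'" "J \<inter> S = J' \<inter> S" for J J'
  proof
    fix x assume x: "x \<in> J"
    then obtain s where s: "s \<in> S" "x - s \<in> I" using S(3) int_idealD(1)[OF J(1)] by blast
    then have "x - (x - s) \<in> J" using x J(1,2) int_ideal_minus by blast
    then have "s \<in> J'" using s J(5) by auto
    moreover have "x - s \<in> J'" using s J(4) by blast
    ultimately have "s + (x - s) \<in> J'" using int_idealD(3)[OF J(3)] by blast
    then show "x \<in> J'" by simp
  qed
  have "inj_on (\<lambda>J. J \<inter> S) {J. int_ideal J \<and> I \<subseteq> J}"
    by (rule inj_onI, rule subset_antisym; rule sub) auto
  moreover have "(\<lambda>J. J \<inter> S) ` {J. int_ideal J \<and> I \<subseteq> J} \<subseteq> Pow S" by auto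
  ultimately show ?thesis using S(1) by (meson finite_Pow_iff inj_on_finite)
qed

text \<open>Noetherian induction, measured by the number of ideals above \<open>I\<close>, which is
  finite and drops strictly as \<open>I\<close> grows.\<close>

lemma int_ideal_induct [consumes 2, case_names step]:
  fixes I :: "'k::number_field set"
  assumes "int_ideal I" "I \<noteq> {0}"
    and step: "\<And>I. int_ideal I \<Longrightarrow> I \<noteq> {0} \<Longrightarrow> (\<And>J. int_ideal J \<Longrightarrow> I \<subset> J \<Longrightarrow> Q J) \<Longrightarrow> Q I"
  shows "Q I"
  using assms(1,2)
proof (induction "card {J. int_ideal J \<and> I \<subseteq> J}" arbitrary: I rule: less_induct)
  case less
  show ?case
  proof (rule step[OF less.prems])
    fix J assume J: "int_ideal J" "I \<subset> J"
    have "{H. int_ideal H \<and> J \<subseteq> H} \<subset> {H. int_ideal H \<and> I \<subseteq> H}" using J less.prems by auto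
    then have "card {H. int_ideal H \<and> J \<subseteq> H} < card {H. int_ideal H \<and> I \<subseteq> H}"
      by (rule psubset_card_mono[OF finite_ideals_above[OF less.prems]])
    moreover have "J \<noteq> {0}" using J less.prems int_idealD(2) by blast
    ultimately show "Q J" using less.hyps J(1) by blast
  qed
qed

text \<open>A finite domain is a field. By pigeonhole two powers of \<open>x\<close> agree modulo
  \<open>P\<close>; cancelling the smaller one, which lies outside the prime, puts some
  \<open>1 - x ^ k\<close> with \<open>k > 0\<close> into \<open>P\<close>, so that an ideal above
  \<open>P\<close> containing \<open>x\<close> contains 1.\<close>

lemma int_prime_maximal:
  fixes P :: "'k::number_field set"
  assumes P: "int_prime P" and J: "int_ideal J" "P \<subseteq> J" "1 \<notin> J"
  shows "J = P"
proof (rule ccontr)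
  assume "J \<noteq> P"
  then obtain x where x: "x \<in> J" "x \<notin> P" using J by blast
  have I: "int_ideal P" "P \<noteq> {0}" using int_primeD[OF P] by auto
  have xi: "x \<in> alg_ints" using x J int_idealD by blast
  obtain S where S: "finite S" "S \<subseteq> alg_ints" "\<And>x. x \<in> alg_ints \<Longrightarrow> \<exists>s\<in>S. x - s \<in> P"
    using finite_residues[OF I] by blast
  from S(3)[OF alg_ints_closed(9)[OF xi]] obtain r where r: "\<And>i::nat. r i \<in> S" "\<And>i. x ^ i - r i \<in> P"
    by metis
  have "\<not> inj r" using S(1) r(1) by (metis finite_subset image_subsetI infinite_UNIV_nat finite_imageD)
  then obtain i j where ij: "i < j" "r i = r j"
    unfolding inj_def by (metis linorder_neqE_nat)
  have "x ^ i - r i - (x ^ j - r j) \<in> P" using r(2) int_ideal_minus[OF I(1)] by blast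
  then have "x ^ i * (1 - x ^ (j - i)) \<in> P"
    using ij by (simp add: right_diff_distrib flip: power_add)
  moreover have "x ^ k \<notin> P" for k
    using int_primeD(3,4)[OF P] x(2) xi by (induction k) auto
  ultimately have "1 - x ^ (j - i) \<in> P" using int_primeD(4)[OF P] xi by blast
  then have "1 - x ^ (j - i) \<in> J" using J by auto
  moreover have "x ^ (j - i) \<in> J"
    using ij int_idealD(5)[OF J(1) _ x(1)] xi by (cases "j - i") auto
  ultimately have "1 - x ^ (j - i) + x ^ (j - i) \<in> J" using int_idealD(3)[OF J(1)] by blast
  then show False using J by simp
qed

definition ideal_adjoin :: "'a::field set \<Rightarrow> 'a \<Rightarrow> 'a set" where
  "ideal_adjoin I x = {a + r * x | a r. a \<in> I \<and> r \<in> alg_ints}"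

lemma ideal_adjoin:
  fixes I :: "'a::field_char_0 set"
  assumes "int_ideal I" "x \<in> alg_ints"
  shows "int_ideal (ideal_adjoin I x)" "I \<subseteq> ideal_adjoin I x" "x \<in> ideal_adjoin I x"
proof -
  show "int_ideal (ideal_adjoin I x)"
    unfolding int_ideal_def
  proof (intro conjI ballI)
    show "ideal_adjoin I x \<subseteq> alg_ints" using assms int_idealD(1) by (auto simp: ideal_adjoin_def)
    show "0 \<in> ideal_adjoin I x"
      unfolding ideal_adjoin_def using int_idealD(2)[OF assms(1)] by (force intro: exI[of _ 0])
    fix y assume "y \<in> ideal_adjoin I x"
    then obtain a r where y: "y = a + r * x" "a \<in> I" "r \<in> alg_ints" by (auto simp: ideal_adjoin_def)
    {
      fix z assume "z \<in> ideal_adjoin I x"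
      then obtain a' r' where z: "z = a' + r' * x" "a' \<in> I" "r' \<in> alg_ints" by (auto simp: ideal_adjoin_def)
      have "y + z = (a + a') + (r + r') * x" by (simp add: y z algebra_simps)
      then show "y + z \<in> ideal_adjoin I x"
        unfolding ideal_adjoin_def using y z int_idealD(3)[OF assms(1)] by blast
    }
    fix s :: 'a assume s: "s \<in> alg_ints"
    have "s * y = s * a + (s * r) * x" by (simp add: y algebra_simps)
    then show "s * y \<in> ideal_adjoin I x"
      unfolding ideal_adjoin_def using y s int_idealD(4)[OF assms(1)] by blast
  qed
  show "I \<subseteq> ideal_adjoin I x"
  proof
    fix a assume "a \<in> I"
    then have "a = a + 0 * x \<and> a \<in> I \<and> 0 \<in> (alg_ints :: 'a set)" by simp
    then show "a \<in> ideal_adjoin I x" unfolding ideal_adjoin_def by blast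
  qed
  have "x = 0 + 1 * x \<and> 0 \<in> I \<and> 1 \<in> (alg_ints :: 'a set)" using int_idealD(2)[OF assms(1)] by simp
  then show "x \<in> ideal_adjoin I x" unfolding ideal_adjoin_def by blast
qed

text \<open>If \<open>x * y\<close> lies in a proper ideal \<open>I\<close> but neither factor does,
  the ideal generated by \<open>I\<close> and \<open>x\<close> is still proper: an identity
  \<open>1 = a + r * x\<close>, multiplied by \<open>y\<close>, would put \<open>y\<close> into
  \<open>I\<close>.\<close>

lemma exists_prime_above:
  fixes I :: "'k::number_field set"
  assumes "int_ideal I" "I \<noteq> {0}" "1 \<notin> I"
  obtains P where "int_prime P" "I \<subseteq> P"
proof -
  have "1 \<notin> I \<longrightarrow> (\<exists>P. int_prime P \<and> I \<subseteq> P)"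
    using assms(1,2)
  proof (induction rule: int_ideal_induct)
    case (step I)
    show ?case
    proof (cases "int_prime I")
      case True
      then show ?thesis by blast
    next
      case False
      show ?thesis
      proof
        assume one: "1 \<notin> I"
        then obtain x y where xy: "x \<in> alg_ints" "y \<in> alg_ints" "x * y \<in> I" "x \<notin> I" "y \<notin> I"
          using False step.hyps by (auto simp: int_prime_def)
        note A = ideal_adjoin[OF step.hyps(1) xy(1)]
        have ss: "I \<subset> ideal_adjoin I x" using A xy(4) by blast
        have "1 \<notin> ideal_adjoin I x"
        proof
          assume "1 \<in> ideal_adjoin I x"
          then obtain a r where ar: "1 = a + r * x" "a \<in> I" "r \<in> alg_ints" by (auto simp: ideal_adjoin_def)
          have "y = a * y + r * (x * y)" using arg_cong[OF ar(1), of "\<lambda>z. z * y"] by (simp add: algebra_simps)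
          moreover have "a * y + r * (x * y) \<in> I" using ar xy step.hyps(1) int_idealD by metis
          ultimately show False using xy(5) by simp
        qed
        then show "\<exists>P. int_prime P \<and> I \<subseteq> P" using step.IH[OF A(1) ss] ss by blast
      qed
    qed
  qed
  then show ?thesis using assms(3) that by blast
qed

hide_const (open) Ring_Hom.ring_hom

section \<open>Products of primes and containment\<close>

abbreviation idl_list :: "'a::field set list \<Rightarrow> 'a set" where
  "idl_list ps \<equiv> foldr (\<lambda>I J. I \<odot> J) ps alg_ints"

lemma int_ideal_list: "(\<And>p. p \<in> set ps \<Longrightarrow> int_ideal p) \<Longrightarrow> int_ideal (idl_list ps :: 'a::field_char_0 set)"
  by (induction ps) (auto intro: int_ideal_alg_ints int_ideal_idl_prod)

lemma idl_list_append:
  "(\<And>p. p \<in> set (ps @ qs) \<Longrightarrow> int_ideal p) \<Longrightarrow> idl_list (ps @ qs) = idl_list ps \<odot> (idl_list qs :: 'a::field_char_0 set)"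
proof (induction ps)
  case Nil
  then show ?case using idl_prod_unit[OF int_ideal_list int_ideal_list, of qs qs] by simp
next
  case (Cons p ps)
  then have "(p \<odot> idl_list ps) \<odot> idl_list qs = p \<odot> (idl_list ps \<odot> idl_list qs)"
    by (intro idl_prod_assoc int_ideal_list) auto
  then show ?case using Cons by simp
qed

lemma idl_list_remove1:
  "p \<in> set ps \<Longrightarrow> (\<And>q. q \<in> set ps \<Longrightarrow> int_ideal q) \<Longrightarrow>
    idl_list ps = p \<odot> (idl_list (remove1 p ps) :: 'a::field_char_0 set)"
proof (induction ps)
  case (Cons q ps)
  show ?case
  proof (cases "p = q")
    case False
    define R where "R = idl_list (remove1 p ps)"
    have R: "int_ideal R" unfolding R_def using Cons.prems by (intro int_ideal_list) (auto dest: notin_set_remove1)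
    have pq: "int_ideal p" "int_ideal q" using Cons.prems by auto
    have "idl_list (q # ps) = q \<odot> (p \<odot> R)" using Cons False by (simp add: R_def)
    also have "\<dots> = (q \<odot> p) \<odot> R" using idl_prod_assoc pq R by metis
    also have "\<dots> = (p \<odot> q) \<odot> R" using idl_prod_commute pq by metis
    also have "\<dots> = p \<odot> (q \<odot> R)" using idl_prod_assoc pq R by metis
    finally show ?thesis using False by (simp add: R_def)
  qed simp
qed simp

lemma idl_list_nonzero:
  "(\<And>p. p \<in> set ps \<Longrightarrow> int_prime p) \<Longrightarrow> idl_list ps \<in> (nz_ideals :: 'a::field_char_0 set set)"
proof (induction ps)
  case Nil
  have "(1::'a) \<in> alg_ints" by simp
  then have "(alg_ints :: 'a set) \<noteq> {0}" by (metis singletonD zero_neq_one)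
  then show ?case using int_ideal_alg_ints by (simp add: nz_ideals_iff)
next
  case (Cons p ps)
  then show ?case using nz_ideals_prod[of p "idl_list ps"] int_primeD(1,2)[of p] by (simp add: nz_ideals_iff)
qed

lemma prime_contains_prod:
  assumes "int_prime (P :: 'a::field_char_0 set)" "int_ideal I" "int_ideal J" "I \<odot> J \<subseteq> P"
  shows "I \<subseteq> P \<or> J \<subseteq> P"
proof (rule ccontr)
  assume "\<not> ?thesis"
  then obtain x y where "x \<in> I" "y \<in> J" "x \<notin> P" "y \<notin> P" by blast
  then show False
    using idl_prod_mem[of x I y J] int_primeD(4)[OF assms(1)] int_idealD(1)[OF assms(2)] int_idealD(1)[OF assms(3)] assms(4)
    by blast
qed

lemma prime_contains_list:
  assumes "int_prime (P :: 'a::field_char_0 set)"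
  shows "(\<And>p. p \<in> set ps \<Longrightarrow> int_ideal p) \<Longrightarrow> idl_list ps \<subseteq> P \<Longrightarrow> \<exists>p\<in>set ps. p \<subseteq> P"
proof (induction ps)
  case Nil
  then show ?case using int_primeD(3)[OF assms] by auto
next
  case (Cons p ps)
  then have "p \<subseteq> P \<or> idl_list ps \<subseteq> P"
    by (intro prime_contains_prod[OF assms] int_ideal_list) auto
  then show ?case using Cons by auto
qed

text \<open>If \<open>x * y\<close> lies in \<open>I\<close> but \<open>x\<close> and
  \<open>y\<close> do not, the prime products found inside I + (x) and I + (y) multiply into
  \<open>I\<close>. Equality has to wait for the invertibility of primes.\<close>

lemma contains_prime_product:
  fixes I :: "'k::number_field set"
  assumes "int_ideal I" "I \<noteq> {0}"
  shows "\<exists>ps. (\<forall>p\<in>set ps. int_prime p) \<and> idl_list ps \<subseteq> I"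
  using assms
proof (induction rule: int_ideal_induct)
  case (step I)
  consider "1 \<in> I" | "int_prime I" | "1 \<notin> I" "\<not> int_prime I" by blast
  then show ?case
  proof cases
    case 1
    then show ?thesis using int_ideal_eq_alg_ints[OF step.hyps(1)] by (intro exI[of _ "[]"]) auto
  next
    case 2
    then have "I \<odot> alg_ints \<subseteq> I" using idl_prod_subset[OF step.hyps(1) int_ideal_alg_ints] by blast
    then show ?thesis using 2 by (intro exI[of _ "[I]"]) auto
  next
    case 3
    then obtain x y where xy: "x \<in> alg_ints" "y \<in> alg_ints" "x * y \<in> I" "x \<notin> I" "y \<notin> I"
      using step.hyps by (auto simp: int_prime_def)
    note A = ideal_adjoin[OF step.hyps(1) xy(1)] and B = ideal_adjoin[OF step.hyps(1) xy(2)]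
    obtain ps where ps: "\<forall>p\<in>set ps. int_prime p" "idl_list ps \<subseteq> ideal_adjoin I x"
      using step.IH[OF A(1)] A(2,3) xy(4) by blast
    obtain qs where qs: "\<forall>p\<in>set qs. int_prime p" "idl_list qs \<subseteq> ideal_adjoin I y"
      using step.IH[OF B(1)] B(2,3) xy(5) by blast
    have "idl_list (ps @ qs) = idl_list ps \<odot> idl_list qs"
      using ps(1) qs(1) by (intro idl_list_append) (auto simp: int_prime_def)
    also have "\<dots> \<subseteq> ideal_adjoin I x \<odot> ideal_adjoin I y" by (rule idl_prod_mono[OF ps(2) qs(2)])
    also have "\<dots> \<subseteq> I"
    proof (rule idl_prod_leI[OF step.hyps(1)])
      fix u v assume "u \<in> ideal_adjoin I x" "v \<in> ideal_adjoin I y"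
      then obtain a r b s where uv: "u = a + r * x" "a \<in> I" "r \<in> alg_ints" "v = b + s * y" "b \<in> I" "s \<in> alg_ints"
        by (auto simp: ideal_adjoin_def)
      note ID = int_idealD[OF step.hyps(1)]
      have "u * v = a * b + (s * y) * a + (r * x) * b + (r * s) * (x * y)" by (simp add: uv algebra_simps)
      also have "\<dots> \<in> I"
      proof -
        have "a * b \<in> I" "(s * y) * a \<in> I" "(r * x) * b \<in> I"
          using uv xy(1,2) ID(1) by (auto intro!: ID(4))
        moreover have "(r * s) * (x * y) \<in> I" using uv xy(3) ID(4) by simp
        ultimately show ?thesis by (intro ID(3))
      qed
      finally show "u * v \<in> I" .
    qed
    finally show ?thesis using ps qs by (intro exI[of _ "ps @ qs"]) auto
  qed
qed

section \<open>Invertibility of primes and unique factorization\<close>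

definition prime_inv :: "'a::field set \<Rightarrow> 'a set" where
  "prime_inv P = {\<beta>. \<forall>x\<in>P. \<beta> * x \<in> alg_ints}"

text \<open>Take a nonzero \<alpha> in \<open>P\<close> and a product of primes inside (\<alpha>)
  with as few factors as possible. One factor is \<open>P\<close>; by minimality the product of the
  others contains some \<gamma> outside (\<alpha>), and \<gamma> / \<alpha> multiplies
  \<open>P\<close> into the integers without being integral itself.\<close>

lemma prime_inv_not_integral:
  fixes P :: "'k::number_field set"
  assumes P: "int_prime P"
  obtains \<beta> where "\<beta> \<in> prime_inv P" "\<beta> \<notin> alg_ints"
proof -
  have IP: "int_ideal P" using int_primeD[OF P] by simp
  obtain \<alpha> where \<alpha>: "\<alpha> \<in> P" "\<alpha> \<noteq> 0" using int_primeD(2)[OF P] int_idealD(2)[OF IP] by blast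
  have \<alpha>i: "\<alpha> \<in> alg_ints" using \<alpha>(1) int_idealD(1)[OF IP] by simp
  define A where "A = {r * \<alpha> | r. r \<in> alg_ints}"
  have A: "int_ideal A"
    unfolding int_ideal_def A_def
  proof (safe, goal_cases)
    case 1 then show ?case using \<alpha>i by simp
  next
    case 2 show ?case by (intro exI[of _ 0]) auto
  next
    case (3 _ _ r s) then show ?case by (intro exI[of _ "r + s"]) (auto simp: algebra_simps)
  next
    case (4 s _ r) then show ?case by (intro exI[of _ "s * r"]) (auto simp: algebra_simps)
  qed
  have "\<alpha> \<in> A" unfolding A_def by (rule CollectI, rule exI[of _ 1]) simp
  then have "A \<noteq> {0}" using \<alpha>(2) by auto
  have AP: "A \<subseteq> P" using \<alpha>(1) int_idealD(4)[OF IP] by (auto simp: A_def)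
  define good where "good ps \<longleftrightarrow> (\<forall>p\<in>set ps. int_prime p) \<and> idl_list ps \<subseteq> A" for ps
  obtain ps0 where "good ps0" using contains_prime_product[OF A \<open>A \<noteq> {0}\<close>] unfolding good_def by blast
  then have "good (arg_min length good)" "\<And>qs. good qs \<Longrightarrow> length (arg_min length good) \<le> length qs"
    by (auto intro: arg_min_natI arg_min_nat_le)
  then obtain ps where ps: "good ps" "\<And>qs. good qs \<Longrightarrow> length ps \<le> length qs" by metis
  have "\<exists>p\<in>set ps. p \<subseteq> P"
    using ps(1) AP int_primeD(1) by (intro prime_contains_list[OF P]) (auto simp: good_def)
  then obtain p where p: "p \<in> set ps" "p \<subseteq> P" by blast
  then have "P = p"
    using ps(1) int_prime_maximal[of p P] IP int_primeD(3)[OF P] by (auto simp: good_def)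
  then have PS: "idl_list ps = P \<odot> idl_list (remove1 P ps)"
    using p ps(1) int_primeD(1) by (intro idl_list_remove1) (auto simp: good_def)
  have "length (remove1 P ps) < length ps" using p \<open>P = p\<close> length_pos_if_in_set[of p ps] by (simp add: length_remove1)
  then have "\<not> good (remove1 P ps)" using ps(2)[of "remove1 P ps"] by linarith
  then have "\<not> idl_list (remove1 P ps) \<subseteq> A" using ps(1) by (auto simp: good_def dest: notin_set_remove1)
  then obtain \<gamma> where \<gamma>: "\<gamma> \<in> idl_list (remove1 P ps)" "\<gamma> \<notin> A" by blast
  show ?thesis
  proof (rule that[of "\<gamma> / \<alpha>"])
    show "\<gamma> / \<alpha> \<in> prime_inv P"
      unfolding prime_inv_def
    proof safe
      fix x assume "x \<in> P"
      then have "x * \<gamma> \<in> A" using idl_prod_mem[OF _ \<gamma>(1)] PS ps(1) by (auto simp: good_def)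
      then obtain r where "x * \<gamma> = r * \<alpha>" "r \<in> alg_ints" by (auto simp: A_def)
      then show "\<gamma> / \<alpha> * x \<in> alg_ints" using \<alpha>(2) by (simp add: field_simps)
    qed
    show "\<gamma> / \<alpha> \<notin> alg_ints"
    proof
      assume "\<gamma> / \<alpha> \<in> alg_ints"
      moreover have "\<gamma> = \<gamma> / \<alpha> * \<alpha>" using \<alpha>(2) by simp
      ultimately show False using \<gamma>(2) unfolding A_def by blast
    qed
  qed
qed

text \<open>As an additive group the ideal is finitely generated, so the determinant trick applies
  to \<beta>.\<close>

lemma stabilizer_of_ideal_integral:
  fixes I :: "'k::number_field set"
  assumes "int_ideal I" "I \<noteq> {0}" "\<And>x. x \<in> I \<Longrightarrow> \<beta> * x \<in> I"
  shows "\<beta> \<in> alg_ints"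
proof -
  obtain B where B: "B \<subseteq> I" "finite B" "I \<subseteq> zmod.span B"
    by (rule int_ideal_finitely_generated[OF assms(1)])
  have "\<exists>b\<in>B. b \<noteq> 0"
  proof (rule ccontr)
    assume z: "\<not> ?thesis"
    have "x = 0" if "x \<in> zmod.span B" for x
      using that by (induction rule: zmod.span_induct_alt) (use z in auto)
    then show False using B(3) assms(2) int_idealD(2)[OF assms(1)] by auto
  qed
  then have "algebraic_int \<beta>"
    using algebraic_int_if_span_stable[OF B(2)] assms(3) B(1,3) by (meson subsetD)
  then show ?thesis by (simp add: alg_ints_def)
qed

lemma one_mem_prime_inv: "int_ideal P \<Longrightarrow> 1 \<in> prime_inv P"
  using int_idealD(1) by (auto simp: prime_inv_def)

lemma prime_inv_scale: "\<beta> \<in> prime_inv P \<Longrightarrow> r \<in> alg_ints \<Longrightarrow> r * \<beta> \<in> prime_inv (P :: 'a::field_char_0 set)"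
  by (auto simp: prime_inv_def mult.assoc)

lemma int_ideal_span:
  fixes G :: "'a::field_char_0 set"
  assumes "G \<subseteq> alg_ints" "\<And>r g. r \<in> alg_ints \<Longrightarrow> g \<in> G \<Longrightarrow> r * g \<in> G"
  shows "int_ideal (zmod.span G)"
proof -
  have sub: "zmod.span G \<subseteq> alg_ints"
  proof
    fix x assume "x \<in> zmod.span G"
    then show "x \<in> alg_ints"
      by (induction rule: zmod.span_induct_alt) (use assms(1) in auto)
  qed
  have mult: "r * x \<in> zmod.span G" if "r \<in> alg_ints" "x \<in> zmod.span G" for r x
    by (rule zmod_span_mult_closed[OF _ that(2)]) (rule zmod.span_base, rule assms(2)[OF that(1)])
  show ?thesis unfolding int_ideal_def
    by (intro conjI ballI) (auto simp: zmod.span_zero intro: zmod.span_add mult dest: subsetD[OF sub])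
qed

text \<open>The span is an ideal that contains \<open>P\<close>, as 1 is in
  \<open>prime_inv P\<close>. If it were proper it would equal \<open>P\<close> by maximality; then
  all of \<open>prime_inv P\<close> would preserve \<open>P\<close> and be integral.\<close>

lemma prime_invertible:
  fixes P :: "'k::number_field set"
  assumes P: "int_prime P"
  shows "1 \<in> zmod.span {\<alpha> * \<beta> | \<alpha> \<beta>. \<alpha> \<in> P \<and> \<beta> \<in> prime_inv P}" (is "1 \<in> zmod.span ?G")
proof (rule ccontr)
  assume n1: "1 \<notin> zmod.span ?G"
  have IP: "int_ideal P" using int_primeD[OF P] by simp
  have G: "?G \<subseteq> alg_ints" by (auto simp: prime_inv_def mult.commute)
  have J: "int_ideal (zmod.span ?G)"
  proof (rule int_ideal_span[OF G])
    fix r g :: 'k assume r: "r \<in> alg_ints" and "g \<in> ?G"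
    then obtain \<alpha> \<beta> where "g = \<alpha> * \<beta>" "\<alpha> \<in> P" "\<beta> \<in> prime_inv P" by blast
    then have "r * g = (r * \<alpha>) * \<beta> \<and> r * \<alpha> \<in> P \<and> \<beta> \<in> prime_inv P"
      using int_idealD(4)[OF IP r] by (simp add: mult.assoc)
    then show "r * g \<in> ?G" by blast
  qed
  have mem: "\<beta> * x \<in> zmod.span ?G" if "x \<in> P" "\<beta> \<in> prime_inv P" for x \<beta>
  proof -
    have "\<beta> * x = x * \<beta>" by simp
    then have "\<beta> * x \<in> ?G" using that by blast
    then show ?thesis by (rule zmod.span_base)
  qed
  have "P \<subseteq> zmod.span ?G" using mem[OF _ one_mem_prime_inv[OF IP]] by auto
  then have eq: "zmod.span ?G = P" using int_prime_maximal[OF P J _ n1] by simp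
  obtain \<beta> where "\<beta> \<in> prime_inv P" "\<beta> \<notin> alg_ints" by (rule prime_inv_not_integral[OF P])
  then show False
    using stabilizer_of_ideal_integral[OF IP int_primeD(2)[OF P], of \<beta>] mem eq by simp
qed

text \<open>The working form of invertibility: with this identity, facts about all products \<beta>
  y, for \<beta> in \<open>prime_inv P\<close>, are recombined to a fact about y.\<close>

lemma prime_invertible_decomposition:
  fixes P :: "'k::number_field set"
  assumes P: "int_prime P"
  obtains A \<alpha> \<beta> where "finite A" "\<And>i. i \<in> A \<Longrightarrow> \<alpha> i \<in> P" "\<And>i. i \<in> A \<Longrightarrow> \<beta> i \<in> prime_inv P"
    "1 = (\<Sum>i\<in>(A :: nat set). \<alpha> i * \<beta> i)"
proof -
  have IP: "int_ideal P" using int_primeD[OF P] by simp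
  let ?G = "{\<alpha> * \<beta> | \<alpha> \<beta>. \<alpha> \<in> P \<and> \<beta> \<in> prime_inv P}"
  have "\<exists>n \<alpha> \<beta>. (\<forall>i<n. \<alpha> i \<in> P \<and> \<beta> i \<in> prime_inv P) \<and> x = (\<Sum>i<(n::nat). \<alpha> i * \<beta> i)"
    if "x \<in> zmod.span ?G" for x
    using that
  proof (induction rule: zmod.span_induct_alt)
    case base
    show ?case by (intro exI[of _ 0]) auto
  next
    case (step c g y)
    then obtain a b n \<alpha> \<beta> where *: "g = a * b" "a \<in> P" "b \<in> prime_inv P"
      "\<forall>i<n. \<alpha> i \<in> P \<and> \<beta> i \<in> prime_inv P" "y = (\<Sum>i<(n::nat). \<alpha> i * \<beta> i)" by blast
    have "of_int c * a \<in> P" using *(2) int_idealD(4)[OF IP] by simp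
    then show ?case
      using * by (intro exI[of _ "Suc n"] exI[of _ "\<alpha>(n := of_int c * a)"] exI[of _ "\<beta>(n := b)"])
        (auto simp: less_Suc_eq algebra_simps intro!: sum.cong)
  qed
  from this[OF prime_invertible[OF P]] obtain n \<alpha> \<beta> where
    "\<forall>i<n. \<alpha> i \<in> P \<and> \<beta> i \<in> prime_inv P" "1 = (\<Sum>i<(n::nat). \<alpha> i * \<beta> i)" by blast
  then show ?thesis using that[of "{..<n}" \<alpha> \<beta>] by simp
qed

lemma int_ideal_sum:
  "int_ideal I \<Longrightarrow> (\<And>i. i \<in> A \<Longrightarrow> f i \<in> I) \<Longrightarrow> sum f A \<in> (I :: 'a::field_char_0 set)"
  by (induction A rule: infinite_finite_induct) (auto dest: int_idealD)

text \<open>For a prime \<open>P\<close> above \<open>I\<close>, the ideal generated by the products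
  of \<open>prime_inv P\<close> with \<open>I\<close> is strictly larger than \<open>I\<close>, and
  multiplying it by \<open>P\<close> gives \<open>I\<close> back.\<close>

lemma idl_list_exists:
  fixes I :: "'k::number_field set"
  assumes "int_ideal I" "I \<noteq> {0}"
  shows "\<exists>ps. (\<forall>p\<in>set ps. int_prime p) \<and> idl_list ps = I"
  using assms
proof (induction rule: int_ideal_induct)
  case (step I)
  note ID = int_idealD[OF step.hyps(1)]
  show ?case
  proof (cases "1 \<in> I")
    case True
    then show ?thesis using int_ideal_eq_alg_ints[OF step.hyps(1)] by (intro exI[of _ "[]"]) auto
  next
    case False
    then obtain P where P: "int_prime P" "I \<subseteq> P" using exists_prime_above step.hyps by blast
    have IP: "int_ideal P" using int_primeD[OF P(1)] by simp
    let ?G = "{\<beta> * x | \<beta> x. \<beta> \<in> prime_inv P \<and> x \<in> I}"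
    define I' where "I' = zmod.span ?G"
    have I': "int_ideal I'" unfolding I'_def
    proof (rule int_ideal_span)
      show "?G \<subseteq> alg_ints" using P(2) by (auto simp: prime_inv_def)
      fix r g :: 'k assume r: "r \<in> alg_ints" and "g \<in> ?G"
      then obtain \<beta> x where "g = \<beta> * x" "x \<in> I" "\<beta> \<in> prime_inv P" by blast
      then have "r * g = (r * \<beta>) * x \<and> r * \<beta> \<in> prime_inv P \<and> x \<in> I"
        using prime_inv_scale[OF _ r] by (simp add: mult.assoc)
      then show "r * g \<in> ?G" by blast
    qed
    have mem: "\<beta> * x \<in> I'" if "\<beta> \<in> prime_inv P" "x \<in> I" for \<beta> x
    proof -
      have "\<beta> * x \<in> ?G" using that by blast
      then show ?thesis unfolding I'_def by (rule zmod.span_base)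
    qed
    have "I \<subseteq> I'" using mem[OF one_mem_prime_inv[OF IP]] by auto
    \<comment> \<open>Otherwise \<open>prime_inv P\<close> would preserve \<open>I\<close> and hence
      consist of integers.\<close>
    moreover have "I \<noteq> I'"
    proof
      assume eq: "I = I'"
      obtain \<beta> where "\<beta> \<in> prime_inv P" "\<beta> \<notin> alg_ints" by (rule prime_inv_not_integral[OF P(1)])
      then show False using stabilizer_of_ideal_integral[OF step.hyps, of \<beta>] mem eq by simp
    qed
    ultimately obtain ps where ps: "\<forall>p\<in>set ps. int_prime p" "idl_list ps = I'"
      using step.IH[OF I'] by blast
    have "P \<odot> I' = I"
    proof
      show "P \<odot> I' \<subseteq> I"
      proof (rule idl_prod_leI[OF step.hyps(1)])
        fix a y assume a: "a \<in> P" and y: "y \<in> I'"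
        show "a * y \<in> I"
          using y unfolding I'_def
        proof (induction rule: zmod.span_induct_alt)
          case base
          show ?case using ID(2) by simp
        next
          case (step c g y)
          then obtain \<beta> x where g: "g = \<beta> * x" "\<beta> \<in> prime_inv P" "x \<in> I" by blast
          have "\<beta> * a \<in> alg_ints" using g(2) a by (auto simp: prime_inv_def)
          then have "(of_int c * (\<beta> * a)) * x \<in> I" using ID(4) g(3) by simp
          then have "(of_int c * (\<beta> * a)) * x + a * y \<in> I" using ID(3) step.IH by simp
          moreover have "a * (of_int c * g + y) = (of_int c * (\<beta> * a)) * x + a * y"
            by (simp add: g(1) algebra_simps)
          ultimately show ?case by simp
        qed
      qed
      show "I \<subseteq> P \<odot> I'"
      proof
        fix x assume x: "x \<in> I"
        obtain A \<alpha> \<beta> where A: "finite A" "\<And>i. i \<in> A \<Longrightarrow> \<alpha> i \<in> P" "\<And>i. i \<in> A \<Longrightarrow> \<beta> i \<in> prime_inv P"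
          "1 = (\<Sum>i\<in>(A :: nat set). \<alpha> i * \<beta> i)" using prime_invertible_decomposition[OF P(1)] by blast
        have "x = (\<Sum>i\<in>A. \<alpha> i * \<beta> i) * x" unfolding A(4)[symmetric] by simp
        also have "\<dots> = (\<Sum>i\<in>A. \<alpha> i * (\<beta> i * x))" by (simp add: sum_distrib_right mult.assoc)
        also have "\<dots> \<in> P \<odot> I'"
          using A(2,3) x mem by (intro int_ideal_sum[OF int_ideal_idl_prod[OF IP I']] idl_prod_mem) auto
        finally show "x \<in> P \<odot> I'" .
      qed
    qed
    then show ?thesis using ps P(1) by (intro exI[of _ "P # ps"]) auto
  qed
qed

lemma idl_prod_cancel:
  fixes P :: "'k::number_field set"
  assumes P: "int_prime P" and I: "int_ideal I" and J: "int_ideal J" and eq: "P \<odot> I \<subseteq> P \<odot> J"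
  shows "I \<subseteq> J"
proof
  fix x assume x: "x \<in> I"
  obtain A \<alpha> \<beta> where A: "finite A" "\<And>i. i \<in> A \<Longrightarrow> \<alpha> i \<in> P" "\<And>i. i \<in> A \<Longrightarrow> \<beta> i \<in> prime_inv P"
    "1 = (\<Sum>i\<in>(A :: nat set). \<alpha> i * \<beta> i)" using prime_invertible_decomposition[OF P] by blast
  have *: "\<beta> * s \<in> J" if b: "\<beta> \<in> prime_inv P" and s: "s \<in> P \<odot> J" for \<beta> s
    using s
  proof (induction rule: ideal_prod.induct)
    case (prod i j)
    then have "\<beta> * i \<in> alg_ints" using b by (auto simp: prime_inv_def)
    then have "(\<beta> * i) * j \<in> J" using int_idealD(4)[OF J] prod by blast
    then show ?case by (simp add: mult.assoc)
  next
    case (sum s t)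
    then show ?case using int_idealD(3)[OF J] by (simp add: distrib_left)
  qed
  have "x = (\<Sum>i\<in>A. \<alpha> i * \<beta> i) * x" unfolding A(4)[symmetric] by simp
  also have "\<dots> = (\<Sum>i\<in>A. \<beta> i * (\<alpha> i * x))" by (simp add: sum_distrib_left sum_distrib_right mult_ac)
  also have "\<dots> \<in> J"
    using A(2,3) idl_prod_mem[OF _ x] eq by (intro int_ideal_sum[OF J] *) blast+
  finally show "x \<in> J" .
qed

text \<open>The first prime on the left contains the product on the right, hence contains and so
  equals one of its factors; then it is cancelled.\<close>

lemma idl_list_unique:
  fixes ps qs :: "'k::number_field set list"
  assumes "\<And>p. p \<in> set ps \<Longrightarrow> int_prime p" "\<And>p. p \<in> set qs \<Longrightarrow> int_prime p" "idl_list ps = idl_list qs"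
  shows "mset ps = mset qs"
  using assms
proof (induction ps arbitrary: qs)
  case Nil
  show ?case
  proof (cases qs)
    case (Cons q qs')
    have q: "int_prime q" using Nil Cons by simp
    have "alg_ints = q \<odot> idl_list qs'" using Nil(3) Cons by simp
    also have "\<dots> \<subseteq> q"
    proof -
      have "int_ideal (idl_list qs')" using int_primeD(1) Nil Cons by (intro int_ideal_list) auto
      then show ?thesis using idl_prod_subset[OF int_primeD(1)[OF q]] by blast
    qed
    finally show ?thesis using int_primeD(3)[OF q] by auto
  qed simp
next
  case (Cons p ps)
  have p: "int_prime p" and ip: "int_ideal p" using Cons.prems int_primeD(1) by auto
  have ips: "int_ideal (idl_list ps)" using Cons.prems int_primeD(1) by (intro int_ideal_list) auto
  have "idl_list qs \<subseteq> p"
    using idl_prod_subset[OF ip ips] Cons.prems(3) by auto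
  then obtain q where q: "q \<in> set qs" "q \<subseteq> p"
    using prime_contains_list[OF p, of qs] Cons.prems(2) int_primeD(1) by blast
  then have "p = q" using int_prime_maximal[of q p] Cons.prems(2) ip int_primeD(3)[OF p] by auto
  then have eq: "p \<odot> idl_list (remove1 p qs) = p \<odot> idl_list ps"
    using idl_list_remove1[of p qs] q Cons.prems int_primeD(1) by auto
  have iqs: "int_ideal (idl_list (remove1 p qs))"
    using Cons.prems int_primeD(1) by (intro int_ideal_list) (auto dest: notin_set_remove1)
  have "idl_list (remove1 p qs) = idl_list ps"
    using idl_prod_cancel[OF p iqs ips] idl_prod_cancel[OF p ips iqs] eq by auto
  then have "mset ps = mset (remove1 p qs)"
    using Cons.prems by (intro Cons.IH) (auto dest: notin_set_remove1)
  then show ?case using q \<open>p = q\<close> by simp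
qed

section \<open>The norm of a prime\<close>

text \<open>Lagrange's bound on the number of roots, modulo a prime. Synthetic division keeps the
  coefficients integral, and a difference \<open>t - s\<close> outside \<open>P\<close> can be
  cancelled, so the argument stays in the ring of integers.\<close>

lemma poly_vanish_mod_prime:
  fixes P :: "'a::field_char_0 set"
  assumes P: "int_prime P"
  shows "(\<And>i. Polynomial.coeff g i \<in> alg_ints) \<Longrightarrow> finite S \<Longrightarrow> S \<subseteq> alg_ints \<Longrightarrow>
    (\<And>x y. x \<in> S \<Longrightarrow> y \<in> S \<Longrightarrow> x \<noteq> y \<Longrightarrow> x - y \<notin> P) \<Longrightarrow> Polynomial.degree g < card S \<Longrightarrow>
    (\<And>s. s \<in> S \<Longrightarrow> poly g s \<in> P) \<Longrightarrow> Polynomial.coeff g i \<in> P"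
proof (induction "Polynomial.degree g" arbitrary: g S i)
  case 0
  then obtain c where g: "g = [:c:]" by (metis degree_eq_zeroE)
  from 0 obtain s where "s \<in> S" by fastforce
  then have "c \<in> P" using 0(7) g by fastforce
  then show ?case using g int_idealD(2)[OF int_primeD(1)[OF P]] by (cases i) auto
next
  case (Suc d)
  note IP = int_primeD(1)[OF P]
  from Suc(7) obtain s where s: "s \<in> S" by fastforce
  have si: "s \<in> alg_ints" using s Suc(5) by auto
  define h where "h = synthetic_div g s"
  have g: "g = [:- s, 1:] * h + [:poly g s:]" unfolding h_def by (rule synthetic_div_correct'[symmetric])
  have dh: "Polynomial.degree h = d" unfolding h_def degree_synthetic_div using Suc(2) by simp
  have ph: "poly g t = poly g s + (t - s) * poly h t" for t
    by (subst g) (simp add: algebra_simps)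
  have poly_int: "poly q s \<in> alg_ints" if "\<And>i. Polynomial.coeff q i \<in> alg_ints" for q
    unfolding poly_altdef using that si by (intro alg_ints_sum) auto
  have hi: "Polynomial.coeff (synthetic_div q s) i \<in> alg_ints" if "\<And>i. Polynomial.coeff q i \<in> alg_ints" for q i
    using that
  proof (induction q arbitrary: i)
    case (pCons a q)
    have q: "Polynomial.coeff q i \<in> alg_ints" for i using pCons.prems[of "Suc i"] by simp
    then show ?case using pCons.IH[OF q] poly_int[OF q] by (cases i) auto
  qed auto
  have hP: "Polynomial.coeff h j \<in> P" for j
  proof (rule Suc(1)[of h "S - {s}"])
    show "d = Polynomial.degree h" using dh by simp
    show "Polynomial.coeff h i \<in> alg_ints" for i unfolding h_def using hi Suc(3) by blast
    show "Polynomial.degree h < card (S - {s})" using dh Suc(2,4,7) s by simp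
    show "poly h t \<in> P" if t: "t \<in> S - {s}" for t
    proof -
      have "poly g t - poly g s \<in> P" using Suc(8) t s int_ideal_minus[OF IP] by auto
      then have "(t - s) * poly h t \<in> P" using ph[of t] by simp
      moreover have "t - s \<in> alg_ints" using t si Suc(5) by auto
      moreover have "poly h t \<in> alg_ints"
        unfolding poly_altdef h_def using hi[OF Suc(3)] t Suc(5) by (intro alg_ints_sum) auto
      ultimately show ?thesis using int_primeD(4)[OF P] Suc(6)[of t s] t s by blast
    qed
  qed (use Suc(4,5,6) in auto)
  have "Polynomial.coeff g i = (case i of 0 \<Rightarrow> poly g s | Suc j \<Rightarrow> Polynomial.coeff h j) - s * Polynomial.coeff h i"
    by (subst g) (simp split: nat.split add: Polynomial.coeff_pCons)
  also have "\<dots> \<in> P"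
    using hP Suc(8)[OF s] int_ideal_minus[OF IP] int_idealD(4)[OF IP si] by (auto split: nat.split)
  finally show ?case .
qed

text \<open>The residue ring is a field with N elements, whose multiplicative group has order N - 1;
  this is Fermat's congruence. For the binomial coefficients, \<open>(t + 1) ^ N - t ^ N - 1\<close>
  has degree below N but vanishes modulo \<open>P\<close> at all N residues, again by Fermat, so its
  coefficients lie in \<open>P\<close>. The residue characteristic is thereby bypassed.\<close>

lemma abs_norm_prime:
  fixes P :: "'k::number_field set"
  assumes P: "int_prime P"
  shows abs_norm_ge_2: "abs_norm P \<ge> 2"
    and power_abs_norm: "x \<in> alg_ints \<Longrightarrow> x ^ abs_norm P - x \<in> P"
    and binomial_abs_norm: "0 < i \<Longrightarrow> i < abs_norm P \<Longrightarrow> of_nat (abs_norm P choose i) \<in> P"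
proof -
  let ?R = "ring_of_integers :: 'k ring"
  interpret R: cring ?R by (rule cring_ring_of_integers)
  note IP = int_primeD(1)[OF P]
  have id: "ideal P ?R" using IP by (simp add: ideal_iff_int_ideal)
  have "maximalideal P ?R"
  proof (rule maximalidealI[OF id])
    show "carrier ?R \<noteq> P" using int_primeD(3)[OF P] by auto
    fix J assume "ideal J ?R" "P \<subseteq> J"
    then show "J = P \<or> J = carrier ?R"
      using int_prime_maximal[OF P, of J] int_ideal_eq_alg_ints[of J] by (auto simp: ideal_iff_int_ideal)
  qed
  then interpret M: maximalideal P ?R .
  interpret F: field "?R Quot P" by (rule M.quotient_is_field) (rule R.is_cring)
  define \<phi> where "\<phi> x = P +>\<^bsub>?R\<^esub> x" for x
  have hom: "\<phi> \<in> ring_hom ?R (?R Quot P)" unfolding \<phi>_def using M.rcos_ring_hom by simp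
  have eq: "\<phi> x = \<phi> y \<longleftrightarrow> x - y \<in> P" if "x \<in> alg_ints" "y \<in> alg_ints" for x y
    using R.quotient_eq_iff_same_a_r_cos[OF id, of x y] that by (simp add: \<phi>_def)
  have car: "carrier (?R Quot P) = \<phi> ` alg_ints"
    by (auto simp: FactRing_def A_RCOSETS_def' \<phi>_def)
  have \<phi>_pow: "\<phi> (x ^ n) = \<phi> x [^]\<^bsub>?R Quot P\<^esub> n" if "x \<in> alg_ints" for x n
    using ring_hom_ring.hom_nat_pow[OF ring_hom_ringI2[OF R.ring_axioms F.ring_axioms hom], of x n] that by simp
  obtain S where S: "finite S" "S \<subseteq> alg_ints" "\<And>x. x \<in> alg_ints \<Longrightarrow> \<exists>s\<in>S. x - s \<in> P"
    using finite_residues[OF IP int_primeD(2)[OF P]] by blast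
  have "\<phi> x \<in> \<phi> ` S" if x: "x \<in> alg_ints" for x
  proof -
    obtain s where s: "s \<in> S" "x - s \<in> P" using S(3)[OF x] by blast
    then have "\<phi> x = \<phi> s" using eq[OF x, of s] S(2) by auto
    with s(1) show ?thesis by blast
  qed
  then have "carrier (?R Quot P) \<subseteq> \<phi> ` S" unfolding car by blast
  then have fin: "finite (carrier (?R Quot P))" using S(1) by (meson finite_imageI finite_subset)
  let ?N = "abs_norm P"
  have N: "?N = card (carrier (?R Quot P))" by (simp add: abs_norm_def)
  have "{\<zero>\<^bsub>?R Quot P\<^esub>, \<one>\<^bsub>?R Quot P\<^esub>} \<subseteq> carrier (?R Quot P)" by auto
  then have "card {\<zero>\<^bsub>?R Quot P\<^esub>, \<one>\<^bsub>?R Quot P\<^esub>} \<le> ?N" unfolding N by (rule card_mono[OF fin])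
  then show N2: "?N \<ge> 2" using F.one_not_zero by (simp add: card_insert_if)
  have \<phi>0: "\<phi> 0 = \<zero>\<^bsub>?R Quot P\<^esub>" using ring_hom_zero[OF hom R.ring_axioms F.ring_axioms] by simp
  show pow: "x ^ ?N - x \<in> P" if x: "x \<in> alg_ints" for x
  proof (cases "\<phi> x = \<phi> 0")
    case True
    then have "x \<in> P" using eq[of x 0] x by simp
    moreover have "x ^ ?N = x ^ (?N - 1) * x" using N2 by (metis Suc_diff_1 mult.commute power_Suc less_le_trans zero_less_numeral)
    ultimately show ?thesis using x int_idealD(4)[OF IP, of "x ^ (?N - 1)" x] int_ideal_minus[OF IP] by auto
  next
    case False
    interpret G: group "Multiplicative_Group.mult_of (?R Quot P)" by (rule F.field_mult_group)
    have mem: "\<phi> x \<in> carrier (Multiplicative_Group.mult_of (?R Quot P))" using False x car \<phi>0 by (auto simp: Multiplicative_Group.carrier_mult_of)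
    have "Coset.order (Multiplicative_Group.mult_of (?R Quot P)) = ?N - 1"
      unfolding Coset.order_def N by (simp add: Multiplicative_Group.carrier_mult_of card_Diff_singleton)
    then have "\<phi> x [^]\<^bsub>?R Quot P\<^esub> (?N - 1) = \<one>\<^bsub>?R Quot P\<^esub>"
      using G.pow_order_eq_1[OF mem] by (simp add: Multiplicative_Group.nat_pow_mult_of)
    also have "\<one>\<^bsub>?R Quot P\<^esub> = \<phi> 1" using ring_hom_one[OF hom] by simp
    finally have "\<phi> (x ^ (?N - 1)) = \<phi> 1" using \<phi>_pow x by simp
    then have "x ^ (?N - 1) - 1 \<in> P" using eq x by simp
    then have "(x ^ (?N - 1) - 1) * x \<in> P" using int_idealD(5)[OF IP x] by simp
    moreover have "x ^ ?N = x ^ (?N - 1) * x" using N2 by (metis Suc_diff_1 mult.commute power_Suc less_le_trans zero_less_numeral)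
    ultimately show ?thesis by (simp add: algebra_simps)
  qed
  define r where "r = inv_into alg_ints \<phi>"
  have r: "r f \<in> alg_ints" "\<phi> (r f) = f" if "f \<in> carrier (?R Quot P)" for f
    using that unfolding car r_def by (rule inv_into_into, rule f_inv_into_f)
  define T where "T = r ` carrier (?R Quot P)"
  have inj: "inj_on r (carrier (?R Quot P))" by (metis inj_onI r(2))
  have T: "finite T" "T \<subseteq> alg_ints" "card T = ?N"
    unfolding T_def N using fin r(1) card_image[OF inj] by auto
  have Td: "x - y \<notin> P" if xy: "x \<in> T" "y \<in> T" "x \<noteq> y" for x y
  proof
    assume d: "x - y \<in> P"
    obtain f g where fg: "f \<in> carrier (?R Quot P)" "g \<in> carrier (?R Quot P)" "x = r f" "y = r g"
      using xy unfolding T_def by blast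
    have "\<phi> x = \<phi> y" using eq[of x y] d xy T(2) by blast
    then have "f = g" using r(2) fg by metis
    then show False using fg xy(3) by simp
  qed
  show "of_nat (?N choose i) \<in> P" if i: "0 < i" "i < ?N"
  proof -
    define g :: "'k Polynomial.poly" where "g = (\<Sum>j\<in>{1..<?N}. Polynomial.monom (of_nat (?N choose j)) j)"
    have cg: "Polynomial.coeff g j = (if j \<in> {1..<?N} then of_nat (?N choose j) else 0)" for j
      by (simp add: g_def Polynomial.coeff_sum Polynomial.coeff_monom)
    have pg: "poly g t = (t + 1) ^ ?N - t ^ ?N - 1" for t
    proof -
      have "(t + 1) ^ ?N = (\<Sum>j\<le>?N. of_nat (?N choose j) * t ^ j)"
        by (simp add: binomial_ring)
      also have "{..?N} = insert 0 (insert ?N {1..<?N})" using N2 by auto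
      also have "(\<Sum>j\<in>\<dots>. of_nat (?N choose j) * t ^ j) = 1 + (t ^ ?N + (\<Sum>j\<in>{1..<?N}. of_nat (?N choose j) * t ^ j))"
        using N2 by simp
      finally show ?thesis by (simp add: g_def Polynomial.poly_sum Polynomial.poly_monom)
    qed
    have "Polynomial.coeff g i \<in> P"
    proof (rule poly_vanish_mod_prime[OF P, of g T])
      have "Polynomial.degree g \<le> ?N - 1" using cg by (intro degree_le) auto
      then show "Polynomial.degree g < card T" using T(3) N2 by simp
      show "poly g t \<in> P" if "t \<in> T" for t
      proof -
        have t: "t \<in> alg_ints" "t + 1 \<in> alg_ints" using that T(2) by auto
        have "((t + 1) ^ ?N - (t + 1)) - (t ^ ?N - t) \<in> P" using pow[OF t(2)] pow[OF t(1)] int_ideal_minus[OF IP] by blast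
        then show ?thesis by (simp add: pg algebra_simps)
      qed
    qed (use cg T Td in auto)
    then show ?thesis using i cg by simp
  qed
qed

declare restrict_apply [simp del] restrict_apply' [simp]

section \<open>Algebras over a number field\<close>

lemma ring_of_type_algebra_simps [simp]:
  "carrier ring_of_type_algebra = UNIV"
  "x \<otimes>\<^bsub>ring_of_type_algebra\<^esub> y = x * y" "x \<oplus>\<^bsub>ring_of_type_algebra\<^esub> y = x + y"
  "\<zero>\<^bsub>ring_of_type_algebra\<^esub> = 0" "\<one>\<^bsub>ring_of_type_algebra\<^esub> = 1"
  by (simp_all add: ring_of_type_algebra_def)

locale k_algebra = cring E for E :: "('k::number_field, 'u) lring" (structure) +
  assumes scal_ring_hom: "scal E \<in> ring_hom ring_of_type_algebra E"
begin

lemma scal_simps [simp]: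
  "scal E k \<in> carrier E" "scal E (k + l) = scal E k \<oplus> scal E l" "scal E (k * l) = scal E k \<otimes> scal E l"
  "scal E 1 = \<one>" "scal E 0 = \<zero>"
proof -
  show "scal E k \<in> carrier E" using ring_hom_closed[OF scal_ring_hom] by simp
  show *: "scal E (k + l) = scal E k \<oplus> scal E l" for k l using ring_hom_add[OF scal_ring_hom, of k l] by simp
  show "scal E (k * l) = scal E k \<otimes> scal E l" using ring_hom_mult[OF scal_ring_hom, of k l] by simp
  show "scal E 1 = \<one>" using ring_hom_one[OF scal_ring_hom] by simp
  show "scal E 0 = \<zero>" using ring_hom_zero[OF scal_ring_hom ring_from_type_algebra ring_axioms] by simp
qed

lemma scal_uminus: "scal E (- k) = \<ominus> scal E k"
  using minus_equality[of "scal E (- k)" "scal E k"] scal_simps(2)[of "- k" k] by simp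

lemma uminus_eq_scal: "x \<in> carrier E \<Longrightarrow> \<ominus> x = scal E (- 1) \<otimes> x"
  by (simp add: scal_uminus l_minus)

lemma scal_assoc: "x \<in> carrier E \<Longrightarrow> scal E k \<otimes> (scal E l \<otimes> x) = scal E (k * l) \<otimes> x"
  by (simp add: m_assoc)

lemma scal_inverse:
  assumes "k \<noteq> 0" "x \<in> carrier E"
  shows "scal E (inverse k) \<otimes> (scal E k \<otimes> x) = x"
proof -
  have "inverse k * k = 1" using assms(1) by simp
  then show ?thesis using scal_assoc[OF assms(2), of "inverse k" k] assms(2) scal_simps(4) by (metis l_one)
qed

lemma scal_cancel:
  assumes "k \<noteq> 0" "x \<in> carrier E" "y \<in> carrier E" "scal E k \<otimes> x = scal E k \<otimes> y"
  shows "x = y"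
  using scal_inverse[OF assms(1,2)] scal_inverse[OF assms(1,3)] assms(4) by metis

definition int_subalg :: "'u set \<Rightarrow> bool" where
  "int_subalg A \<longleftrightarrow> A \<subseteq> carrier E \<and> scal E ` alg_ints \<subseteq> A \<and>
     (\<forall>x\<in>A. \<forall>y\<in>A. x \<oplus> y \<in> A) \<and> (\<forall>x\<in>A. \<forall>y\<in>A. x \<otimes> y \<in> A)"

lemma int_subalgD:
  assumes "int_subalg A"
  shows "x \<in> A \<Longrightarrow> x \<in> carrier E" "k \<in> alg_ints \<Longrightarrow> scal E k \<in> A" "x \<in> A \<Longrightarrow> y \<in> A \<Longrightarrow> x \<oplus> y \<in> A"
    "x \<in> A \<Longrightarrow> y \<in> A \<Longrightarrow> x \<otimes> y \<in> A" "\<zero> \<in> A" "\<one> \<in> A" "x \<in> A \<Longrightarrow> \<ominus> x \<in> A"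
    "x \<in> A \<Longrightarrow> y \<in> A \<Longrightarrow> x \<ominus> y \<in> A" "x \<in> A \<Longrightarrow> x [^] (n::nat) \<in> A"
proof -
  show c: "x \<in> A \<Longrightarrow> x \<in> carrier E" for x using assms by (auto simp: int_subalg_def)
  show s: "k \<in> alg_ints \<Longrightarrow> scal E k \<in> A" for k using assms by (auto simp: int_subalg_def)
  show a: "x \<in> A \<Longrightarrow> y \<in> A \<Longrightarrow> x \<oplus> y \<in> A" for x y using assms by (auto simp: int_subalg_def)
  show m: "x \<in> A \<Longrightarrow> y \<in> A \<Longrightarrow> x \<otimes> y \<in> A" for x y using assms by (auto simp: int_subalg_def)
  show "\<zero> \<in> A" using s[of 0] by simp
  show o: "\<one> \<in> A" using s[of 1] by simp
  show n: "x \<in> A \<Longrightarrow> \<ominus> x \<in> A" for x using m[OF s[of "- 1"], of x] c[of x] uminus_eq_scal[of x] by simp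
  show "x \<in> A \<Longrightarrow> y \<in> A \<Longrightarrow> x \<ominus> y \<in> A" using a n by (simp add: a_minus_def)
  show "x \<in> A \<Longrightarrow> x [^] n \<in> A" for n :: nat by (induction n) (auto intro: o m)
qed

lemma int_subalg_iff: "int_subalg A \<longleftrightarrow> subring A E \<and> scal E ` alg_ints \<subseteq> A"
proof
  assume A: "int_subalg A"
  have "subring A E"
    by (rule subringI) (use int_subalgD[OF A] in auto)
  then show "subring A E \<and> scal E ` alg_ints \<subseteq> A" using A by (simp add: int_subalg_def)
next
  assume A: "subring A E \<and> scal E ` alg_ints \<subseteq> A"
  then show "int_subalg A" using subringE[of A E] by (auto simp: int_subalg_def)
qed

text \<open>Since \<open>P\<close> is invertible, \<open>PA\<close> consists of the elements that \<open>prime_inv P\<close> multiplies into \<open>A\<close>.\<close>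

lemma ext_ideal_iff:
  assumes P: "int_prime P" and A: "int_subalg A"
  shows "y \<in> ext_ideal E A P \<longleftrightarrow> y \<in> carrier E \<and> (\<forall>\<beta>\<in>prime_inv P. scal E \<beta> \<otimes> y \<in> A)"
proof
  note AD = int_subalgD[OF A]
  note IP = int_primeD(1)[OF P]
  let ?R = "E\<lparr>carrier := A\<rparr>"
  have ringA: "ring ?R" using A int_subalg_iff subring_is_ring by blast
  interpret R: ring ?R by (rule ringA)
  \<comment> \<open>This turns out to be an ideal of \<open>A\<close> containing \<open>P\<close>,
    hence contains the ideal generated by \<open>P\<close>. The other inclusion multiplies
    \<open>y\<close> by the decomposition of 1.\<close>
  define J where "J = {y \<in> carrier E. \<forall>\<beta>\<in>prime_inv P. scal E \<beta> \<otimes> y \<in> A}"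
  have JA: "y \<in> A" if "y \<in> J" for y
    using that one_mem_prime_inv[OF IP] by (force simp: J_def)
  have Jadd: "x \<oplus> y \<in> J" if "x \<in> J" "y \<in> J" for x y
    using that AD(3) by (auto simp: J_def r_distr)
  have Jmult: "x \<otimes> y \<in> J" if "x \<in> A" "y \<in> J" for x y
    using that AD(1,4) by (auto simp: J_def m_lcomm)
  have J0: "\<zero> \<in> J" using AD(5) by (auto simp: J_def)
  have inv: "inv\<^bsub>add_monoid ?R\<^esub> x = scal E (- 1) \<otimes> x" if "x \<in> A" for x
  proof -
    have "\<ominus>\<^bsub>?R\<^esub> x = scal E (- 1) \<otimes> x"
    proof (rule R.minus_equality)
      show "scal E (- 1) \<otimes> x \<oplus>\<^bsub>?R\<^esub> x = \<zero>\<^bsub>?R\<^esub>"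
        using AD(1)[OF that] uminus_eq_scal[of x] l_neg[of x] by simp
    qed (use that AD(2)[of "- 1"] AD(4) in auto)
    then show ?thesis by (simp add: a_inv_def)
  qed
  have "ideal J ?R"
  proof (rule idealI[OF ringA])
    show "subgroup J (add_monoid ?R)"
    proof (unfold_locales, goal_cases)
      case 1 then show ?case using JA by auto
    next
      case (4 x)
      then show ?case using inv[OF JA] Jmult AD(2)[of "- 1"] by simp
    qed (use Jadd J0 in auto)
    show "x \<otimes>\<^bsub>?R\<^esub> a \<in> J" if "a \<in> J" "x \<in> carrier ?R" for a x using that Jmult by simp
    show "a \<otimes>\<^bsub>?R\<^esub> x \<in> J" if "a \<in> J" "x \<in> carrier ?R" for a x
      using that Jmult[of x a] m_comm[of a x] JA[of a] AD(1) by simp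
  qed
  moreover have "scal E ` P \<subseteq> J"
    using AD(2) int_idealD(1)[OF IP] by (auto simp: J_def prime_inv_def simp flip: scal_simps(3))
  ultimately have "ext_ideal E A P \<subseteq> J"
    unfolding ext_ideal_def genideal_def by blast
  then show "y \<in> ext_ideal E A P \<Longrightarrow> y \<in> carrier E \<and> (\<forall>\<beta>\<in>prime_inv P. scal E \<beta> \<otimes> y \<in> A)"
    by (auto simp: J_def)
  assume y: "y \<in> carrier E \<and> (\<forall>\<beta>\<in>prime_inv P. scal E \<beta> \<otimes> y \<in> A)"
  show "y \<in> ext_ideal E A P"
    unfolding ext_ideal_def genideal_def
  proof safe
    fix I assume I: "ideal I ?R" "scal E ` P \<subseteq> I"
    interpret I: ideal I ?R by (rule I)
    obtain S \<alpha> \<beta> where S: "finite S" "\<And>i. i \<in> S \<Longrightarrow> \<alpha> i \<in> P" "\<And>i. i \<in> S \<Longrightarrow> \<beta> i \<in> prime_inv P"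
      "1 = (\<Sum>i\<in>(S :: nat set). \<alpha> i * \<beta> i)" using prime_invertible_decomposition[OF P] by blast
    have "scal E (\<Sum>i\<in>S. \<alpha> i * \<beta> i) \<otimes> y \<in> I"
      using S(1-3)
    proof (induction S)
      case empty
      then show ?case using y I.zero_closed by simp
    next
      case (insert i S)
      have "scal E (\<alpha> i) \<otimes> (scal E (\<beta> i) \<otimes> y) \<in> I"
        using I.I_r_closed[of "scal E (\<alpha> i)" "scal E (\<beta> i) \<otimes> y"] I(2) insert.prems y by auto
      moreover have "scal E (\<Sum>i\<in>S. \<alpha> i * \<beta> i) \<otimes> y \<in> I" using insert by auto
      ultimately have "scal E (\<alpha> i) \<otimes> (scal E (\<beta> i) \<otimes> y) \<oplus> scal E (\<Sum>i\<in>S. \<alpha> i * \<beta> i) \<otimes> y \<in> I"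
        using I.a_closed by simp
      then show ?case using insert.hyps y by (simp add: l_distr m_assoc)
    qed
    then show "y \<in> I" using y S(4)[symmetric] by simp
  qed
qed

end

section \<open>The ghost ring\<close>

definition closed_subring :: "'a::comm_ring_1 set \<Rightarrow> bool" where
  "closed_subring A \<longleftrightarrow> 0 \<in> A \<and> 1 \<in> A \<and> (\<forall>x\<in>A. \<forall>y\<in>A. x + y \<in> A \<and> x * y \<in> A) \<and> (\<forall>x\<in>A. - x \<in> A)"

lemma closed_subring_UNIV: "closed_subring UNIV" by (auto simp: closed_subring_def)

lemma closed_subring_alg_ints: "closed_subring (alg_ints :: 'a::field_char_0 set)"
  by (auto simp: closed_subring_def)

lemma ghost_ring_simps:
  "carrier (ghost_ring A) = nz_ideals \<rightarrow>\<^sub>E A"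
  "\<xi> \<otimes>\<^bsub>ghost_ring A\<^esub> \<zeta> = (\<lambda>\<aa>\<in>nz_ideals. \<xi> \<aa> * \<zeta> \<aa>)"
  "\<xi> \<oplus>\<^bsub>ghost_ring A\<^esub> \<zeta> = (\<lambda>\<aa>\<in>nz_ideals. \<xi> \<aa> + \<zeta> \<aa>)"
  "\<one>\<^bsub>ghost_ring A\<^esub> = (\<lambda>\<aa>\<in>nz_ideals. 1)"
  "\<zero>\<^bsub>ghost_ring A\<^esub> = (\<lambda>\<aa>\<in>nz_ideals. 0)"
  "scal (ghost_ring A) k = (\<lambda>\<aa>\<in>nz_ideals. to_ac k)"
  "psi (ghost_ring A) \<aa> \<xi> = (\<lambda>\<bb>\<in>nz_ideals. \<xi> (\<aa> \<odot> \<bb>))"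
  by (simp_all add: ghost_ring_def)

lemma ghost_ring_cring:
  assumes A: "closed_subring (A :: 'k::field alg_closure set)"
  shows "cring (ghost_ring A)"
proof (rule cringI)
  show "abelian_group (ghost_ring A)"
  proof (rule abelian_groupI)
    fix x assume "x \<in> carrier (ghost_ring A)"
    then show "\<exists>y\<in>carrier (ghost_ring A). y \<oplus>\<^bsub>ghost_ring A\<^esub> x = \<zero>\<^bsub>ghost_ring A\<^esub>"
      using A by (intro bexI[of _ "\<lambda>a\<in>nz_ideals. - x a"])
        (auto simp: ghost_ring_simps closed_subring_def PiE_iff intro!: restrict_ext)
  qed (use A in \<open>auto simp: ghost_ring_simps closed_subring_def PiE_iff extensional_def
        restrict_def fun_eq_iff add_ac\<close>)
  show "Group.comm_monoid (ghost_ring A)"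
    by (rule comm_monoidI)
      (use A in \<open>auto simp: ghost_ring_simps closed_subring_def PiE_iff extensional_def
        restrict_def fun_eq_iff mult_ac\<close>)
qed (use A in \<open>auto simp: ghost_ring_simps closed_subring_def PiE_iff extensional_def
        restrict_def fun_eq_iff algebra_simps\<close>)

lemma ghost_ring_minus:
  assumes A: "closed_subring (A :: 'k::field alg_closure set)"
    and "x \<in> carrier (ghost_ring A)" "y \<in> carrier (ghost_ring A)"
  shows "\<ominus>\<^bsub>ghost_ring A\<^esub> y = (\<lambda>a\<in>nz_ideals. - y a)" "x \<ominus>\<^bsub>ghost_ring A\<^esub> y = (\<lambda>a\<in>nz_ideals. x a - y a)"
proof -
  interpret cring "ghost_ring A" by (rule ghost_ring_cring[OF A])
  show *: "\<ominus>\<^bsub>ghost_ring A\<^esub> y = (\<lambda>a\<in>nz_ideals. - y a)"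
    by (rule minus_equality)
      (use assms in \<open>auto simp: ghost_ring_simps closed_subring_def PiE_iff intro!: restrict_ext\<close>)
  show "x \<ominus>\<^bsub>ghost_ring A\<^esub> y = (\<lambda>a\<in>nz_ideals. x a - y a)"
    unfolding a_minus_def * by (auto simp: ghost_ring_simps intro!: restrict_ext)
qed

lemma ghost_ring_pow:
  assumes "x \<in> carrier (ghost_ring A)"
  shows "x [^]\<^bsub>ghost_ring A\<^esub> (n::nat) = (\<lambda>a\<in>nz_ideals. x a ^ n)"
  by (induction n) (use assms in \<open>auto simp: ghost_ring_simps mult.commute intro!: restrict_ext\<close>)

lemma ghost_ring_finsum:
  assumes A: "closed_subring (A :: 'k::field alg_closure set)"
    and "finite I" "\<And>i. i \<in> I \<Longrightarrow> f i \<in> carrier (ghost_ring A)"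
  shows "(\<Oplus>\<^bsub>ghost_ring A\<^esub>i\<in>I. f i) = (\<lambda>a\<in>nz_ideals. \<Sum>i\<in>I. f i a)"
proof -
  interpret cring "ghost_ring A" by (rule ghost_ring_cring[OF A])
  show ?thesis
    using assms(2,3)
  proof (induction I)
    case empty
    then show ?case by (simp add: ghost_ring_simps)
  next
    case (insert i I)
    then have "(\<Oplus>\<^bsub>ghost_ring A\<^esub>i\<in>insert i I. f i) = f i \<oplus>\<^bsub>ghost_ring A\<^esub> (\<Oplus>\<^bsub>ghost_ring A\<^esub>i\<in>I. f i)"
      by (intro finsum_insert) auto
    then show ?case using insert by (auto simp: ghost_ring_simps intro!: restrict_ext)
  qed
qed

text \<open>The full product over the algebraic closure is a K-algebra, unlike the product over a
  ring of integers. Its operations are the same functions as those of \<open>ghost_ring A\<close>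
  for any \<open>A\<close>.\<close>

abbreviation ghost :: "('k::field, 'k set \<Rightarrow> 'k alg_closure) lring" where
  "ghost \<equiv> ghost_ring UNIV"

interpretation ghost: k_algebra "ghost :: ('k::number_field, 'k set \<Rightarrow> 'k alg_closure) lring"
proof (intro k_algebra.intro ghost_ring_cring[OF closed_subring_UNIV] k_algebra_axioms.intro)
  show "scal ghost \<in> ring_hom ring_of_type_algebra ghost"
    by (rule ring_hom_memI) (auto simp: ghost_ring_simps intro!: restrict_ext)
qed

lemma ghost_eqI:
  "x \<in> carrier (ghost_ring A) \<Longrightarrow> y \<in> carrier (ghost_ring B) \<Longrightarrow> (\<And>a. a \<in> nz_ideals \<Longrightarrow> x a = y a) \<Longrightarrow> x = y"
  unfolding ghost_ring_simps PiE_iff by (rule extensionalityI[of _ nz_ideals]) auto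

lemma alg_ints_in_nz_ideals [simp, intro]: "(alg_ints :: 'k::field_char_0 set) \<in> nz_ideals"
  using idl_list_nonzero[of "[]"] by simp

lemma nz_prime_ideal: "int_prime p \<Longrightarrow> (p :: 'k::field_char_0 set) \<in> nz_ideals"
  using int_primeD(1,2) by (auto simp: nz_ideals_iff)

lemma nz_prime_prod [simp, intro]: "int_prime p \<Longrightarrow> a \<in> nz_ideals \<Longrightarrow> (p :: 'k::field_char_0 set) \<odot> a \<in> nz_ideals"
  using nz_ideals_prod nz_prime_ideal by blast

lemma psi_ghost_closed:
  fixes \<xi> :: "'k::field_char_0 set \<Rightarrow> 'k alg_closure"
  assumes "int_prime p" "\<xi> \<in> carrier (ghost_ring A)"
  shows "psi (ghost_ring A) p \<xi> \<in> carrier (ghost_ring A)"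
  using assms nz_prime_prod[OF assms(1)] unfolding ghost_ring_simps restrict_PiE_iff by (auto dest: PiE_mem)

definition frob_diff :: "'k::field set \<Rightarrow> ('k set \<Rightarrow> 'k alg_closure) \<Rightarrow> 'k set \<Rightarrow> 'k alg_closure" where
  "frob_diff p \<xi> = (\<lambda>a\<in>nz_ideals. \<xi> (p \<odot> a) - \<xi> a ^ abs_norm p)"

text \<open>Rewrites the congruence through \<open>prime_inv p\<close>. Products with \<beta> may
  leave \<open>ghost_ring A\<close>, so they are formed in the full ghost ring, which has the same
  operations and hence the same extended ideals.\<close>

lemma frobenius_lift_ghost:
  assumes A: "closed_subring (A :: 'k::number_field alg_closure set)"
    and \<xi>: "\<xi> \<in> carrier (ghost_ring A)" and p: "int_prime p" and U: "ghost.int_subalg U"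
  shows "frobenius_lift (ghost_ring A) U p \<xi> \<longleftrightarrow>
    (\<forall>\<beta>\<in>prime_inv p. scal ghost \<beta> \<otimes>\<^bsub>ghost\<^esub> frob_diff p \<xi> \<in> U)"
proof -
  interpret cring "ghost_ring A" by (rule ghost_ring_cring[OF A])
  have psi: "psi (ghost_ring A) p \<xi> \<in> carrier (ghost_ring A)"
    by (rule psi_ghost_closed[OF p \<xi>])
  have pw: "\<xi> [^]\<^bsub>ghost_ring A\<^esub> abs_norm p \<in> carrier (ghost_ring A)" using \<xi> by simp
  have "psi (ghost_ring A) p \<xi> \<ominus>\<^bsub>ghost_ring A\<^esub> \<xi> [^]\<^bsub>ghost_ring A\<^esub> abs_norm p = frob_diff p \<xi>"
    unfolding ghost_ring_minus(2)[OF A psi pw]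
    unfolding ghost_ring_pow[OF \<xi>] frob_diff_def
    by (auto simp: ghost_ring_simps intro!: restrict_ext)
  moreover have "ext_ideal (ghost_ring A) U p = ext_ideal ghost U p"
    by (simp add: ext_ideal_def ghost_ring_def)
  moreover have "frob_diff p \<xi> \<in> carrier ghost" by (simp add: frob_diff_def ghost_ring_simps)
  ultimately show ?thesis
    unfolding frobenius_lift_def using ghost.ext_ideal_iff[OF p U] by simp
qed

section \<open>Witt vectors\<close>

lemma ghost_sum_closed:
  assumes U: "ghost.int_subalg U" and "finite I" "\<And>i. i \<in> I \<Longrightarrow> (\<lambda>a\<in>nz_ideals. f i a) \<in> U"
  shows "(\<lambda>a\<in>nz_ideals. \<Sum>i\<in>I. f i a) \<in> (U :: ('k::number_field set \<Rightarrow> 'k alg_closure) set)"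
  using assms(2,3)
proof (induction I)
  case empty
  show ?case using ghost.int_subalgD(5)[OF U] unfolding ghost_ring_simps sum.empty .
next
  case (insert i I)
  then have "(\<lambda>a\<in>nz_ideals. f i a) \<oplus>\<^bsub>ghost\<^esub> (\<lambda>a\<in>nz_ideals. \<Sum>i\<in>I. f i a) \<in> U"
    using ghost.int_subalgD(3)[OF U] by auto
  also have "(\<lambda>a\<in>nz_ideals. f i a) \<oplus>\<^bsub>ghost\<^esub> (\<lambda>a\<in>nz_ideals. \<Sum>i\<in>I. f i a) = (\<lambda>a\<in>nz_ideals. \<Sum>i\<in>insert i I. f i a)"
    using insert by (auto simp: ghost_ring_simps intro!: restrict_ext)
  finally show ?case .
qed

lemma algebraic_int_to_ac_iff [simp]:
  "to_ac x \<in> alg_ints \<longleftrightarrow> (x :: 'k::field_char_0) \<in> alg_ints"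
proof -
  have "poly (map_poly of_int q) (to_ac x) = to_ac (poly (map_poly of_int q) x)" for q :: "int Polynomial.poly"
    by (simp add: poly_altdef to_ac_sum)
  then show ?thesis unfolding alg_ints_def mem_Collect_eq algebraic_int_altdef_ipoly by auto
qed

text \<open>One step of the recursion that defines the Witt vectors. Constants are covered by
  Fermat. For products, \<psi>(xy) - (xy)^N equals \<psi>(x) (\<psi>(y) - y^N) + y^N (\<psi>(x) -
  x^N). For sums, the mixed terms of the N-th power carry binomial coefficients in \<open>p\<close>.
  Stability under \<psi> holds because these operators commute.\<close>

lemma frob_subring:
  fixes U :: "('k::number_field set \<Rightarrow> 'k alg_closure) set"
  assumes U: "ghost.int_subalg U" and psi: "\<And>p \<xi>. int_prime p \<Longrightarrow> \<xi> \<in> U \<Longrightarrow> psi ghost p \<xi> \<in> U"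
  defines "V \<equiv> {\<xi> \<in> U. \<forall>p. int_prime p \<longrightarrow> (\<forall>\<beta>\<in>prime_inv p. scal ghost \<beta> \<otimes>\<^bsub>ghost\<^esub> frob_diff p \<xi> \<in> U)}"
  shows "ghost.int_subalg V" "\<And>p \<xi>. int_prime p \<Longrightarrow> \<xi> \<in> V \<Longrightarrow> psi ghost p \<xi> \<in> V"
proof -
  note UD = ghost.int_subalgD[OF U]
  note gs = ghost_ring_simps
  show "ghost.int_subalg V"
    unfolding ghost.int_subalg_def
  proof (intro conjI ballI subsetI)
    show "x \<in> carrier ghost" if "x \<in> V" for x using that UD(1) by (auto simp: V_def)
    show "x \<in> V" if x: "x \<in> scal ghost ` alg_ints" for x
    proof -
      obtain c where c: "x = scal ghost c" "c \<in> alg_ints" using x by blast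
      have "scal ghost \<beta> \<otimes>\<^bsub>ghost\<^esub> frob_diff p x \<in> U" if p: "int_prime p" and \<beta>: "\<beta> \<in> prime_inv p" for p \<beta>
      proof -
        have "c - c ^ abs_norm p \<in> p"
          using int_ideal_uminus[OF int_primeD(1)[OF p] power_abs_norm[OF p c(2)]] by simp
        then have "\<beta> * (c - c ^ abs_norm p) \<in> alg_ints" using \<beta> by (auto simp: prime_inv_def)
        moreover have "scal ghost \<beta> \<otimes>\<^bsub>ghost\<^esub> frob_diff p x = scal ghost (\<beta> * (c - c ^ abs_norm p))"
          using p by (auto simp: gs frob_diff_def c(1) simp del: to_ac_mult intro!: restrict_ext) (simp)
        ultimately show ?thesis using UD(2) by (simp only:)
      qed
      then show ?thesis using UD(2) c by (auto simp: V_def)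
    qed
    fix x y assume xy: "x \<in> V" "y \<in> V"
    then have xyU: "x \<in> U" "y \<in> U" by (auto simp: V_def)
    then have xyc: "x \<in> carrier ghost" "y \<in> carrier ghost" using UD(1) by auto
    have dx: "scal ghost \<beta> \<otimes>\<^bsub>ghost\<^esub> frob_diff p z \<in> U" if "int_prime p" "\<beta> \<in> prime_inv p" "z \<in> V" for p \<beta> z
      using that by (auto simp: V_def)
    show "x \<otimes>\<^bsub>ghost\<^esub> y \<in> V"
      unfolding V_def
    proof (intro CollectI conjI allI impI ballI)
      show "x \<otimes>\<^bsub>ghost\<^esub> y \<in> U" using xyU UD(4) by blast
      fix p :: "'k set" and \<beta> assume p: "int_prime p" and \<beta>: "\<beta> \<in> prime_inv p"
      have "psi ghost p x \<otimes>\<^bsub>ghost\<^esub> (scal ghost \<beta> \<otimes>\<^bsub>ghost\<^esub> frob_diff p y) \<oplus>\<^bsub>ghost\<^esub>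
        y [^]\<^bsub>ghost\<^esub> abs_norm p \<otimes>\<^bsub>ghost\<^esub> (scal ghost \<beta> \<otimes>\<^bsub>ghost\<^esub> frob_diff p x) \<in> U"
        by (rule UD(3)[OF UD(4)[OF psi[OF p xyU(1)] dx[OF p \<beta> xy(2)]] UD(4)[OF UD(9)[OF xyU(2)] dx[OF p \<beta> xy(1)]]])
      also have "psi ghost p x \<otimes>\<^bsub>ghost\<^esub> (scal ghost \<beta> \<otimes>\<^bsub>ghost\<^esub> frob_diff p y) \<oplus>\<^bsub>ghost\<^esub>
        y [^]\<^bsub>ghost\<^esub> abs_norm p \<otimes>\<^bsub>ghost\<^esub> (scal ghost \<beta> \<otimes>\<^bsub>ghost\<^esub> frob_diff p x) =
        scal ghost \<beta> \<otimes>\<^bsub>ghost\<^esub> frob_diff p (x \<otimes>\<^bsub>ghost\<^esub> y)"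
        unfolding ghost_ring_pow[OF xyc(2)] using p
        by (auto simp: gs frob_diff_def algebra_simps power_mult_distrib intro!: restrict_ext)
      finally show "scal ghost \<beta> \<otimes>\<^bsub>ghost\<^esub> frob_diff p (x \<otimes>\<^bsub>ghost\<^esub> y) \<in> U" .
    qed
    show "x \<oplus>\<^bsub>ghost\<^esub> y \<in> V"
      unfolding V_def
    proof (intro CollectI conjI allI impI ballI)
      show "x \<oplus>\<^bsub>ghost\<^esub> y \<in> U" using xyU UD(3) by blast
      fix p :: "'k set" and \<beta> assume p: "int_prime p" and \<beta>: "\<beta> \<in> prime_inv p"
      let ?N = "abs_norm p"
      \<comment> \<open>The mixed terms of the N-th power of the sum, multiplied by \<beta>; the
        product of \<beta> with each binomial coefficient is integral.\<close>
      define R where "R = (\<lambda>a\<in>nz_ideals. \<Sum>i\<in>{1..<?N}. to_ac (\<beta> * of_nat (?N choose i)) * (x a ^ i * y a ^ (?N - i)))"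
      have "R \<in> U" unfolding R_def
      proof (rule ghost_sum_closed[OF U])
        fix i assume i: "i \<in> {1..<?N}"
        then have "\<beta> * of_nat (?N choose i) \<in> alg_ints"
          using binomial_abs_norm[OF p, of i] \<beta> by (auto simp: prime_inv_def)
        then have "scal ghost (\<beta> * of_nat (?N choose i)) \<otimes>\<^bsub>ghost\<^esub> (x [^]\<^bsub>ghost\<^esub> i \<otimes>\<^bsub>ghost\<^esub> y [^]\<^bsub>ghost\<^esub> (?N - i)) \<in> U"
          using xyU by (intro UD)
        also have "scal ghost (\<beta> * of_nat (?N choose i)) \<otimes>\<^bsub>ghost\<^esub> (x [^]\<^bsub>ghost\<^esub> i \<otimes>\<^bsub>ghost\<^esub> y [^]\<^bsub>ghost\<^esub> (?N - i)) =
          (\<lambda>a\<in>nz_ideals. to_ac (\<beta> * of_nat (?N choose i)) * (x a ^ i * y a ^ (?N - i)))"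
          unfolding ghost_ring_pow[OF xyc(1)] ghost_ring_pow[OF xyc(2)]
          by (auto simp: gs intro!: restrict_ext)
        finally show "(\<lambda>a\<in>nz_ideals. to_ac (\<beta> * of_nat (?N choose i)) * (x a ^ i * y a ^ (?N - i))) \<in> U" .
      qed simp
      then have "scal ghost \<beta> \<otimes>\<^bsub>ghost\<^esub> frob_diff p x \<oplus>\<^bsub>ghost\<^esub> scal ghost \<beta> \<otimes>\<^bsub>ghost\<^esub> frob_diff p y \<oplus>\<^bsub>ghost\<^esub>
          scal ghost (- 1) \<otimes>\<^bsub>ghost\<^esub> R \<in> U"
        by (intro UD(3)[OF UD(3)[OF dx[OF p \<beta> xy(1)] dx[OF p \<beta> xy(2)]] UD(4)[OF UD(2)]]) auto
      also have "scal ghost \<beta> \<otimes>\<^bsub>ghost\<^esub> frob_diff p x \<oplus>\<^bsub>ghost\<^esub> scal ghost \<beta> \<otimes>\<^bsub>ghost\<^esub> frob_diff p y \<oplus>\<^bsub>ghost\<^esub>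
          scal ghost (- 1) \<otimes>\<^bsub>ghost\<^esub> R = scal ghost \<beta> \<otimes>\<^bsub>ghost\<^esub> frob_diff p (x \<oplus>\<^bsub>ghost\<^esub> y)"
      proof (rule ghost_eqI)
        fix a :: "'k set" assume a: "a \<in> nz_ideals"
        have N2: "?N \<ge> 2" by (rule abs_norm_ge_2[OF p])
        have "(x a + y a) ^ ?N = (\<Sum>i\<le>?N. of_nat (?N choose i) * x a ^ i * y a ^ (?N - i))" by (rule binomial_ring)
        also have "{..?N} = insert 0 (insert ?N {1..<?N})" using N2 by auto
        also have "(\<Sum>i\<in>\<dots>. of_nat (?N choose i) * x a ^ i * y a ^ (?N - i)) =
          y a ^ ?N + (x a ^ ?N + (\<Sum>i\<in>{1..<?N}. of_nat (?N choose i) * x a ^ i * y a ^ (?N - i)))"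
          using N2 by simp
        finally have bin: "(x a + y a) ^ ?N =
          y a ^ ?N + (x a ^ ?N + (\<Sum>i\<in>{1..<?N}. of_nat (?N choose i) * x a ^ i * y a ^ (?N - i)))" .
        have "R a = to_ac \<beta> * (\<Sum>i\<in>{1..<?N}. of_nat (?N choose i) * x a ^ i * y a ^ (?N - i))"
          using a by (simp add: R_def sum_distrib_left mult.assoc)
        then show "(scal ghost \<beta> \<otimes>\<^bsub>ghost\<^esub> frob_diff p x \<oplus>\<^bsub>ghost\<^esub> scal ghost \<beta> \<otimes>\<^bsub>ghost\<^esub> frob_diff p y \<oplus>\<^bsub>ghost\<^esub>
          scal ghost (- 1) \<otimes>\<^bsub>ghost\<^esub> R) a = (scal ghost \<beta> \<otimes>\<^bsub>ghost\<^esub> frob_diff p (x \<oplus>\<^bsub>ghost\<^esub> y)) a"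
          using a p by (simp add: gs frob_diff_def bin algebra_simps)
      qed (auto simp: gs)
      finally show "scal ghost \<beta> \<otimes>\<^bsub>ghost\<^esub> frob_diff p (x \<oplus>\<^bsub>ghost\<^esub> y) \<in> U" .
    qed
  qed
  fix p :: "'k set" and \<xi> assume p: "int_prime p" and \<xi>: "\<xi> \<in> V"
  show "psi ghost p \<xi> \<in> V"
    unfolding V_def
  proof (intro CollectI conjI allI impI ballI)
    show "psi ghost p \<xi> \<in> U" using psi[OF p] \<xi> by (simp add: V_def)
    fix q :: "'k set" and \<beta> assume q: "int_prime q" and \<beta>: "\<beta> \<in> prime_inv q"
    have "psi ghost p (scal ghost \<beta> \<otimes>\<^bsub>ghost\<^esub> frob_diff q \<xi>) \<in> U"
      using psi[OF p] \<xi> q \<beta> by (auto simp: V_def)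
    also have "psi ghost p (scal ghost \<beta> \<otimes>\<^bsub>ghost\<^esub> frob_diff q \<xi>) = scal ghost \<beta> \<otimes>\<^bsub>ghost\<^esub> frob_diff q (psi ghost p \<xi>)"
    proof (rule ghost_eqI)
      fix a :: "'k set" assume a: "a \<in> nz_ideals"
      have ids: "int_ideal p" "int_ideal q" "int_ideal a" using p q a int_primeD(1) by (auto simp: nz_ideals_iff)
      have "q \<odot> (p \<odot> a) = p \<odot> (q \<odot> a)"
        using idl_prod_assoc[OF ids(2,1,3)] idl_prod_assoc[OF ids(1,2,3)] idl_prod_commute[OF ids(1,2)] by simp
      then show "psi ghost p (scal ghost \<beta> \<otimes>\<^bsub>ghost\<^esub> frob_diff q \<xi>) a = (scal ghost \<beta> \<otimes>\<^bsub>ghost\<^esub> frob_diff q (psi ghost p \<xi>)) a"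
        using a p q by (simp add: gs frob_diff_def)
    qed (auto simp: gs)
    finally show "scal ghost \<beta> \<otimes>\<^bsub>ghost\<^esub> frob_diff q (psi ghost p \<xi>) \<in> U" .
  qed
qed

lemma witt_approx_props:
  "ghost.int_subalg (witt_approx (alg_ints :: 'k::number_field alg_closure set) n)"
  "\<And>p \<xi>. int_prime p \<Longrightarrow> \<xi> \<in> witt_approx (alg_ints :: 'k alg_closure set) n \<Longrightarrow> psi ghost p \<xi> \<in> witt_approx alg_ints n"
  "witt_approx (alg_ints :: 'k alg_closure set) (Suc n) = {\<xi> \<in> witt_approx alg_ints n.
     \<forall>p. int_prime p \<longrightarrow> (\<forall>\<beta>\<in>prime_inv p. scal ghost \<beta> \<otimes>\<^bsub>ghost\<^esub> frob_diff p \<xi> \<in> witt_approx alg_ints n)}"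
proof -
  have car: "witt_approx (alg_ints :: 'k alg_closure set) n \<subseteq> carrier (ghost_ring alg_ints)" for n
    by (induction n) auto
  have step: "witt_approx (alg_ints :: 'k alg_closure set) (Suc n) = {\<xi> \<in> witt_approx alg_ints n.
     \<forall>p. int_prime p \<longrightarrow> (\<forall>\<beta>\<in>prime_inv p. scal ghost \<beta> \<otimes>\<^bsub>ghost\<^esub> frob_diff p \<xi> \<in> witt_approx alg_ints n)}"
    if "ghost.int_subalg (witt_approx (alg_ints :: 'k alg_closure set) n)" for n
    using frobenius_lift_ghost[OF closed_subring_alg_ints _ _ that] car[of n]
    by (auto simp: nz_primes_iff)
  have *: "ghost.int_subalg (witt_approx (alg_ints :: 'k alg_closure set) n) \<and>
    (\<forall>p \<xi>. int_prime p \<longrightarrow> \<xi> \<in> witt_approx (alg_ints :: 'k alg_closure set) n \<longrightarrow> psi ghost p \<xi> \<in> witt_approx alg_ints n)" for n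
  proof (induction n)
    case 0
    have "ghost.int_subalg (witt_approx (alg_ints :: 'k alg_closure set) 0)"
      by (auto simp: ghost.int_subalg_def ghost_ring_simps PiE_iff restrict_apply)
    moreover have "psi ghost p \<xi> \<in> carrier (ghost_ring alg_ints)"
      if "int_prime p" "\<xi> \<in> carrier (ghost_ring alg_ints)" for p and \<xi> :: "'k set \<Rightarrow> 'k alg_closure"
      using psi_ghost_closed[OF that] by (simp add: ghost_ring_simps)
    ultimately show ?case by simp
  next
    case (Suc n)
    then show ?case using frob_subring[of "witt_approx (alg_ints :: 'k alg_closure set) n"] step[of n] by auto
  qed
  show "ghost.int_subalg (witt_approx (alg_ints :: 'k alg_closure set) n)" using * by blast
  show "\<And>p \<xi>. int_prime p \<Longrightarrow> \<xi> \<in> witt_approx (alg_ints :: 'k alg_closure set) n \<Longrightarrow> psi ghost p \<xi> \<in> witt_approx alg_ints n"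
    using * by blast
  show "witt_approx (alg_ints :: 'k alg_closure set) (Suc n) = {\<xi> \<in> witt_approx alg_ints n.
     \<forall>p. int_prime p \<longrightarrow> (\<forall>\<beta>\<in>prime_inv p. scal ghost \<beta> \<otimes>\<^bsub>ghost\<^esub> frob_diff p \<xi> \<in> witt_approx alg_ints n)}"
    using step * by blast
qed

text \<open>A monic equation confines the values to its finite set of roots. Conversely each of
  finitely many values has a monic integer polynomial, and the product of these annihilates every
  component at once.\<close>

lemma integral_elem_ghost_iff:
  fixes \<xi> :: "'k::number_field set \<Rightarrow> 'k alg_closure"
  assumes \<xi>: "\<xi> \<in> carrier (ghost_ring alg_ints)"
  shows "integral_elem (ghost_ring alg_ints) \<xi> \<longleftrightarrow> finite (\<xi> ` nz_ideals)"
proof -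
  interpret cring "ghost_ring (alg_ints :: 'k alg_closure set)" by (rule ghost_ring_cring[OF closed_subring_alg_ints])
  have ev: "\<xi> [^]\<^bsub>ghost_ring alg_ints\<^esub> n \<oplus>\<^bsub>ghost_ring alg_ints\<^esub>
      (\<Oplus>\<^bsub>ghost_ring alg_ints\<^esub>i\<in>{..<n}. scal (ghost_ring alg_ints) (c i) \<otimes>\<^bsub>ghost_ring alg_ints\<^esub> \<xi> [^]\<^bsub>ghost_ring alg_ints\<^esub> i) =
      (\<lambda>a\<in>nz_ideals. \<xi> a ^ n + (\<Sum>i<n. to_ac (c i) * \<xi> a ^ i))"
    if "\<forall>i<n. algebraic_int (c i)" for n and c :: "nat \<Rightarrow> 'k"
  proof -
    have "scal (ghost_ring alg_ints) (c i) \<in> carrier (ghost_ring alg_ints)" if "i < n" for i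
      using that \<open>\<forall>i<n. algebraic_int (c i)\<close> by (auto simp: ghost_ring_simps) (simp add: alg_ints_def)
    then have "(\<Oplus>\<^bsub>ghost_ring alg_ints\<^esub>i\<in>{..<n}. scal (ghost_ring alg_ints) (c i) \<otimes>\<^bsub>ghost_ring alg_ints\<^esub> \<xi> [^]\<^bsub>ghost_ring alg_ints\<^esub> i) =
      (\<lambda>a\<in>nz_ideals. \<Sum>i\<in>{..<n}. (scal (ghost_ring alg_ints) (c i) \<otimes>\<^bsub>ghost_ring alg_ints\<^esub> \<xi> [^]\<^bsub>ghost_ring alg_ints\<^esub> i) a)"
      using \<xi> by (intro ghost_ring_finsum[OF closed_subring_alg_ints]) auto
    then show ?thesis
      unfolding ghost_ring_pow[OF \<xi>] by (auto simp: ghost_ring_simps intro!: restrict_ext)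
  qed
  show ?thesis
  proof
    assume "integral_elem (ghost_ring alg_ints) \<xi>"
    then obtain n and c :: "nat \<Rightarrow> 'k" where c0: "\<forall>i<n. algebraic_int (c i)"
      "\<xi> [^]\<^bsub>ghost_ring alg_ints\<^esub> n \<oplus>\<^bsub>ghost_ring alg_ints\<^esub>
      (\<Oplus>\<^bsub>ghost_ring alg_ints\<^esub>i\<in>{..<n}. scal (ghost_ring alg_ints) (c i) \<otimes>\<^bsub>ghost_ring alg_ints\<^esub> \<xi> [^]\<^bsub>ghost_ring alg_ints\<^esub> i) =
      \<zero>\<^bsub>ghost_ring alg_ints\<^esub>"
      unfolding integral_elem_def by blast
    have c: "(\<lambda>a\<in>nz_ideals. \<xi> a ^ n + (\<Sum>i<n. to_ac (c i) * \<xi> a ^ i)) = \<zero>\<^bsub>ghost_ring alg_ints\<^esub>"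
      using ev[OF c0(1)] c0(2) by simp
    define q :: "'k alg_closure Polynomial.poly" where
      "q = Polynomial.monom 1 n + (\<Sum>i<n. Polynomial.monom (to_ac (c i)) i)"
    have "Polynomial.coeff q n = 1" by (simp add: q_def Polynomial.coeff_sum)
    then have "q \<noteq> 0" by auto
    have "poly q (\<xi> a) = 0" if "a \<in> nz_ideals" for a
      using fun_cong[OF c, of a] that by (simp add: q_def ghost_ring_simps Polynomial.poly_sum Polynomial.poly_monom)
    then have "\<xi> ` nz_ideals \<subseteq> {x. poly q x = 0}" by auto
    then show "finite (\<xi> ` nz_ideals)"
      using poly_roots_finite[OF \<open>q \<noteq> 0\<close>] by (rule finite_subset)
  next
    assume fin: "finite (\<xi> ` nz_ideals)"
    have "\<exists>q :: int Polynomial.poly. poly (map_poly of_int q) v = 0 \<and> Polynomial.lead_coeff q = 1" if "v \<in> \<xi> ` nz_ideals" for v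
      using that \<xi> unfolding algebraic_int_altdef_ipoly[symmetric] by (auto simp: ghost_ring_simps PiE_iff alg_ints_def)
    then obtain q :: "'k alg_closure \<Rightarrow> int Polynomial.poly" where
      q: "\<And>v. v \<in> \<xi> ` nz_ideals \<Longrightarrow> poly (map_poly of_int (q v)) v = 0 \<and> Polynomial.lead_coeff (q v) = 1" by metis
    define Q where "Q = (\<Prod>v\<in>\<xi> ` nz_ideals. q v)"
    have lead: "Polynomial.lead_coeff Q = 1" unfolding Q_def lead_coeff_prod using q by simp
    define n where "n = Polynomial.degree Q"
    have root: "\<xi> a ^ n + (\<Sum>i<n. of_int (Polynomial.coeff Q i) * \<xi> a ^ i) = 0" if a: "a \<in> nz_ideals" for a
    proof -
      have "poly (map_poly of_int Q) (\<xi> a) = (\<Prod>v\<in>\<xi> ` nz_ideals. poly (map_poly of_int (q v)) (\<xi> a))"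
        unfolding Q_def by (simp add: of_int_poly_hom.hom_prod poly_prod)
      also have "\<dots> = 0" using fin a q by (intro prod_zero bexI[of _ "\<xi> a"]) auto
      finally have "0 = (\<Sum>i\<le>n. of_int (Polynomial.coeff Q i) * \<xi> a ^ i)"
        by (simp add: poly_altdef n_def)
      also have "\<dots> = (\<Sum>i<n. of_int (Polynomial.coeff Q i) * \<xi> a ^ i) + \<xi> a ^ n"
        using lead by (simp add: n_def flip: lessThan_Suc_atMost)
      finally show ?thesis by (simp add: add.commute)
    qed
    show "integral_elem (ghost_ring alg_ints) \<xi>"
      unfolding integral_elem_def
    proof (intro exI conjI)
      show "\<forall>i<n. algebraic_int (of_int (Polynomial.coeff Q i) :: 'k)" by simp
      then show "\<xi> [^]\<^bsub>ghost_ring alg_ints\<^esub> n \<oplus>\<^bsub>ghost_ring alg_ints\<^esub>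
        (\<Oplus>\<^bsub>ghost_ring alg_ints\<^esub>i\<in>{..<n}. scal (ghost_ring alg_ints) (of_int (Polynomial.coeff Q i)) \<otimes>\<^bsub>ghost_ring alg_ints\<^esub> \<xi> [^]\<^bsub>ghost_ring alg_ints\<^esub> i) = \<zero>\<^bsub>ghost_ring alg_ints\<^esub>"
        by (subst ev) (auto simp: root ghost_ring_simps intro!: restrict_ext)
    qed
  qed
qed

section \<open>The ring W^a and its characterization\<close>

definition iwitt :: "('k::number_field set \<Rightarrow> 'k alg_closure) set" where
  "iwitt = carrier (integral_witt_ring (carrier ring_of_integers))"

lemma integral_witt_ring_eq:
  "integral_witt_ring (carrier ring_of_integers) = ghost\<lparr>carrier := (iwitt :: ('k::number_field set \<Rightarrow> 'k alg_closure) set)\<rparr>"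
  by (simp add: integral_witt_ring_def iwitt_def ghost_ring_def)

lemma iwitt_iff:
  "\<xi> \<in> iwitt \<longleftrightarrow> (\<forall>n. \<xi> \<in> witt_approx (alg_ints :: 'k::number_field alg_closure set) n) \<and> finite (\<xi> ` nz_ideals)"
proof -
  have "\<xi> \<in> carrier (ghost_ring alg_ints)" if "\<forall>n. \<xi> \<in> witt_approx (alg_ints :: 'k alg_closure set) n"
    using spec[OF that, of 0] by simp
  then show ?thesis
    using integral_elem_ghost_iff[of \<xi>] by (auto simp: iwitt_def integral_witt_ring_def witt_vectors_def)
qed

lemma iwitt_values: "\<xi> \<in> iwitt \<Longrightarrow> a \<in> nz_ideals \<Longrightarrow> \<xi> a \<in> alg_ints"
  using iwitt_iff[of \<xi>] by (auto simp: ghost_ring_simps PiE_iff dest!: spec[of _ 0])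

lemma finite_image2:
  assumes "finite (u ` S)" "finite (v ` S)"
  shows "finite ((\<lambda>x. w (u x) (v x)) ` S)"
proof (rule finite_subset)
  show "(\<lambda>x. w (u x) (v x)) ` S \<subseteq> (\<lambda>z. w (fst z) (snd z)) ` (u ` S \<times> v ` S)" by force
  show "finite ((\<lambda>z. w (fst z) (snd z)) ` (u ` S \<times> v ` S))" using assms by simp
qed

lemma iwitt_int_subalg: "ghost.int_subalg (iwitt :: ('k::number_field set \<Rightarrow> 'k alg_closure) set)"
proof -
  note UD = ghost.int_subalgD[OF witt_approx_props(1)]
  show ?thesis
    unfolding ghost.int_subalg_def
  proof (intro conjI ballI subsetI)
    show "x \<in> carrier ghost" if "x \<in> iwitt" for x :: "'k set \<Rightarrow> 'k alg_closure"
      using that UD(1) unfolding iwitt_iff by blast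
    show "x \<in> iwitt" if "x \<in> scal ghost ` alg_ints" for x :: "'k set \<Rightarrow> 'k alg_closure"
      unfolding iwitt_iff using that UD(2) by (auto simp: ghost_ring_simps image_constant_conv)
    fix x y :: "'k set \<Rightarrow> 'k alg_closure" assume xy: "x \<in> iwitt" "y \<in> iwitt"
    then have fin: "finite ((\<lambda>a. h (x a) (y a)) ` nz_ideals)" for h :: "'k alg_closure \<Rightarrow> _ \<Rightarrow> 'k alg_closure"
      using finite_image2 unfolding iwitt_iff by metis
    show "x \<oplus>\<^bsub>ghost\<^esub> y \<in> iwitt"
      using xy UD(3)[of x _ y] fin[of "(+)"] unfolding iwitt_iff by (simp add: ghost_ring_simps)
    show "x \<otimes>\<^bsub>ghost\<^esub> y \<in> iwitt"
      using xy UD(4)[of x _ y] fin[of "(*)"] unfolding iwitt_iff by (simp add: ghost_ring_simps)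
  qed
qed

lemma iwitt_psi:
  assumes "int_prime p" "\<xi> \<in> iwitt"
  shows "psi ghost p \<xi> \<in> iwitt"
proof -
  have "(\<lambda>a. \<xi> (p \<odot> a)) ` nz_ideals \<subseteq> \<xi> ` nz_ideals" using assms(1) by auto
  moreover have "finite (\<xi> ` nz_ideals)" using assms(2) by (simp add: iwitt_iff)
  ultimately have "finite ((\<lambda>a. \<xi> (p \<odot> a)) ` nz_ideals)" by (rule finite_subset)
  then show ?thesis
    using assms witt_approx_props(2)[OF assms(1)] unfolding iwitt_iff by (auto simp: ghost_ring_simps)
qed

text \<open>Level \<open>Suc n\<close> puts the product with \<beta> only at level \<open>n\<close>,
  but an element of the intersection is available at every level. So the Frobenius defect, divided
  by \<open>p\<close> in this sense, is again in W^a.\<close>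

lemma iwitt_frobenius:
  fixes \<xi> :: "'k::number_field set \<Rightarrow> 'k alg_closure"
  assumes p: "int_prime p" and \<xi>: "\<xi> \<in> iwitt" and \<beta>: "\<beta> \<in> prime_inv p"
  shows "scal ghost \<beta> \<otimes>\<^bsub>ghost\<^esub> frob_diff p \<xi> \<in> iwitt"
  unfolding iwitt_iff
proof (intro conjI allI)
  fix n
  have "\<xi> \<in> witt_approx alg_ints (Suc n)" using \<xi> unfolding iwitt_iff by blast
  then show "scal ghost \<beta> \<otimes>\<^bsub>ghost\<^esub> frob_diff p \<xi> \<in> witt_approx alg_ints n"
    using witt_approx_props(3)[of n] p \<beta> by auto
next
  have fin: "finite (\<xi> ` nz_ideals)" "finite (psi ghost p \<xi> ` nz_ideals)" using \<xi> iwitt_psi[OF p \<xi>] by (auto simp: iwitt_iff)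
  have "(scal ghost \<beta> \<otimes>\<^bsub>ghost\<^esub> frob_diff p \<xi>) ` nz_ideals =
    (\<lambda>a. to_ac \<beta> * (psi ghost p \<xi> a - \<xi> a ^ abs_norm p)) ` nz_ideals"
    by (rule image_cong) (auto simp: ghost_ring_simps frob_diff_def)
  then show "finite ((scal ghost \<beta> \<otimes>\<^bsub>ghost\<^esub> frob_diff p \<xi>) ` nz_ideals)"
    using finite_image2[OF fin(2,1), of "\<lambda>u v. to_ac \<beta> * (u - v ^ abs_norm p)"] by simp
qed

text \<open>The universal property of Witt vectors: by induction on the level, a set of integral
  families closed under division of Frobenius defects lies in every approximation.\<close>

lemma iwitt_frobeniusI:
  fixes \<xi> :: "'k::number_field set \<Rightarrow> 'k alg_closure" and Z :: "('k set \<Rightarrow> 'k alg_closure) set"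
  assumes Z: "\<And>\<xi> a. \<xi> \<in> Z \<Longrightarrow> a \<in> nz_ideals \<Longrightarrow> \<xi> a \<in> alg_ints" "Z \<subseteq> carrier ghost"
    "\<And>\<xi>. \<xi> \<in> Z \<Longrightarrow> finite (\<xi> ` nz_ideals)" and IA: "ghost.int_subalg Z"
    and frob: "\<And>\<xi> p \<beta>. \<xi> \<in> Z \<Longrightarrow> int_prime p \<Longrightarrow> \<beta> \<in> prime_inv p \<Longrightarrow> scal ghost \<beta> \<otimes>\<^bsub>ghost\<^esub> frob_diff p \<xi> \<in> Z"
  shows "Z \<subseteq> iwitt"
proof -
  have "Z \<subseteq> witt_approx alg_ints n" for n
  proof (induction n)
    case 0
    show ?case using Z(1,2) by (fastforce simp: ghost_ring_simps PiE_iff)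
  next
    case (Suc n)
    then show ?case unfolding witt_approx_props(3) using frob by blast
  qed
  then show ?thesis using Z(3) by (intro subsetI) (unfold iwitt_iff, blast)
qed

section \<open>Periodicity at a prime\<close>

lemma alg_ints_power_diff:
  fixes u v :: "'a::field_char_0"
  assumes "u \<in> alg_ints" "v \<in> alg_ints" "c * (u - v) \<in> alg_ints"
  shows "c * (u ^ n - v ^ n) \<in> alg_ints"
proof -
  have eq: "c * (u ^ n - v ^ n) = (c * (u - v)) * (\<Sum>i<n. v ^ (n - Suc i) * u ^ i)"
    by (simp add: power_diff_sumr2 mult.assoc)
  show ?thesis unfolding eq
    by (rule alg_ints_closed(7)[OF assms(3)]) (use assms(1,2) in \<open>auto intro!: alg_ints_sum\<close>)
qed

text \<open>Each q-th power gains one factor p: the mixed binomial terms carry a coefficient in p,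
  and the pure term \<open>t ^ q\<close> contains \<open>t\<close> at least twice. With
  \<open>b\<close> in the inverse of p, a congruence modulo p thus becomes one modulo p^(m+1) for
  the powers with exponent q^m. All smaller \<open>k\<close> take part in the induction, because the
  pure term also uses the congruence modulo p itself.\<close>

lemma frobenius_power_congruence:
  fixes u v b :: "'a::field_char_0"
  assumes uv: "u \<in> alg_ints" "v \<in> alg_ints" "b * (u - v) \<in> alg_ints" and q: "q \<ge> 2"
    and bin: "\<And>i. 0 < i \<Longrightarrow> i < q \<Longrightarrow> b * of_nat (q choose i) \<in> alg_ints"
  shows "k \<le> Suc m \<Longrightarrow> b ^ k * (u ^ (q ^ m) - v ^ (q ^ m)) \<in> alg_ints"
proof (induction m arbitrary: k)
  case 0
  then have "k = 0 \<or> k = 1" by auto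
  then show ?case using uv by auto
next
  case (Suc m)
  define x where "x = u ^ (q ^ m)"
  define y where "y = v ^ (q ^ m)"
  define t where "t = x - y"
  have ints: "x \<in> alg_ints" "y \<in> alg_ints" "t \<in> alg_ints" using uv by (auto simp: x_def y_def t_def)
  have IH: "k \<le> Suc m \<Longrightarrow> b ^ k * t \<in> alg_ints" for k using Suc.IH by (simp add: t_def x_def y_def)
  have eq: "u ^ (q ^ Suc m) - v ^ (q ^ Suc m) = (t + y) ^ q - y ^ q"
    by (simp add: t_def x_def y_def power_mult[symmetric] mult.commute)
  have "(t + y) ^ q = (\<Sum>i\<le>q. of_nat (q choose i) * t ^ i * y ^ (q - i))" by (rule binomial_ring)
  also have "{..q} = insert 0 (insert q {1..<q})" using q by auto
  also have "(\<Sum>i\<in>\<dots>. of_nat (q choose i) * t ^ i * y ^ (q - i)) =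
    y ^ q + (t ^ q + (\<Sum>i\<in>{1..<q}. of_nat (q choose i) * t ^ i * y ^ (q - i)))"
    using q by simp
  finally have ex: "(t + y) ^ q - y ^ q = t ^ q + (\<Sum>i\<in>{1..<q}. of_nat (q choose i) * t ^ i * y ^ (q - i))" by simp
  show ?case
  proof (cases k)
    case 0
    then show ?thesis using uv by auto
  next
    case (Suc k')
    then have k': "k' \<le> Suc m" using Suc.prems by simp
    \<comment> \<open>Of the \<open>k\<close> factors \<open>b\<close>, all but one go with one copy
      of \<open>t\<close> and the last one with another copy; this is where \<open>q \<ge> 2\<close>
      enters.\<close>
    have "b ^ k * t ^ q = (b ^ k' * t) * (b ^ 1 * t) * t ^ (q - 2)"
    proof -
      have "t ^ q = t * t * t ^ (q - 2)" using q by (metis le_add_diff_inverse power2_eq_square power_add)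
      then show ?thesis by (simp add: Suc)
    qed
    also have "\<dots> \<in> alg_ints" using IH[OF k'] IH[of 1] ints
      by (intro alg_ints_closed(7)[OF alg_ints_closed(7)]) auto
    finally have A: "b ^ k * t ^ q \<in> alg_ints" .
    have B: "b ^ k * (of_nat (q choose i) * t ^ i * y ^ (q - i)) \<in> alg_ints" if i: "i \<in> {1..<q}" for i
    proof -
      have "t ^ i = t * t ^ (i - 1)" using i by (cases i) auto
      then have "b ^ k * (of_nat (q choose i) * t ^ i * y ^ (q - i)) =
        (b * of_nat (q choose i)) * (b ^ k' * t) * t ^ (i - 1) * y ^ (q - i)"
        by (simp add: Suc)
      also have "\<dots> \<in> alg_ints" using bin[of i] i IH[OF k'] ints
        by (intro alg_ints_closed(7)[OF alg_ints_closed(7)[OF alg_ints_closed(7)]]) auto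
      finally show ?thesis .
    qed
    show ?thesis unfolding eq ex distrib_left sum_distrib_left
      using A B by (intro alg_ints_closed(5) alg_ints_sum) auto
  qed
qed

text \<open>All powers of \<open>v\<close> lie in a finitely generated group, which has finitely
  many residues modulo \<open>m\<close>, so two of the iterated powers are congruent. Further q-th
  powers preserve this, as \<open>s - t\<close> divides the difference of equal powers of
  \<open>s\<close> and \<open>t\<close>.\<close>

lemma power_residue_periodic:
  fixes v :: "'a::field_char_0"
  assumes v: "v \<in> alg_ints" and m: "m > 0"
  obtains n0 f where "f > 0" "\<And>n. n \<ge> n0 \<Longrightarrow> \<exists>y\<in>alg_ints. v ^ (q ^ (n + f)) - v ^ (q ^ n) = of_nat m * y"
proof -
  have "algebraic_int v" using v by (simp add: alg_ints_def)
  then obtain d and c :: "nat \<Rightarrow> int" where d: "d > 0" "v ^ d = - (\<Sum>i<d. of_int (c i) * v ^ i)"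
    by (rule algebraic_int_monic_relation)
  define B where "B = (\<lambda>i. v ^ i) ` {..<d}"
  have B: "B \<subseteq> alg_ints" "finite B" using v by (auto simp: B_def)
  have base: "v ^ i \<in> zmod.span B" if "i < d" for i
    using that by (intro zmod.span_base) (auto simp: B_def)
  have dd: "v ^ d \<in> zmod.span B"
    unfolding d(2) by (intro zmod.span_neg zmod.span_sum zmod.span_scale base) auto
  have mult: "v * b \<in> zmod.span B" if b: "b \<in> B" for b
  proof -
    obtain i where i: "i < d" "b = v ^ i" using b by (auto simp: B_def)
    then have "v * b = v ^ Suc i" by simp
    then show ?thesis using base[of "Suc i"] dd i(1) by (cases "Suc i = d") auto
  qed
  have pow: "v ^ k \<in> zmod.span B" for k
  proof (induction k)
    case 0
    show ?case by (rule base[OF d(1)])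
  next
    case (Suc k)
    then show ?case using zmod_span_mult_closed[OF mult Suc] by simp
  qed
  obtain S where S: "finite S" "S \<subseteq> alg_ints" "\<forall>x\<in>zmod.span B. \<exists>s\<in>S. \<exists>y\<in>alg_ints. x - s = of_nat m * y"
    using finite_residues_span[OF m B] by (elim exE conjE)
  have "\<exists>s\<in>S. \<exists>y\<in>alg_ints. v ^ (q ^ n) - s = of_nat m * y" for n using S(3) pow by simp
  then obtain r y where r: "\<And>n. r n \<in> S" "\<And>n. y n \<in> alg_ints" "\<And>n. v ^ (q ^ n) - r n = of_nat m * y n"
    by metis
  have "\<not> inj r" using S(1) r(1) by (metis finite_subset image_subsetI infinite_UNIV_nat finite_imageD)
  then obtain n0 n1 where n: "n0 < n1" "r n0 = r n1"
    unfolding inj_def by (metis linorder_neqE_nat)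
  define f where "f = n1 - n0"
  have f: "f > 0" "n1 = n0 + f" using n by (auto simp: f_def)
  have key: "v ^ (q ^ (n0 + f)) - v ^ (q ^ n0) = of_nat m * (y n1 - y n0)"
    using r(3)[of n1] r(3)[of n0] n(2) f(2) by (simp add: algebra_simps)
  show ?thesis
  proof (rule that[of f n0, OF f(1)])
    fix n assume "n \<ge> n0"
    then obtain j where j: "n = n0 + j" by (metis le_Suc_ex)
    define s where "s = v ^ (q ^ (n0 + f))"
    define t where "t = v ^ (q ^ n0)"
    have st: "s \<in> alg_ints" "t \<in> alg_ints" using v by (auto simp: s_def t_def)
    have "v ^ (q ^ (n + f)) - v ^ (q ^ n) = s ^ (q ^ j) - t ^ (q ^ j)"
      by (simp add: j s_def t_def power_mult[symmetric] power_add mult_ac)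
    also have "\<dots> = (s - t) * (\<Sum>i<q ^ j. t ^ (q ^ j - Suc i) * s ^ i)" by (rule power_diff_sumr2)
    also have "\<dots> = of_nat m * ((y n1 - y n0) * (\<Sum>i<q ^ j. t ^ (q ^ j - Suc i) * s ^ i))"
      using key by (simp add: s_def t_def mult.assoc)
    finally show "\<exists>y\<in>alg_ints. v ^ (q ^ (n + f)) - v ^ (q ^ n) = of_nat m * y"
      using r(2) st by (intro bexI[of _ "(y n1 - y n0) * (\<Sum>i<q ^ j. t ^ (q ^ j - Suc i) * s ^ i)"]) (auto intro!: alg_ints_sum)
  qed
qed

text \<open>
  For \<open>b\<close> in \<open>prime_inv p\<close> but not integral, this stands for eventual periodicity modulo \<open>p ^ M\<close>, uniformly in the
  index. The exponent \<open>M\<close> is raised through the congruence between \<open>\<psi>\<^sub>p\<close> and the \<open>N p\<close>-th power.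
\<close>

definition evper :: "'a::field_char_0 \<Rightarrow> nat \<Rightarrow> 'i set \<Rightarrow> (nat \<Rightarrow> 'i \<Rightarrow> 'a) \<Rightarrow> bool" where
  "evper b M A s \<longleftrightarrow> (\<exists>n0 f. f > 0 \<and> (\<forall>n\<ge>n0. \<forall>a\<in>A. b ^ M * (s (n + f) a - s n a) \<in> alg_ints))"

lemma evper_multiple:
  fixes s :: "nat \<Rightarrow> 'i \<Rightarrow> 'a::field_char_0"
  assumes "\<forall>n\<ge>n0. \<forall>a\<in>A. b ^ M * (s (n + f) a - s n a) \<in> alg_ints" "n \<ge> n0" "a \<in> A"
  shows "b ^ M * (s (n + k * f) a - s n a) \<in> alg_ints"
proof (induction k)
  case (Suc k)
  have "n + k * f \<ge> n0" using assms(2) by simp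
  then have "b ^ M * (s (n + k * f + f) a - s (n + k * f) a) \<in> alg_ints" using assms by blast
  then have "b ^ M * (s (n + k * f + f) a - s (n + k * f) a) + b ^ M * (s (n + k * f) a - s n a) \<in> alg_ints"
    using Suc by blast
  then show ?case by (simp add: algebra_simps)
qed simp

lemma evper_common:
  assumes "evper b M A s" "evper b M B t"
  shows "\<exists>n0 f. f > 0 \<and> (\<forall>n\<ge>n0. \<forall>a\<in>A. b ^ M * (s (n + f) a - s n a) \<in> alg_ints) \<and>
    (\<forall>n\<ge>n0. \<forall>a\<in>B. b ^ M * (t (n + f) a - t n a) \<in> alg_ints)"
proof -
  obtain n1 f1 where 1: "f1 > 0" "\<forall>n\<ge>n1. \<forall>a\<in>A. b ^ M * (s (n + f1) a - s n a) \<in> alg_ints"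
    using assms(1) unfolding evper_def by blast
  obtain n2 f2 where 2: "f2 > 0" "\<forall>n\<ge>n2. \<forall>a\<in>B. b ^ M * (t (n + f2) a - t n a) \<in> alg_ints"
    using assms(2) unfolding evper_def by blast
  show ?thesis
  proof (rule exI[of _ "max n1 n2"], rule exI[of _ "f1 * f2"], intro conjI allI impI ballI)
    show "f1 * f2 > 0" using 1 2 by simp
    show "b ^ M * (s (n + f1 * f2) a - s n a) \<in> alg_ints" if "n \<ge> max n1 n2" "a \<in> A" for n a
      using evper_multiple[OF 1(2), of n a f2] that by (simp add: mult.commute)
    show "b ^ M * (t (n + f1 * f2) a - t n a) \<in> alg_ints" if "n \<ge> max n1 n2" "a \<in> B" for n a
      using evper_multiple[OF 2(2), of n a f1] that by simp
  qed
qed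

lemma evper_add:
  assumes "evper b M A s" "evper b M A t"
  shows "evper b M A (\<lambda>n a. s n a + t n a)"
proof -
  obtain n0 f where nf: "f > 0" "\<forall>n\<ge>n0. \<forall>a\<in>A. b ^ M * (s (n + f) a - s n a) \<in> alg_ints"
    "\<forall>n\<ge>n0. \<forall>a\<in>A. b ^ M * (t (n + f) a - t n a) \<in> alg_ints"
    using evper_common[OF assms] by (elim exE conjE)
  have "b ^ M * (s (n + f) a + t (n + f) a - (s n a + t n a)) \<in> alg_ints" if "n \<ge> n0" "a \<in> A" for n a
    using alg_ints_closed(5)[OF nf(2)[rule_format, OF that] nf(3)[rule_format, OF that]] by (simp add: algebra_simps)
  then show ?thesis unfolding evper_def using nf(1) by blast
qed

lemma evper_Un:
  assumes "evper b M A s" "evper b M B s"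
  shows "evper b M (A \<union> B) s"
proof -
  obtain n0 f where "f > 0" "\<forall>n\<ge>n0. \<forall>a\<in>A. b ^ M * (s (n + f) a - s n a) \<in> alg_ints"
    "\<forall>n\<ge>n0. \<forall>a\<in>B. b ^ M * (s (n + f) a - s n a) \<in> alg_ints"
    using evper_common[OF assms] by (elim exE conjE)
  then show ?thesis unfolding evper_def by blast
qed

lemma evper_Suc:
  assumes "evper b M A (\<lambda>n. s (Suc n))"
  shows "evper b M A s"
proof -
  obtain n0 f where "f > 0" "\<forall>n\<ge>n0. \<forall>a\<in>A. b ^ M * (s (Suc (n + f)) a - s (Suc n) a) \<in> alg_ints"
    using assms unfolding evper_def by blast
  then have "\<forall>n\<ge>Suc n0. \<forall>a\<in>A. b ^ M * (s (n + f) a - s n a) \<in> alg_ints"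
    by (metis Suc_le_D Suc_le_mono add_Suc)
  then show ?thesis unfolding evper_def using \<open>f > 0\<close> by blast
qed

lemma evper_congruent:
  assumes "evper b M A s" "\<And>n a. a \<in> A \<Longrightarrow> b ^ M * (t n a - s n a) \<in> alg_ints"
  shows "evper b M A t"
proof -
  obtain n0 f where nf: "f > 0" "\<forall>n\<ge>n0. \<forall>a\<in>A. b ^ M * (s (n + f) a - s n a) \<in> alg_ints"
    using assms unfolding evper_def by blast
  have "b ^ M * (t (n + f) a - t n a) \<in> alg_ints" if "n \<ge> n0" "a \<in> A" for n a
  proof -
    have "b ^ M * (t (n + f) a - s (n + f) a) + b ^ M * (s (n + f) a - s n a) - b ^ M * (t n a - s n a) \<in> alg_ints"
      using nf(2) that assms(2) by blast
    then show ?thesis by (simp add: algebra_simps)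
  qed
  then show ?thesis unfolding evper_def using nf(1) by blast
qed

text \<open>With a denominator \<open>d\<close> of \<open>b\<close>, a congruence modulo
  \<open>d ^ M\<close> makes the product with \<open>b ^ M\<close> integral, so periodicity modulo a
  positive integer suffices.\<close>

lemma evper_powers:
  fixes b :: "'a::field_char_0"
  assumes V: "finite V" "V \<subseteq> alg_ints" and d: "d > 0" "of_nat d * b \<in> alg_ints"
  shows "evper b M V (\<lambda>n v. v ^ (q ^ n))"
  using V
proof (induction V)
  case empty
  show ?case unfolding evper_def by auto
next
  case (insert v V)
  have "d ^ M > 0" using d(1) by simp
  moreover have "v \<in> alg_ints" using insert.prems by simp
  ultimately obtain n0 f where nf: "f > 0" "\<And>n. n \<ge> n0 \<Longrightarrow> \<exists>y\<in>alg_ints. v ^ (q ^ (n + f)) - v ^ (q ^ n) = of_nat (d ^ M) * y"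
    using power_residue_periodic[of v "d ^ M" q] by metis
  have "b ^ M * (v ^ (q ^ (n + f)) - v ^ (q ^ n)) \<in> alg_ints" if n: "n \<ge> n0" for n
  proof -
    obtain y where y: "y \<in> alg_ints" "v ^ (q ^ (n + f)) - v ^ (q ^ n) = of_nat (d ^ M) * y" using nf(2)[OF n] by blast
    then have "b ^ M * (v ^ (q ^ (n + f)) - v ^ (q ^ n)) = (of_nat d * b) ^ M * y"
      by (simp add: power_mult_distrib)
    then show ?thesis using y(1) d(2) by auto
  qed
  then have "evper b M {v} (\<lambda>n v. v ^ (q ^ n))" unfolding evper_def using nf(1) by blast
  then show ?case using evper_Un[of b M "{v}" _ V] insert by simp
qed

text \<open>If all powers of \<beta> carried some nonzero \<delta> to integers, the elements of K
  with this property would form an ideal stable under \<beta>. It is nonzero, as it contains a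
  positive integer divisible by \<delta>, so \<beta> would be integral. For finite \<open>V\<close>
  one exponent serves all differences.\<close>

lemma nonintegral_separates:
  fixes \<beta> :: "'k::number_field"
  assumes \<beta>: "\<beta> \<notin> alg_ints" and V: "finite V" "V \<subseteq> (alg_ints :: 'k alg_closure set)"
  obtains M where "\<And>u v. u \<in> V \<Longrightarrow> v \<in> V \<Longrightarrow> to_ac \<beta> ^ M * (u - v) \<in> alg_ints \<Longrightarrow> u = v"
proof -
  let ?b = "to_ac \<beta>"
  have ex: "\<exists>M. ?b ^ M * \<delta> \<notin> alg_ints" if \<delta>: "\<delta> \<in> alg_ints" "\<delta> \<noteq> 0" for \<delta>
  proof (rule ccontr)
    assume "\<not> ?thesis"
    then have all: "?b ^ M * \<delta> \<in> alg_ints" for M by blast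
    obtain n :: nat and y where n: "n > 0" "algebraic_int y" "of_nat n = \<delta> * y"
      using algebraic_int_divisor_nat[of \<delta>] \<delta> by (auto simp: alg_ints_def)
    define I where "I = {x. \<forall>M. \<beta> ^ M * x \<in> alg_ints}"
    have I: "int_ideal I"
      unfolding int_ideal_def I_def
    proof (intro conjI subsetI ballI CollectI allI)
      show "x \<in> alg_ints" if "x \<in> {x. \<forall>M. \<beta> ^ M * x \<in> alg_ints}" for x using that by (auto dest: spec[of _ 0])
    qed (auto simp: distrib_left mult.left_commute)
    have "to_ac (\<beta> ^ M * of_nat n) = (?b ^ M * \<delta>) * y" for M using n(3) by simp
    moreover have "(?b ^ M * \<delta>) * y \<in> alg_ints" for M using all n(2) by (auto simp: alg_ints_def)
    ultimately have "of_nat n \<in> I" unfolding I_def mem_Collect_eq using algebraic_int_to_ac_iff by metis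
    moreover have "of_nat n \<noteq> (0::'k)" using n(1) by simp
    ultimately have "I \<noteq> {0}" by blast
    moreover have "\<beta> * x \<in> I" if x: "x \<in> I" for x
    proof -
      have "\<beta> ^ Suc M * x \<in> alg_ints" for M using x unfolding I_def by blast
      then show ?thesis unfolding I_def by (simp add: mult_ac)
    qed
    ultimately show False using stabilizer_of_ideal_integral[OF I] \<beta> by blast
  qed
  have mono: "?b ^ k * \<delta> \<in> alg_ints" if \<delta>: "\<delta> \<in> alg_ints" "?b ^ (k + j) * \<delta> \<in> alg_ints" for \<delta> k j
  proof (cases "k = 0")
    case False
    define x where "x = ?b ^ k * \<delta>"
    \<comment> \<open>If a higher power of \<beta> carries \<delta> to an integer, so does a lower
      one, because a power of \<open>x\<close> is integral. Hence the exponents found for the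
      individual \<delta> can be raised to a common one.\<close>
    have "x ^ (k + j) = (?b ^ (k + j) * \<delta>) ^ k * \<delta> ^ j"
      by (simp add: x_def power_mult_distrib power_add mult_ac flip: power_mult)
    also have "\<dots> \<in> alg_ints" using \<delta> by blast
    finally have "algebraic_int (x ^ (k + j))" by (simp add: alg_ints_def)
    then have "algebraic_int x"
      by (rule algebraic_int_root[of _ "Polynomial.monom 1 (k + j)"])
        (use False in \<open>auto simp: Polynomial.poly_monom Polynomial.degree_monom_eq Polynomial.coeff_monom\<close>)
    then show ?thesis by (simp add: x_def alg_ints_def)
  qed (use \<delta> in simp)
  define D where "D = (\<lambda>(u, v). u - v) ` (V \<times> V) - {0}"
  have D: "finite D" "D \<subseteq> alg_ints" using V by (auto simp: D_def)
  have "\<forall>\<delta>\<in>D. \<exists>M. ?b ^ M * \<delta> \<notin> alg_ints" using ex D by (auto simp: D_def)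
  then obtain M where M: "\<And>\<delta>. \<delta> \<in> D \<Longrightarrow> ?b ^ M \<delta> * \<delta> \<notin> alg_ints" by metis
  define m where "m = Max (insert 0 (M ` D))"
  show ?thesis
  proof (rule that[of m])
    fix u v assume uv: "u \<in> V" "v \<in> V" "?b ^ m * (u - v) \<in> alg_ints"
    show "u = v"
    proof (rule ccontr)
      assume "u \<noteq> v"
      then have d: "u - v \<in> D" using uv by (auto simp: D_def)
      then have "M (u - v) \<le> m" unfolding m_def using D(1) by (intro Max_ge) auto
      then obtain j where "m = M (u - v) + j" by (metis le_Suc_ex)
      then have "?b ^ M (u - v) * (u - v) \<in> alg_ints" using mono[of "u - v" "M (u - v)" j] uv(3) d D(2) by auto
      then show False using M[OF d] by blast
    qed
  qed
qed

section \<open>Iterates of \<psi>_p on integral Witt vectors\<close>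

lemma iwitt_frobenius_value:
  fixes \<xi> :: "'k::number_field set \<Rightarrow> 'k alg_closure"
  assumes "int_prime p" "\<xi> \<in> iwitt" "\<beta> \<in> prime_inv p" "a \<in> nz_ideals"
  shows "to_ac \<beta> * (\<xi> (p \<odot> a) - \<xi> a ^ abs_norm p) \<in> alg_ints"
  using iwitt_values[OF iwitt_frobenius[OF assms(1-3)] assms(4)] assms(1,4)
  by (simp add: ghost_ring_simps frob_diff_def)

text \<open>Two nested inductions. The outer one raises the exponent from M to M + 1 for all
  elements of W^a at once, so that it applies to the divided Frobenius defects of powers of
  \<open>x\<close>. The inner one descends from \<open>x ^ (q ^ M)\<close>, for which iterating
  \<psi>_p agrees modulo p^(M+1) with taking q-th powers, to \<open>x\<close> itself.\<close>

lemma iwitt_evper: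
  fixes x :: "'k::number_field set \<Rightarrow> 'k alg_closure"
  assumes p: "int_prime p" and \<beta>: "\<beta> \<in> prime_inv p" and x: "x \<in> iwitt"
  shows "evper (to_ac \<beta>) M nz_ideals (\<lambda>n a. x (((\<odot>) p ^^ n) a))"
  using x
proof (induction M arbitrary: x)
  case 0
  have nz: "((\<odot>) p ^^ n) a \<in> nz_ideals" if "a \<in> nz_ideals" for n a
    by (induction n) (use p that in auto)
  show ?case unfolding evper_def
    by (intro exI[of _ 0] exI[of _ 1]) (auto simp del: funpow.simps intro!: alg_ints_closed(6) iwitt_values[OF 0 nz])
next
  case (Suc M)
  let ?b = "to_ac \<beta>" and ?q = "abs_norm p"
  define pw where "pw n a = ((\<odot>) p ^^ n) a" for n a
  have nz: "pw n a \<in> nz_ideals" if "a \<in> nz_ideals" for n a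
    unfolding pw_def by (induction n) (use p that in auto)
  have pwS: "pw (Suc n) a = p \<odot> pw n a" for n a by (simp add: pw_def)
  note IA = ghost.int_subalgD[OF iwitt_int_subalg]
  define Y where "Y m = x [^]\<^bsub>ghost\<^esub> (?q ^ m)" for m :: nat
  have YW: "Y m \<in> iwitt" for m unfolding Y_def by (rule IA(9)[OF Suc.prems])
  have Yv: "Y m a = x a ^ (?q ^ m)" if "a \<in> nz_ideals" for m a
    unfolding Y_def ghost_ring_pow[OF IA(1)[OF Suc.prems]] using that by simp
  \<comment> \<open>The image of \<open>Y m\<close> under \<psi>_p is the sum of
    \<open>Y (Suc m)\<close> and the Frobenius defect. The product of \<beta> with the defect is in
    W^a and periodic modulo p^M, so the defect is periodic modulo p^(M+1).\<close>
  have step: "evper ?b (Suc M) nz_ideals (\<lambda>n a. Y m (pw n a))"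
    if ev: "evper ?b (Suc M) nz_ideals (\<lambda>n a. Y (Suc m) (pw n a))" for m
  proof (rule evper_Suc)
    define w where "w = scal ghost \<beta> \<otimes>\<^bsub>ghost\<^esub> frob_diff p (Y m)"
    have w: "w \<in> iwitt" unfolding w_def by (rule iwitt_frobenius[OF p YW \<beta>])
    have wv: "w a = ?b * (Y m (p \<odot> a) - Y m a ^ ?q)" if "a \<in> nz_ideals" for a
      using that p by (simp add: w_def ghost_ring_simps frob_diff_def)
    have "evper ?b M nz_ideals (\<lambda>n a. w (pw n a))" using Suc.IH[OF w] by (simp add: pw_def)
    then have "evper ?b (Suc M) nz_ideals (\<lambda>n a. Y m (p \<odot> pw n a) - Y m (pw n a) ^ ?q)"
      unfolding evper_def by (simp add: wv nz algebra_simps)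
    from evper_add[OF ev this]
    show "evper ?b (Suc M) nz_ideals (\<lambda>n a. Y m (pw (Suc n) a))"
      by (elim evper_congruent) (simp add: pwS Yv nz p power_mult[symmetric] mult.commute)
  qed
  \<comment> \<open>Finitely many values occur, so the periodicity of iterated powers is uniform in
    the ideal.\<close>
  have "evper ?b (Suc M) nz_ideals (\<lambda>n a. Y M a ^ (?q ^ n))"
  proof -
    obtain d :: nat where d: "d > 0" "of_nat d * \<beta> \<in> alg_ints" by (rule number_field_integer_multiple)
    have "to_ac (of_nat d * \<beta>) \<in> alg_ints" using d(2) by (simp only: algebraic_int_to_ac_iff)
    then have d': "of_nat d * ?b \<in> alg_ints" by simp
    have "evper ?b (Suc M) (Y M ` nz_ideals) (\<lambda>n v. v ^ (?q ^ n))"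
      using YW[of M] iwitt_values by (intro evper_powers[OF _ _ d(1) d']) (auto simp: iwitt_iff)
    then show ?thesis unfolding evper_def by simp
  qed
  \<comment> \<open>One further \<psi>_p is compared with a q-th power through the Frobenius
    congruence of \<open>x\<close>; raising that congruence to the power with exponent q^M improves
    it to one modulo p^(M+1).\<close>
  moreover have "?b ^ Suc M * (Y M (pw n a) - Y M a ^ (?q ^ n)) \<in> alg_ints" if a: "a \<in> nz_ideals" for n a
  proof (induction n)
    case 0
    show ?case by (simp add: pw_def)
  next
    case (Suc n)
    let ?c = "pw n a"
    have c: "?c \<in> nz_ideals" "p \<odot> ?c \<in> nz_ideals" using nz[OF a] p by auto
    have xi: "x ?c \<in> alg_ints" "x (p \<odot> ?c) \<in> alg_ints" using iwitt_values[OF \<open>x \<in> iwitt\<close>] c by auto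
    have A: "?b ^ Suc M * (x (p \<odot> ?c) ^ (?q ^ M) - (x ?c ^ ?q) ^ (?q ^ M)) \<in> alg_ints"
    proof (rule frobenius_power_congruence)
      show "?b * (x (p \<odot> ?c) - x ?c ^ ?q) \<in> alg_ints"
        by (rule iwitt_frobenius_value[OF p \<open>x \<in> iwitt\<close> \<beta> c(1)])
      show "?q \<ge> 2" by (rule abs_norm_ge_2[OF p])
      fix i assume "0 < i" "i < ?q"
      then have "\<beta> * of_nat (?q choose i) \<in> alg_ints"
        using binomial_abs_norm[OF p, of i] \<beta> by (auto simp: prime_inv_def)
      then have "to_ac (\<beta> * of_nat (?q choose i)) \<in> alg_ints" by (simp only: algebraic_int_to_ac_iff)
      then show "?b * of_nat (?q choose i) \<in> alg_ints" by simp
    qed (use xi in auto)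
    have "?b ^ Suc M * (Y M ?c ^ ?q - (Y M a ^ (?q ^ n)) ^ ?q) \<in> alg_ints"
      using iwitt_values[OF YW c(1)] iwitt_values[OF YW a] Suc.IH by (intro alg_ints_power_diff) auto
    from alg_ints_closed(5)[OF A this]
    have "?b ^ Suc M * ((x (p \<odot> ?c) ^ (?q ^ M) - (x ?c ^ ?q) ^ (?q ^ M)) + (Y M ?c ^ ?q - (Y M a ^ (?q ^ n)) ^ ?q)) \<in> alg_ints"
      by (simp only: distrib_left)
    moreover have "(x (p \<odot> ?c) ^ (?q ^ M) - (x ?c ^ ?q) ^ (?q ^ M)) + (Y M ?c ^ ?q - (Y M a ^ (?q ^ n)) ^ ?q) =
      Y M (pw (Suc n) a) - Y M a ^ (?q ^ Suc n)"
      by (simp add: pwS Yv c a power_mult[symmetric] mult_ac)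
    ultimately show ?case by (simp only:)
  qed
  ultimately have top: "evper ?b (Suc M) nz_ideals (\<lambda>n a. Y M (pw n a))"
    by (rule evper_congruent)
  have "evper ?b (Suc M) nz_ideals (\<lambda>n a. Y (M - j) (pw n a))" if "j \<le> M" for j
    using that
  proof (induction j)
    case (Suc j)
    then have "Suc (M - Suc j) = M - j" by simp
    then show ?case using Suc step[of "M - Suc j"] by simp
  qed (use top in simp)
  from this[of M] have "evper ?b (Suc M) nz_ideals (\<lambda>n a. Y 0 (pw n a))" by simp
  then show ?case
    by (rule evper_congruent) (simp add: Yv nz pw_def[symmetric])
qed

lemma iwitt_psi_funpow:
  assumes p: "int_prime p" and x: "x \<in> carrier ghost" and a: "(a :: 'k::number_field set) \<in> nz_ideals"
  shows "(psi ghost p ^^ n) x a = x (((\<odot>) p ^^ n) a)"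
  using a
proof (induction n arbitrary: a)
  case (Suc n)
  have "(psi ghost p ^^ Suc n) x a = (psi ghost p ^^ n) x (p \<odot> a)"
    using Suc.prems by (simp add: ghost_ring_simps)
  also have "\<dots> = x (((\<odot>) p ^^ n) (p \<odot> a))" using Suc p by simp
  also have "((\<odot>) p ^^ n) (p \<odot> a) = ((\<odot>) p ^^ Suc n) a" by (simp only: funpow_Suc_right o_apply)
  finally show ?case .
qed simp

text \<open>M is chosen so large that values of \<open>x\<close> congruent modulo p^M are equal;
  uniform periodicity modulo p^M then is periodicity of the iterates themselves.\<close>

lemma iwitt_finite_prime_orbit:
  fixes x :: "'k::number_field set \<Rightarrow> 'k alg_closure"
  assumes p: "int_prime p" and x: "x \<in> iwitt"
  shows "finite (range (\<lambda>n. (psi ghost p ^^ n) x))"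
proof -
  let ?\<phi> = "psi ghost p"
  obtain \<beta> where \<beta>: "\<beta> \<in> prime_inv p" "\<beta> \<notin> alg_ints" by (rule prime_inv_not_integral[OF p])
  have V: "finite (x ` nz_ideals)" "x ` nz_ideals \<subseteq> alg_ints"
    using x iwitt_values[OF x] by (auto simp: iwitt_iff)
  obtain M where M: "\<And>u v. u \<in> x ` nz_ideals \<Longrightarrow> v \<in> x ` nz_ideals \<Longrightarrow> to_ac \<beta> ^ M * (u - v) \<in> alg_ints \<Longrightarrow> u = v"
    using nonintegral_separates[OF \<beta>(2) V] by blast
  obtain n0 f where nf: "f > 0" "\<forall>n\<ge>n0. \<forall>a\<in>nz_ideals. to_ac \<beta> ^ M * (x (((\<odot>) p ^^ (n + f)) a) - x (((\<odot>) p ^^ n) a)) \<in> alg_ints"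
    using iwitt_evper[OF p \<beta>(1) x, of M] unfolding evper_def by blast
  have nz: "((\<odot>) p ^^ n) a \<in> nz_ideals" if "a \<in> nz_ideals" for n a
    by (induction n) (use p that in auto)
  have xc: "x \<in> carrier ghost" using ghost.int_subalgD(1)[OF iwitt_int_subalg x] .
  have car: "(?\<phi> ^^ n) x \<in> carrier ghost" for n
    by (induction n) (use xc psi_ghost_closed[OF p] in auto)
  have per: "(?\<phi> ^^ (n + f)) x = (?\<phi> ^^ n) x" if n: "n \<ge> n0" for n
  proof (rule ghost_eqI[OF car car])
    fix a :: "'k set" assume a: "a \<in> nz_ideals"
    have "x (((\<odot>) p ^^ (n + f)) a) = x (((\<odot>) p ^^ n) a)"
      using nf(2) n a nz[OF a] by (intro M) auto
    then show "(?\<phi> ^^ (n + f)) x a = (?\<phi> ^^ n) x a" by (simp only: iwitt_psi_funpow[OF p xc a])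
  qed
  have "(?\<phi> ^^ n) x \<in> (\<lambda>n. (?\<phi> ^^ n) x) ` {..<n0 + f}" for n
  proof (induction n rule: less_induct)
    case (less n)
    show ?case
    proof (cases "n < n0 + f")
      case False
      then have "(?\<phi> ^^ n) x = (?\<phi> ^^ (n - f)) x" using per[of "n - f"] nf(1) by simp
      then show ?thesis using less[of "n - f"] False nf(1) by simp
    qed simp
  qed
  then have "range (\<lambda>n. (?\<phi> ^^ n) x) \<subseteq> (\<lambda>n. (?\<phi> ^^ n) x) ` {..<n0 + f}" by blast
  then show ?thesis by (rule finite_subset) simp
qed

section \<open>Finite orbits\<close>

lemma psi_ghost_commute:
  assumes "int_prime p" "int_prime q"
  shows "psi ghost p (psi ghost q x) = psi ghost q (psi ghost (p :: 'k::number_field set) x)"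
proof (rule ghost_eqI[of _ UNIV _ UNIV])
  fix a :: "'k set" assume a: "a \<in> nz_ideals"
  have ids: "int_ideal p" "int_ideal q" "int_ideal a" using assms a int_primeD(1) by (auto simp: nz_ideals_iff)
  have "q \<odot> (p \<odot> a) = p \<odot> (q \<odot> a)"
    using idl_prod_assoc[OF ids(2,1,3)] idl_prod_assoc[OF ids(1,2,3)] idl_prod_commute[OF ids(1,2)] by simp
  then show "psi ghost p (psi ghost q x) a = psi ghost q (psi ghost p x) a"
    using a assms by (simp add: ghost_ring_simps)
qed (auto simp: ghost_ring_simps)

lemma iwitt_finite_orbit_finite_primes:
  fixes x :: "'k::number_field set \<Rightarrow> 'k alg_closure"
  assumes "finite B" "\<And>p. p \<in> B \<Longrightarrow> int_prime p" "x \<in> iwitt"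
  shows "\<exists>Z. finite Z \<and> x \<in> Z \<and> Z \<subseteq> iwitt \<and> (\<forall>p\<in>B. \<forall>\<eta>\<in>Z. psi ghost p \<eta> \<in> Z)"
  using assms
proof (induction B)
  case empty
  then show ?case by (intro exI[of _ "{x}"]) auto
next
  case (insert p B)
  have p: "int_prime p" using insert.prems by simp
  let ?\<phi> = "psi ghost p"
  from insert.IH insert.prems obtain Z where Z: "finite Z" "x \<in> Z" "Z \<subseteq> iwitt" "\<forall>q\<in>B. \<forall>\<eta>\<in>Z. psi ghost q \<eta> \<in> Z"
    by (metis insertI2)
  define Z' where "Z' = (\<Union>\<eta>\<in>Z. range (\<lambda>n. (?\<phi> ^^ n) \<eta>))"
  have mem: "(?\<phi> ^^ n) \<eta> \<in> Z'" if "\<eta> \<in> Z" for n \<eta> using that unfolding Z'_def by blast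
  have W: "(?\<phi> ^^ n) \<eta> \<in> iwitt" if "\<eta> \<in> Z" for n \<eta>
    by (induction n) (use that Z(3) iwitt_psi[OF p] in auto)
  have comm: "psi ghost q ((?\<phi> ^^ n) \<eta>) = (?\<phi> ^^ n) (psi ghost q \<eta>)" if "int_prime q" for q n \<eta>
    by (induction n) (use psi_ghost_commute[OF that p] in auto)
  show ?case
  proof (intro exI[of _ Z'] conjI ballI)
    show "finite Z'" unfolding Z'_def using Z(1,3) iwitt_finite_prime_orbit[OF p] by auto
    show "x \<in> Z'" using mem[OF Z(2), of 0] by simp
    show "Z' \<subseteq> iwitt" using W unfolding Z'_def by blast
    fix q \<eta>' assume q: "q \<in> insert p B" and "\<eta>' \<in> Z'"
    then obtain n \<eta> where \<eta>: "\<eta> \<in> Z" "\<eta>' = (?\<phi> ^^ n) \<eta>" unfolding Z'_def by blast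
    show "psi ghost q \<eta>' \<in> Z'"
    proof (cases "q = p")
      case True
      then show ?thesis using mem[OF \<eta>(1), of "Suc n"] \<eta>(2) by simp
    next
      case False
      then have "psi ghost q \<eta> \<in> Z" using q Z(4) \<eta>(1) by blast
      then show ?thesis using mem[of "psi ghost q \<eta>" n] comm[of q] q insert.prems \<eta>(2) by simp
    qed
  qed
qed

lemma finite_primes_containing_nat:
  assumes "n > 0"
  shows "finite {p :: 'k::number_field set. int_prime p \<and> of_nat n \<in> p}"
proof -
  define I where "I = {of_nat n * x | x :: 'k. x \<in> alg_ints}"
  have I: "int_ideal I"
    unfolding int_ideal_def I_def
  proof (safe, goal_cases)
    case 2 show ?case by (intro exI[of _ 0]) auto
  next
    case (3 _ _ r s) then show ?case by (intro exI[of _ "r + s"]) (auto simp: algebra_simps)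
  next
    case (4 s _ r) then show ?case by (intro exI[of _ "s * r"]) (auto simp: algebra_simps)
  qed auto
  have "of_nat n \<in> I" unfolding I_def by (rule CollectI, rule exI[of _ 1]) simp
  then have "I \<noteq> {0}" using assms by auto
  then have "finite {J. int_ideal J \<and> I \<subseteq> J}" by (rule finite_ideals_above[OF I])
  moreover have "{p. int_prime p \<and> of_nat n \<in> p} \<subseteq> {J. int_ideal J \<and> I \<subseteq> J}"
    using int_primeD(1) int_idealD(5) by (auto simp: I_def)
  ultimately show ?thesis by (rule finite_subset[rotated])
qed

text \<open>The condition on \<open>p\<close> expresses \<open>\<delta> \<equiv> 0\<close> modulo \<open>p\<close> without reference to primes above \<open>p\<close>.\<close>

lemma finite_bad_primes:
  assumes \<delta>: "(\<delta> :: 'k::number_field alg_closure) \<in> alg_ints" "\<delta> \<noteq> 0"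
  shows "finite {p :: 'k set. int_prime p \<and> (\<forall>\<beta>\<in>prime_inv p. to_ac \<beta> * \<delta> \<in> alg_ints)}"
proof -
  obtain n :: nat and y where n: "n > 0" "algebraic_int y" "of_nat n = \<delta> * y"
    using algebraic_int_divisor_nat[of \<delta>] \<delta> by (auto simp: alg_ints_def)
  have "of_nat n \<in> p" if p: "int_prime p" and *: "\<forall>\<beta>\<in>prime_inv p. to_ac \<beta> * \<delta> \<in> alg_ints" for p :: "'k set"
  proof -
    have b: "\<beta> * of_nat n \<in> alg_ints" if "\<beta> \<in> prime_inv p" for \<beta>
    proof -
      have "to_ac (\<beta> * of_nat n) = (to_ac \<beta> * \<delta>) * y" using n(3) by simp
      also have "\<dots> \<in> alg_ints" by (rule alg_ints_closed(7)) (use * that n(2) in \<open>auto simp: alg_ints_def\<close>)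
      finally show ?thesis by (simp only: algebraic_int_to_ac_iff)
    qed
    obtain A \<alpha> \<beta> where A: "finite A" "\<And>i. i \<in> A \<Longrightarrow> \<alpha> i \<in> p" "\<And>i. i \<in> A \<Longrightarrow> \<beta> i \<in> prime_inv p"
      "1 = (\<Sum>i\<in>(A :: nat set). \<alpha> i * \<beta> i)" using prime_invertible_decomposition[OF p] by blast
    have "of_nat n = (\<Sum>i\<in>A. \<alpha> i * \<beta> i) * of_nat n" unfolding A(4)[symmetric] by simp
    also have "\<dots> = (\<Sum>i\<in>A. \<alpha> i * (\<beta> i * of_nat n))" by (simp add: sum_distrib_right mult.assoc)
    also have "\<dots> \<in> p"
      using A b by (intro int_ideal_sum[OF int_primeD(1)[OF p]] int_idealD(5)[OF int_primeD(1)[OF p]]) auto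
    finally show ?thesis .
  qed
  then have "{p :: 'k set. int_prime p \<and> (\<forall>\<beta>\<in>prime_inv p. to_ac \<beta> * \<delta> \<in> alg_ints)} \<subseteq> {p. int_prime p \<and> of_nat n \<in> p}"
    by blast
  then show ?thesis using finite_primes_containing_nat[OF n(1)] by (rule finite_subset)
qed

text \<open>The stable set consists of composites F \<circ> \<eta>, with F a map of the finite value
  set \<open>V\<close> to itself and \<eta> a translate of \<open>x\<close> from a finite set stable
  under the bad primes. A bad \<psi>_p moves \<eta>; a good one acts through a map g of the values
  and replaces F by F \<circ> g. Composites need not be Witt vectors, so the conclusion places them
  in the ghost ring only.\<close>

theorem iwitt_finite_orbit:
  fixes x :: "'k::number_field set \<Rightarrow> 'k alg_closure"
  assumes x: "x \<in> iwitt"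
  shows "\<exists>Z. finite Z \<and> x \<in> Z \<and> Z \<subseteq> carrier ghost \<and> (\<forall>\<eta>\<in>Z. finite (\<eta> ` nz_ideals)) \<and>
    (\<forall>p. int_prime p \<longrightarrow> (\<forall>\<eta>\<in>Z. psi ghost p \<eta> \<in> Z))"
proof -
  define V where "V = x ` nz_ideals"
  have V: "finite V" "V \<subseteq> alg_ints" using x iwitt_values[OF x] by (auto simp: V_def iwitt_iff)
  define Bad where "Bad = (\<Union>\<delta>\<in>(\<lambda>(u, v). u - v) ` (V \<times> V) - {0}.
    {p :: 'k set. int_prime p \<and> (\<forall>\<beta>\<in>prime_inv p. to_ac \<beta> * \<delta> \<in> alg_ints)})"
  have Bad: "finite Bad"
    unfolding Bad_def using V by (intro finite_UN_I finite_bad_primes) auto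
  \<comment> \<open>Both sides are congruent modulo p to the same N-th power, and at a good prime
    distinct values are incongruent.\<close>
  have good: "x (p \<odot> a) = x (p \<odot> a')"
    if p: "int_prime p" "p \<notin> Bad" and a: "a \<in> nz_ideals" "a' \<in> nz_ideals" "x a = x a'" for p a a'
  proof (rule ccontr)
    assume ne: "x (p \<odot> a) \<noteq> x (p \<odot> a')"
    have "to_ac \<beta> * (x (p \<odot> a) - x (p \<odot> a')) \<in> alg_ints" if \<beta>: "\<beta> \<in> prime_inv p" for \<beta>
      using alg_ints_closed(6)[OF iwitt_frobenius_value[OF p(1) x \<beta> a(1)] iwitt_frobenius_value[OF p(1) x \<beta> a(2)]] a(3)
      by (simp add: algebra_simps)
    moreover have "x (p \<odot> a) - x (p \<odot> a') \<in> (\<lambda>(u, v). u - v) ` (V \<times> V) - {0}"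
      using ne a p by (auto simp: V_def)
    ultimately show False using p unfolding Bad_def by blast
  qed
  obtain Z0 where Z0: "finite Z0" "x \<in> Z0" "Z0 \<subseteq> iwitt" "\<forall>p\<in>Bad. \<forall>\<eta>\<in>Z0. psi ghost p \<eta> \<in> Z0"
    using iwitt_finite_orbit_finite_primes[OF Bad _ x] by (auto simp: Bad_def)
  \<comment> \<open>Being a translate of \<open>x\<close> is recorded because the values of such an
    \<eta> are values of \<open>x\<close> at other ideals, where g describes a good
    \<psi>_p.\<close>
  define Orb where "Orb = (\<lambda>c. psi ghost c x) ` nz_ideals"
  have xc: "x \<in> carrier ghost" using ghost.int_subalgD(1)[OF iwitt_int_subalg x] .
  have psi_psi: "psi ghost p (psi ghost c x) = psi ghost (p \<odot> c) x" if "int_prime p" "c \<in> nz_ideals" for p c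
  proof (rule ghost_eqI[of _ UNIV _ UNIV])
    fix a :: "'k set" assume a: "a \<in> nz_ideals"
    have ids: "int_ideal p" "int_ideal c" "int_ideal a" using that a int_primeD(1) by (auto simp: nz_ideals_iff)
    have "c \<odot> (p \<odot> a) = (p \<odot> c) \<odot> a"
      using idl_prod_assoc[OF ids(2,1,3)] idl_prod_commute[OF ids(1,2)] by simp
    then show "psi ghost p (psi ghost c x) a = psi ghost (p \<odot> c) x a"
      using a that by (simp add: ghost_ring_simps)
  qed (auto simp: ghost_ring_simps)
  define Z where "Z = (\<lambda>(F, \<eta>). \<lambda>a\<in>nz_ideals. F (\<eta> a)) ` ((V \<rightarrow>\<^sub>E V) \<times> (Z0 \<inter> Orb))"
  have mem: "(\<lambda>a\<in>nz_ideals. F (\<eta> a)) \<in> Z" if "F \<in> V \<rightarrow>\<^sub>E V" "\<eta> \<in> Z0" "\<eta> \<in> Orb" for F \<eta>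
    unfolding Z_def using that by (intro image_eqI[of _ _ "(F, \<eta>)"]) auto
  have OrbV: "\<eta> a \<in> V" if "\<eta> \<in> Orb" "a \<in> nz_ideals" for \<eta> a
    using that nz_ideals_prod[OF _ that(2)] by (auto simp: Orb_def V_def ghost_ring_simps intro!: imageI)
  have x1: "psi ghost alg_ints x = x"
  proof (rule ghost_eqI[of _ UNIV, OF _ xc])
    fix a :: "'k set" assume a: "a \<in> nz_ideals"
    then show "psi ghost alg_ints x a = x a" using idl_prod_unit[of a a] by (simp add: ghost_ring_simps nz_ideals_iff)
  qed (auto simp: ghost_ring_simps)
  show ?thesis
  proof (intro exI[of _ Z] conjI ballI allI impI)
    show "finite Z" unfolding Z_def using V Z0(1) by (auto intro!: finite_PiE)
    have xO: "x \<in> Orb" unfolding Orb_def by (rule image_eqI[of _ _ alg_ints]) (use x1 in auto)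
    have "(\<lambda>a\<in>nz_ideals. (\<lambda>v\<in>V. v) (x a)) \<in> Z" using mem[OF _ Z0(2) xO, of "\<lambda>v\<in>V. v"] by auto
    also have "(\<lambda>a\<in>nz_ideals. (\<lambda>v\<in>V. v) (x a)) = x"
      by (rule ghost_eqI[of _ UNIV, OF _ xc]) (auto simp: ghost_ring_simps V_def)
    finally show "x \<in> Z" .
    show "Z \<subseteq> carrier ghost" by (auto simp: Z_def ghost_ring_simps restrict_apply)
    fix \<zeta> assume "\<zeta> \<in> Z"
    then obtain F \<eta> where F: "F \<in> V \<rightarrow>\<^sub>E V" and \<eta>: "\<eta> \<in> Z0" "\<eta> \<in> Orb" and \<zeta>: "\<zeta> = (\<lambda>a\<in>nz_ideals. F (\<eta> a))"
      unfolding Z_def by auto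
    have "\<zeta> ` nz_ideals \<subseteq> V" using F OrbV[OF \<eta>(2)] by (auto simp: \<zeta> dest: PiE_mem)
    then show "finite (\<zeta> ` nz_ideals)" using V(1) by (rule finite_subset)
    fix p :: "'k set" assume p: "int_prime p"
    obtain c where c: "c \<in> nz_ideals" "\<eta> = psi ghost c x" using \<eta>(2) unfolding Orb_def by blast
    have eq: "psi ghost p \<zeta> = (\<lambda>a\<in>nz_ideals. F (psi ghost p \<eta> a))"
      using p by (auto simp: \<zeta> ghost_ring_simps intro!: restrict_ext)
    have pO: "psi ghost p \<eta> \<in> Orb" unfolding c(2) psi_psi[OF p c(1)] Orb_def using c(1) p by blast
    show "psi ghost p \<zeta> \<in> Z"
    proof (cases "p \<in> Bad")
      case True
      then show ?thesis unfolding eq using mem[OF F _ pO] Z0(4) \<eta>(1) by blast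
    next
      case False
      \<comment> \<open>The map that \<psi>_p induces on the values of \<open>x\<close>, well
        defined by \<open>good\<close>.\<close>
      define g where "g v = x (p \<odot> (SOME a. a \<in> nz_ideals \<and> x a = v))" for v
      have g: "g (x a) = x (p \<odot> a)" if a: "a \<in> nz_ideals" for a
      proof -
        have "\<exists>a'. a' \<in> nz_ideals \<and> x a' = x a" using a by blast
        then have "(SOME a'. a' \<in> nz_ideals \<and> x a' = x a) \<in> nz_ideals \<and> x (SOME a'. a' \<in> nz_ideals \<and> x a' = x a) = x a"
          by (rule someI_ex)
        then show ?thesis unfolding g_def using good[OF p False _ a] by blast
      qed
      define G where "G = (\<lambda>v\<in>V. F (g v))"
      have gV: "g v \<in> V" if "v \<in> V" for v
        using that g p unfolding V_def by auto
      have GE: "G \<in> V \<rightarrow>\<^sub>E V" unfolding G_def using gV F by (auto dest: PiE_mem)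
      have "psi ghost p \<zeta> = (\<lambda>a\<in>nz_ideals. G (\<eta> a))"
        unfolding eq
      proof (rule restrict_ext)
        fix a :: "'k set" assume a: "a \<in> nz_ideals"
        have ids: "int_ideal p" "int_ideal c" "int_ideal a" using p c(1) a int_primeD(1) by (auto simp: nz_ideals_iff)
        have e1: "c \<odot> (p \<odot> a) = p \<odot> (c \<odot> a)"
          using idl_prod_assoc[OF ids(2,1,3)] idl_prod_assoc[OF ids(1,2,3)] idl_prod_commute[OF ids(1,2)] by simp
        have ca: "c \<odot> a \<in> nz_ideals" using nz_ideals_prod[OF c(1) a] .
        have "psi ghost p \<eta> a = x (p \<odot> (c \<odot> a))" using a p by (simp add: c(2) ghost_ring_simps e1)
        also have "\<dots> = g (\<eta> a)" using g[OF ca] a by (simp add: c(2) ghost_ring_simps)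
        finally show "F (psi ghost p \<eta> a) = G (\<eta> a)" using OrbV[OF \<eta>(2) a] by (simp add: G_def)
      qed
      then show ?thesis using mem[OF GE \<eta>] by simp
    qed
  qed
qed

section \<open>Extension of scalars as a localization\<close>

context k_algebra
begin

definition tensor_val :: "('k \<times> 'u) list \<Rightarrow> 'u" where
  "tensor_val l = foldr (\<lambda>(k, x) s. (scal E k \<otimes> x) \<oplus> s) l \<zero>"

text \<open>The image of K \<otimes> A in \<open>E\<close>: every element of K has an integral
  multiple by a positive integer, so positive integers suffice as denominators.\<close>

definition saturation :: "'u set \<Rightarrow> 'u set" where
  "saturation A = {x \<in> carrier E. \<exists>n>0. scal E (of_nat n) \<otimes> x \<in> A}"

abbreviation restr :: "'u set \<Rightarrow> ('k, 'u) lring" where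
  "restr A \<equiv> E\<lparr>carrier := A\<rparr>"

context
  fixes A :: "'u set"
  assumes A: "int_subalg A"
begin

lemmas AD = int_subalgD[OF A]

lemma tensor_val_simps [simp]:
  "tensor_val [] = \<zero>" "tensor_val ((k, x) # l) = (scal E k \<otimes> x) \<oplus> tensor_val l"
  by (simp_all add: tensor_val_def)

lemma tensor_val_closed [simp]: "set l \<subseteq> UNIV \<times> A \<Longrightarrow> tensor_val l \<in> carrier E"
  by (induction l) (auto dest: AD(1))

lemma tensor_val_append: "set l \<subseteq> UNIV \<times> A \<Longrightarrow> set m \<subseteq> UNIV \<times> A \<Longrightarrow> tensor_val (l @ m) = tensor_val l \<oplus> tensor_val m"
  by (induction l) (auto dest: AD(1) simp: a_assoc)

lemma tensor_rel_sound:
  "(l, m) \<in> tensor_rel (restr A) \<Longrightarrow> set l \<subseteq> UNIV \<times> A \<and> set m \<subseteq> UNIV \<times> A \<and> tensor_val l = tensor_val m"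
proof (induction rule: tensor_rel.induct)
  case (append l l' m m')
  then show ?case by (simp add: tensor_val_append)
next
  case (commute l m)
  then show ?case by (simp add: tensor_val_append a_comm)
next
  case (zero x)
  then show ?case using AD(1) by simp
next
  case (add_left x k k')
  then show ?case using AD(1) by (simp add: l_distr)
next
  case (add_right x y k)
  then show ?case using AD(1,3) by (simp add: r_distr)
next
  case (balance x r k)
  then have "r \<in> alg_ints" by (simp add: alg_ints_def)
  then show ?case using balance AD(1,2,4) by (simp add: m_assoc)
qed auto

lemma tensor_rel_intros_restr:
  "x \<in> A \<Longrightarrow> r \<in> alg_ints \<Longrightarrow> ([(k * r, x)], [(k, scal E r \<otimes> x)]) \<in> tensor_rel (restr A)"
  "x \<in> A \<Longrightarrow> y \<in> A \<Longrightarrow> ([(k, x), (k, y)], [(k, x \<oplus> y)]) \<in> tensor_rel (restr A)"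
  using tensor_rel.balance[of x "restr A" r k] tensor_rel.add_right[of x "restr A" y k, THEN tensor_rel.sym]
  by (auto simp: alg_ints_def)

lemma tensor_rel_clear_denominator:
  assumes "m > 0" "x \<in> A" "of_nat m * k \<in> alg_ints"
  shows "([(k, x)], [(1 / of_nat m, scal E (of_nat m * k) \<otimes> x)]) \<in> tensor_rel (restr A)"
proof -
  have "(1 / of_nat m) * (of_nat m * k) = k" using assms(1) by simp
  then show ?thesis using tensor_rel_intros_restr(1)[OF assms(2,3), of "1 / of_nat m"] by (simp only:)
qed

text \<open>A pure tensor becomes (1/m) \<otimes> x' by moving an integral multiple of its scalar to
  the right factor; two such tensors are added over the common denominator m n.\<close>

lemma tensor_rel_normal_form:
  "set l \<subseteq> UNIV \<times> A \<Longrightarrow> \<exists>n>0. \<exists>w\<in>A. (l, [(1 / of_nat n, w)]) \<in> tensor_rel (restr A)"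
proof (induction l)
  case Nil
  have "([(0, \<zero>)], []) \<in> tensor_rel (restr A)"
    using tensor_rel.zero[of "\<zero>" "restr A"] AD(5) by simp
  moreover have "([(0, \<zero>)], [(1 / of_nat 1, scal E (of_nat 1 * 0) \<otimes> \<zero>)]) \<in> tensor_rel (restr A)"
    by (rule tensor_rel_clear_denominator) (use AD(5) in auto)
  ultimately have "([], [(1 / of_nat 1, scal E (of_nat 1 * 0) \<otimes> \<zero>)]) \<in> tensor_rel (restr A)"
    by (blast intro: tensor_rel.sym tensor_rel.trans)
  moreover have "scal E (of_nat 1 * 0) \<otimes> \<zero> \<in> A" using AD(5) by simp
  ultimately show ?case by (intro exI[of _ 1] conjI bexI) auto
next
  case (Cons p l)
  obtain k x where p: "p = (k, x)" by (cases p)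
  have x: "x \<in> A" using Cons.prems p by simp
  from Cons obtain n w where n: "n > 0" "w \<in> A" "(l, [(1 / of_nat n, w)]) \<in> tensor_rel (restr A)" by auto
  obtain m :: nat where m: "m > 0" "of_nat m * k \<in> alg_ints" by (rule number_field_integer_multiple)
  define x' where "x' = scal E (of_nat m * k) \<otimes> x"
  have x': "x' \<in> A" unfolding x'_def by (rule AD(4)[OF AD(2)[OF m(2)] x])
  let ?d = "1 / of_nat (m * n) :: 'k"
  have n': "(of_nat n :: 'k) \<in> alg_ints" "(of_nat m :: 'k) \<in> alg_ints" by auto
  have e1: "?d * of_nat n = 1 / of_nat m" and e2: "?d * of_nat m = 1 / of_nat n" using n(1) m(1) by (auto simp: field_simps)
  have r1: "([(1 / of_nat m, x')], [(?d, scal E (of_nat n) \<otimes> x')]) \<in> tensor_rel (restr A)"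
    using tensor_rel_intros_restr(1)[OF x' n'(1), of ?d] unfolding e1 .
  have r2: "([(1 / of_nat n, w)], [(?d, scal E (of_nat m) \<otimes> w)]) \<in> tensor_rel (restr A)"
    using tensor_rel_intros_restr(1)[OF n(2) n'(2), of ?d] unfolding e2 .
  have r0: "([(k, x)], [(1 / of_nat m, x')]) \<in> tensor_rel (restr A)"
    unfolding x'_def by (rule tensor_rel_clear_denominator[OF m(1) x m(2)])
  have "([(k, x)] @ l, [(?d, scal E (of_nat n) \<otimes> x')] @ [(?d, scal E (of_nat m) \<otimes> w)]) \<in> tensor_rel (restr A)"
    by (intro tensor_rel.append tensor_rel.trans[OF r0 r1] tensor_rel.trans[OF n(3) r2])
  moreover have mem: "scal E (of_nat n) \<otimes> x' \<in> A" "scal E (of_nat m) \<otimes> w \<in> A"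
    using AD(4)[OF AD(2)[OF n'(1)] x'] AD(4)[OF AD(2)[OF n'(2)] n(2)] by auto
  moreover note tensor_rel_intros_restr(2)[OF mem, of ?d]
  ultimately have "(p # l, [(?d, scal E (of_nat n) \<otimes> x' \<oplus> scal E (of_nat m) \<otimes> w)]) \<in> tensor_rel (restr A)"
    by (auto simp: p intro: tensor_rel.trans)
  moreover have "scal E (of_nat n) \<otimes> x' \<oplus> scal E (of_nat m) \<otimes> w \<in> A" using AD(3)[OF mem] .
  moreover have "m * n > 0" using m(1) n(1) by simp
  ultimately show ?case by blast
qed

text \<open>Injectivity of the multiplication map from K \<otimes> A to \<open>E\<close>: normal
  forms over a common denominator with equal values have equal numerators, since nonzero scalars act
  injectively on \<open>E\<close>.\<close>

lemma tensor_rel_iff: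
  "(l, m) \<in> tensor_rel (restr A) \<longleftrightarrow> set l \<subseteq> UNIV \<times> A \<and> set m \<subseteq> UNIV \<times> A \<and> tensor_val l = tensor_val m"
proof
  assume lm: "set l \<subseteq> UNIV \<times> A \<and> set m \<subseteq> UNIV \<times> A \<and> tensor_val l = tensor_val m"
  obtain n w where n: "n > 0" "w \<in> A" "(l, [(1 / of_nat n, w)]) \<in> tensor_rel (restr A)"
    using tensor_rel_normal_form lm by blast
  obtain n' w' where n': "n' > 0" "w' \<in> A" "(m, [(1 / of_nat n', w')]) \<in> tensor_rel (restr A)"
    using tensor_rel_normal_form lm by blast
  let ?d = "1 / of_nat (n * n') :: 'k"
  have ni: "(of_nat n :: 'k) \<in> alg_ints" "(of_nat n' :: 'k) \<in> alg_ints" by auto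
  have e: "?d * of_nat n' = 1 / of_nat n" "?d * of_nat n = 1 / of_nat n'" using n(1) n'(1) by (auto simp: field_simps)
  have "([(1 / of_nat n, w)], [(?d, scal E (of_nat n') \<otimes> w)]) \<in> tensor_rel (restr A)"
    using tensor_rel_intros_restr(1)[OF n(2) ni(2), of ?d] unfolding e .
  then have l: "(l, [(?d, scal E (of_nat n') \<otimes> w)]) \<in> tensor_rel (restr A)" by (rule tensor_rel.trans[OF n(3)])
  have "([(1 / of_nat n', w')], [(?d, scal E (of_nat n) \<otimes> w')]) \<in> tensor_rel (restr A)"
    using tensor_rel_intros_restr(1)[OF n'(2) ni(1), of ?d] unfolding e .
  then have m: "(m, [(?d, scal E (of_nat n) \<otimes> w')]) \<in> tensor_rel (restr A)" by (rule tensor_rel.trans[OF n'(3)])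
  have mem: "scal E (of_nat n') \<otimes> w \<in> carrier E" "scal E (of_nat n) \<otimes> w' \<in> carrier E" using n(2) n'(2) AD(1) by auto
  have "scal E ?d \<otimes> (scal E (of_nat n') \<otimes> w) = scal E ?d \<otimes> (scal E (of_nat n) \<otimes> w')"
    using tensor_rel_sound[OF l] tensor_rel_sound[OF m] lm mem by simp
  moreover have "?d \<noteq> 0" using n(1) n'(1) by simp
  ultimately have "scal E (of_nat n') \<otimes> w = scal E (of_nat n) \<otimes> w'" using scal_cancel[of ?d] mem by blast
  then show "(l, m) \<in> tensor_rel (restr A)" using l m by (metis tensor_rel.sym tensor_rel.trans)
qed (rule tensor_rel_sound)

lemma tensor_val_image: "tensor_val ` {l. set l \<subseteq> UNIV \<times> A} = saturation A"
proof
  show "tensor_val ` {l. set l \<subseteq> UNIV \<times> A} \<subseteq> saturation A"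
  proof safe
    fix l :: "('k \<times> 'u) list" assume l: "set l \<subseteq> UNIV \<times> A"
    obtain n w where n: "n > 0" "w \<in> A" "(l, [(1 / of_nat n, w)]) \<in> tensor_rel (restr A)"
      using tensor_rel_normal_form[OF l] by blast
    have "tensor_val l = scal E (1 / of_nat n) \<otimes> w"
      using tensor_rel_sound[OF n(3)] AD(1)[OF n(2)] by simp
    moreover have "inverse (1 / of_nat n) = (of_nat n :: 'k)" by simp
    ultimately have "scal E (of_nat n) \<otimes> tensor_val l = w"
      using scal_inverse[of "1 / of_nat n" w] n(1) AD(1)[OF n(2)] by simp
    then show "tensor_val l \<in> saturation A" unfolding saturation_def using n(1,2) l by auto
  qed
  show "saturation A \<subseteq> tensor_val ` {l. set l \<subseteq> UNIV \<times> A}"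
  proof
    fix x assume "x \<in> saturation A"
    then obtain n where n: "x \<in> carrier E" "n > 0" "scal E (of_nat n) \<otimes> x \<in> A" unfolding saturation_def by blast
    show "x \<in> tensor_val ` {l. set l \<subseteq> UNIV \<times> A}"
    proof (rule image_eqI)
      show "x = tensor_val [(inverse (of_nat n), scal E (of_nat n) \<otimes> x)]"
        using scal_inverse[of "of_nat n" x] n by simp
    qed (use n(3) in auto)
  qed
qed

text \<open>By \<open>tensor_rel_iff\<close> these are the classes that make up the base change,
  indexed by their values. The base change is thus identified with
  \<open>saturation A\<close>.\<close>

definition tcls :: "'u \<Rightarrow> ('k \<times> 'u) list set" where
  "tcls v = {l. set l \<subseteq> UNIV \<times> A \<and> tensor_val l = v}"

lemma tensor_rel_class: "set l \<subseteq> UNIV \<times> A \<Longrightarrow> tensor_rel (restr A) `` {l} = tcls (tensor_val l)"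
  by (auto simp: tensor_rel_iff tcls_def)

lemma base_change_carrier: "carrier (base_change (restr A)) = tcls ` saturation A"
proof -
  have "carrier (base_change (restr A)) = (\<lambda>l. tensor_rel (restr A) `` {l}) ` {l. set l \<subseteq> UNIV \<times> A}"
    by (auto simp: base_change_def quotient_def)
  also have "\<dots> = (\<lambda>l. tcls (tensor_val l)) ` {l. set l \<subseteq> UNIV \<times> A}"
    by (rule image_cong) (auto simp: tensor_rel_class)
  also have "\<dots> = tcls ` tensor_val ` {l. set l \<subseteq> UNIV \<times> A}" by (simp add: image_image)
  finally show ?thesis by (simp add: tensor_val_image)
qed

lemma tcls_nonempty: "v \<in> saturation A \<Longrightarrow> \<exists>l. l \<in> tcls v"
  unfolding tensor_val_image[symmetric] tcls_def by auto

lemma scalar_mult_map_tcls: "v \<in> saturation A \<Longrightarrow> scalar_mult_map E (tcls v) = v"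
proof -
  assume "v \<in> saturation A"
  then have "tensor_val ` tcls v = {v}" using tcls_nonempty[of v] by (auto simp: tcls_def)
  then show ?thesis unfolding scalar_mult_map_def tensor_val_def[abs_def] by simp
qed

lemma scalar_mult_map_bij: "bij_betw (scalar_mult_map E) (carrier (base_change (restr A))) (saturation A)"
  unfolding base_change_carrier
  by (rule bij_betw_byWitness[of _ tcls]) (auto simp: scalar_mult_map_tcls)

lemma tcls_UN:
  assumes "v \<in> saturation A" "\<And>l. l \<in> tcls v \<Longrightarrow> f l = C"
  shows "(\<Union>l\<in>tcls v. f l) = C"
  using assms tcls_nonempty[OF assms(1)] by auto

lemma tcls_add:
  assumes v: "v \<in> saturation A" and w: "w \<in> saturation A"
  shows "tcls v \<oplus>\<^bsub>base_change (restr A)\<^esub> tcls w = tcls (v \<oplus> w)"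
proof -
  have "tcls v \<oplus>\<^bsub>base_change (restr A)\<^esub> tcls w = (\<Union>l\<in>tcls v. \<Union>m\<in>tcls w. tensor_rel (restr A) `` {l @ m})"
    by (simp add: base_change_def)
  also have "\<dots> = tcls (v \<oplus> w)"
    by (intro tcls_UN v w, subst tensor_rel_class) (auto simp: tcls_def tensor_val_append)
  finally show ?thesis .
qed

lemma tensor_val_scale:
  "set m \<subseteq> UNIV \<times> A \<Longrightarrow> x \<in> A \<Longrightarrow>
    tensor_val [(k * k', x \<otimes> y). (k', y) \<leftarrow> m] = (scal E k \<otimes> x) \<otimes> tensor_val m"
proof (induction m)
  case (Cons p m)
  obtain k' y where p: "p = (k', y)" by (cases p)
  have c: "x \<in> carrier E" "y \<in> carrier E" using Cons.prems p AD(1) by auto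
  have tm: "tensor_val m \<in> carrier E" using Cons.prems by simp
  have "scal E (k * k') \<otimes> (x \<otimes> y) = (scal E k \<otimes> x) \<otimes> (scal E k' \<otimes> y)" using c by (simp add: m_ac)
  then show ?case using Cons p c tm by (simp add: r_distr)
qed (use AD(1) in simp)

lemma tensor_val_mult:
  "set l \<subseteq> UNIV \<times> A \<Longrightarrow> set m \<subseteq> UNIV \<times> A \<Longrightarrow>
    set [(k * k', x \<otimes> y). (k, x) \<leftarrow> l, (k', y) \<leftarrow> m] \<subseteq> UNIV \<times> A \<and>
    tensor_val [(k * k', x \<otimes> y). (k, x) \<leftarrow> l, (k', y) \<leftarrow> m] = tensor_val l \<otimes> tensor_val m"
proof (induction l)
  case (Cons p l)
  obtain k x where p: "p = (k, x)" by (cases p)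
  have x: "x \<in> A" using Cons.prems p by auto
  have s: "set [(k * k', x \<otimes> y). (k', y) \<leftarrow> m] \<subseteq> UNIV \<times> A" using Cons.prems x AD(4) by auto
  have c: "x \<in> carrier E" "tensor_val l \<in> carrier E" "tensor_val m \<in> carrier E" using x AD(1) Cons.prems by auto
  have IH: "set [(k * k', x \<otimes> y). (k, x) \<leftarrow> l, (k', y) \<leftarrow> m] \<subseteq> UNIV \<times> A"
    "tensor_val [(k * k', x \<otimes> y). (k, x) \<leftarrow> l, (k', y) \<leftarrow> m] = tensor_val l \<otimes> tensor_val m"
    using Cons by auto
  show ?case
    using s IH c tensor_val_scale[OF Cons.prems(2) x, of k] unfolding p
    by (simp add: tensor_val_append l_distr)
qed simp

lemma tcls_mult:
  assumes v: "v \<in> saturation A" and w: "w \<in> saturation A"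
  shows "tcls v \<otimes>\<^bsub>base_change (restr A)\<^esub> tcls w = tcls (v \<otimes> w)"
proof -
  have "tcls v \<otimes>\<^bsub>base_change (restr A)\<^esub> tcls w =
    (\<Union>l\<in>tcls v. \<Union>m\<in>tcls w. tensor_rel (restr A) `` {[(k * k', x \<otimes> y). (k, x) \<leftarrow> l, (k', y) \<leftarrow> m]})"
    by (simp add: base_change_def)
  also have "\<dots> = tcls (v \<otimes> w)"
  proof (intro tcls_UN v w)
    fix l m assume "l \<in> tcls v" "m \<in> tcls w"
    then show "tensor_rel (restr A) `` {[(k * k', x \<otimes> y). (k, x) \<leftarrow> l, (k', y) \<leftarrow> m]} = tcls (v \<otimes> w)"
      using tensor_val_mult[of l m] by (subst tensor_rel_class) (auto simp: tcls_def)
  qed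
  finally show ?thesis .
qed

lemma tcls_scal: "scal (base_change (restr A)) k = tcls (scal E k)"
  "\<one>\<^bsub>base_change (restr A)\<^esub> = tcls \<one>"
  using tensor_rel_class[of "[(k, \<one>)]"] tensor_rel_class[of "[(1, \<one>)]"] AD(6) by (simp_all add: base_change_def)

lemma tcls_psi:
  assumes hom: "\<And>x y. x \<in> carrier E \<Longrightarrow> y \<in> carrier E \<Longrightarrow> psi E p (x \<oplus> y) = psi E p x \<oplus> psi E p y"
      "\<And>x k. x \<in> carrier E \<Longrightarrow> psi E p (scal E k \<otimes> x) = scal E k \<otimes> psi E p x"
      "\<And>x. x \<in> A \<Longrightarrow> psi E p x \<in> A" "psi E p \<zero> = \<zero>"
    and v: "v \<in> saturation A"
  shows "psi (base_change (restr A)) p (tcls v) = tcls (psi E p v)"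
proof -
  have val: "set [(k, psi E p x). (k, x) \<leftarrow> l] \<subseteq> UNIV \<times> A \<and> tensor_val [(k, psi E p x). (k, x) \<leftarrow> l] = psi E p (tensor_val l)"
    if "set l \<subseteq> UNIV \<times> A" for l
    using that
  proof (induction l)
    case (Cons q l)
    obtain k x where q: "q = (k, x)" by (cases q)
    then show ?case using Cons hom AD(1) by (auto simp: q)
  qed (simp add: hom(4))
  have "psi (base_change (restr A)) p (tcls v) = (\<Union>l\<in>tcls v. tensor_rel (restr A) `` {[(k, psi E p x). (k, x) \<leftarrow> l]})"
    by (simp add: base_change_def)
  also have "\<dots> = tcls (psi E p v)"
  proof (intro tcls_UN v)
    fix l assume "l \<in> tcls v"
    then show "tensor_rel (restr A) `` {[(k, psi E p x). (k, x) \<leftarrow> l]} = tcls (psi E p v)"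
      using val[of l] by (subst tensor_rel_class) (auto simp: tcls_def)
  qed
  finally show ?thesis .
qed

end

end

section \<open>Direct limits\<close>

text \<open>When the stages embed compatibly into \<open>F\<close>, elements of two stages are
  identified exactly if their images agree: directedness gives a common stage, where injectivity
  applies. So the classes are the fibres over \<open>F\<close>, and the limit is the union of the
  images.\<close>

lemma direct_limit_embedding:
  fixes I :: "'i set" and E :: "'i \<Rightarrow> ('k::field, 'u) lring" and F :: "('k, 'v) lring"
    and h :: "'i \<Rightarrow> 'u \<Rightarrow> 'v"
  assumes ne: "I \<noteq> {}"
    and directed: "\<And>i j. i \<in> I \<Longrightarrow> j \<in> I \<Longrightarrow> \<exists>k\<in>I. leq i k \<and> leq j k"
    and t: "\<And>i j x. i \<in> I \<Longrightarrow> j \<in> I \<Longrightarrow> leq i j \<Longrightarrow> x \<in> carrier (E i) \<Longrightarrow> t i j x \<in> carrier (E j) \<and> h j (t i j x) = h i x"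
    and inj: "\<And>i. i \<in> I \<Longrightarrow> inj_on (h i) (carrier (E i))"
    and mult: "\<And>i x y. i \<in> I \<Longrightarrow> x \<in> carrier (E i) \<Longrightarrow> y \<in> carrier (E i) \<Longrightarrow>
      x \<otimes>\<^bsub>E i\<^esub> y \<in> carrier (E i) \<and> h i (x \<otimes>\<^bsub>E i\<^esub> y) = h i x \<otimes>\<^bsub>F\<^esub> h i y"
    and add: "\<And>i x y. i \<in> I \<Longrightarrow> x \<in> carrier (E i) \<Longrightarrow> y \<in> carrier (E i) \<Longrightarrow>
      x \<oplus>\<^bsub>E i\<^esub> y \<in> carrier (E i) \<and> h i (x \<oplus>\<^bsub>E i\<^esub> y) = h i x \<oplus>\<^bsub>F\<^esub> h i y"
    and one: "\<And>i. i \<in> I \<Longrightarrow> \<one>\<^bsub>E i\<^esub> \<in> carrier (E i) \<and> h i \<one>\<^bsub>E i\<^esub> = \<one>\<^bsub>F\<^esub>"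
    and scal: "\<And>i k. i \<in> I \<Longrightarrow> k \<in> S \<Longrightarrow> scal (E i) k \<in> carrier (E i) \<and> h i (scal (E i) k) = scal F k"
    and psi: "\<And>i p x. i \<in> I \<Longrightarrow> p \<in> nz_primes \<Longrightarrow> x \<in> carrier (E i) \<Longrightarrow>
      psi (E i) p x \<in> carrier (E i) \<and> h i (psi (E i) p x) = psi F p (h i x)"
    and image: "(\<Union>i\<in>I. h i ` carrier (E i)) = carrier F"
  shows "\<exists>f\<in>lambda_iso S (direct_limit I leq E t) F.
    \<forall>i\<in>I. \<forall>x\<in>carrier (E i). f (limit_rel I leq E t `` {(i, x)}) = h i x"
proof -
  define C where "C v = {(i, x). i \<in> I \<and> x \<in> carrier (E i) \<and> h i x = v}" for v
  have rel: "((i, x), (j, y)) \<in> limit_rel I leq E t \<longleftrightarrow>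
    i \<in> I \<and> x \<in> carrier (E i) \<and> j \<in> I \<and> y \<in> carrier (E j) \<and> h i x = h j y" for i x j y
  proof -
    have "(\<exists>k\<in>I. leq i k \<and> leq j k \<and> t i k x = t j k y) \<longleftrightarrow> h i x = h j y"
      if ij: "i \<in> I" "x \<in> carrier (E i)" "j \<in> I" "y \<in> carrier (E j)"
    proof
      assume "\<exists>k\<in>I. leq i k \<and> leq j k \<and> t i k x = t j k y"
      then show "h i x = h j y" using t ij by metis
    next
      assume eq: "h i x = h j y"
      obtain k where k: "k \<in> I" "leq i k" "leq j k" using directed ij by blast
      have "t i k x = t j k y"
        by (rule inj_onD[OF inj[OF k(1)]]) (use t[of i k x] t[of j k y] k ij eq in auto)
      then show "\<exists>k\<in>I. leq i k \<and> leq j k \<and> t i k x = t j k y" using k by blast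
    qed
    then show ?thesis unfolding limit_rel_def by auto
  qed
  have cls: "limit_rel I leq E t `` {(i, x)} = C (h i x)" if "i \<in> I" "x \<in> carrier (E i)" for i x
    using that rel by (auto simp: C_def)
  have Cne: "\<exists>i x. (i, x) \<in> C v" if "v \<in> carrier F" for v
  proof -
    have "v \<in> (\<Union>i\<in>I. h i ` carrier (E i))" using that image by simp
    then show ?thesis unfolding C_def by blast
  qed
  let ?L = "direct_limit I leq E t"
  have car: "carrier ?L = C ` carrier F"
  proof -
    have "carrier ?L = (\<lambda>(i, x). limit_rel I leq E t `` {(i, x)}) ` (SIGMA i:I. carrier (E i))"
      by (auto simp: direct_limit_def quotient_def Let_def)
    also have "\<dots> = (\<lambda>(i, x). C (h i x)) ` (SIGMA i:I. carrier (E i))"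
    proof (rule image_cong)
      fix z assume "z \<in> (SIGMA i:I. carrier (E i))"
      then obtain i x where z: "z = (i, x)" "i \<in> I" "x \<in> carrier (E i)" by blast
      show "(\<lambda>(i, x). limit_rel I leq E t `` {(i, x)}) z = (\<lambda>(i, x). C (h i x)) z"
        unfolding z(1) prod.case by (rule cls[OF z(2,3)])
    qed simp
    also have "\<dots> = C ` (\<Union>i\<in>I. h i ` carrier (E i))" by force
    finally show ?thesis using image by simp
  qed
  define f where "f = (\<lambda>a\<in>carrier ?L. the_elem ((\<lambda>(i, x). h i x) ` a))"
  have fC: "f (C v) = v" if "v \<in> carrier F" for v
  proof -
    have "(\<lambda>(i, x). h i x) ` C v = {v}" using Cne[OF that] by (auto simp: C_def image_iff)
    then show ?thesis using that car by (simp add: f_def)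
  qed
  have UN: "(\<Union>z\<in>C v. G (fst z) (snd z)) = B"
    if "v \<in> carrier F" "\<And>i x. i \<in> I \<Longrightarrow> x \<in> carrier (E i) \<Longrightarrow> h i x = v \<Longrightarrow> G i x = B" for v G B
    using Cne[OF that(1)] that(2) by (force simp: C_def)
  have hF: "h i x \<in> carrier F" if "i \<in> I" "x \<in> carrier (E i)" for i x using that image by blast
  obtain i0 where i0: "i0 \<in> I" using ne by blast
  \<comment> \<open>One computation for both ring operations. The unions run over representatives
    and upper bounds, all terms are equal, and directedness provides at least one.\<close>
  have op: "(\<Union>z\<in>C v. \<Union>z'\<in>C w. \<Union>k\<in>{k\<in>I. leq (fst z) k \<and> leq (fst z') k}.
      limit_rel I leq E t `` {(k, o1 k (t (fst z) k (snd z)) (t (fst z') k (snd z')))}) = C (o2 v w)"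
    if vw: "v \<in> carrier F" "w \<in> carrier F"
      and o: "\<And>i x y. i \<in> I \<Longrightarrow> x \<in> carrier (E i) \<Longrightarrow> y \<in> carrier (E i) \<Longrightarrow> o1 i x y \<in> carrier (E i) \<and> h i (o1 i x y) = o2 (h i x) (h i y)"
    for v w o1 o2
  proof (rule UN[OF vw(1)], rule UN[OF vw(2)])
    fix i x j y assume ix: "i \<in> I" "x \<in> carrier (E i)" "h i x = v" and jy: "j \<in> I" "y \<in> carrier (E j)" "h j y = w"
    have "limit_rel I leq E t `` {(k, o1 k (t i k x) (t j k y))} = C (o2 v w)" if k: "k \<in> I" "leq i k" "leq j k" for k
    proof -
      have tx: "t i k x \<in> carrier (E k)" "h k (t i k x) = v" "t j k y \<in> carrier (E k)" "h k (t j k y) = w"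
        using t[of i k x] t[of j k y] ix jy k by auto
      then show ?thesis using o[OF k(1) tx(1,3)] cls[OF k(1), of "o1 k (t i k x) (t j k y)"] by simp
    qed
    moreover obtain k where "k \<in> I" "leq i k" "leq j k" using directed ix jy by blast
    ultimately show "(\<Union>k\<in>{k\<in>I. leq i k \<and> leq j k}. limit_rel I leq E t `` {(k, o1 k (t i k x) (t j k y))}) = C (o2 v w)"
      by blast
  qed
  have mF: "v \<otimes>\<^bsub>F\<^esub> w \<in> carrier F \<and> v \<oplus>\<^bsub>F\<^esub> w \<in> carrier F" if vw: "v \<in> carrier F" "w \<in> carrier F" for v w
  proof -
    obtain i x j y where ij: "i \<in> I" "x \<in> carrier (E i)" "h i x = v" "j \<in> I" "y \<in> carrier (E j)" "h j y = w"
      using Cne[OF vw(1)] Cne[OF vw(2)] unfolding C_def by blast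
    obtain k where k: "k \<in> I" "leq i k" "leq j k" using directed ij by blast
    have tx: "t i k x \<in> carrier (E k)" "h k (t i k x) = v" "t j k y \<in> carrier (E k)" "h k (t j k y) = w"
      using t[of i k x] t[of j k y] ij k by auto
    then show ?thesis using mult[OF k(1) tx(1,3)] add[OF k(1) tx(1,3)] hF[OF k(1)] by metis
  qed
  have Lmult: "C v \<otimes>\<^bsub>?L\<^esub> C w = C (v \<otimes>\<^bsub>F\<^esub> w)" if vw: "v \<in> carrier F" "w \<in> carrier F" for v w
    using op[OF vw, of "\<lambda>k. monoid.mult (E k)" "monoid.mult F"] mult by (simp add: direct_limit_def Let_def case_prod_beta)
  have Ladd: "C v \<oplus>\<^bsub>?L\<^esub> C w = C (v \<oplus>\<^bsub>F\<^esub> w)" if vw: "v \<in> carrier F" "w \<in> carrier F" for v w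
    using op[OF vw, of "\<lambda>k. ring.add (E k)" "ring.add F"] add by (simp add: direct_limit_def Let_def case_prod_beta)
  have Lone: "\<one>\<^bsub>?L\<^esub> = C \<one>\<^bsub>F\<^esub>"
    using one cls i0 by (auto simp: direct_limit_def Let_def)
  have Lscal: "scal ?L k = C (scal F k)" if "k \<in> S" for k
    using scal[OF _ that] cls i0 by (auto simp: direct_limit_def Let_def)
  have Lpsi: "psi ?L p (C v) = C (psi F p v)" if p: "p \<in> nz_primes" and v: "v \<in> carrier F" for p v
  proof -
    have "psi ?L p (C v) = (\<Union>z\<in>C v. limit_rel I leq E t `` {(fst z, psi (E (fst z)) p (snd z))})"
      by (simp add: direct_limit_def Let_def case_prod_beta)
    also have "\<dots> = C (psi F p v)" by (rule UN[OF v]) (use psi[OF _ p] cls in auto)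
    finally show ?thesis .
  qed
  have oneF: "\<one>\<^bsub>F\<^esub> \<in> carrier F" using one[OF i0] hF[OF i0] by metis
  have scalF: "scal F k \<in> carrier F" if "k \<in> S" for k using scal[OF i0 that] hF[OF i0] by metis
  have psiF: "psi F p v \<in> carrier F" if pv: "p \<in> nz_primes" "v \<in> carrier F" for p v
  proof -
    obtain i x where ix: "i \<in> I" "x \<in> carrier (E i)" "h i x = v" using Cne[OF pv(2)] unfolding C_def by blast
    then show ?thesis using psi[OF ix(1) pv(1) ix(2)] hF[OF ix(1)] by metis
  qed
  have "f \<in> ring_hom ?L F"
    by (rule ring_hom_memI) (auto simp: car fC Lmult Ladd Lone mF oneF)
  moreover have "f \<in> extensional (carrier ?L)" by (simp add: f_def)
  moreover have "\<forall>k\<in>S. f (scal ?L k) = scal F k" using Lscal fC scalF by simp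
  moreover have "\<forall>p\<in>nz_primes. \<forall>x\<in>carrier ?L. f (psi ?L p x) = psi F p (f x)"
    using Lpsi fC psiF car by auto
  moreover have "bij_betw f (carrier ?L) (carrier F)"
    unfolding car by (rule bij_betw_byWitness[of _ C]) (auto simp: fC)
  ultimately have "f \<in> lambda_iso S ?L F" by (simp add: lambda_iso_def lambda_hom_def)
  moreover have "f (limit_rel I leq E t `` {(i, x)}) = h i x" if "i \<in> I" "x \<in> carrier (E i)" for i x
    using cls[OF that] fC hF[OF that] by simp
  ultimately show ?thesis by blast
qed

section \<open>Extension of embeddings to the algebraic closure\<close>

lemma map_poly_to_ac_pCons: "map_poly to_ac (pCons c r) = pCons (to_ac c) (map_poly to_ac r)"
  by (rule poly_eqI) (simp add: coeff_map_poly Polynomial.coeff_pCons split: nat.split)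

lemma map_poly_to_ac_smult: "map_poly to_ac (Polynomial.smult c r) = Polynomial.smult (to_ac c) (map_poly to_ac r)"
  by (rule poly_eqI) (simp add: coeff_map_poly)

lemma degree_map_poly_to_ac: "Polynomial.degree (map_poly to_ac p) = Polynomial.degree p"
  unfolding Polynomial.degree_def by (simp add: coeff_map_poly)

text \<open>Divide an equation of \<open>y\<close> over K by powers of \<open>y\<close> until its
  constant term is nonzero, then solve for the inverse.\<close>

lemma inverse_as_polynomial:
  fixes y :: "'k::field alg_closure"
  assumes "y \<noteq> 0"
  obtains q :: "'k Polynomial.poly" where "inverse y = poly (map_poly to_ac q) y"
proof -
  have pc: "poly (map_poly to_ac (pCons c r)) y = to_ac c + y * poly (map_poly to_ac r) y" for c and r :: "'k Polynomial.poly"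
    by (simp add: map_poly_to_ac_pCons)
  have "p \<noteq> 0 \<Longrightarrow> poly (map_poly to_ac p) y = 0 \<Longrightarrow> \<exists>q :: 'k Polynomial.poly. inverse y = poly (map_poly to_ac q) y"
    for p :: "'k Polynomial.poly"
  proof (induction p)
    case (pCons c r)
    have eq: "to_ac c + y * poly (map_poly to_ac r) y = 0" using pCons.prems(2) pc by simp
    show ?case
    proof (cases "c = 0")
      case True
      then show ?thesis using pCons eq assms by auto
    next
      case False
      then have "inverse y = to_ac (- inverse c) * poly (map_poly to_ac r) y"
        using eq assms by (simp add: field_simps) (simp add: eq_neg_iff_add_eq_0 add.commute)
      moreover have "poly (map_poly to_ac (Polynomial.smult (- inverse c) r)) y = to_ac (- inverse c) * poly (map_poly to_ac r) y"
        by (simp only: map_poly_to_ac_smult Polynomial.poly_smult)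
      ultimately show ?thesis by metis
    qed
  qed simp
  then show ?thesis using alg_closure_algebraic[of y] that by metis
qed

text \<open>
  A partial embedding of the algebraic closure into itself, given by its graph. Closure under
  inverses is automatic, since the closure is algebraic over the base field.
\<close>

definition emb_graph :: "('k::field alg_closure \<times> 'k alg_closure) set \<Rightarrow> bool" where
  "emb_graph G \<longleftrightarrow> (\<forall>k. (to_ac k, to_ac k) \<in> G) \<and>
     (\<forall>x y x' y'. (x, y) \<in> G \<longrightarrow> (x', y') \<in> G \<longrightarrow> (x + x', y + y') \<in> G \<and> (x * x', y * y') \<in> G) \<and>
     (\<forall>y. (0, y) \<in> G \<longrightarrow> y = 0)"

lemma emb_graphD:
  assumes "emb_graph G"
  shows "(to_ac k, to_ac k) \<in> G" "(x, y) \<in> G \<Longrightarrow> (x', y') \<in> G \<Longrightarrow> (x + x', y + y') \<in> G"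
    "(x, y) \<in> G \<Longrightarrow> (x', y') \<in> G \<Longrightarrow> (x * x', y * y') \<in> G" "(0, y) \<in> G \<Longrightarrow> y = 0"
    "(0, 0) \<in> G" "(1, 1) \<in> G" "(x, y) \<in> G \<Longrightarrow> (- x, - y) \<in> G"
proof -
  show "(to_ac k, to_ac k) \<in> G" for k using assms by (auto simp: emb_graph_def)
  note k = this
  show "(x, y) \<in> G \<Longrightarrow> (x', y') \<in> G \<Longrightarrow> (x + x', y + y') \<in> G" using assms by (auto simp: emb_graph_def)
  show m: "(x, y) \<in> G \<Longrightarrow> (x', y') \<in> G \<Longrightarrow> (x * x', y * y') \<in> G" for x y x' y' using assms by (auto simp: emb_graph_def)
  show "(0, y) \<in> G \<Longrightarrow> y = 0" using assms by (auto simp: emb_graph_def)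
  show "(0, 0) \<in> G" using k[of 0] by simp
  show "(1, 1) \<in> G" using k[of 1] by simp
  show "(x, y) \<in> G \<Longrightarrow> (- x, - y) \<in> G" using m[OF k[of "- 1"], of x y] by simp
qed

lemma emb_graph_unique:
  assumes "emb_graph G" "(x, y) \<in> G" "(x, y') \<in> G"
  shows "y = y'"
proof -
  have "(x + (- x), y + (- y')) \<in> G"
    by (rule emb_graphD(2)[OF assms(1,2) emb_graphD(7)[OF assms(1,3)]])
  then have "y - y' = 0" using emb_graphD(4)[OF assms(1), of "y - y'"] by simp
  then show ?thesis by simp
qed

lemma emb_graph_sum:
  assumes G: "emb_graph G"
  shows "(\<And>i. i \<in> I \<Longrightarrow> (f i, g i) \<in> G) \<Longrightarrow> (sum f I, sum g I) \<in> G"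
  by (induction I rule: infinite_finite_induct) (auto intro: emb_graphD[OF G])

lemma emb_graph_poly:
  fixes q :: "'k::field Polynomial.poly"
  assumes G: "emb_graph G" and xy: "(x, y) \<in> G"
  shows "(poly (map_poly to_ac q) x, poly (map_poly to_ac q) y) \<in> G"
proof (induction q)
  case (pCons c q)
  then show ?case using emb_graphD[OF G] xy by (simp add: map_poly_to_ac_pCons)
qed (use emb_graphD[OF G] in simp)

lemma emb_graph_inverse:
  assumes G: "emb_graph G" and xy: "(x, y) \<in> G" and "x \<noteq> 0"
  shows "(inverse x, inverse y) \<in> G"
proof -
  obtain q where q: "inverse x = poly (map_poly to_ac q) x" using inverse_as_polynomial[OF \<open>x \<noteq> 0\<close>] by blast
  define w where "w = poly (map_poly to_ac q) y"
  have w: "(inverse x, w) \<in> G" unfolding q w_def by (rule emb_graph_poly[OF G xy])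
  then have "(1, y * w) \<in> G" using emb_graphD(3)[OF G xy w] assms(3) by simp
  then have "y * w = 1" using emb_graph_unique[OF G] emb_graphD(6)[OF G] by blast
  then have "w = inverse y" by (metis inverse_unique)
  then show ?thesis using w by simp
qed

text \<open>The polynomial \<open>g'\<close> arises from \<open>g\<close> by applying the partial
  embedding to the coefficients; it is a relation because the embedding is given by its
  graph.\<close>

definition poly_graph :: "('a::comm_ring_1 \<times> 'a) set \<Rightarrow> 'a Polynomial.poly \<Rightarrow> 'a Polynomial.poly \<Rightarrow> bool" where
  "poly_graph G g g' \<longleftrightarrow> (\<forall>i. (Polynomial.coeff g i, Polynomial.coeff g' i) \<in> G)"

lemma poly_graph_ops:
  assumes G: "emb_graph G"
  shows "poly_graph G g g' \<Longrightarrow> poly_graph G r r' \<Longrightarrow> poly_graph G (g + r) (g' + r')"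
    "poly_graph G g g' \<Longrightarrow> poly_graph G r r' \<Longrightarrow> poly_graph G (g * r) (g' * r')"
    "(a, a') \<in> G \<Longrightarrow> poly_graph G g g' \<Longrightarrow> poly_graph G (pCons a g) (pCons a' g')"
    "(a, a') \<in> G \<Longrightarrow> poly_graph G g g' \<Longrightarrow> poly_graph G (Polynomial.smult a g) (Polynomial.smult a' g')"
    "poly_graph G g g' \<Longrightarrow> poly_graph G r r' \<Longrightarrow> poly_graph G (g - r) (g' - r')"
    "poly_graph G 0 0"
  using emb_graphD[OF G] emb_graphD(2)[OF G, of _ _ "- x" "- y" for x y]
  by (auto simp: poly_graph_def coeff_mult Polynomial.coeff_pCons split: nat.split intro!: emb_graph_sum[OF G])

text \<open>Division with remainder by a monic polynomial, carried out in parallel on both sides of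
  the embedding. The degree of \<open>m\<close> enters as an index \<open>d\<close> with coefficient
  1 and zeros above it.\<close>

lemma poly_graph_division:
  assumes G: "emb_graph G" and m: "poly_graph G m m'" "Polynomial.coeff m d = 1" "\<forall>i>d. Polynomial.coeff m i = 0"
  shows "poly_graph G g g' \<Longrightarrow> \<exists>q q' r r'. poly_graph G q q' \<and> poly_graph G r r' \<and> g = q * m + r \<and> g' = q' * m' + r' \<and>
    (\<forall>i\<ge>d. Polynomial.coeff r i = 0)"
proof (induction g arbitrary: g')
  case 0
  have "g' = 0"
    by (rule poly_eqI) (use 0 emb_graphD(4)[OF G] in \<open>auto simp: poly_graph_def\<close>)
  then show ?case using poly_graph_ops(6)[OF G] by (intro exI[of _ 0]) auto
next
  case (pCons a g)
  obtain a' h' where g': "g' = pCons a' h'" by (cases g')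
  have aa: "(a, a') \<in> G" using pCons.prems[unfolded poly_graph_def, rule_format, of 0] g' by simp
  have gh: "poly_graph G g h'"
    unfolding poly_graph_def
  proof
    fix i show "(Polynomial.coeff g i, Polynomial.coeff h' i) \<in> G"
      using pCons.prems[unfolded poly_graph_def, rule_format, of "Suc i"] g' by simp
  qed
  obtain q q' r r' where IH: "poly_graph G q q'" "poly_graph G r r'" "g = q * m + r" "h' = q' * m' + r'"
    "\<forall>i\<ge>d. Polynomial.coeff r i = 0" using pCons.IH[OF gh] by blast
  define s where "s = pCons a r"
  define s' where "s' = pCons a' r'"
  have s: "poly_graph G s s'" unfolding s_def s'_def by (rule poly_graph_ops(3)[OF G aa IH(2)])
  define c where "c = Polynomial.coeff s d"
  define c' where "c' = Polynomial.coeff s' d"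
  have cc: "(c, c') \<in> G" using s by (simp add: poly_graph_def c_def c'_def)
  have q2: "poly_graph G (pCons c q) (pCons c' q')" by (rule poly_graph_ops(3)[OF G cc IH(1)])
  have r2: "poly_graph G (s - Polynomial.smult c m) (s' - Polynomial.smult c' m')"
    by (intro poly_graph_ops[OF G] s cc m)
  have "\<forall>i\<ge>d. Polynomial.coeff (s - Polynomial.smult c m) i = 0"
  proof safe
    fix i assume i: "i \<ge> d"
    show "Polynomial.coeff (s - Polynomial.smult c m) i = 0"
    proof (cases "i = d")
      case True
      then show ?thesis using m(2) by (simp add: c_def)
    next
      case False
      then have "i > d" using i by simp
      then have "Polynomial.coeff s i = 0" using IH(5) by (cases i) (auto simp: s_def)
      then show ?thesis using m(3) \<open>i > d\<close> by simp
    qed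
  qed
  moreover have "pCons a g = pCons c q * m + (s - Polynomial.smult c m)"
    by (simp add: s_def IH(3))
  moreover have "g' = pCons c' q' * m' + (s' - Polynomial.smult c' m')"
    by (simp add: s'_def IH(4) g')
  ultimately show ?case using q2 r2 by blast
qed

text \<open>The extension to one more element: \<open>m\<close> is a monic polynomial of least
  degree over the domain of \<open>G\<close> vanishing at \<open>x\<close>, and \<open>x\<close>
  goes to a root \<open>y\<close> of the transported polynomial \<open>m'\<close>. The new graph
  consists of the values of corresponding polynomials.\<close>

lemma emb_graph_extend:
  fixes x :: "'k::field alg_closure"
  assumes G: "emb_graph G"
  shows "\<exists>G'. emb_graph G' \<and> G \<subseteq> G' \<and> (\<exists>y. (x, y) \<in> G')"
proof -
  define Q where "Q d \<longleftrightarrow> (\<exists>m m'. poly_graph G m m' \<and> Polynomial.coeff m d = 1 \<and> (\<forall>i>d. Polynomial.coeff m i = 0) \<and> poly m x = 0)" for d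
  have lead: "\<exists>d'\<le>d. Q d'" if r: "poly_graph G r r'" "r \<noteq> 0" "poly r x = 0" "Polynomial.degree r = d" for r r' d
  proof -
    define c where "c = Polynomial.lead_coeff r"
    have c0: "c \<noteq> 0" using r(2) by (simp add: c_def)
    have "(c, Polynomial.coeff r' d) \<in> G" using r(1,4) by (simp add: poly_graph_def c_def)
    then have ic: "(inverse c, inverse (Polynomial.coeff r' d)) \<in> G" by (rule emb_graph_inverse[OF G _ c0])
    have "Q d" unfolding Q_def
      by (rule exI[of _ "Polynomial.smult (inverse c) r"],
          rule exI[of _ "Polynomial.smult (inverse (Polynomial.coeff r' d)) r'"], intro conjI poly_graph_ops(4)[OF G ic r(1)])
        (use c0 r(3,4) in \<open>auto simp: c_def intro: coeff_eq_0\<close>)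
    then show ?thesis by blast
  qed
  obtain p :: "'k Polynomial.poly" where p: "p \<noteq> 0" "poly (map_poly to_ac p) x = 0" using alg_closure_algebraic by blast
  have "poly_graph G (map_poly to_ac p) (map_poly to_ac p)"
    using emb_graphD(1)[OF G] by (simp add: poly_graph_def coeff_map_poly)
  moreover have "map_poly to_ac p \<noteq> 0" using p(1) by (simp add: map_poly_eq_0_iff)
  ultimately have "\<exists>d. Q d" using lead p(2) by blast
  define d where "d = (LEAST d. Q d)"
  have "Q d" unfolding d_def using \<open>\<exists>d. Q d\<close> by (rule LeastI_ex)
  then obtain m m' where m: "poly_graph G m m'" "Polynomial.coeff m d = 1" "\<forall>i>d. Polynomial.coeff m i = 0" "poly m x = 0"
    unfolding Q_def by blast
  have least: "d \<le> d'" if "Q d'" for d' unfolding d_def using that by (rule Least_le)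
  have m'd: "Polynomial.coeff m' i = (if i = d then 1 else Polynomial.coeff m' i)" "i > d \<Longrightarrow> Polynomial.coeff m' i = 0" for i
    using m(1,2,3) emb_graph_unique[OF G _ emb_graphD(6)[OF G]] emb_graphD(4)[OF G]
    unfolding poly_graph_def by (metis, metis)
  have "d > 0"
  proof (rule ccontr)
    assume "\<not> d > 0"
    then have "m = 1" using m(2,3) by (intro poly_eqI) (auto simp: Polynomial.coeff_1)
    then show False using m(4) by simp
  qed
  moreover have degm: "Polynomial.degree m' = d"
    by (rule antisym[OF degree_le le_degree]) (use m'd(2) m'd(1)[of d] in auto)
  moreover have "Polynomial.lead_coeff m' = 1" unfolding degm using m'd(1)[of d] by simp
  ultimately obtain y where y: "poly m' y = 0" using alg_closed_imp_poly_has_root[of m'] by auto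
  define G' where "G' = {(poly g x, poly g' y) | g g'. poly_graph G g g'}"
  have mem: "(poly g x, poly g' y) \<in> G'" if "poly_graph G g g'" for g g' using that unfolding G'_def by blast
  have const: "poly_graph G [:a:] [:a':]" if "(a, a') \<in> G" for a a'
    by (rule poly_graph_ops(3)[OF G that poly_graph_ops(6)[OF G]])
  have sub: "G \<subseteq> G'" using mem[OF const] by auto
  have xy: "(x, y) \<in> G'"
    using mem[OF poly_graph_ops(3)[OF G emb_graphD(5)[OF G] const[OF emb_graphD(6)[OF G]]]] by simp
  have "emb_graph G'"
    unfolding emb_graph_def
  proof (intro conjI allI impI)
    show "(to_ac k, to_ac k) \<in> G'" for k using sub emb_graphD(1)[OF G] by blast
    fix u v u' v' assume "(u, v) \<in> G'" "(u', v') \<in> G'"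
    then obtain g g' r r' where gr: "poly_graph G g g'" "u = poly g x" "v = poly g' y"
      "poly_graph G r r'" "u' = poly r x" "v' = poly r' y" unfolding G'_def by blast
    show "(u + u', v + v') \<in> G'" using mem[OF poly_graph_ops(1)[OF G gr(1,4)]] gr by simp
    show "(u * u', v * v') \<in> G'" using mem[OF poly_graph_ops(2)[OF G gr(1,4)]] gr by simp
  next
    fix v assume "(0, v) \<in> G'"
    then obtain g g' where g: "poly_graph G g g'" "poly g x = 0" "v = poly g' y" unfolding G'_def by auto
    obtain q q' r r' where d: "poly_graph G q q'" "poly_graph G r r'" "g = q * m + r" "g' = q' * m' + r'"
      "\<forall>i\<ge>d. Polynomial.coeff r i = 0" using poly_graph_division[OF G m(1-3) g(1)] by blast
    have rx: "poly r x = 0" using g(2) m(4) d(3) by simp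
    \<comment> \<open>The remainder vanishes at \<open>x\<close> and has degree below
      \<open>d\<close>, so it is zero by minimality. Hence \<open>g'\<close> is a multiple of
      \<open>m'\<close> and vanishes at \<open>y\<close>, which makes the new graph
      single-valued.\<close>
    have "r = 0"
    proof (rule ccontr)
      assume r0: "r \<noteq> 0"
      then obtain d' where "d' \<le> Polynomial.degree r" "Q d'" using lead[OF d(2) r0 rx HOL.refl] by blast
      then have "d \<le> Polynomial.degree r" using least by fastforce
      then have "Polynomial.lead_coeff r = 0" using d(5) by blast
      then show False using r0 by simp
    qed
    then have "r' = 0"
      by (intro poly_eqI) (use d(2) emb_graphD(4)[OF G] in \<open>auto simp: poly_graph_def\<close>)
    then show "v = 0" using g(3) d(4) y by simp
  qed
  with sub xy show ?thesis by blast
qed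

text \<open>A maximal graph from Zorn's lemma is total by \<open>emb_graph_extend\<close>. It is
  injective as a homomorphism of fields and surjective because it permutes the finitely many roots
  of each polynomial over K.\<close>

lemma emb_graph_extends_to_automorphism:
  fixes G :: "('k::field alg_closure \<times> 'k alg_closure) set"
  assumes G: "emb_graph G"
  obtains \<sigma> where "\<sigma> \<in> galois_group" "\<And>x y. (x, y) \<in> G \<Longrightarrow> \<sigma> x = y"
proof -
  let ?A = "{G'. emb_graph G' \<and> G \<subseteq> G'}"
  have "\<exists>M\<in>?A. \<forall>Z\<in>?A. M \<subseteq> Z \<longrightarrow> Z = M"
  proof (rule subset_Zorn_nonempty)
    show "?A \<noteq> {}" using G by blast
    fix C assume C: "C \<noteq> {}" "subset.chain ?A C"
    have CA: "emb_graph Z" "G \<subseteq> Z" if "Z \<in> C" for Z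
      using C(2) that by (auto simp: subset.chain_def)
    have common: "\<exists>Z\<in>C. z \<in> Z \<and> w \<in> Z" if zw: "z \<in> \<Union>C" "w \<in> \<Union>C" for z w
    proof -
      obtain Z1 Z2 where Z: "Z1 \<in> C" "z \<in> Z1" "Z2 \<in> C" "w \<in> Z2" using zw by blast
      then have "Z1 \<subseteq> Z2 \<or> Z2 \<subseteq> Z1" using C(2) unfolding subset.chain_def by blast
      then show ?thesis using Z by blast
    qed
    have "emb_graph (\<Union>C)"
      unfolding emb_graph_def
    proof (intro conjI allI impI)
      show "(to_ac k, to_ac k) \<in> \<Union>C" for k using C(1) CA(1) emb_graphD(1) by blast
      fix x y x' y' assume "(x, y) \<in> \<Union>C" "(x', y') \<in> \<Union>C"
      then obtain Z where Z: "Z \<in> C" "(x, y) \<in> Z" "(x', y') \<in> Z" using common by blast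
      show "(x + x', y + y') \<in> \<Union>C" using emb_graphD(2)[OF CA(1)[OF Z(1)] Z(2,3)] Z(1) by blast
      show "(x * x', y * y') \<in> \<Union>C" using emb_graphD(3)[OF CA(1)[OF Z(1)] Z(2,3)] Z(1) by blast
    next
      fix y assume "(0, y) \<in> \<Union>C"
      then show "y = 0" using CA(1) emb_graphD(4) by blast
    qed
    moreover have "G \<subseteq> \<Union>C" using C(1) CA(2) by blast
    ultimately show "\<Union>C \<in> ?A" by blast
  qed
  then obtain M where M0: "M \<in> ?A" "\<forall>Z\<in>?A. M \<subseteq> Z \<longrightarrow> Z = M" by (elim bexE)
  have M: "emb_graph M" "G \<subseteq> M" using M0(1) by auto
  have M3: "Z = M" if "emb_graph Z" "M \<subseteq> Z" for Z using M0(2) that M(2) by simp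
  have total: "\<exists>y. (x, y) \<in> M" for x
  proof -
    obtain Z where "emb_graph Z" "M \<subseteq> Z" "\<exists>y. (x, y) \<in> Z" using emb_graph_extend[OF M(1)] by blast
    then show ?thesis using M3[of Z] by auto
  qed
  define \<sigma> where "\<sigma> x = (THE y. (x, y) \<in> M)" for x
  have \<sigma>: "(x, y) \<in> M \<longleftrightarrow> \<sigma> x = y" for x y
  proof -
    have "(x, \<sigma> x) \<in> M" unfolding \<sigma>_def
      by (rule theI') (use total emb_graph_unique[OF M(1)] in blast)
    then show ?thesis using emb_graph_unique[OF M(1)] by blast
  qed
  note MD = emb_graphD[OF M(1), unfolded \<sigma>]
  have add: "\<sigma> (x + y) = \<sigma> x + \<sigma> y" and mult: "\<sigma> (x * y) = \<sigma> x * \<sigma> y" for x y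
    using MD(2)[of x _ y] MD(3)[of x _ y] by auto
  have inj: "inj \<sigma>"
  proof (rule injI)
    fix x y assume eq: "\<sigma> x = \<sigma> y"
    have "\<sigma> (x - y) = 0" using add[of "x - y" y] eq by simp
    have "x - y = 0"
    proof (rule ccontr)
      assume "x - y \<noteq> 0"
      then have "1 = \<sigma> ((x - y) * inverse (x - y))" using MD(6) by simp
      then show False using mult[of "x - y" "inverse (x - y)"] \<open>\<sigma> (x - y) = 0\<close> by simp
    qed
    then show "x = y" by simp
  qed
  have "y \<in> range \<sigma>" for y
  proof -
    obtain p :: "'k Polynomial.poly" where p: "p \<noteq> 0" "poly (map_poly to_ac p) y = 0" using alg_closure_algebraic by blast
    define R where "R = {z. poly (map_poly to_ac p) z = 0}"
    have "map_poly to_ac p \<noteq> 0" using p(1) by (simp add: map_poly_eq_0_iff)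
    then have fin: "finite R" unfolding R_def by (rule poly_roots_finite)
    have "poly (map_poly to_ac p) (\<sigma> z) = \<sigma> (poly (map_poly to_ac p) z)" for z
      using emb_graph_poly[OF M(1), of z "\<sigma> z" p] \<sigma> by simp
    then have "\<sigma> ` R \<subseteq> R" using MD(5) by (auto simp: R_def)
    then have "\<sigma> ` R = R" using fin inj by (meson endo_inj_surj inj_on_subset subset_UNIV)
    then show ?thesis using p(2) unfolding R_def by blast
  qed
  then have "bij \<sigma>" using inj by (auto simp: bij_def)
  then have "\<sigma> \<in> galois_group"
    unfolding galois_group_def ring_iso_def
    using add mult MD(1,6) by (auto intro!: ring_hom_memI)
  then show ?thesis using that M(2) \<sigma> by blast
qed

section \<open>Finite subextensions\<close>

text \<open>Not a field with finitely many elements, but a subfield of the closure containing K and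
  finite-dimensional over the rationals, where the trace coordinates are formed.\<close>

definition finite_field :: "'k::number_field alg_closure set \<Rightarrow> bool" where
  "finite_field L \<longleftrightarrow> (\<exists>B. finite B \<and> L = qvs.span B) \<and> range to_ac \<subseteq> L \<and>
     (\<forall>x\<in>L. \<forall>y\<in>L. x * y \<in> L) \<and> (\<forall>x\<in>L. inverse x \<in> L)"

lemma finite_fieldD:
  assumes "finite_field L"
  shows "to_ac k \<in> L" "x \<in> L \<Longrightarrow> y \<in> L \<Longrightarrow> x * y \<in> L" "x \<in> L \<Longrightarrow> y \<in> L \<Longrightarrow> x + y \<in> L" "x \<in> L \<Longrightarrow> inverse x \<in> L"
    "x \<in> L \<Longrightarrow> - x \<in> L" "0 \<in> L" "1 \<in> L" "\<exists>B. finite B \<and> L = qvs.span B"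
proof -
  obtain B where B: "L = qvs.span B" using assms by (auto simp: finite_field_def)
  show k: "to_ac k \<in> L" for k using assms by (auto simp: finite_field_def)
  show "x \<in> L \<Longrightarrow> y \<in> L \<Longrightarrow> x * y \<in> L" "x \<in> L \<Longrightarrow> inverse x \<in> L" using assms by (auto simp: finite_field_def)
  show "x \<in> L \<Longrightarrow> y \<in> L \<Longrightarrow> x + y \<in> L" "x \<in> L \<Longrightarrow> - x \<in> L" unfolding B by (auto intro: qvs.span_add qvs.span_neg)
  show "0 \<in> L" "1 \<in> L" using k[of 0] k[of 1] by auto
  show "\<exists>B. finite B \<and> L = qvs.span B" using assms by (auto simp: finite_field_def)
qed

text \<open>The equation of \<open>x\<close> has coefficients in K. Once it is made monic, a common
  denominator \<open>n\<close> of its coefficients gives a monic equation for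
  \<open>of_nat n * x\<close> with integral coefficients.\<close>

lemma alg_closure_integer_multiple:
  fixes x :: "'k::number_field alg_closure"
  obtains n :: nat where "n > 0" "of_nat n * x \<in> alg_ints"
proof -
  obtain p0 :: "'k Polynomial.poly" where p0: "p0 \<noteq> 0" "poly (map_poly to_ac p0) x = 0" using alg_closure_algebraic by blast
  define p where "p = Polynomial.smult (inverse (Polynomial.lead_coeff p0)) p0"
  have p: "Polynomial.lead_coeff p = 1" "poly (map_poly to_ac p) x = 0"
    using p0 by (auto simp: p_def map_poly_to_ac_smult)
  define d where "d = Polynomial.degree p"
  have "\<exists>n::nat. n > 0 \<and> (\<forall>i\<in>I. of_nat n * Polynomial.coeff p i \<in> alg_ints)" if "finite I" for I
    using that
  proof (induction I)
    case empty
    then show ?case by (intro exI[of _ 1]) auto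
  next
    case (insert i I)
    then obtain n :: nat where n: "n > 0" "\<forall>i\<in>I. of_nat n * Polynomial.coeff p i \<in> alg_ints" by blast
    obtain m :: nat where m: "m > 0" "of_nat m * Polynomial.coeff p i \<in> alg_ints" by (rule number_field_integer_multiple)
    have "of_nat (m * n) * Polynomial.coeff p j \<in> alg_ints" if "j \<in> insert i I" for j
    proof (cases "j = i")
      case True
      then show ?thesis using alg_ints_closed(7)[OF alg_ints_closed(3)[of n] m(2)] by (simp add: mult_ac)
    next
      case False
      then show ?thesis using alg_ints_closed(7)[OF alg_ints_closed(3)[of m], of "of_nat n * Polynomial.coeff p j"] n(2) that
        by (simp add: mult_ac)
    qed
    then show ?case using n(1) m(1) by (intro exI[of _ "m * n"]) auto
  qed
  from this[of "{..<d}"] obtain n :: nat where n: "n > 0" "\<And>i. i < d \<Longrightarrow> of_nat n * Polynomial.coeff p i \<in> alg_ints" by auto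
  have "0 = (\<Sum>i\<le>d. to_ac (Polynomial.coeff p i) * x ^ i)"
    using p(2) by (simp add: poly_altdef coeff_map_poly d_def degree_map_poly_to_ac)
  also have "\<dots> = (\<Sum>i<d. to_ac (Polynomial.coeff p i) * x ^ i) + x ^ d"
    using p(1) by (simp add: d_def flip: lessThan_Suc_atMost)
  finally have "of_nat n ^ d * ((\<Sum>i<d. to_ac (Polynomial.coeff p i) * x ^ i) + x ^ d) = 0" by simp
  moreover have "of_nat n ^ d * ((\<Sum>i<d. to_ac (Polynomial.coeff p i) * x ^ i) + x ^ d) =
    (of_nat n * x) ^ d + (\<Sum>i<d. to_ac (of_nat n ^ (d - Suc i) * (of_nat n * Polynomial.coeff p i)) * (of_nat n * x) ^ i)"
  proof -
    have "of_nat n ^ d * (to_ac (Polynomial.coeff p i) * x ^ i) =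
      to_ac (of_nat n ^ (d - Suc i) * (of_nat n * Polynomial.coeff p i)) * (of_nat n * x) ^ i" if "i < d" for i
    proof -
      have "d = (d - Suc i) + 1 + i" using that by simp
      then have "(of_nat n :: 'k alg_closure) ^ d = of_nat n ^ (d - Suc i) * of_nat n * of_nat n ^ i"
        by (metis power_add power_one_right)
      then show ?thesis by (simp add: power_mult_distrib mult_ac)
    qed
    then have S: "(\<Sum>i<d. of_nat n ^ d * (to_ac (Polynomial.coeff p i) * x ^ i)) =
      (\<Sum>i<d. to_ac (of_nat n ^ (d - Suc i) * (of_nat n * Polynomial.coeff p i)) * (of_nat n * x) ^ i)"
      by (intro sum.cong) auto
    show ?thesis
      by (simp only: distrib_left sum_distrib_left S power_mult_distrib[of "of_nat n" x d] add.commute)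
  qed
  ultimately have rel: "(of_nat n * x) ^ d + (\<Sum>i<d. to_ac (of_nat n ^ (d - Suc i) * (of_nat n * Polynomial.coeff p i)) * (of_nat n * x) ^ i) = 0"
    by (simp only:)
  have "algebraic_int (of_nat n * x)"
  proof (rule algebraic_int_monic_root[OF _ rel])
    fix i assume "i < d"
    then have "of_nat n ^ (d - Suc i) * (of_nat n * Polynomial.coeff p i) \<in> alg_ints"
      by (intro alg_ints_closed(7)[OF alg_ints_closed(9)[OF alg_ints_closed(3)]] n(2))
    then show "algebraic_int (to_ac (of_nat n ^ (d - Suc i) * (of_nat n * Polynomial.coeff p i)))"
      using algebraic_int_to_ac_iff unfolding alg_ints_def by blast
  qed
  then show ?thesis using that n(1) by (simp add: alg_ints_def)
qed

lemma qvs_span_scale_cancel: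
  assumes "n > 0" "of_nat n * x \<in> qvs.span B"
  shows "(x :: 'a::field_char_0) \<in> qvs.span B"
proof -
  have "of_rat (inverse (of_nat n)) * (of_nat n * x) \<in> qvs.span B" using assms(2) by (rule qvs.span_scale)
  then show ?thesis using assms(1) by (simp add: of_rat_inverse mult.assoc[symmetric])
qed

text \<open>After scaling, the given elements preserve a common lattice. The multipliers of its
  rational span form a ring \<open>L\<close>, of finite dimension because 1 lies in the span, and a
  field because inverses are polynomial expressions over K.\<close>

lemma finite_field_containing:
  fixes V :: "'k::number_field alg_closure set"
  assumes V: "finite V"
  obtains L where "finite_field L" "V \<subseteq> L"
proof -
  obtain BK :: "'k set" where BK: "finite BK" "UNIV = qvs.span BK" using number_field_finite_span by blast
  \<comment> \<open>Rational generators of K are included so that K lies in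
    \<open>L\<close>.\<close>
  define V' where "V' = V \<union> to_ac ` BK"
  have V': "finite V'" using V BK by (simp add: V'_def)
  have "\<exists>n::nat. n > 0 \<and> of_nat n * v \<in> alg_ints" for v :: "'k alg_closure"
    by (rule alg_closure_integer_multiple[of v]) blast
  then obtain n :: "'k alg_closure \<Rightarrow> nat" where n: "\<And>v. n v > 0" "\<And>v. of_nat (n v) * v \<in> alg_ints" by metis
  define S where "S = (\<lambda>v. of_nat (n v) * v) ` V'"
  obtain B where B: "finite B" "1 \<in> B" "\<forall>s\<in>S. \<forall>b\<in>B. s * b \<in> zmod.span B"
    using algebraic_ints_common_module[of S] V' n(2) by (auto simp: S_def alg_ints_def)
  have zq: "x \<in> qvs.span B" if "x \<in> zmod.span B" for x
    using that
  proof (induction rule: zmod.span_induct_alt)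
    case base
    show ?case by (rule qvs.span_zero)
  next
    case (step c b y)
    then show ?case using qvs.span_add[OF qvs.span_scale[OF qvs.span_base[OF step(1)], of "of_int c"] step(2)] by simp
  qed
  define L where "L = {y. \<forall>b\<in>qvs.span B. y * b \<in> qvs.span B}"
  have LI: "y \<in> L" if y: "\<And>b. b \<in> B \<Longrightarrow> y * b \<in> qvs.span B" for y
    unfolding L_def
  proof safe
    fix z assume "z \<in> qvs.span B"
    then show "y * z \<in> qvs.span B"
    proof (induction rule: qvs.span_induct_alt)
      case base
      show ?case by (simp add: qvs.span_zero)
    next
      case (step c b z)
      then show ?case using qvs.span_add[OF qvs.span_scale[OF y[OF step(1)], of c] step(2)]
        by (simp add: algebra_simps)
    qed
  qed
  have VL: "v \<in> L" if "v \<in> V'" for v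
  proof (rule LI)
    fix b assume "b \<in> B"
    then have "(of_nat (n v) * v) * b \<in> qvs.span B" using B(3) that zq unfolding S_def by blast
    then have "of_nat (n v) * (v * b) \<in> qvs.span B" by (simp add: mult.assoc)
    then show "v * b \<in> qvs.span B" by (rule qvs_span_scale_cancel[OF n(1)])
  qed
  have Lsub: "qvs.subspace L"
    unfolding qvs.subspace_def L_def
    by (auto simp: distrib_right mult.assoc intro: qvs.span_zero qvs.span_add qvs.span_scale)
  have LB: "L \<subseteq> qvs.span B"
  proof
    fix y assume "y \<in> L"
    then have "y * 1 \<in> qvs.span B" using B(2) qvs.span_base unfolding L_def by blast
    then show "y \<in> qvs.span B" by simp
  qed
  obtain B' where B': "B' \<subseteq> L" "qvs.independent B'" "L \<subseteq> qvs.span B'"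
    using qvs.maximal_independent_subset[of L] by blast
  have fin: "finite B'" using qvs.independent_span_bound[OF B(1) B'(2)] B'(1) LB by auto
  have LB': "L = qvs.span B'"
    using B'(1,3) Lsub by (metis qvs.span_minimal subset_antisym)
  have one: "1 \<in> L" unfolding L_def by simp
  have mult: "x * y \<in> L" if "x \<in> L" "y \<in> L" for x y using that unfolding L_def by (simp add: mult.assoc)
  have ac: "to_ac k \<in> L" for k
  proof -
    have "k \<in> qvs.span BK" using BK(2) by auto
    then show ?thesis
    proof (induction rule: qvs.span_induct_alt)
      case base
      show ?case using Lsub by (simp add: qvs.subspace_0)
    next
      case (step c b y)
      have "to_ac (of_rat c) = (of_rat c :: 'k alg_closure)"
        by (cases c) (simp add: Fract_of_int_quotient of_rat_divide)
      moreover have "to_ac b \<in> L" using VL step(1) by (simp add: V'_def)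
      ultimately show ?case
        using qvs.subspace_add[OF Lsub qvs.subspace_scale[OF Lsub, of "to_ac b" c] step(2)] by simp
    qed
  qed
  have poly_L: "poly (map_poly to_ac q) x \<in> L" if "x \<in> L" for q :: "'k Polynomial.poly" and x
    by (induction q) (use that ac mult qvs.subspace_add[OF Lsub] qvs.subspace_0[OF Lsub] in \<open>auto simp: map_poly_to_ac_pCons\<close>)
  have inv: "inverse x \<in> L" if x: "x \<in> L" for x
  proof (cases "x = 0")
    case True
    then show ?thesis using qvs.subspace_0[OF Lsub] by simp
  next
    case False
    then obtain q where "inverse x = poly (map_poly to_ac q) x" by (rule inverse_as_polynomial)
    then show ?thesis using poly_L[OF x] by simp
  qed
  have "finite_field L"
    unfolding finite_field_def using fin LB' ac mult inv by auto
  then show ?thesis using that VL by (auto simp: V'_def)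
qed

lemma field_of_type_algebra_inv [simp]:
  fixes x :: "'a::field"
  shows "\<ominus>\<^bsub>ring_of_type_algebra\<^esub> x = - x" "x \<noteq> 0 \<Longrightarrow> inv\<^bsub>ring_of_type_algebra\<^esub> x = inverse x"
proof -
  interpret R: field "ring_of_type_algebra :: 'a ring" by (rule field_from_type_algebra)
  show "\<ominus>\<^bsub>ring_of_type_algebra\<^esub> x = - x" by (rule R.minus_equality) auto
  show "x \<noteq> 0 \<Longrightarrow> inv\<^bsub>ring_of_type_algebra\<^esub> x = inverse x"
    by (rule R.inv_char) auto
qed

lemma subfield_of_type_algebraI:
  fixes L :: "'a::field set"
  assumes "1 \<in> L" "\<And>x. x \<in> L \<Longrightarrow> - x \<in> L" "\<And>x y. x \<in> L \<Longrightarrow> y \<in> L \<Longrightarrow> x * y \<in> L"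
    "\<And>x y. x \<in> L \<Longrightarrow> y \<in> L \<Longrightarrow> x + y \<in> L" "\<And>x. x \<in> L \<Longrightarrow> inverse x \<in> L"
  shows "subfield L ring_of_type_algebra"
proof -
  interpret R: field "ring_of_type_algebra :: 'a ring" by (rule field_from_type_algebra)
  show ?thesis
    by (rule R.subfieldI'[OF R.subringI]) (use assms in auto)
qed

text \<open>For a polynomial of least degree vanishing at \<open>x\<close>, one factor in any
  product \<open>c * e\<close> vanishes at \<open>x\<close> and so has full degree. A common divisor
  with the derivative has smaller degree, the derivative being nonzero in characteristic zero, hence
  is constant.\<close>

lemma exists_separable_polynomial:
  fixes x :: "'k::field_char_0 alg_closure"
  shows "\<exists>p :: 'k Polynomial.poly. coprime p (pderiv p) \<and> poly (map_poly to_ac p) x = 0"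
proof -
  define Q where "Q d \<longleftrightarrow> (\<exists>p :: 'k Polynomial.poly. p \<noteq> 0 \<and> poly (map_poly to_ac p) x = 0 \<and> Polynomial.degree p = d)" for d
  obtain p0 :: "'k Polynomial.poly" where "p0 \<noteq> 0" "poly (map_poly to_ac p0) x = 0" using alg_closure_algebraic by blast
  then have "\<exists>d. Q d" unfolding Q_def by blast
  then have "Q (LEAST d. Q d)" by (rule LeastI_ex)
  then obtain p :: "'k Polynomial.poly" where p: "p \<noteq> 0" "poly (map_poly to_ac p) x = 0" "Polynomial.degree p = (LEAST d. Q d)"
    unfolding Q_def by blast
  have least: "Polynomial.degree p \<le> Polynomial.degree r" if "r \<noteq> 0" "poly (map_poly to_ac r) x = 0" for r
    unfolding p(3) by (rule Least_le) (use that Q_def in blast)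
  have mult: "map_poly to_ac (c * e) = map_poly to_ac c * map_poly to_ac e" for c e :: "'k Polynomial.poly"
    by (rule poly_eqI) (simp add: coeff_map_poly coeff_mult to_ac_sum)
  have "Polynomial.degree p > 0"
  proof (rule ccontr)
    assume "\<not> Polynomial.degree p > 0"
    then obtain c where "p = [:c:]" by (metis degree_eq_zeroE gr0I)
    then show False using p by (simp add: map_poly_to_ac_pCons)
  qed
  have "coprime p (pderiv p)"
  proof (rule coprimeI)
    fix c assume c: "c dvd p" "c dvd pderiv p"
    then obtain e where e: "p = c * e" by blast
    have ce: "c \<noteq> 0" "e \<noteq> 0" using p(1) e by auto
    have "poly (map_poly to_ac c) x = 0 \<or> poly (map_poly to_ac e) x = 0" using p(2) unfolding e mult by simp
    then have "Polynomial.degree p \<le> Polynomial.degree c \<or> Polynomial.degree p \<le> Polynomial.degree e"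
      using least ce by blast
    moreover have "Polynomial.degree p = Polynomial.degree c + Polynomial.degree e"
      unfolding e using ce by (rule degree_mult_eq)
    moreover have "Polynomial.degree c < Polynomial.degree p"
    proof -
      have "pderiv p \<noteq> 0" using \<open>Polynomial.degree p > 0\<close> by (auto simp: pderiv_eq_0_iff)
      then have "Polynomial.degree c \<le> Polynomial.degree (pderiv p)" using c(2) by (rule dvd_imp_degree_le[rotated])
      then show ?thesis using \<open>Polynomial.degree p > 0\<close> by (simp add: degree_pderiv)
    qed
    ultimately have "Polynomial.degree c = 0" by linarith
    then show "is_unit c" using ce(1) by (simp add: is_unit_iff_degree)
  qed
  with p(2) show ?thesis by blast
qed

lemma finite_separable_extensionI:
  fixes L0 :: "'k::number_field alg_closure set"
  assumes L0: "finite_field L0" "L \<subseteq> L0" and ac: "\<And>k. to_ac k \<in> L"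
    and ops: "\<And>x y. x \<in> L \<Longrightarrow> y \<in> L \<Longrightarrow> x * y \<in> L" "\<And>x y. x \<in> L \<Longrightarrow> y \<in> L \<Longrightarrow> x + y \<in> L" "\<And>x. x \<in> L \<Longrightarrow> inverse x \<in> L"
  shows "finite_separable_extension L"
proof -
  let ?R = "ring_of_type_algebra :: 'k alg_closure ring"
  interpret R: field ?R by (rule field_from_type_algebra)
  have neg: "- x \<in> L" if "x \<in> L" for x using ops(1)[OF ac[of "- 1"] that] by simp
  have sf: "subfield L ?R"
    by (rule subfield_of_type_algebraI) (use ac[of 1] ops neg in auto)
  have K: "subfield (range to_ac :: 'k alg_closure set) ?R"
  proof (rule subfield_of_type_algebraI)
    show "1 \<in> range (to_ac :: 'k \<Rightarrow> 'k alg_closure)" by (rule range_eqI[of _ _ 1]) simp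
    fix x y :: "'k alg_closure" assume "x \<in> range to_ac" "y \<in> range to_ac"
    then obtain u v where uv: "x = to_ac u" "y = to_ac v" by (elim rangeE)
    show "x * y \<in> range to_ac" by (rule range_eqI[of _ _ "u * v"]) (simp add: uv)
    show "x + y \<in> range to_ac" by (rule range_eqI[of _ _ "u + v"]) (simp add: uv)
  next
    fix x :: "'k alg_closure" assume "x \<in> range to_ac"
    then obtain u where u: "x = to_ac u" by (elim rangeE)
    show "- x \<in> range to_ac" by (rule range_eqI[of _ _ "- u"]) (simp add: u)
    show "inverse x \<in> range to_ac" by (rule range_eqI[of _ _ "inverse u"]) (simp add: u)
  qed
  obtain B where B: "finite B" "L0 = qvs.span B" using finite_fieldD(8)[OF L0(1)] by blast
  obtain bs where bs: "set bs = B" using finite_list[OF B(1)] by blast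
  let ?S = "R.Span (range to_ac) bs"
  have bc: "set bs \<subseteq> carrier ?R" by simp
  interpret S: subalgebra "range to_ac" ?S ?R by (rule R.Span_is_subalgebra[OF K bc])
  have "L0 \<subseteq> ?S"
  proof
    fix x assume "x \<in> L0"
    then have "x \<in> qvs.span B" using B by simp
    then show "x \<in> ?S"
    proof (induction rule: qvs.span_induct_alt)
      case base
      show ?case using S.one_closed by simp
    next
      case (step c b y)
      obtain n d where nd: "c = of_int n / of_int d" using quotient_of_div[of c] by (cases "quotient_of c") auto
      have "to_ac (of_int n / of_int d :: 'k) = (of_int n / of_int d :: 'k alg_closure)"
        unfolding to_ac_divide to_ac_of_int by (rule HOL.refl)
      then have "to_ac (of_rat c :: 'k) = (of_rat c :: 'k alg_closure)"
        unfolding nd of_rat_divide of_rat_of_int_eq .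
      then have c: "of_rat c \<in> range (to_ac :: 'k \<Rightarrow> 'k alg_closure)" by (rule image_eqI[OF HOL.sym UNIV_I])
      have "b \<in> ?S" using R.Span_base_incl[OF K bc] step(1) bs by blast
      from S.smult_closed[OF c this] have "of_rat c * b \<in> ?S" unfolding ring_of_type_algebra_simps .
      from S.m_closed[OF this step(2)] show ?case by simp
    qed
  qed
  then have LS: "L \<subseteq> ?S" using L0(2) by blast
  have "subalgebra (range to_ac) L ?R"
  proof (intro subalgebra.intro subalgebra_axioms.intro)
    have "inv\<^bsub>add_monoid ?R\<^esub> x = - x" for x :: "'k alg_closure"
      using field_of_type_algebra_inv(1)[of x] by (simp add: a_inv_def)
    then show "subgroup L (add_monoid ?R)"
      using ops(2) neg ac[of 0] by unfold_locales auto
    show "k \<otimes>\<^bsub>?R\<^esub> v \<in> L" if "k \<in> range to_ac" "v \<in> L" for k v using that ac ops(1) by auto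
  qed
  then have "R.finite_dimension (range to_ac) L"
    using R.subalbegra_incl_imp_finite_dimension[OF K R.Span_finite_dimension[OF K bc] _ LS] by blast
  then show ?thesis
    unfolding finite_separable_extension_def using sf ac exists_separable_polynomial by auto
qed

section \<open>Componentwise operations in finite products of rings\<close>

lemma RDirProd_list_ops:
  fixes u v :: "'i \<Rightarrow> 'a" and G :: "'i \<Rightarrow> ('a, 'b) ring_scheme"
  assumes "\<And>k. k \<in> set ks \<Longrightarrow> u k \<in> carrier (G k)" "\<And>k. k \<in> set ks \<Longrightarrow> v k \<in> carrier (G k)"
  shows "map u ks \<in> carrier (RDirProd_list (map G ks))"
    "map u ks \<otimes>\<^bsub>RDirProd_list (map G ks)\<^esub> map v ks = map (\<lambda>k. u k \<otimes>\<^bsub>G k\<^esub> v k) ks"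
    "map u ks \<oplus>\<^bsub>RDirProd_list (map G ks)\<^esub> map v ks = map (\<lambda>k. u k \<oplus>\<^bsub>G k\<^esub> v k) ks"
    "\<one>\<^bsub>RDirProd_list (map G ks)\<^esub> = map (\<lambda>k. \<one>\<^bsub>G k\<^esub>) ks"
proof -
  have mem: "map w ks \<in> carrier (RDirProd_list (map G ks))" if "\<And>k. k \<in> set ks \<Longrightarrow> w k \<in> carrier (G k)" for w ks
    by (rule RDirProd_list_carrier_memI) (use that in auto)
  show "map u ks \<in> carrier (RDirProd_list (map G ks))" using mem assms by blast
  have "map u ks \<otimes>\<^bsub>RDirProd_list (map G ks)\<^esub> map v ks = map (\<lambda>k. u k \<otimes>\<^bsub>G k\<^esub> v k) ks \<and>
    map u ks \<oplus>\<^bsub>RDirProd_list (map G ks)\<^esub> map v ks = map (\<lambda>k. u k \<oplus>\<^bsub>G k\<^esub> v k) ks"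
    using assms
  proof (induction ks)
    case Nil
    then show ?case by (simp add: RDirProd_list_def monoid.defs)
  next
    case (Cons k ks)
    let ?P = "RDirProd (G k) (RDirProd_list (map G ks))"
    have iso: "(\<lambda>(a, as). a # as) \<in> ring_hom ?P (RDirProd_list (G k # map G ks))"
      by (rule RDirProd_list_hom1)
    have c: "(w k, map w ks) \<in> carrier ?P" if "\<And>k'. k' \<in> set (k # ks) \<Longrightarrow> w k' \<in> carrier (G k')" for w
      unfolding RDirProd_carrier using that mem[of ks w] by auto
    have P: "(a, as) \<otimes>\<^bsub>?P\<^esub> (b, cs) = (a \<otimes>\<^bsub>G k\<^esub> b, as \<otimes>\<^bsub>RDirProd_list (map G ks)\<^esub> cs)"
      "(a, as) \<oplus>\<^bsub>?P\<^esub> (b, cs) = (a \<oplus>\<^bsub>G k\<^esub> b, as \<oplus>\<^bsub>RDirProd_list (map G ks)\<^esub> cs)" for a as b cs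
      by (simp_all add: RDirProd_def DirProd_def monoid.defs)
    show ?case
      using ring_hom_mult[OF iso c[of u] c[of v]] ring_hom_add[OF iso c[of u] c[of v]] Cons
      by (simp add: P)
  qed
  then show "map u ks \<otimes>\<^bsub>RDirProd_list (map G ks)\<^esub> map v ks = map (\<lambda>k. u k \<otimes>\<^bsub>G k\<^esub> v k) ks"
    "map u ks \<oplus>\<^bsub>RDirProd_list (map G ks)\<^esub> map v ks = map (\<lambda>k. u k \<oplus>\<^bsub>G k\<^esub> v k) ks" by auto
  show "\<one>\<^bsub>RDirProd_list (map G ks)\<^esub> = map (\<lambda>k. \<one>\<^bsub>G k\<^esub>) ks"
    unfolding RDirProd_list_one by (induction ks) auto
qed

section \<open>Finite \<open>\<Lambda>\<close>-rings inside the ghost ring\<close>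

text \<open>The factorization chosen in \<open>psi_ideal\<close> does not depend on the ring, so one
  list of primes describes the composite operator in all rings over \<open>'u\<close>
  simultaneously.\<close>

lemma psi_ideal_witness:
  assumes "a \<in> (nz_ideals :: 'k::number_field set set)"
  obtains ps where "\<And>p. p \<in> set ps \<Longrightarrow> int_prime p" "idl_list ps = a"
    "\<And>E :: ('k, 'u) lring. psi_ideal E a = foldr (psi E) ps"
proof -
  have "\<exists>ps. (\<forall>p\<in>set ps. int_prime p) \<and> idl_list ps = a" using idl_list_exists assms by (auto simp: nz_ideals_iff)
  then have ex: "\<exists>ps. set ps \<subseteq> nz_primes \<and> foldr (ideal_prod ring_of_integers) ps (carrier ring_of_integers) = a"
    by (auto simp: subset_iff nz_primes_iff)
  define ps where "ps = (SOME ps. set ps \<subseteq> nz_primes \<and> foldr (ideal_prod ring_of_integers) ps (carrier ring_of_integers) = a)"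
  have ps: "set ps \<subseteq> nz_primes \<and> foldr (ideal_prod ring_of_integers) ps (carrier ring_of_integers) = a"
    unfolding ps_def using ex by (rule someI_ex)
  show ?thesis
    by (rule that[of ps]) (use ps in \<open>auto simp: psi_ideal_def ps_def nz_primes_iff subset_iff\<close>)
qed

text \<open>Its two instances are a galois object with the map given by its root, and a copy in
  another type of a subalgebra of the ghost ring; both directions of the comparison share what
  follows.\<close>

locale ghost_hom = k_algebra E for E :: "('k::number_field, 'u) lring" (structure) +
  fixes h :: "'u \<Rightarrow> 'k set \<Rightarrow> 'k alg_closure"
  assumes h_closed: "x \<in> carrier E \<Longrightarrow> h x \<in> carrier ghost"
    and h_inj: "inj_on h (carrier E)"
    and h_add: "x \<in> carrier E \<Longrightarrow> y \<in> carrier E \<Longrightarrow> h (x \<oplus> y) = h x \<oplus>\<^bsub>ghost\<^esub> h y"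
    and h_mult: "x \<in> carrier E \<Longrightarrow> y \<in> carrier E \<Longrightarrow> h (x \<otimes> y) = h x \<otimes>\<^bsub>ghost\<^esub> h y"
    and h_scal: "h (scal E k) = scal ghost k"
    and psi_closed: "int_prime p \<Longrightarrow> x \<in> carrier E \<Longrightarrow> psi E p x \<in> carrier E"
    and h_psi: "int_prime p \<Longrightarrow> x \<in> carrier E \<Longrightarrow> h (psi E p x) = psi ghost p (h x)"
begin

lemma h_eqI: "x \<in> carrier E \<Longrightarrow> y \<in> carrier E \<Longrightarrow> (\<And>a. a \<in> nz_ideals \<Longrightarrow> h x a = h y a) \<Longrightarrow> x = y"
  using inj_onD[OF h_inj] ghost_eqI[OF h_closed h_closed] by blast

lemma h_val:
  assumes "a \<in> nz_ideals"
  shows "x \<in> carrier E \<Longrightarrow> y \<in> carrier E \<Longrightarrow> h (x \<oplus> y) a = h x a + h y a"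
    "x \<in> carrier E \<Longrightarrow> y \<in> carrier E \<Longrightarrow> h (x \<otimes> y) a = h x a * h y a"
    "h (scal E k) a = to_ac k" "h \<one> a = 1" "h \<zero> a = 0" "x \<in> carrier E \<Longrightarrow> h (\<ominus> x) a = - h x a"
    "x \<in> carrier E \<Longrightarrow> y \<in> carrier E \<Longrightarrow> h (x \<ominus> y) a = h x a - h y a"
    "x \<in> carrier E \<Longrightarrow> h (x [^] (n::nat)) a = h x a ^ n"
    "int_prime p \<Longrightarrow> x \<in> carrier E \<Longrightarrow> h (psi E p x) a = h x (p \<odot> a)"
proof -
  show ad: "x \<in> carrier E \<Longrightarrow> y \<in> carrier E \<Longrightarrow> h (x \<oplus> y) a = h x a + h y a" for x y
    using assms by (simp add: h_add ghost_ring_simps)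
  show m: "x \<in> carrier E \<Longrightarrow> y \<in> carrier E \<Longrightarrow> h (x \<otimes> y) a = h x a * h y a" for x y
    using assms by (simp add: h_mult ghost_ring_simps)
  show s: "h (scal E k) a = to_ac k" for k using assms by (simp add: h_scal ghost_ring_simps)
  show o: "h \<one> a = 1" using s[of 1] by simp
  show "h \<zero> a = 0" using s[of 0] by simp
  show n: "x \<in> carrier E \<Longrightarrow> h (\<ominus> x) a = - h x a" for x
    using m[OF scal_simps(1)[of "- 1"], of x] s[of "- 1"] uminus_eq_scal[of x] by simp
  show "x \<in> carrier E \<Longrightarrow> y \<in> carrier E \<Longrightarrow> h (x \<ominus> y) a = h x a - h y a"
    using ad[of x "\<ominus> y"] n[of y] by (simp add: a_minus_def)
  show "x \<in> carrier E \<Longrightarrow> h (x [^] n) a = h x a ^ n" for n :: nat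
    by (induction n) (auto simp: o m mult.commute)
  show "int_prime p \<Longrightarrow> x \<in> carrier E \<Longrightarrow> h (psi E p x) a = h x (p \<odot> a)"
    using assms by (simp add: h_psi ghost_ring_simps)
qed

lemma psi_scal: "int_prime p \<Longrightarrow> psi E p (scal E k) = scal E k"
  by (rule h_eqI) (auto simp: psi_closed h_val)

lemma psi_ring_hom: "int_prime p \<Longrightarrow> psi E p \<in> ring_hom E E"
  by (rule ring_hom_memI; (rule psi_closed)?; (rule h_eqI)?) (auto simp: psi_closed h_val)

lemma foldr_psi:
  assumes "\<And>p. p \<in> set ps \<Longrightarrow> int_prime p" "x \<in> carrier E" "b \<in> nz_ideals"
  shows "foldr (psi E) ps x \<in> carrier E" "h (foldr (psi E) ps x) b = h x (idl_list ps \<odot> b)"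
proof -
  have "foldr (psi E) ps x \<in> carrier E \<and> (\<forall>b\<in>nz_ideals. h (foldr (psi E) ps x) b = h x (idl_list ps \<odot> b))"
    using assms(1)
  proof (induction ps)
    case Nil
    have "alg_ints \<odot> b = b" if "b \<in> nz_ideals" for b :: "'k set" using idl_prod_unit[of b b] that by (simp add: nz_ideals_iff)
    then show ?case using assms(2) by simp
  next
    case (Cons p ps)
    then have p: "int_prime p" and ip: "int_ideal p" "int_ideal (idl_list ps)"
      using int_primeD(1) by (auto intro!: int_ideal_list)
    have "h (foldr (psi E) (p # ps) x) b = h x (idl_list (p # ps) \<odot> b)" if b: "b \<in> nz_ideals" for b
    proof -
      have ib: "int_ideal b" using b by (simp add: nz_ideals_iff)
      have "idl_list ps \<odot> (p \<odot> b) = (p \<odot> idl_list ps) \<odot> b"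
        using idl_prod_assoc[OF ip(2,1) ib] idl_prod_commute[OF ip] by simp
      then show ?thesis using Cons p b by (simp add: h_val)
    qed
    then show ?case using Cons p psi_closed by auto
  qed
  then show "foldr (psi E) ps x \<in> carrier E" "h (foldr (psi E) ps x) b = h x (idl_list ps \<odot> b)"
    using assms(3) by auto
qed

lemma h_psi_ideal:
  assumes "a \<in> nz_ideals" "x \<in> carrier E"
  shows "psi_ideal E a x \<in> carrier E" "b \<in> nz_ideals \<Longrightarrow> h (psi_ideal E a x) b = h x (a \<odot> b)"
proof -
  obtain ps where ps: "\<And>p. p \<in> set ps \<Longrightarrow> int_prime p" "idl_list ps = a"
    "\<And>E :: ('k, 'u) lring. psi_ideal E a = foldr (psi E) ps"
    by (rule psi_ideal_witness[OF assms(1)]) blast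
  show "psi_ideal E a x \<in> carrier E" "b \<in> nz_ideals \<Longrightarrow> h (psi_ideal E a x) b = h x (a \<odot> b)"
    using foldr_psi[OF ps(1) assms(2)] ps(2) unfolding ps(3) by auto
qed

lemma h_poly:
  assumes "x \<in> carrier E"
  shows "\<exists>y\<in>carrier E. \<forall>a\<in>nz_ideals. h y a = poly (map_poly to_ac q) (h x a)"
proof (induction q)
  case 0
  show ?case by (intro bexI[of _ "\<zero>"]) (auto simp: h_val)
next
  case (pCons c q)
  then obtain y where "y \<in> carrier E" "\<forall>a\<in>nz_ideals. h y a = poly (map_poly to_ac q) (h x a)" by blast
  then show ?case using assms
    by (intro bexI[of _ "scal E c \<oplus> x \<otimes> y"]) (auto simp: h_val map_poly_to_ac_pCons)
qed

text \<open>An inverse is a K-polynomial in the value, so the image of evaluation at an ideal is a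
  field.\<close>

lemma h_inverse:
  assumes "x \<in> carrier E" "a \<in> nz_ideals" "h x a \<noteq> 0"
  shows "\<exists>y\<in>carrier E. h y a = inverse (h x a)"
proof -
  obtain q where "inverse (h x a) = poly (map_poly to_ac q) (h x a)" using assms(3) by (rule inverse_as_polynomial)
  then show ?thesis using h_poly[OF assms(1), of q] assms(2) by auto
qed

definition max_model :: "'u set" where
  "max_model = {x \<in> carrier E. h x \<in> iwitt}"

lemma max_model_int_subalg: "int_subalg max_model"
  unfolding int_subalg_def max_model_def
  using ghost.int_subalgD[OF iwitt_int_subalg] by (auto simp: h_scal h_add h_mult)

lemma h_frobenius:
  assumes "int_prime p" "x \<in> carrier E"
  shows "h (scal E \<beta> \<otimes> (psi E p x \<ominus> x [^] abs_norm p)) = scal ghost \<beta> \<otimes>\<^bsub>ghost\<^esub> frob_diff p (h x)"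
proof (rule ghost_eqI[OF h_closed])
  show "scal E \<beta> \<otimes> (psi E p x \<ominus> x [^] abs_norm p) \<in> carrier E" using assms psi_closed by simp
  show "scal ghost \<beta> \<otimes>\<^bsub>ghost\<^esub> frob_diff p (h x) \<in> carrier ghost" by (simp add: ghost_ring_simps frob_diff_def restrict_PiE_iff)
  fix a :: "'k set" assume a: "a \<in> nz_ideals"
  then show "h (scal E \<beta> \<otimes> (psi E p x \<ominus> x [^] abs_norm p)) a = (scal ghost \<beta> \<otimes>\<^bsub>ghost\<^esub> frob_diff p (h x)) a"
    using assms psi_closed[OF assms] by (simp add: h_val) (simp add: ghost_ring_simps frob_diff_def)
qed

lemma max_model_frobenius_lift:
  assumes p: "int_prime p" and x: "x \<in> max_model"
  shows "psi E p x \<in> max_model" "frobenius_lift E max_model p x"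
proof -
  have xc: "x \<in> carrier E" and xW: "h x \<in> iwitt" using x by (auto simp: max_model_def)
  show "psi E p x \<in> max_model" using psi_closed[OF p xc] iwitt_psi[OF p xW] by (simp add: max_model_def h_psi[OF p xc])
  show "frobenius_lift E max_model p x"
    unfolding frobenius_lift_def ext_ideal_iff[OF p max_model_int_subalg]
    using psi_closed[OF p xc] xc iwitt_frobenius[OF p xW] by (auto simp: max_model_def h_frobenius[OF p xc])
qed

lemma h_finsum:
  assumes "finite S" "S \<subseteq> carrier E" "a \<in> nz_ideals"
  shows "h (\<Oplus>b\<in>S. scal E (c b) \<otimes> b) a = (\<Sum>b\<in>S. to_ac (c b) * h b a)"
  using assms(1,2)
proof (induction S)
  case empty
  then show ?case using assms(3) by (simp add: h_val)
next
  case (insert b S)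
  have S: "(\<lambda>b. scal E (c b) \<otimes> b) \<in> S \<rightarrow> carrier E" "b \<in> carrier E" using insert.prems by auto
  then have "(\<Oplus>b\<in>insert b S. scal E (c b) \<otimes> b) = scal E (c b) \<otimes> b \<oplus> (\<Oplus>b\<in>S. scal E (c b) \<otimes> b)"
    using insert.hyps by (intro finsum_insert) auto
  then show ?case using insert assms(3) S finsum_closed[OF S(1)] by (simp add: h_val)
qed

text \<open>The image of the model meets the criterion \<open>iwitt_frobeniusI\<close>. At each
  ideal the values of the generators form an eigenvector of the matrix of multiplication by
  \<open>x\<close>, nonzero because 1 is a combination of generators; this gives integrality. One
  matrix serves all ideals, so all values of \<open>x\<close> are roots of one polynomial and finite
  in number.\<close>

lemma integral_model_subset:
  assumes A: "integral_model E A"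
  shows "A \<subseteq> max_model"
proof -
  have IA: "int_subalg A" using A unfolding integral_model_def int_subalg_iff by simp
  note AD = int_subalgD[OF IA]
  obtain B where B: "B \<subseteq> A" "finite B" "\<forall>x\<in>A. \<exists>c\<in>B \<rightarrow> alg_ints. x = (\<Oplus>b\<in>B. scal E (c b) \<otimes> b)"
    using A unfolding integral_model_def by auto
  have frob: "frobenius_lift E A p x" if p: "int_prime p" and x: "x \<in> A" for p :: "'k set" and x
  proof -
    have "p \<in> nz_primes" using p by (simp add: nz_primes_iff)
    then show ?thesis using A x unfolding integral_model_def by blast
  qed
  have Bc: "b \<in> carrier E" if "b \<in> B" for b using that B(1) AD(1) by blast
  have BE: "B \<subseteq> carrier E" using Bc by blast
  note h_sum = h_finsum[OF B(2) BE]
  obtain c1 where c1: "\<one> = (\<Oplus>b\<in>B. scal E (c1 b) \<otimes> b)" using B(3) AD(6) by blast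
  have nonzero: "\<exists>b\<in>B. h b a \<noteq> 0" if a: "a \<in> nz_ideals" for a
  proof (rule ccontr)
    assume "\<not> ?thesis"
    then have "h \<one> a = 0" using c1 h_sum[OF a, of c1] by simp
    then show False using a by (simp add: h_val)
  qed
  have int: "(\<forall>a\<in>nz_ideals. h x a \<in> alg_ints) \<and> finite (h x ` nz_ideals)" if xA: "x \<in> A" for x
  proof -
    have "\<exists>c\<in>B \<rightarrow> alg_ints. x \<otimes> b = (\<Oplus>b'\<in>B. scal E (c b') \<otimes> b')" if "b \<in> B" for b
      using B(1,3) AD(4) xA that by blast
    then have "\<forall>b\<in>B. \<exists>c. c \<in> B \<rightarrow> alg_ints \<and> x \<otimes> b = (\<Oplus>b'\<in>B. scal E (c b') \<otimes> b')" by blast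
    from bchoice[OF this] obtain c where "\<forall>b\<in>B. c b \<in> B \<rightarrow> alg_ints \<and> x \<otimes> b = (\<Oplus>b'\<in>B. scal E (c b b') \<otimes> b')" ..
    then have c: "c b \<in> B \<rightarrow> alg_ints" "x \<otimes> b = (\<Oplus>b'\<in>B. scal E (c b b') \<otimes> b')" if "b \<in> B" for b using that by auto
    have eigen: "h x a * h b a = (\<Sum>b'\<in>B. to_ac (c b b') * h b' a)" if "b \<in> B" "a \<in> nz_ideals" for a b
      using arg_cong[OF c(2)[OF that(1)], of "\<lambda>y. h y a"] h_sum[OF that(2), of "c b"] AD(1)[OF xA] Bc[OF that(1)] that(2)
      by (simp add: h_val)
    have "algebraic_int (h x a)" if a: "a \<in> nz_ideals" for a
    proof (rule algebraic_int_if_fin_gen_stable[of B "\<lambda>b. h b a" "\<lambda>b b'. to_ac (c b b')"])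
      show "algebraic_int (to_ac (c b b'))" if "b \<in> B" "b' \<in> B" for b b'
        using c(1)[OF that(1)] that(2) algebraic_int_to_ac_iff[of "c b b'"] unfolding alg_ints_def by auto
    qed (rule B(2) nonzero[OF a] eigen[OF _ a]; assumption?)+
    moreover obtain p where p: "p \<noteq> 0" "\<And>x v. \<exists>b\<in>B. v b \<noteq> 0 \<Longrightarrow> (\<And>b. b \<in> B \<Longrightarrow> x * v b = (\<Sum>b'\<in>B. to_ac (c b b') * v b')) \<Longrightarrow> poly p x = 0"
    proof (rule common_polynomial_of_eigenvalues[OF B(2), of "\<lambda>b b'. to_ac (c b b')"])
      fix p assume p: "p \<noteq> 0" "\<And>x v. \<exists>b\<in>B. v b \<noteq> 0 \<Longrightarrow> (\<And>b. b \<in> B \<Longrightarrow> x * v b = (\<Sum>b'\<in>B. to_ac (c b b') * v b')) \<Longrightarrow> poly p x = 0"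
      show thesis by (rule that[OF p])
    qed
    have "h x ` nz_ideals \<subseteq> {z. poly p z = 0}"
    proof (rule image_subsetI, rule CollectI)
      fix a :: "'k set" assume a: "a \<in> nz_ideals"
      show "poly p (h x a) = 0" by (rule p(2)[of "\<lambda>b. h b a"]) (rule nonzero[OF a] eigen[OF _ a]; assumption?)+
    qed
    then have "finite (h x ` nz_ideals)" by (rule finite_subset) (rule poly_roots_finite[OF p(1)])
    ultimately show ?thesis by (simp add: alg_ints_def)
  qed
  have "h ` A \<subseteq> iwitt"
  proof (rule iwitt_frobeniusI)
    show "ghost.int_subalg (h ` A)"
      unfolding ghost.int_subalg_def
    proof (intro conjI ballI)
      show "h ` A \<subseteq> carrier ghost" using AD(1) h_closed by blast
      show "scal ghost ` alg_ints \<subseteq> h ` A"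
      proof (rule image_subsetI)
        fix k :: 'k assume "k \<in> alg_ints"
        then show "scal ghost k \<in> h ` A" unfolding h_scal[symmetric] by (intro imageI AD(2))
      qed
      fix x y assume "x \<in> h ` A" "y \<in> h ` A"
      then obtain u v where uv: "u \<in> A" "x = h u" "v \<in> A" "y = h v" by (elim imageE)
      note c = AD(1)[OF uv(1)] AD(1)[OF uv(3)]
      show "x \<oplus>\<^bsub>ghost\<^esub> y \<in> h ` A" unfolding uv(2,4) h_add[OF c, symmetric] by (rule imageI[OF AD(3)[OF uv(1,3)]])
      show "x \<otimes>\<^bsub>ghost\<^esub> y \<in> h ` A" unfolding uv(2,4) h_mult[OF c, symmetric] by (rule imageI[OF AD(4)[OF uv(1,3)]])
    qed
    show "scal ghost \<beta> \<otimes>\<^bsub>ghost\<^esub> frob_diff p \<xi> \<in> h ` A"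
      if x: "\<xi> \<in> h ` A" and p: "int_prime p" and \<beta>: "\<beta> \<in> prime_inv p" for \<xi> p \<beta>
    proof -
      obtain x where xA: "x \<in> A" "\<xi> = h x" using x by blast
      have "scal E \<beta> \<otimes> (psi E p x \<ominus> x [^] abs_norm p) \<in> A"
        using frob[OF p xA(1)] \<beta> unfolding frobenius_lift_def ext_ideal_iff[OF p IA] by blast
      then show ?thesis unfolding xA(2) h_frobenius[OF p AD(1)[OF xA(1)], symmetric] by (rule imageI)
    qed
  qed (use int AD(1) h_closed in auto)
  then show ?thesis using AD(1) by (auto simp: max_model_def)
qed

end

text \<open>The finiteness of an object of the category, seen in the ghost ring: every evaluation
  agrees with one at an ideal of the finite set \<open>R\<close>, and all values lie in a finite
  extension \<open>L\<close>.\<close>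

locale finite_ghost_hom = ghost_hom E h for E :: "('k::number_field, 'u) lring" (structure) and h +
  fixes R :: "'k set set" and L :: "'k alg_closure set"
  assumes h_sat: "x \<in> carrier E \<Longrightarrow> h x \<in> ghost.saturation iwitt"
    and R: "finite R" "R \<subseteq> nz_ideals" "\<And>b. b \<in> nz_ideals \<Longrightarrow> \<exists>r\<in>R. \<forall>x\<in>carrier E. h x b = h x r"
    and L: "finite_field L" "\<And>x b. x \<in> carrier E \<Longrightarrow> b \<in> nz_ideals \<Longrightarrow> h x b \<in> L"

context ghost_hom
begin

text \<open>A positive multiple of any element is a combination of the finitely many generators of
  the model. These have finitely many values, so only finitely many patterns of values occur, and
  \<open>R\<close> contains an ideal for each.\<close>

lemma finite_ghost_hom_of_integral_model:
  assumes A: "integral_model E A"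
  shows "\<exists>R L. finite_ghost_hom E h R L"
proof -
  have IA: "int_subalg A" using A unfolding integral_model_def int_subalg_iff by simp
  note AD = int_subalgD[OF IA]
  note AM = integral_model_subset[OF A]
  obtain B where B: "B \<subseteq> A" "finite B" "\<forall>x\<in>A. \<exists>c\<in>B \<rightarrow> alg_ints. x = (\<Oplus>b\<in>B. scal E (c b) \<otimes> b)"
    using A unfolding integral_model_def by auto
  have BE: "B \<subseteq> carrier E" using B(1) AD(1) by blast
  have bij: "bij_betw (scalar_mult_map E) (carrier (base_change (restr A))) (carrier E)"
    using A unfolding integral_model_def by (elim conjE)
  have "saturation A = carrier E"
    using bij_betw_imp_surj_on[OF scalar_mult_map_bij[OF IA]] bij_betw_imp_surj_on[OF bij] by (simp only:)
  then have sat: "\<exists>n::nat. n > 0 \<and> scal E (of_nat n) \<otimes> x \<in> A" if "x \<in> carrier E" for x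
    using that unfolding saturation_def by blast
  have comb: "\<exists>n c. (n::nat) > 0 \<and> (\<forall>a\<in>nz_ideals. of_nat n * h x a = (\<Sum>b\<in>B. to_ac (c b) * h b a))" if x: "x \<in> carrier E" for x
  proof -
    obtain n :: nat where n: "n > 0" "scal E (of_nat n) \<otimes> x \<in> A" using sat[OF x] by blast
    obtain c where c: "scal E (of_nat n) \<otimes> x = (\<Oplus>b\<in>B. scal E (c b) \<otimes> b)" using B(3) n(2) by blast
    have "of_nat n * h x a = (\<Sum>b\<in>B. to_ac (c b) * h b a)" if "a \<in> nz_ideals" for a
      using h_finsum[OF B(2) BE that, of c] x that unfolding c[symmetric] by (simp add: h_val)
    then show ?thesis using n(1) by blast
  qed
  have fin: "finite (h b ` nz_ideals)" if "b \<in> B" for b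
    using that B(1) AM unfolding max_model_def iwitt_iff by blast
  define g where "g a = (\<lambda>b\<in>B. h b a)" for a
  have "g ` nz_ideals \<subseteq> (\<Pi>\<^sub>E b\<in>B. h b ` nz_ideals)" by (auto simp: g_def restrict_apply)
  then have "finite (g ` nz_ideals)" by (rule finite_subset) (intro finite_PiE B(2) fin)
  from finite_subset_image[OF this subset_refl] obtain R where R: "R \<subseteq> nz_ideals" "finite R" "g ` nz_ideals = g ` R" by blast
  have "finite (\<Union>b\<in>B. h b ` nz_ideals)" using B(2) fin by blast
  then obtain L where L: "finite_field L" "(\<Union>b\<in>B. h b ` nz_ideals) \<subseteq> L" by (rule finite_field_containing)
  have "finite_ghost_hom_axioms E h R L"
  proof
    fix x assume x: "x \<in> carrier E"
    obtain n :: nat where n: "n > 0" "scal E (of_nat n) \<otimes> x \<in> A" using sat[OF x] by blast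
    then have "scal ghost (of_nat n) \<otimes>\<^bsub>ghost\<^esub> h x \<in> iwitt"
      using AM x by (auto simp: max_model_def h_mult h_scal)
    then show "h x \<in> ghost.saturation iwitt" using n(1) h_closed[OF x] unfolding ghost.saturation_def by blast
  next
    show "finite R" "R \<subseteq> nz_ideals" "finite_field L" by fact+
    fix b :: "'k set" assume b: "b \<in> nz_ideals"
    then obtain r where r: "r \<in> R" "g b = g r" using R(3) by blast
    have eq: "h b' b = h b' r" if "b' \<in> B" for b' using fun_cong[OF r(2), of b'] that by (simp add: g_def)
    have "h x b = h x r" if x: "x \<in> carrier E" for x
    proof -
      obtain n c where n: "(n::nat) > 0" "\<And>a. a \<in> nz_ideals \<Longrightarrow> of_nat n * h x a = (\<Sum>b\<in>B. to_ac (c b) * h b a)"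
        using comb[OF x] by blast
      have "of_nat n * h x b = of_nat n * h x r" using n(2)[OF b] n(2)[of r] R(1) r(1) eq by auto
      then show ?thesis using n(1) by simp
    qed
    then show "\<exists>r\<in>R. \<forall>x\<in>carrier E. h x b = h x r" using r(1) by blast
  next
    fix x and a :: "'k set" assume x: "x \<in> carrier E" and a: "a \<in> nz_ideals"
    obtain n c where n: "(n::nat) > 0" "of_nat n * h x a = (\<Sum>b\<in>B. to_ac (c b) * h b a)"
      using comb[OF x] a by blast
    have Lsum: "(\<Sum>b\<in>S. to_ac (c b) * h b a) \<in> L" if "finite S" "S \<subseteq> B" for S
      using that
    proof (induction S)
      case (insert b S)
      have "to_ac (c b) * h b a \<in> L" using insert.prems L(2) a by (intro finite_fieldD(1,2)[OF L(1)]) blast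
      then show ?case using insert finite_fieldD(3)[OF L(1)] by simp
    qed (simp add: finite_fieldD(6)[OF L(1)])
    have "inverse (to_ac (of_nat n)) * (of_nat n * h x a) \<in> L"
      unfolding n(2) by (intro finite_fieldD(1,2,4)[OF L(1)] Lsum B(2) subset_refl)
    then show "h x a \<in> L" using n(1) by (simp add: mult.assoc[symmetric])
  qed
  then show ?thesis using ghost_hom_axioms by (intro exI[of _ R] exI[of _ L] finite_ghost_hom.intro)
qed

end

section \<open>The maximal integral model\<close>

context finite_ghost_hom
begin

lemma R_nz: "r \<in> R \<Longrightarrow> r \<in> nz_ideals" using R(2) by blast

lemma h_R_eqI: "x \<in> carrier E \<Longrightarrow> y \<in> carrier E \<Longrightarrow> (\<And>r. r \<in> R \<Longrightarrow> h x r = h y r) \<Longrightarrow> x = y"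
  using R(3) by (intro h_eqI) metis+

lemma max_model_saturation: "saturation max_model = carrier E"
proof
  show "saturation max_model \<subseteq> carrier E" by (auto simp: saturation_def)
  show "carrier E \<subseteq> saturation max_model"
  proof
    fix x assume x: "x \<in> carrier E"
    then obtain n where n: "n > 0" "scal ghost (of_nat n) \<otimes>\<^bsub>ghost\<^esub> h x \<in> iwitt"
      using h_sat[OF x] unfolding ghost.saturation_def by blast
    then have "scal E (of_nat n) \<otimes> x \<in> max_model" using x by (simp add: max_model_def h_mult h_scal)
    then show "x \<in> saturation max_model" using n(1) x unfolding saturation_def by blast
  qed
qed

text \<open>The coordinates are trace coordinates of the values at the ideals in \<open>R\<close>,
  which separate elements because \<open>R\<close> represents all evaluations. Taking for
  \<open>H\<close> the combinations of \<open>B\<close> over the integers of K passes from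
  generation as a group to generation as a module.\<close>

lemma max_model_finitely_generated:
  "\<exists>B\<subseteq>max_model. finite B \<and> (\<forall>x\<in>max_model. \<exists>c\<in>B \<rightarrow> alg_ints. x = (\<Oplus>b\<in>B. scal E (c b) \<otimes> b))"
proof -
  note AD = int_subalgD[OF max_model_int_subalg]
  obtain B0 where B0: "finite B0" "L = qvs.span B0" using finite_fieldD(8)[OF L(1)] by blast
  obtain C0 :: "('k alg_closure \<Rightarrow> int) set" where C0: "finite C0"
    "\<And>c x y. c \<in> C0 \<Longrightarrow> x \<in> L \<Longrightarrow> y \<in> L \<Longrightarrow> algebraic_int x \<Longrightarrow> algebraic_int y \<Longrightarrow> c (x + y) = c x + c y"
    "\<And>x. x \<in> L \<Longrightarrow> algebraic_int x \<Longrightarrow> (\<And>c. c \<in> C0 \<Longrightarrow> c x = 0) \<Longrightarrow> x = 0"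
  proof (rule integral_coordinates[OF B0(2,1) finite_fieldD(7)[OF L(1)] finite_fieldD(2)[OF L(1)] finite_fieldD(4)[OF L(1)]])
    fix C :: "('k alg_closure \<Rightarrow> int) set" assume C: "finite C"
      "\<And>c x y. c \<in> C \<Longrightarrow> x \<in> L \<Longrightarrow> y \<in> L \<Longrightarrow> algebraic_int x \<Longrightarrow> algebraic_int y \<Longrightarrow> c (x + y) = c x + c y"
      "\<And>x. x \<in> L \<Longrightarrow> algebraic_int x \<Longrightarrow> (\<And>c. c \<in> C \<Longrightarrow> c x = 0) \<Longrightarrow> x = 0"
    show thesis by (rule that[OF C])
  qed
  define C where "C = (\<lambda>(c, r) x. c (h x r)) ` (C0 \<times> R)"
  have val: "h x r \<in> L" "algebraic_int (h x r)" if "x \<in> max_model" "r \<in> R" for x r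
    using that L(2)[of x r] R_nz iwitt_values[of "h x" r] by (auto simp: max_model_def alg_ints_def)
  have Cadd: "c (x \<oplus> y) = c x + c y" if cxy: "c \<in> C" "x \<in> max_model" "y \<in> max_model" for c x y
  proof -
    obtain c' r where c: "c' \<in> C0" "r \<in> R" "c = (\<lambda>x. c' (h x r))" using cxy(1) unfolding C_def by auto
    show ?thesis unfolding c(3) using cxy(2,3) AD(1) R_nz[OF c(2)] C0(2)[OF c(1)] val c(2) by (simp add: h_val)
  qed
  have C_zero: "c \<zero> = 0" if "c \<in> C" for c using Cadd[OF that AD(5) AD(5)] by simp
  have Cneg: "c (\<ominus> x) = - c x" if "c \<in> C" "x \<in> max_model" for c x
    using Cadd[OF that(1,2) AD(7)[OF that(2)]] C_zero[OF that(1)] AD(1)[OF that(2)] by (simp add: r_neg)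
  have Cinj: "x = y" if xy: "x \<in> max_model" "y \<in> max_model" and eq: "\<And>c. c \<in> C \<Longrightarrow> c x = c y" for x y
  proof (rule h_R_eqI)
    fix r assume r: "r \<in> R"
    have mem: "x \<ominus> y \<in> max_model" using AD(8) xy by blast
    have "h (x \<ominus> y) r = 0"
    proof (rule C0(3)[OF val[OF mem r]])
      fix c assume c: "c \<in> C0"
      have cC: "(\<lambda>x. c (h x r)) \<in> C" unfolding C_def using c r by force
      have "c (h (x \<ominus> y) r) = c (h x r) - c (h y r)"
        using Cadd[OF cC xy(1) AD(7)[OF xy(2)]] Cneg[OF cC xy(2)] by (simp add: a_minus_def)
      then show "c (h (x \<ominus> y) r) = 0" using eq[OF cC] by simp
    qed
    then show "h x r = h y r" using h_val(7)[OF R_nz[OF r]] AD(1) xy by simp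
  qed (use xy AD(1) in auto)
  have "finite C" unfolding C_def using C0(1) R(1) by simp
  then have "\<exists>B\<subseteq>max_model. finite B \<and> (\<forall>H. \<zero> \<in> H \<longrightarrow> B \<subseteq> H \<longrightarrow> (\<forall>x\<in>H. \<forall>y\<in>H. x \<oplus> y \<in> H) \<longrightarrow>
    (\<forall>x\<in>H. \<ominus> x \<in> H) \<longrightarrow> max_model \<subseteq> H)"
    by (rule finitely_generated_by_coordinates[where C = C]) (fact AD(5) AD(3) AD(7) C_zero Cadd Cneg Cinj)+
  then obtain B where B: "B \<subseteq> max_model" "finite B" "\<forall>H. \<zero> \<in> H \<longrightarrow> B \<subseteq> H \<longrightarrow> (\<forall>x\<in>H. \<forall>y\<in>H. x \<oplus> y \<in> H) \<longrightarrow>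
    (\<forall>x\<in>H. \<ominus> x \<in> H) \<longrightarrow> max_model \<subseteq> H" by (elim exE conjE)
  define H where "H = {x. \<exists>c\<in>B \<rightarrow> alg_ints. x = (\<Oplus>b\<in>B. scal E (c b) \<otimes> b)}"
  have Bc: "b \<in> carrier E" if "b \<in> B" for b using that B(1) AD(1) by blast
  have tc: "(\<lambda>b. scal E (c b) \<otimes> b) \<in> B \<rightarrow> carrier E" for c using Bc by auto
  have "max_model \<subseteq> H"
  proof (rule B(3)[rule_format])
    have "(\<Oplus>b\<in>B. scal E 0 \<otimes> b) = \<zero>" using Bc by (intro finsum_all0) auto
    then show "\<zero> \<in> H" unfolding H_def by (intro CollectI bexI[of _ "\<lambda>b. 0"]) auto
    show "B \<subseteq> H"
    proof
      fix b assume b: "b \<in> B"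
      have "(\<Oplus>b'\<in>B. scal E (if b = b' then 1 else 0) \<otimes> b') = (\<Oplus>b'\<in>B. if b = b' then b' else \<zero>)"
        using Bc by (intro finsum_cong') auto
      also have "\<dots> = b" using b B(2) Bc by (intro finsum_singleton[of b B "\<lambda>x. x"]) auto
      finally show "b \<in> H" unfolding H_def by (intro CollectI bexI[of _ "\<lambda>b'. if b = b' then 1 else 0"]) auto
    qed
    fix x assume "x \<in> H"
    then obtain c where c: "c \<in> B \<rightarrow> alg_ints" "x = (\<Oplus>b\<in>B. scal E (c b) \<otimes> b)" unfolding H_def by blast
    {
      fix y assume "y \<in> H"
      then obtain d where d: "d \<in> B \<rightarrow> alg_ints" "y = (\<Oplus>b\<in>B. scal E (d b) \<otimes> b)" unfolding H_def by blast
      have "(\<Oplus>b\<in>B. scal E (c b + d b) \<otimes> b) = (\<Oplus>b\<in>B. scal E (c b) \<otimes> b \<oplus> scal E (d b) \<otimes> b)"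
        using Bc by (intro finsum_cong') (auto simp: l_distr)
      also have "\<dots> = x \<oplus> y" unfolding c(2) d(2) by (rule finsum_addf[OF tc tc])
      finally show "x \<oplus> y \<in> H" unfolding H_def using c(1) d(1) by (intro CollectI bexI[of _ "\<lambda>b. c b + d b"]) auto
    }
    have xc: "x \<in> carrier E" unfolding c(2) by (rule finsum_closed[OF tc])
    have "\<ominus> x = (\<Oplus>b\<in>B. scal E (- 1) \<otimes> (scal E (c b) \<otimes> b))"
      unfolding uminus_eq_scal[OF xc] unfolding c(2) by (rule finsum_rdistr[OF B(2) _ tc]) simp
    also have "\<dots> = (\<Oplus>b\<in>B. scal E (- c b) \<otimes> b)"
      using Bc by (intro finsum_cong') (auto simp: scal_assoc simp del: scal_simps(3))
    finally show "\<ominus> x \<in> H" unfolding H_def using c(1) by (intro CollectI bexI[of _ "\<lambda>b. - c b"]) auto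
  qed
  then show ?thesis using B(1,2) unfolding H_def by (intro exI[of _ B]) blast
qed

lemma integral_model_max_model: "integral_model E max_model"
proof -
  have "subring max_model E" "scal E ` alg_ints \<subseteq> max_model" using max_model_int_subalg int_subalg_iff by auto
  moreover have "bij_betw (scalar_mult_map E) (carrier (base_change (restr max_model))) (carrier E)"
    using scalar_mult_map_bij[OF max_model_int_subalg] by (simp add: max_model_saturation)
  ultimately show ?thesis
    unfolding integral_model_def
    using max_model_finitely_generated max_model_frobenius_lift by (auto simp: nz_primes_iff)
qed

lemma maximal_integral_model_eq: "maximal_integral_model E = restr max_model"
proof -
  have "(GREATEST A. integral_model E A) = max_model"
    by (rule Greatest_equality) (rule integral_model_max_model, rule integral_model_subset)
  then show ?thesis by (simp add: maximal_integral_model_def)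
qed

section \<open>The splitting into fields and the points of an object\<close>

definition ker_at :: "'k set \<Rightarrow> 'u set" where
  "ker_at r = {x \<in> carrier E. h x r = 0}"

text \<open>The kernels are maximal ideals, as the images of evaluations are fields. An element
  lying in only one of them is normalized by an inverse value \<open>y\<close>, or replaced by
  \<open>1 - x y\<close> if it lies in the wrong one.\<close>

lemma separating_element:
  assumes r: "r \<in> R" "r' \<in> R" "ker_at r \<noteq> ker_at r'"
  shows "\<exists>e\<in>carrier E. h e r = 1 \<and> h e r' = 0"
proof -
  have nz: "r \<in> nz_ideals" "r' \<in> nz_ideals" using r R_nz by auto
  consider x where "x \<in> ker_at r'" "x \<notin> ker_at r" | x where "x \<in> ker_at r" "x \<notin> ker_at r'" using r(3) by blast
  then show ?thesis
  proof cases
    case 1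
    then have x: "x \<in> carrier E" "h x r' = 0" "h x r \<noteq> 0" by (auto simp: ker_at_def)
    obtain y where y: "y \<in> carrier E" "h y r = inverse (h x r)" using h_inverse[OF x(1) nz(1) x(3)] by blast
    show ?thesis using x y nz by (intro bexI[of _ "x \<otimes> y"]) (auto simp: h_val)
  next
    case 2
    then have x: "x \<in> carrier E" "h x r = 0" "h x r' \<noteq> 0" by (auto simp: ker_at_def)
    obtain y where y: "y \<in> carrier E" "h y r' = inverse (h x r')" using h_inverse[OF x(1) nz(2) x(3)] by blast
    show ?thesis using x y nz by (intro bexI[of _ "\<one> \<ominus> x \<otimes> y"]) (auto simp: h_val)
  qed
qed

lemma crt:
  assumes S: "finite S" "S \<subseteq> R" "inj_on ker_at S" and xx: "\<And>r. r \<in> S \<Longrightarrow> xx r \<in> carrier E"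
  shows "\<exists>y\<in>carrier E. \<forall>r\<in>S. h y r = h (xx r) r"
proof -
  have SR: "r \<in> R" "r \<in> nz_ideals" if "r \<in> S" for r using that S(2) R_nz by auto
  have e: "\<exists>e\<in>carrier E. h e r = 1 \<and> (\<forall>r'\<in>T. h e r' = 0)" if T: "finite T" "T \<subseteq> S" "r \<in> S" "r \<notin> T" for r T
    using T
  proof (induction T)
    case empty
    then show ?case using SR by (intro bexI[of _ "\<one>"]) (auto simp: h_val)
  next
    case (insert r' T)
    then obtain e where e: "e \<in> carrier E" "h e r = 1" "\<forall>r'\<in>T. h e r' = 0" by auto
    have "ker_at r \<noteq> ker_at r'" using insert.prems S(3) by (auto dest: inj_onD)
    then obtain e' where e': "e' \<in> carrier E" "h e' r = 1" "h e' r' = 0"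
      using separating_element[of r r'] SR insert.prems by blast
    show ?case using e e' insert.prems SR by (intro bexI[of _ "e \<otimes> e'"]) (auto simp: h_val)
  qed
  have "\<exists>y\<in>carrier E. (\<forall>r\<in>T. h y r = h (xx r) r) \<and> (\<forall>r\<in>S - T. h y r = 0)" if T: "finite T" "T \<subseteq> S" for T
    using T
  proof (induction T)
    case empty
    then show ?case using SR by (intro bexI[of _ "\<zero>"]) (auto simp: h_val)
  next
    case (insert t T)
    then obtain y where y: "y \<in> carrier E" "\<forall>r\<in>T. h y r = h (xx r) r" "\<forall>r\<in>S - T. h y r = 0" by auto
    obtain f where f: "f \<in> carrier E" "h f t = 1" "\<forall>r'\<in>S - {t}. h f r' = 0"
      using e[of "S - {t}" t] S(1) insert.prems by auto
    have t: "xx t \<in> carrier E" "t \<in> S" using insert.prems xx by auto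
    have fT: "h f r = 0" if "r \<in> T" for r using f(3) that insert.prems insert.hyps by blast
    show ?case
      using y f t fT insert.prems insert.hyps SR by (intro bexI[of _ "y \<oplus> f \<otimes> xx t"]) (auto simp: h_val)
  qed
  from this[OF S(1) subset_refl] show ?thesis by blast
qed

text \<open>Evaluations with different values may have the same kernel, so \<open>S\<close> keeps
  one ideal for each kernel. Evaluation at \<open>S\<close> is injective, since vanishing at an
  ideal depends only on the kernel, and surjective by the Chinese remainder theorem.\<close>

lemma finite_etale_E: "finite_etale E"
proof -
  define rk where "rk = inv_into R ker_at"
  have rk: "rk k \<in> R" "ker_at (rk k) = k" if "k \<in> ker_at ` R" for k
    using that unfolding rk_def by (rule inv_into_into, rule f_inv_into_f)
  define S where "S = rk ` ker_at ` R"
  have S: "finite S" "S \<subseteq> R" "inj_on ker_at S"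
    using R(1) rk by (auto simp: S_def inj_on_def)
  have cover: "\<exists>s\<in>S. ker_at s = ker_at r" if "r \<in> R" for r
    using that rk(2)[of "ker_at r"] unfolding S_def by blast
  have SN: "s \<in> nz_ideals" if "s \<in> S" for s using that S(2) R_nz by blast
  obtain ss where ss: "set ss = S" "distinct ss" using finite_distinct_list[OF S(1)] by blast
  define LL where "LL s = (\<lambda>x. h x s) ` carrier E" for s
  define G where "G s = (ring_of_type_algebra :: 'k alg_closure ring)\<lparr>carrier := LL s\<rparr>" for s
  have Gs: "carrier (G s) = LL s" "x \<otimes>\<^bsub>G s\<^esub> y = x * y" "x \<oplus>\<^bsub>G s\<^esub> y = x + y" "\<one>\<^bsub>G s\<^esub> = 1" for s x y
    by (simp_all add: G_def ring_of_type_algebra_def)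
  define f where "f x = map (\<lambda>s. h x s) ss" for x
  let ?P = "RDirProd_list (map G ss)"
  have mem: "h x s \<in> carrier (G s)" if "x \<in> carrier E" for x s using that by (auto simp: Gs LL_def)
  have hom: "f \<in> ring_hom E ?P"
  proof (rule ring_hom_memI)
    fix x y assume xy: "x \<in> carrier E" "y \<in> carrier E"
    note ops = RDirProd_list_ops[of ss "\<lambda>s. h x s" G "\<lambda>s. h y s", OF mem[OF xy(1)] mem[OF xy(2)]]
    show "f x \<in> carrier ?P" unfolding f_def by (rule ops(1))
    show "f (x \<otimes> y) = f x \<otimes>\<^bsub>?P\<^esub> f y" unfolding f_def ops(2) using xy SN ss(1) by (auto simp: h_val Gs)
    show "f (x \<oplus> y) = f x \<oplus>\<^bsub>?P\<^esub> f y" unfolding f_def ops(3) using xy SN ss(1) by (auto simp: h_val Gs)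
  next
    note ops = RDirProd_list_ops(4)[of ss "\<lambda>s. h \<one> s" G "\<lambda>s. h \<one> s", OF mem[OF one_closed] mem[OF one_closed]]
    show "f \<one> = \<one>\<^bsub>?P\<^esub>" unfolding f_def ops using SN ss(1) by (auto simp: h_val Gs)
  qed
  have "inj_on f (carrier E)"
  proof (rule inj_onI)
    fix x y assume xy: "x \<in> carrier E" "y \<in> carrier E" "f x = f y"
    have eq: "h x s = h y s" if "s \<in> S" for s using xy(3) that ss(1) by (auto simp: f_def)
    show "x = y"
    proof (rule h_R_eqI[OF xy(1,2)])
      fix r assume r: "r \<in> R"
      obtain s where s: "s \<in> S" "ker_at s = ker_at r" using cover[OF r] by blast
      have "x \<ominus> y \<in> ker_at s" using eq[OF s(1)] xy SN[OF s(1)] by (simp add: ker_at_def h_val)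
      then have "h (x \<ominus> y) r = 0" unfolding s(2) by (simp add: ker_at_def)
      then show "h x r = h y r" using xy R_nz[OF r] by (simp add: h_val)
    qed
  qed
  moreover have "f ` carrier E = carrier ?P"
  proof
    show "f ` carrier E \<subseteq> carrier ?P" using ring_hom_closed[OF hom] by blast
    show "carrier ?P \<subseteq> f ` carrier E"
    proof
      fix w assume w: "w \<in> carrier ?P"
      have len: "length w = length ss" using RDirProd_list_carrier_mem(1)[OF w] by simp
      have wi: "w ! i \<in> LL (ss ! i)" if "i < length ss" for i
        using RDirProd_list_carrier_mem(2)[OF w, of i] that by (simp add: Gs)
      have "\<exists>x\<in>carrier E. h x s = w ! (SOME i. i < length ss \<and> ss ! i = s)" if s: "s \<in> S" for s
      proof -
        have "\<exists>i. i < length ss \<and> ss ! i = s" using s ss(1) by (metis in_set_conv_nth)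
        then have "(SOME i. i < length ss \<and> ss ! i = s) < length ss \<and> ss ! (SOME i. i < length ss \<and> ss ! i = s) = s"
          by (rule someI_ex)
        then show ?thesis using wi[of "SOME i. i < length ss \<and> ss ! i = s"] by (auto simp: LL_def)
      qed
      then have "\<forall>s\<in>S. \<exists>x. x \<in> carrier E \<and> h x s = w ! (SOME i. i < length ss \<and> ss ! i = s)" by blast
      from bchoice[OF this] obtain xx where xx': "\<forall>s\<in>S. xx s \<in> carrier E \<and> h (xx s) s = w ! (SOME i. i < length ss \<and> ss ! i = s)" ..
      then have xx: "xx s \<in> carrier E" "h (xx s) s = w ! (SOME i. i < length ss \<and> ss ! i = s)" if "s \<in> S" for s using that by auto
      have "\<exists>y\<in>carrier E. \<forall>s\<in>S. h y s = h (xx s) s" by (rule crt[OF S]) (rule xx(1))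
      then obtain y where y: "y \<in> carrier E" "\<forall>s\<in>S. h y s = h (xx s) s" by (elim bexE)
      have "f y = w"
      proof (rule nth_equalityI)
        show "length (f y) = length w" using len by (simp add: f_def)
        fix i assume "i < length (f y)"
        then have i: "i < length ss" by (simp add: f_def)
        have "(SOME j. j < length ss \<and> ss ! j = ss ! i) = i"
          by (rule some_equality) (use i ss(2) in \<open>auto simp: nth_eq_iff_index_eq\<close>)
        moreover have "ss ! i \<in> S" using i ss(1) by auto
        ultimately show "f y ! i = w ! i" using y(2) xx(2)[of "ss ! i"] i by (simp add: f_def)
      qed
      then show "w \<in> f ` carrier E" using y(1) by blast
    qed
  qed
  ultimately have iso: "f \<in> ring_iso E ?P" using hom by (auto simp: ring_iso_def bij_betw_def)
  have sep: "finite_separable_extension (LL s)" if s: "s \<in> S" for s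
  proof (rule finite_separable_extensionI[OF L(1)])
    note sn = SN[OF s]
    show "LL s \<subseteq> L" using L(2) sn by (auto simp: LL_def)
    show "to_ac k \<in> LL s" for k unfolding LL_def by (rule image_eqI[of _ _ "scal E k"]) (simp_all add: h_val(3)[OF sn])
    fix x y assume "x \<in> LL s" "y \<in> LL s"
    then obtain u v where uv: "u \<in> carrier E" "x = h u s" "v \<in> carrier E" "y = h v s" unfolding LL_def by auto
    show "x * y \<in> LL s" unfolding LL_def by (rule image_eqI[of _ _ "u \<otimes> v"]) (simp_all add: uv h_val(2)[OF sn])
    show "x + y \<in> LL s" unfolding LL_def by (rule image_eqI[of _ _ "u \<oplus> v"]) (simp_all add: uv h_val(1)[OF sn])
  next
    note sn = SN[OF s]
    show "inverse x \<in> LL s" if x: "x \<in> LL s" for x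
    proof -
      obtain u where u: "u \<in> carrier E" "x = h u s" using x by (auto simp: LL_def)
      show ?thesis
      proof (cases "x = 0")
        case True
        then show ?thesis using x by simp
      next
        case False
        then obtain y where "y \<in> carrier E" "h y s = inverse (h u s)" using h_inverse[OF u(1) sn] u(2) by blast
        then show ?thesis unfolding LL_def u(2) by (metis imageI)
      qed
    qed
  qed
  show ?thesis
    unfolding finite_etale_def
  proof (intro conjI exI[of _ "map LL ss"] ballI bexI[of _ f])
    show "cring E" by (rule is_cring)
    show "scal E \<in> ring_hom ring_of_type_algebra E" by (rule scal_ring_hom)
    show "finite_separable_extension Ls" if "Ls \<in> set (map LL ss)" for Ls using that sep ss(1) by auto
    show "\<forall>k. f (scal E k) = replicate (length (map LL ss)) (to_ac k)"
      using SN ss(1) by (auto simp: f_def h_val map_replicate_const[symmetric] intro!: map_cong)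
    have "map (\<lambda>L. (ring_of_type_algebra :: 'k alg_closure ring)\<lparr>carrier := L\<rparr>) (map LL ss) = map G ss"
      by (simp add: G_def)
    then show "f \<in> ring_iso E (RDirProd_list (map (\<lambda>L. ring_of_type_algebra\<lparr>carrier := L\<rparr>) (map LL ss)))"
      using iso by (simp only:)
  qed
qed

lemma finite_etale_lambda_E: "finite_etale_lambda E"
  unfolding finite_etale_lambda_def
proof (intro conjI ballI allI)
  fix p q :: "'k set" and x assume "p \<in> nz_primes" "q \<in> nz_primes" "x \<in> carrier E"
  then have pq: "int_prime p" "int_prime q" and x: "x \<in> carrier E" by (auto simp: nz_primes_iff)
  show "psi E p (psi E q x) = psi E q (psi E p x)"
    by (rule inj_onD[OF h_inj]) (use pq x psi_closed in \<open>auto simp: h_psi psi_ghost_commute\<close>)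
qed (use finite_etale_E psi_ring_hom psi_scal in \<open>auto simp: nz_primes_iff\<close>)

text \<open>The candidate root: evaluation at the unit ideal becomes evaluation at \<open>a\<close>
  when composed with \<psi>_a.\<close>

definition base_point :: "'u \<Rightarrow> 'k alg_closure" where
  "base_point = (\<lambda>x\<in>carrier E. h x alg_ints)"

text \<open>Some evaluation has its kernel inside that of \<open>s\<close>: otherwise elements
  \<open>xx r\<close> with value 0 at \<open>r\<close> but not under \<open>s\<close> would have a
  product over \<open>R\<close> that vanishes everywhere and yet is not killed by \<open>s\<close>.
  For such an \<open>r\<close> the pairs of values form a partial embedding, which extends to an
  automorphism of the closure.\<close>

lemma point_is_conjugate:
  assumes s: "s \<in> points E"
  shows "\<exists>\<sigma>\<in>galois_group. \<exists>a\<in>nz_ideals. \<forall>x\<in>carrier E. s x = \<sigma> (h x a)"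
proof -
  have sh: "s \<in> ring_hom E ring_of_type_algebra" and sk: "\<And>k. s (scal E k) = to_ac k"
    using s by (auto simp: points_def)
  have s_ops: "s (x \<otimes> y) = s x * s y" "s (x \<oplus> y) = s x + s y" if "x \<in> carrier E" "y \<in> carrier E" for x y
    using ring_hom_mult[OF sh that] ring_hom_add[OF sh that] by auto
  have s1: "s \<one> = 1" and s0: "s \<zero> = 0" using sk[of 1] sk[of 0] by auto
  have "\<exists>r\<in>R. \<forall>x\<in>carrier E. h x r = 0 \<longrightarrow> s x = 0"
  proof (rule ccontr)
    assume "\<not> ?thesis"
    then obtain xx where xx: "\<And>r. r \<in> R \<Longrightarrow> xx r \<in> carrier E \<and> h (xx r) r = 0 \<and> s (xx r) \<noteq> 0" by metis
    have "\<exists>y\<in>carrier E. s y \<noteq> 0 \<and> (\<forall>r\<in>T. h y r = 0)" if T: "finite T" "T \<subseteq> R" for T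
      using T
    proof (induction T)
      case empty
      then show ?case using s1 by (intro bexI[of _ "\<one>"]) auto
    next
      case (insert t T)
      then obtain y where "y \<in> carrier E" "s y \<noteq> 0" "\<forall>r\<in>T. h y r = 0" by auto
      then show ?case using xx[of t] insert.prems R_nz s_ops
        by (intro bexI[of _ "y \<otimes> xx t"]) (auto simp: h_val subset_iff)
    qed
    from this[OF R(1) subset_refl] obtain y where y: "y \<in> carrier E" "s y \<noteq> 0" "\<forall>r\<in>R. h y r = 0" by blast
    have "y = \<zero>" by (rule h_R_eqI) (use y R_nz in \<open>auto simp: h_val\<close>)
    then show False using y(2) s0 by simp
  qed
  then obtain r where r: "r \<in> R" "\<And>x. x \<in> carrier E \<Longrightarrow> h x r = 0 \<Longrightarrow> s x = 0" by blast
  note rn = R_nz[OF r(1)]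
  define G where "G = (\<lambda>x. (h x r, s x)) ` carrier E"
  have "emb_graph G"
    unfolding emb_graph_def
  proof (intro conjI allI impI)
    show "(to_ac k, to_ac k) \<in> G" for k
      unfolding G_def by (rule image_eqI[of _ _ "scal E k"]) (use rn sk in \<open>auto simp: h_val\<close>)
    fix x y x' y' assume "(x, y) \<in> G" "(x', y') \<in> G"
    then obtain u v where uv: "u \<in> carrier E" "x = h u r" "y = s u" "v \<in> carrier E" "x' = h v r" "y' = s v"
      unfolding G_def by auto
    show "(x + x', y + y') \<in> G" unfolding G_def
      by (rule image_eqI[of _ _ "u \<oplus> v"]) (use uv rn s_ops in \<open>auto simp: h_val\<close>)
    show "(x * x', y * y') \<in> G" unfolding G_def
      by (rule image_eqI[of _ _ "u \<otimes> v"]) (use uv rn s_ops in \<open>auto simp: h_val\<close>)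
  next
    fix y assume "(0, y) \<in> G"
    then show "y = 0" unfolding G_def using r(2) by auto
  qed
  then obtain \<sigma> where \<sigma>: "\<sigma> \<in> galois_group" "\<And>x y. (x, y) \<in> G \<Longrightarrow> \<sigma> x = y"
    using emb_graph_extends_to_automorphism by blast
  have "s x = \<sigma> (h x r)" if "x \<in> carrier E" for x
    using \<sigma>(2)[of "h x r" "s x"] that unfolding G_def by auto
  then show ?thesis using \<sigma>(1) rn by blast
qed

lemma is_root_base_point: "Defs.is_root E base_point"
proof -
  have "base_point \<in> points E"
    unfolding points_def base_point_def
    by (auto simp: h_val intro!: ring_hom_memI)
  moreover have "base_point (psi_ideal E a x) = h x a" if "a \<in> nz_ideals" "x \<in> carrier E" for a x
  proof -
    have "a \<odot> alg_ints = a" using idl_prod_unit[of a a] idl_prod_commute[of a alg_ints] that(1) int_ideal_alg_ints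
      by (simp add: nz_ideals_iff)
    then show ?thesis using h_psi_ideal[OF that] by (simp add: base_point_def)
  qed
  ultimately show ?thesis
    unfolding Defs.is_root_def using point_is_conjugate by (metis (no_types, lifting))
qed

lemma galois_object: "(E, base_point) \<in> galois_objects"
  unfolding galois_objects_def using finite_etale_lambda_E integral_model_max_model is_root_base_point by auto

end

section \<open>Galois objects inside the ghost ring\<close>

lemma RDirProd_list_nth:
  assumes "u \<in> carrier (RDirProd_list Rs)" "v \<in> carrier (RDirProd_list Rs)" "i < length Rs"
  shows "(u \<otimes>\<^bsub>RDirProd_list Rs\<^esub> v) ! i = u ! i \<otimes>\<^bsub>Rs ! i\<^esub> v ! i"
    "(u \<oplus>\<^bsub>RDirProd_list Rs\<^esub> v) ! i = u ! i \<oplus>\<^bsub>Rs ! i\<^esub> v ! i"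
    "\<one>\<^bsub>RDirProd_list Rs\<^esub> ! i = \<one>\<^bsub>Rs ! i\<^esub>"
proof -
  define ks where "ks = [0..<length Rs]"
  have Rs: "Rs = map ((!) Rs) ks" by (simp add: ks_def map_nth)
  have u: "u = map ((!) u) ks" and v: "v = map ((!) v) ks"
    using RDirProd_list_carrier_mem(1)[OF assms(1)] RDirProd_list_carrier_mem(1)[OF assms(2)]
    by (metis ks_def map_nth)+
  have k: "k < length Rs" if "k \<in> set ks" for k using that by (simp add: ks_def)
  note ops = RDirProd_list_ops[of ks "(!) u" "(!) Rs" "(!) v",
      OF RDirProd_list_carrier_mem(2)[OF assms(1) k] RDirProd_list_carrier_mem(2)[OF assms(2) k]]
  show "(u \<otimes>\<^bsub>RDirProd_list Rs\<^esub> v) ! i = u ! i \<otimes>\<^bsub>Rs ! i\<^esub> v ! i"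
    using ops(2) assms(3) unfolding Rs[symmetric] u[symmetric] v[symmetric] by (simp add: ks_def)
  show "(u \<oplus>\<^bsub>RDirProd_list Rs\<^esub> v) ! i = u ! i \<oplus>\<^bsub>Rs ! i\<^esub> v ! i"
    using ops(3) assms(3) unfolding Rs[symmetric] u[symmetric] v[symmetric] by (simp add: ks_def)
  show "\<one>\<^bsub>RDirProd_list Rs\<^esub> ! i = \<one>\<^bsub>Rs ! i\<^esub>"
    using ops(4) assms(3) unfolding Rs[symmetric] u[symmetric] v[symmetric] by (simp add: ks_def)
qed

definition rooted_ghost :: "('k::number_field, 'u) rooted \<Rightarrow> 'u \<Rightarrow> 'k set \<Rightarrow> 'k alg_closure" where
  "rooted_ghost P x = (\<lambda>a\<in>nz_ideals. snd P (psi_ideal (fst P) a x))"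

locale galois_object =
  fixes E :: "('k::number_field, 'u) lring" (structure) and s :: "'u \<Rightarrow> 'k alg_closure"
  assumes obj: "(E, s) \<in> galois_objects"
begin

lemma etale: "finite_etale_lambda E" "Defs.is_root E s"
  using obj by (auto simp: galois_objects_def)

sublocale k_algebra E
  using etale(1) by (auto simp: finite_etale_lambda_def finite_etale_def intro!: k_algebra.intro k_algebra_axioms.intro)

lemma psi_hom:
  assumes "int_prime p"
  shows "psi E p \<in> ring_hom E E" "psi E p (scal E k) = scal E k"
    "int_prime q \<Longrightarrow> x \<in> carrier E \<Longrightarrow> psi E p (psi E q x) = psi E q (psi E p x)"
  using etale(1) assms nz_primes_iff[of p] nz_primes_iff[of q] unfolding finite_etale_lambda_def by blast+

lemma psi_closed: "int_prime p \<Longrightarrow> x \<in> carrier E \<Longrightarrow> psi E p x \<in> carrier E"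
  by (rule ring_hom_closed[OF psi_hom(1)])

lemma s_ops:
  "x \<in> carrier E \<Longrightarrow> y \<in> carrier E \<Longrightarrow> s (x \<otimes> y) = s x * s y"
  "x \<in> carrier E \<Longrightarrow> y \<in> carrier E \<Longrightarrow> s (x \<oplus> y) = s x + s y"
  "s (scal E k) = to_ac k"
proof -
  have s: "s \<in> ring_hom E ring_of_type_algebra" "s (scal E k) = to_ac k"
    using etale(2) unfolding Defs.is_root_def points_def by auto
  then show "x \<in> carrier E \<Longrightarrow> y \<in> carrier E \<Longrightarrow> s (x \<otimes> y) = s x * s y"
    "x \<in> carrier E \<Longrightarrow> y \<in> carrier E \<Longrightarrow> s (x \<oplus> y) = s x + s y" "s (scal E k) = to_ac k"
    using ring_hom_mult[OF s(1)] ring_hom_add[OF s(1)] by auto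
qed

lemma foldr_psi_hom:
  assumes "\<And>p. p \<in> set ps \<Longrightarrow> int_prime p"
  shows "x \<in> carrier E \<Longrightarrow> foldr (psi E) ps x \<in> carrier E"
    "x \<in> carrier E \<Longrightarrow> y \<in> carrier E \<Longrightarrow> foldr (psi E) ps (x \<otimes> y) = foldr (psi E) ps x \<otimes> foldr (psi E) ps y"
    "x \<in> carrier E \<Longrightarrow> y \<in> carrier E \<Longrightarrow> foldr (psi E) ps (x \<oplus> y) = foldr (psi E) ps x \<oplus> foldr (psi E) ps y"
    "foldr (psi E) ps (scal E k) = scal E k"
proof -
  have "(\<forall>x\<in>carrier E. foldr (psi E) ps x \<in> carrier E) \<and>
    (\<forall>x\<in>carrier E. \<forall>y\<in>carrier E. foldr (psi E) ps (x \<otimes> y) = foldr (psi E) ps x \<otimes> foldr (psi E) ps y \<and>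
      foldr (psi E) ps (x \<oplus> y) = foldr (psi E) ps x \<oplus> foldr (psi E) ps y) \<and>
    foldr (psi E) ps (scal E k) = scal E k"
    using assms
  proof (induction ps)
    case (Cons p ps)
    then have p: "int_prime p" by simp
    show ?case
      using Cons psi_closed[OF p] psi_hom(2)[OF p] ring_hom_mult[OF psi_hom(1)[OF p]] ring_hom_add[OF psi_hom(1)[OF p]]
      by auto
  qed simp
  then show "x \<in> carrier E \<Longrightarrow> foldr (psi E) ps x \<in> carrier E"
    "x \<in> carrier E \<Longrightarrow> y \<in> carrier E \<Longrightarrow> foldr (psi E) ps (x \<otimes> y) = foldr (psi E) ps x \<otimes> foldr (psi E) ps y"
    "x \<in> carrier E \<Longrightarrow> y \<in> carrier E \<Longrightarrow> foldr (psi E) ps (x \<oplus> y) = foldr (psi E) ps x \<oplus> foldr (psi E) ps y"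
    "foldr (psi E) ps (scal E k) = scal E k" by auto
qed

lemma foldr_psi_mset:
  assumes "mset ps = mset qs" "\<And>p. p \<in> set ps \<Longrightarrow> int_prime p" and x: "x \<in> carrier E"
  shows "foldr (psi E) ps x = foldr (psi E) qs x"
proof -
  \<comment> \<open>The operators are known to commute on the carrier only; extended by the identity
    elsewhere they commute as functions, as reordering a fold requires.\<close>
  define g where "g p y = (if y \<in> carrier E then psi E p y else y)" for p y
  have g: "foldr (psi E) ps x = foldr g ps x" if "\<And>p. p \<in> set ps \<Longrightarrow> int_prime p" for ps
    using that
  proof (induction ps)
    case (Cons p ps)
    have "foldr (psi E) ps x \<in> carrier E" by (rule foldr_psi_hom(1)[OF _ x]) (use Cons.prems in auto)
    then show ?case using Cons by (simp add: g_def)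
  qed simp
  have sets: "set ps = set qs" using assms(1) by (rule mset_eq_setD)
  have "fold g (rev ps) = fold g (rev qs)"
  proof (rule fold_multiset_equiv)
    fix p q assume "p \<in> set (rev ps)" "q \<in> set (rev ps)"
    then have pq: "int_prime p" "int_prime q" using assms(2) by auto
    show "g p \<circ> g q = g q \<circ> g p"
      by (rule ext) (use pq psi_closed psi_hom(3) in \<open>auto simp: g_def\<close>)
  qed (simp add: assms(1))
  then have "foldr g ps x = foldr g qs x" by (simp add: foldr_conv_fold)
  then show ?thesis using g[of ps] g[of qs] assms(2) sets by simp
qed

text \<open>By unique factorization the list chosen in \<open>psi_ideal\<close> is a permutation of
  any other list of primes with the same product.\<close>

lemma psi_ideal_foldr:
  assumes "\<And>p. p \<in> set ps \<Longrightarrow> int_prime p" "idl_list ps \<in> nz_ideals" "x \<in> carrier E"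
  shows "psi_ideal E (idl_list ps) x = foldr (psi E) ps x"
proof -
  obtain qs where qs: "\<And>p. p \<in> set qs \<Longrightarrow> int_prime p" "idl_list qs = idl_list ps"
    "\<And>E :: ('k, 'u) lring. psi_ideal E (idl_list ps) = foldr (psi E) qs"
    by (rule psi_ideal_witness[OF assms(2)]) blast
  have "mset qs = mset ps" by (rule idl_list_unique[OF qs(1) assms(1) qs(2)])
  then show ?thesis unfolding qs(3) by (rule foldr_psi_mset[OF _ qs(1) assms(3)])
qed

abbreviation h :: "'u \<Rightarrow> 'k set \<Rightarrow> 'k alg_closure" where
  "h \<equiv> rooted_ghost (E, s)"

lemma h_nz: "a \<in> nz_ideals \<Longrightarrow> h x a = s (psi_ideal E a x)"
  by (simp add: rooted_ghost_def)

lemma h_foldr: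
  assumes a: "a \<in> nz_ideals"
  obtains ps where "\<And>p. p \<in> set ps \<Longrightarrow> int_prime p" "idl_list ps = a"
    "\<And>x. x \<in> carrier E \<Longrightarrow> h x a = s (foldr (psi E) ps x)"
proof -
  obtain ps where ps: "\<And>p. p \<in> set ps \<Longrightarrow> int_prime p" "idl_list ps = a"
    using psi_ideal_witness[OF a] by metis
  show ?thesis
  proof (rule that[OF ps])
    fix x assume x: "x \<in> carrier E"
    have "psi_ideal E (idl_list ps) x = foldr (psi E) ps x" by (rule psi_ideal_foldr) (use ps a x in auto)
    then show "h x a = s (foldr (psi E) ps x)" using a unfolding ps(2) by (simp add: h_nz)
  qed
qed

lemma h_unit: "x \<in> carrier E \<Longrightarrow> h x alg_ints = s x"
  using psi_ideal_foldr[of "[]"] by (simp add: h_nz)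

text \<open>Injectivity is where the root property enters. The components of the decomposition into
  fields are points, each of the form \<sigma> \<circ> s \<circ> \<psi>_a, so they agree on elements
  with equal ghost images.\<close>

lemma h_is_ghost_hom: "ghost_hom E h"
proof
  have G: "h x \<in> carrier ghost" for x by (simp add: rooted_ghost_def ghost_ring_simps restrict_PiE_iff)
  fix x y assume x: "x \<in> carrier E" and y: "y \<in> carrier E"
  show "h (x \<oplus> y) = h x \<oplus>\<^bsub>ghost\<^esub> h y"
  proof (rule ghost_eqI[OF G ghost.a_closed[OF G G]])
    fix a :: "'k set" assume a: "a \<in> nz_ideals"
    obtain ps where ps: "\<And>p. p \<in> set ps \<Longrightarrow> int_prime p" "\<And>x. x \<in> carrier E \<Longrightarrow> h x a = s (foldr (psi E) ps x)"
      by (rule h_foldr[OF a]) (rule that)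
    show "h (x \<oplus> y) a = (h x \<oplus>\<^bsub>ghost\<^esub> h y) a"
      using x y a foldr_psi_hom[OF ps(1)] by (simp add: ghost_ring_simps ps(2) s_ops)
  qed
  show "h (x \<otimes> y) = h x \<otimes>\<^bsub>ghost\<^esub> h y"
  proof (rule ghost_eqI[OF G ghost.m_closed[OF G G]])
    fix a :: "'k set" assume a: "a \<in> nz_ideals"
    obtain ps where ps: "\<And>p. p \<in> set ps \<Longrightarrow> int_prime p" "\<And>x. x \<in> carrier E \<Longrightarrow> h x a = s (foldr (psi E) ps x)"
      by (rule h_foldr[OF a]) (rule that)
    show "h (x \<otimes> y) a = (h x \<otimes>\<^bsub>ghost\<^esub> h y) a"
      using x y a foldr_psi_hom[OF ps(1)] by (simp add: ghost_ring_simps ps(2) s_ops)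
  qed
next
  show "h x \<in> carrier ghost" for x by (simp add: rooted_ghost_def ghost_ring_simps restrict_PiE_iff)
  show "h (scal E k) = scal ghost k" for k
  proof (rule ghost_eqI[of _ UNIV _ UNIV])
    fix a :: "'k set" assume a: "a \<in> nz_ideals"
    obtain ps where ps: "\<And>p. p \<in> set ps \<Longrightarrow> int_prime p" "\<And>x. x \<in> carrier E \<Longrightarrow> h x a = s (foldr (psi E) ps x)"
      by (rule h_foldr[OF a]) (rule that)
    show "h (scal E k) a = scal ghost k a"
      using a foldr_psi_hom[OF ps(1)] by (simp add: ghost_ring_simps ps(2) s_ops)
  qed (auto simp: rooted_ghost_def ghost_ring_simps restrict_PiE_iff)
  show "psi E p x \<in> carrier E" if "int_prime p" "x \<in> carrier E" for p x using psi_closed that by blast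
  show "h (psi E p x) = psi ghost p (h x)" if p: "int_prime p" and x: "x \<in> carrier E" for p :: "'k set" and x
  proof (rule ghost_eqI[of _ UNIV _ UNIV])
    fix a :: "'k set" assume a: "a \<in> nz_ideals"
    obtain ps where ps: "\<And>p. p \<in> set ps \<Longrightarrow> int_prime p" "idl_list ps = a" "\<And>x. x \<in> carrier E \<Longrightarrow> h x a = s (foldr (psi E) ps x)"
      by (rule h_foldr[OF a]) (rule that)
    have pps: "int_prime q" if "q \<in> set (p # ps)" for q using that ps(1) p by auto
    have "psi_ideal E (idl_list (p # ps)) x = foldr (psi E) (p # ps) x"
      using psi_ideal_foldr[of "p # ps"] pps p a ps(2) x by simp
    \<comment> \<open>Moving \<open>p\<close> to the innermost place turns the composite for
      \<open>p \<odot> a\<close> into the composite for \<open>a\<close> applied to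
      \<open>psi E p x\<close>.\<close>
    also have "\<dots> = foldr (psi E) (ps @ [p]) x" by (rule foldr_psi_mset[OF _ pps x]) simp_all
    finally have "h x (p \<odot> a) = h (psi E p x) a"
      using ps(2,3) p a x psi_closed by (simp add: h_nz[of "p \<odot> a"])
    then show "h (psi E p x) a = psi ghost p (h x) a" using p a by (simp add: ghost_ring_simps)
  qed (auto simp: rooted_ghost_def ghost_ring_simps restrict_PiE_iff)
  show "inj_on h (carrier E)"
  proof (rule inj_onI)
    fix x y assume xy: "x \<in> carrier E" "y \<in> carrier E" and eq: "h x = h y"
    obtain Ls and f :: "'u \<Rightarrow> 'k alg_closure list" where f: "f \<in> ring_iso E (RDirProd_list (map (\<lambda>L. ring_of_type_algebra\<lparr>carrier := L\<rparr>) Ls))"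
      "\<And>k. f (scal E k) = replicate (length Ls) (to_ac k)"
      using etale(1) unfolding finite_etale_lambda_def finite_etale_def by blast
    define Rs where "Rs = map (\<lambda>L. (ring_of_type_algebra :: 'k alg_closure ring)\<lparr>carrier := L\<rparr>) Ls"
    have fh: "f \<in> ring_hom E (RDirProd_list Rs)" and fb: "bij_betw f (carrier E) (carrier (RDirProd_list Rs))"
      using f(1) by (auto simp: Rs_def ring_iso_def)
    have len: "length (f z) = length Ls" if "z \<in> carrier E" for z
      using RDirProd_list_carrier_mem(1)[OF ring_hom_closed[OF fh that]] by (simp add: Rs_def)
    have Ri: "u \<otimes>\<^bsub>Rs ! i\<^esub> v = u * v" "u \<oplus>\<^bsub>Rs ! i\<^esub> v = u + v" if "i < length Ls" for u v i
      using that by (auto simp: Rs_def ring_of_type_algebra_def)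
    have "f x = f y"
    proof (rule nth_equalityI)
      show "length (f x) = length (f y)" using len xy by simp
      fix i assume "i < length (f x)"
      then have i: "i < length Ls" "i < length Rs" using len xy by (auto simp: Rs_def)
      define t where "t = (\<lambda>z\<in>carrier E. f z ! i)"
      have "t \<in> points E"
        unfolding points_def
      proof (intro CollectI conjI IntI allI ring_hom_memI)
        show "t \<in> extensional (carrier E)" by (simp add: t_def)
        show sc: "t (scal E k) = to_ac k" for k using i f(2) by (simp add: t_def)
        show "t \<one> = \<one>\<^bsub>ring_of_type_algebra\<^esub>" using sc[of 1] by simp
        fix u v assume uv: "u \<in> carrier E" "v \<in> carrier E"
        note c = ring_hom_closed[OF fh uv(1)] ring_hom_closed[OF fh uv(2)]
        show "t (u \<otimes> v) = t u \<otimes>\<^bsub>ring_of_type_algebra\<^esub> t v"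
          using uv ring_hom_mult[OF fh uv] RDirProd_list_nth(1)[OF c i(2)] Ri[OF i(1)] by (simp add: t_def)
        show "t (u \<oplus> v) = t u \<oplus>\<^bsub>ring_of_type_algebra\<^esub> t v"
          using uv ring_hom_add[OF fh uv] RDirProd_list_nth(2)[OF c i(2)] Ri[OF i(1)] by (simp add: t_def)
      qed simp
      then obtain \<sigma> a where "a \<in> nz_ideals" "\<forall>z\<in>carrier E. t z = \<sigma> (s (psi_ideal E a z))"
        using etale(2) unfolding Defs.is_root_def by blast
      then have "t z = \<sigma> (h z a)" if "z \<in> carrier E" for z using that by (simp add: h_nz)
      then show "f x ! i = f y ! i" using xy eq by (simp add: t_def)
    qed
    then show "x = y" using bij_betw_imp_inj_on[OF fb] xy by (auto dest: inj_onD)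
  qed
qed

lemma finite_ghost_hom: "\<exists>R L. finite_ghost_hom E h R L"
proof -
  obtain A where "integral_model E A" using obj by (auto simp: galois_objects_def)
  then show ?thesis by (rule ghost_hom.finite_ghost_hom_of_integral_model[OF h_is_ghost_hom])
qed

end

lemma psi_ideal_lambda_hom:
  fixes E F :: "('k::number_field, 'u) lring"
  assumes f: "f \<in> lambda_hom S E F" and x: "x \<in> carrier E" and a: "a \<in> nz_ideals"
    and closed: "\<And>p x. int_prime p \<Longrightarrow> x \<in> carrier E \<Longrightarrow> psi E p x \<in> carrier E"
  shows "f (psi_ideal E a x) = psi_ideal F a (f x)"
proof -
  obtain ps where ps: "\<And>p. p \<in> set ps \<Longrightarrow> int_prime p" "\<And>E :: ('k, 'u) lring. psi_ideal E a = foldr (psi E) ps"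
    by (rule psi_ideal_witness[OF a]) (rule that)
  have fp: "f (psi E p y) = psi F p (f y)" if "int_prime p" "y \<in> carrier E" for p y
    using f that nz_primes_iff[of p] unfolding lambda_hom_def by blast
  have "foldr (psi E) ps x \<in> carrier E \<and> f (foldr (psi E) ps x) = foldr (psi F) ps (f x)"
    using ps(1) by (induction ps) (auto simp: x fp closed)
  then show ?thesis by (simp add: ps(2))
qed

lemma (in k_algebra) saturation_closed:
  assumes A: "int_subalg A"
  shows "scal E k \<in> saturation A"
    "x \<in> saturation A \<Longrightarrow> y \<in> saturation A \<Longrightarrow> x \<oplus> y \<in> saturation A"
    "x \<in> saturation A \<Longrightarrow> y \<in> saturation A \<Longrightarrow> x \<otimes> y \<in> saturation A"
proof -
  note AD = int_subalgD[OF A]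
  obtain n :: nat where n: "n > 0" "of_nat n * k \<in> alg_ints" by (rule number_field_integer_multiple)
  have "scal E (of_nat n) \<otimes> scal E k \<in> A" using AD(2)[OF n(2)] by simp
  then show "scal E k \<in> saturation A" using n(1) by (auto simp: saturation_def)
  have nat: "scal E (of_nat m) \<in> A" for m :: nat by (rule AD(2)) (simp add: alg_ints_def)
  assume "x \<in> saturation A" "y \<in> saturation A"
  then obtain m n :: nat where xy: "x \<in> carrier E" "m > 0" "scal E (of_nat m) \<otimes> x \<in> A"
    "y \<in> carrier E" "n > 0" "scal E (of_nat n) \<otimes> y \<in> A" unfolding saturation_def by blast
  have eq: "scal E (of_nat (m * n)) \<otimes> x = scal E (of_nat n) \<otimes> (scal E (of_nat m) \<otimes> x)"
    "scal E (of_nat (m * n)) \<otimes> y = scal E (of_nat m) \<otimes> (scal E (of_nat n) \<otimes> y)"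
    "scal E (of_nat (m * n)) \<otimes> (x \<otimes> y) = (scal E (of_nat m) \<otimes> x) \<otimes> (scal E (of_nat n) \<otimes> y)"
    using xy(1,4) by (simp_all add: m_ac)
  have "scal E (of_nat (m * n)) \<otimes> (x \<oplus> y) = scal E (of_nat (m * n)) \<otimes> x \<oplus> scal E (of_nat (m * n)) \<otimes> y"
    by (rule r_distr) (simp_all add: xy)
  then have "scal E (of_nat (m * n)) \<otimes> (x \<oplus> y) \<in> A" "scal E (of_nat (m * n)) \<otimes> (x \<otimes> y) \<in> A"
    using AD(3,4) nat xy(3,6) unfolding eq by simp_all
  moreover have "m * n > 0" using xy by simp
  ultimately show "x \<oplus> y \<in> saturation A" "x \<otimes> y \<in> saturation A" using xy unfolding saturation_def by blast+
qed

lemma (in k_algebra) k_algebra_if_embeds: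
  fixes F :: "('k, 'v) lring"
  assumes closed: "\<And>x. x \<in> carrier F \<Longrightarrow> j x \<in> carrier E"
      "\<And>x y. x \<in> carrier F \<Longrightarrow> y \<in> carrier F \<Longrightarrow> x \<oplus>\<^bsub>F\<^esub> y \<in> carrier F"
      "\<And>x y. x \<in> carrier F \<Longrightarrow> y \<in> carrier F \<Longrightarrow> x \<otimes>\<^bsub>F\<^esub> y \<in> carrier F"
      "\<And>k. scal F k \<in> carrier F"
    and inj: "inj_on j (carrier F)"
    and j: "\<And>x y. x \<in> carrier F \<Longrightarrow> y \<in> carrier F \<Longrightarrow> j (x \<oplus>\<^bsub>F\<^esub> y) = j x \<oplus> j y"
      "\<And>x y. x \<in> carrier F \<Longrightarrow> y \<in> carrier F \<Longrightarrow> j (x \<otimes>\<^bsub>F\<^esub> y) = j x \<otimes> j y"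
      "\<And>k. j (scal F k) = scal E k"
    and units: "\<one>\<^bsub>F\<^esub> = scal F 1" "\<zero>\<^bsub>F\<^esub> = scal F 0"
  shows "k_algebra F"
proof (intro k_algebra.intro k_algebra_axioms.intro cringI abelian_groupI comm_monoidI ring_hom_memI)
  have eqI: "x = y" if "j x = j y" "x \<in> carrier F" "y \<in> carrier F" for x y
    using inj_onD[OF inj that] .
  show "\<exists>y\<in>carrier F. y \<oplus>\<^bsub>F\<^esub> x = \<zero>\<^bsub>F\<^esub>" if "x \<in> carrier F" for x
  proof (rule bexI[of _ "scal F (- 1) \<otimes>\<^bsub>F\<^esub> x"])
    show "scal F (- 1) \<otimes>\<^bsub>F\<^esub> x \<oplus>\<^bsub>F\<^esub> x = \<zero>\<^bsub>F\<^esub>"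
      by (rule eqI) (use that closed in \<open>simp_all add: j units uminus_eq_scal[symmetric] l_neg\<close>)
  qed (use closed that in auto)
  fix x y z assume xyz: "x \<in> carrier F" "y \<in> carrier F" "z \<in> carrier F"
  show "x \<oplus>\<^bsub>F\<^esub> y \<oplus>\<^bsub>F\<^esub> z = x \<oplus>\<^bsub>F\<^esub> (y \<oplus>\<^bsub>F\<^esub> z)" "x \<otimes>\<^bsub>F\<^esub> y \<otimes>\<^bsub>F\<^esub> z = x \<otimes>\<^bsub>F\<^esub> (y \<otimes>\<^bsub>F\<^esub> z)"
    "(x \<oplus>\<^bsub>F\<^esub> y) \<otimes>\<^bsub>F\<^esub> z = x \<otimes>\<^bsub>F\<^esub> z \<oplus>\<^bsub>F\<^esub> y \<otimes>\<^bsub>F\<^esub> z"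
    by (rule eqI; use xyz closed in \<open>simp add: j a_assoc m_assoc l_distr\<close>)+
next
  have eqI: "x = y" if "j x = j y" "x \<in> carrier F" "y \<in> carrier F" for x y
    using inj_onD[OF inj that] .
  fix x y assume xy: "x \<in> carrier F" "y \<in> carrier F"
  show "x \<oplus>\<^bsub>F\<^esub> y = y \<oplus>\<^bsub>F\<^esub> x" "x \<otimes>\<^bsub>F\<^esub> y = y \<otimes>\<^bsub>F\<^esub> x"
    by (rule eqI; use xy closed in \<open>simp add: j a_comm m_comm\<close>)+
next
  have eqI: "x = y" if "j x = j y" "x \<in> carrier F" "y \<in> carrier F" for x y
    using inj_onD[OF inj that] .
  fix x assume x: "x \<in> carrier F"
  show "\<zero>\<^bsub>F\<^esub> \<oplus>\<^bsub>F\<^esub> x = x" "\<one>\<^bsub>F\<^esub> \<otimes>\<^bsub>F\<^esub> x = x"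
    by (rule eqI; use x closed in \<open>simp add: j units\<close>)+
next
  have eqI: "x = y" if "j x = j y" "x \<in> carrier F" "y \<in> carrier F" for x y
    using inj_onD[OF inj that] .
  fix k l :: 'k
  show "scal F (k \<otimes>\<^bsub>ring_of_type_algebra\<^esub> l) = scal F k \<otimes>\<^bsub>F\<^esub> scal F l"
    "scal F (k \<oplus>\<^bsub>ring_of_type_algebra\<^esub> l) = scal F k \<oplus>\<^bsub>F\<^esub> scal F l"
    by (rule eqI; use closed in \<open>simp add: j\<close>)+
qed (use closed units in auto)

section \<open>Finite pieces of K \<otimes> W^a and their copies\<close>

definition ghost_alg :: "('k::number_field set \<Rightarrow> 'k alg_closure) set \<Rightarrow> 'k alg_closure set \<Rightarrow> ('k set \<Rightarrow> 'k alg_closure) set" where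
  "ghost_alg Z L = {\<zeta> \<in> ghost.saturation iwitt. (\<forall>b\<in>nz_ideals. \<zeta> b \<in> L) \<and>
     (\<forall>b\<in>nz_ideals. \<forall>b'\<in>nz_ideals. (\<forall>\<eta>\<in>Z. \<eta> b = \<eta> b') \<longrightarrow> \<zeta> b = \<zeta> b')}"

text \<open>What counts is the relation on ideals of not being separated by \<open>Z\<close>: it has
  finitely many classes and is compatible with multiplication by primes. Hence the members may be
  arbitrary families, as produced by \<open>iwitt_finite_orbit\<close>.\<close>

definition orbit_set :: "('k::number_field set \<Rightarrow> 'k alg_closure) set \<Rightarrow> bool" where
  "orbit_set Z \<longleftrightarrow> finite Z \<and> (\<forall>\<eta>\<in>Z. finite (\<eta> ` nz_ideals)) \<and> (\<forall>p. int_prime p \<longrightarrow> (\<forall>\<eta>\<in>Z. psi ghost p \<eta> \<in> Z))"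

lemma orbit_set_UN: "finite S \<Longrightarrow> (\<And>i. i \<in> S \<Longrightarrow> orbit_set (Z i)) \<Longrightarrow> orbit_set (\<Union>i\<in>S. Z i)"
  unfolding orbit_set_def by blast

lemma iwitt_orbit_set: "x \<in> iwitt \<Longrightarrow> \<exists>Z. orbit_set Z \<and> x \<in> Z"
  using iwitt_finite_orbit[of x] unfolding orbit_set_def by blast

lemma ghost_alg_mono: "Z \<subseteq> Z' \<Longrightarrow> L \<subseteq> L' \<Longrightarrow> ghost_alg Z L \<subseteq> ghost_alg Z' L'"
  unfolding ghost_alg_def by blast

lemma countable_funcset_finite_domain:
  assumes "finite I" "countable S"
  shows "countable (I \<rightarrow>\<^sub>E S)"
proof -
  obtain xs where xs: "set xs = I" using finite_list[OF assms(1)] by blast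
  have "inj_on (\<lambda>f. map f xs) (I \<rightarrow>\<^sub>E S)"
    by (rule inj_onI, rule PiE_ext) (auto simp: xs)
  moreover have "(\<lambda>f. map f xs) ` (I \<rightarrow>\<^sub>E S) \<subseteq> lists S" using xs by (auto dest: PiE_mem)
  ultimately show ?thesis using countable_lists[OF assms(2)] by (meson countable_image_inj_on countable_subset)
qed

lemma finite_field_countable:
  assumes "finite_field L"
  shows "countable L"
proof -
  obtain B where B: "finite B" "L = qvs.span B" using finite_fieldD(8)[OF assms] by blast
  have "L \<subseteq> (\<lambda>u. \<Sum>b\<in>B. of_rat (u b) * b) ` (B \<rightarrow>\<^sub>E (UNIV :: rat set))"
  proof
    fix x assume "x \<in> L"
    then obtain u where "x = (\<Sum>b\<in>B. of_rat (u b) * b)" unfolding B(2) qvs.span_finite[OF B(1)] by blast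
    then have "x = (\<Sum>b\<in>B. of_rat (restrict u B b) * b)" by simp
    then show "x \<in> (\<lambda>u. \<Sum>b\<in>B. of_rat (u b) * b) ` (B \<rightarrow>\<^sub>E (UNIV :: rat set))"
      by (rule image_eqI[of _ _ "restrict u B"]) (simp add: restrict_PiE_iff)
  qed
  moreover have "countable (B \<rightarrow>\<^sub>E (UNIV :: rat set))" using B(1) by (intro countable_funcset_finite_domain) auto
  ultimately show ?thesis by (meson countable_image countable_subset)
qed

lemma finite_field_join:
  assumes "finite_field L1" "finite_field L2"
  obtains L where "finite_field L" "L1 \<subseteq> L" "L2 \<subseteq> L"
proof -
  obtain B1 B2 where B: "finite B1" "L1 = qvs.span B1" "finite B2" "L2 = qvs.span B2"
    using finite_fieldD(8) assms by metis
  obtain L where L: "finite_field L" "B1 \<union> B2 \<subseteq> L" using finite_field_containing[of "B1 \<union> B2"] B by auto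
  obtain C where C: "L = qvs.span C" using finite_fieldD(8)[OF L(1)] by blast
  have "qvs.span B1 \<subseteq> L" "qvs.span B2 \<subseteq> L"
    unfolding C using L(2) by (intro qvs.span_minimal qvs.subspace_span; simp add: C)+
  then show thesis using that L(1) B by blast
qed

lemma psi_saturation_iwitt:
  fixes x :: "'k::number_field set \<Rightarrow> 'k alg_closure"
  assumes p: "int_prime p" and x: "x \<in> ghost.saturation iwitt"
  shows "psi ghost p x \<in> ghost.saturation iwitt"
proof -
  obtain n :: nat where n: "n > 0" "x \<in> carrier ghost" "scal ghost (of_nat n) \<otimes>\<^bsub>ghost\<^esub> x \<in> iwitt"
    using x unfolding ghost.saturation_def by blast
  have "psi ghost p (scal ghost (of_nat n) \<otimes>\<^bsub>ghost\<^esub> x) = scal ghost (of_nat n) \<otimes>\<^bsub>ghost\<^esub> psi ghost p x"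
    by (rule ghost_eqI[of _ UNIV _ UNIV]) (use p in \<open>auto simp: ghost_ring_simps restrict_PiE_iff\<close>)
  then have "scal ghost (of_nat n) \<otimes>\<^bsub>ghost\<^esub> psi ghost p x \<in> iwitt" using iwitt_psi[OF p n(3)] by simp
  then show ?thesis using n psi_ghost_closed[OF p n(2)] unfolding ghost.saturation_def by blast
qed

context
  fixes Z :: "('k::number_field set \<Rightarrow> 'k alg_closure) set" and L :: "'k alg_closure set"
  assumes Z: "orbit_set Z" and L: "finite_field L"
begin

lemma ghost_algD:
  assumes "x \<in> ghost_alg Z L"
  shows "x \<in> ghost.saturation iwitt" "x \<in> carrier ghost" "b \<in> nz_ideals \<Longrightarrow> x b \<in> L"
    "b \<in> nz_ideals \<Longrightarrow> b' \<in> nz_ideals \<Longrightarrow> (\<And>\<eta>. \<eta> \<in> Z \<Longrightarrow> \<eta> b = \<eta> b') \<Longrightarrow> x b = x b'"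
  using assms unfolding ghost_alg_def ghost.saturation_def by blast+

lemma ghost_alg_closed:
  "scal ghost k \<in> ghost_alg Z L"
  "x \<in> ghost_alg Z L \<Longrightarrow> y \<in> ghost_alg Z L \<Longrightarrow> x \<oplus>\<^bsub>ghost\<^esub> y \<in> ghost_alg Z L"
  "x \<in> ghost_alg Z L \<Longrightarrow> y \<in> ghost_alg Z L \<Longrightarrow> x \<otimes>\<^bsub>ghost\<^esub> y \<in> ghost_alg Z L"
  "int_prime p \<Longrightarrow> x \<in> ghost_alg Z L \<Longrightarrow> psi ghost p x \<in> ghost_alg Z L"
proof -
  note sat = ghost.saturation_closed[OF iwitt_int_subalg]
  have I: "x \<in> ghost_alg Z L" if "x \<in> ghost.saturation iwitt" "\<And>b. b \<in> nz_ideals \<Longrightarrow> x b \<in> L"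
    "\<And>b b'. b \<in> nz_ideals \<Longrightarrow> b' \<in> nz_ideals \<Longrightarrow> (\<And>\<eta>. \<eta> \<in> Z \<Longrightarrow> \<eta> b = \<eta> b') \<Longrightarrow> x b = x b'" for x
    using that unfolding ghost_alg_def by blast
  show "scal ghost k \<in> ghost_alg Z L"
    by (rule I[OF sat(1)]) (simp_all add: ghost_ring_simps finite_fieldD(1)[OF L])
  {
    assume x: "x \<in> ghost_alg Z L" and y: "y \<in> ghost_alg Z L"
    show "x \<oplus>\<^bsub>ghost\<^esub> y \<in> ghost_alg Z L"
    proof (rule I[OF sat(2)[OF ghost_algD(1)[OF x] ghost_algD(1)[OF y]]])
      fix b b' :: "'k set" assume b: "b \<in> nz_ideals" "b' \<in> nz_ideals" "\<And>\<eta>. \<eta> \<in> Z \<Longrightarrow> \<eta> b = \<eta> b'"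
      show "(x \<oplus>\<^bsub>ghost\<^esub> y) b = (x \<oplus>\<^bsub>ghost\<^esub> y) b'" using b ghost_algD(4)[OF x b] ghost_algD(4)[OF y b] by (simp add: ghost_ring_simps)
    qed (simp add: ghost_ring_simps finite_fieldD(3)[OF L] ghost_algD(3)[OF x] ghost_algD(3)[OF y])
    show "x \<otimes>\<^bsub>ghost\<^esub> y \<in> ghost_alg Z L"
    proof (rule I[OF sat(3)[OF ghost_algD(1)[OF x] ghost_algD(1)[OF y]]])
      fix b b' :: "'k set" assume b: "b \<in> nz_ideals" "b' \<in> nz_ideals" "\<And>\<eta>. \<eta> \<in> Z \<Longrightarrow> \<eta> b = \<eta> b'"
      show "(x \<otimes>\<^bsub>ghost\<^esub> y) b = (x \<otimes>\<^bsub>ghost\<^esub> y) b'" using b ghost_algD(4)[OF x b] ghost_algD(4)[OF y b] by (simp add: ghost_ring_simps)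
    qed (simp add: ghost_ring_simps finite_fieldD(2)[OF L] ghost_algD(3)[OF x] ghost_algD(3)[OF y])
  }
  assume p: "int_prime p" and x: "x \<in> ghost_alg Z L"
  show "psi ghost p x \<in> ghost_alg Z L"
  proof (rule I[OF psi_saturation_iwitt[OF p ghost_algD(1)[OF x]]])
    fix b b' :: "'k set" assume b: "b \<in> nz_ideals" "b' \<in> nz_ideals" "\<And>\<eta>. \<eta> \<in> Z \<Longrightarrow> \<eta> b = \<eta> b'"
    \<comment> \<open>By stability of \<open>Z\<close>, ideals not separated by \<open>Z\<close>
      remain so after multiplication by p.\<close>
    have "\<eta> (p \<odot> b) = \<eta> (p \<odot> b')" if "\<eta> \<in> Z" for \<eta>
    proof -
      have "psi ghost p \<eta> \<in> Z" using Z p that unfolding orbit_set_def by blast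
      from b(3)[OF this] show ?thesis using b(1,2) by (simp add: ghost_ring_simps)
    qed
    then show "psi ghost p x b = psi ghost p x b'"
      using b(1,2) p ghost_algD(4)[OF x, of "p \<odot> b" "p \<odot> b'"] by (simp add: ghost_ring_simps)
  qed (simp add: ghost_ring_simps p ghost_algD(3)[OF x])
qed

lemma ghost_alg_representatives:
  "\<exists>R. finite R \<and> R \<subseteq> nz_ideals \<and> (\<forall>b\<in>nz_ideals. \<exists>r\<in>R. \<forall>x\<in>ghost_alg Z L. x b = x r)"
proof -
  define g where "g b = (\<lambda>\<eta>\<in>Z. \<eta> b)" for b :: "'k set"
  have "g ` nz_ideals \<subseteq> (\<Pi>\<^sub>E \<eta>\<in>Z. \<eta> ` nz_ideals)" by (auto simp: g_def restrict_apply)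
  moreover have "finite (\<Pi>\<^sub>E \<eta>\<in>Z. \<eta> ` (nz_ideals :: 'k set set))" using Z unfolding orbit_set_def by (intro finite_PiE) auto
  ultimately have "finite (g ` nz_ideals)" by (rule finite_subset)
  from finite_subset_image[OF this subset_refl] obtain R where R: "R \<subseteq> nz_ideals" "finite R" "g ` nz_ideals = g ` R" by blast
  have "\<exists>r\<in>R. \<forall>x\<in>ghost_alg Z L. x b = x r" if b: "b \<in> nz_ideals" for b
  proof -
    obtain r where r: "r \<in> R" "g b = g r" using R(3) b by blast
    have "\<eta> b = \<eta> r" if "\<eta> \<in> Z" for \<eta> using fun_cong[OF r(2), of \<eta>] that by (simp add: g_def)
    then have "x b = x r" if "x \<in> ghost_alg Z L" for x using ghost_algD(4)[OF that b, of r] R(1) r(1) by blast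
    then show ?thesis using r(1) by blast
  qed
  then show ?thesis using R by blast
qed

text \<open>An element is determined by its values at finitely many representatives, which lie in a
  finite and hence countable extension of the rationals.\<close>

lemma ghost_alg_countable: "countable (ghost_alg Z L)"
proof -
  obtain R where R: "finite R" "R \<subseteq> nz_ideals" "\<forall>b\<in>nz_ideals. \<exists>r\<in>R. \<forall>x\<in>ghost_alg Z L. x b = x r"
    using ghost_alg_representatives by blast
  have "inj_on (\<lambda>x. restrict x R) (ghost_alg Z L)"
  proof (rule inj_onI)
    fix x y assume x: "x \<in> ghost_alg Z L" and y: "y \<in> ghost_alg Z L" and eq: "restrict x R = restrict y R"
    show "x = y"
    proof (rule ghost_eqI[OF ghost_algD(2)[OF x] ghost_algD(2)[OF y]])
      fix b :: "'k set" assume "b \<in> nz_ideals"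
      then obtain r where "r \<in> R" "x b = x r" "y b = y r" using R(3) x y by blast
      then show "x b = y b" using fun_cong[OF eq, of r] by simp
    qed
  qed
  moreover have "(\<lambda>x. restrict x R) ` ghost_alg Z L \<subseteq> R \<rightarrow>\<^sub>E L"
    using R(2) ghost_algD(3) by (auto simp: restrict_apply)
  moreover have "countable (R \<rightarrow>\<^sub>E L)" using R(1) finite_field_countable[OF L] by (rule countable_funcset_finite_domain)
  ultimately show ?thesis by (meson countable_image_inj_on countable_subset)
qed

text \<open>The copy along an injection into \<open>'u\<close> is an instance of
  \<open>finite_ghost_hom\<close>, which supplies the etale structure, the integral model and the
  root. With the base point as root, the ghost map undoes the copying, so its image is the
  subalgebra itself.\<close>

lemma exists_galois_object:
  assumes "infinite (UNIV :: 'u set)"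
  shows "\<exists>P\<in>(galois_objects :: ('k, 'u) rooted set). rooted_ghost P ` carrier (fst P) = ghost_alg Z L"
proof -
  obtain f :: "nat \<Rightarrow> 'u" where f: "inj f" using infinite_countable_subset[OF assms] by blast
  define \<iota> where "\<iota> = f \<circ> to_nat_on (ghost_alg Z L)"
  have \<iota>: "inj_on \<iota> (ghost_alg Z L)"
    unfolding \<iota>_def using inj_on_to_nat_on[OF ghost_alg_countable] f by (meson comp_inj_on inj_on_subset subset_UNIV)
  define j where "j = inv_into (ghost_alg Z L) \<iota>"
  define E :: "('k, 'u) lring" where "E = \<lparr>carrier = \<iota> ` ghost_alg Z L,
    monoid.mult = (\<lambda>x y. \<iota> (j x \<otimes>\<^bsub>ghost\<^esub> j y)), one = \<iota> \<one>\<^bsub>ghost\<^esub>, ring.zero = \<iota> \<zero>\<^bsub>ghost\<^esub>,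
    add = (\<lambda>x y. \<iota> (j x \<oplus>\<^bsub>ghost\<^esub> j y)), scal = (\<lambda>k. \<iota> (scal ghost k)), psi = (\<lambda>p x. \<iota> (psi ghost p (j x)))\<rparr>"
  have Es: "carrier E = \<iota> ` ghost_alg Z L" "x \<otimes>\<^bsub>E\<^esub> y = \<iota> (j x \<otimes>\<^bsub>ghost\<^esub> j y)" "x \<oplus>\<^bsub>E\<^esub> y = \<iota> (j x \<oplus>\<^bsub>ghost\<^esub> j y)"
    "\<one>\<^bsub>E\<^esub> = \<iota> \<one>\<^bsub>ghost\<^esub>" "\<zero>\<^bsub>E\<^esub> = \<iota> \<zero>\<^bsub>ghost\<^esub>" "scal E k = \<iota> (scal ghost k)" "psi E p x = \<iota> (psi ghost p (j x))" for x y k p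
    by (simp_all add: E_def)
  have j\<iota>: "j (\<iota> x) = x" if "x \<in> ghost_alg Z L" for x unfolding j_def by (rule inv_into_f_f[OF \<iota> that])
  have jm: "j x \<in> ghost_alg Z L" if "x \<in> carrier E" for x using that j\<iota> unfolding Es by auto
  have inj: "inj_on j (carrier E)" unfolding Es j_def by (rule inj_on_inv_into) simp
  have j_ops: "x \<oplus>\<^bsub>E\<^esub> y \<in> carrier E \<and> j (x \<oplus>\<^bsub>E\<^esub> y) = j x \<oplus>\<^bsub>ghost\<^esub> j y \<and>
    x \<otimes>\<^bsub>E\<^esub> y \<in> carrier E \<and> j (x \<otimes>\<^bsub>E\<^esub> y) = j x \<otimes>\<^bsub>ghost\<^esub> j y" if "x \<in> carrier E" "y \<in> carrier E" for x y
    using ghost_alg_closed(2,3)[OF jm[OF that(1)] jm[OF that(2)]] by (simp add: Es j\<iota>)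
  have j_scal: "scal E k \<in> carrier E" "j (scal E k) = scal ghost k" for k
    using ghost_alg_closed(1)[of k] by (simp_all add: Es j\<iota>)
  have j_psi: "psi E p x \<in> carrier E \<and> j (psi E p x) = psi ghost p (j x)" if "int_prime p" "x \<in> carrier E" for p x
    using ghost_alg_closed(4)[OF that(1) jm[OF that(2)]] by (simp add: Es j\<iota>)
  have "k_algebra E"
    by (rule ghost.k_algebra_if_embeds[of E j])
      (use j_ops j_scal inj ghost_algD(2)[OF jm] in \<open>auto simp: Es(4-6) ghost.scal_simps(4,5)\<close>)
  then have gh: "ghost_hom E j"
    by (intro ghost_hom.intro ghost_hom_axioms.intro)
      (use j_ops j_scal j_psi inj ghost_algD(2)[OF jm] in auto)
  obtain R where R: "finite R" "R \<subseteq> nz_ideals" "\<forall>b\<in>nz_ideals. \<exists>r\<in>R. \<forall>x\<in>ghost_alg Z L. x b = x r"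
    using ghost_alg_representatives by blast
  have "finite_ghost_hom E j R L"
  proof (intro finite_ghost_hom.intro gh finite_ghost_hom_axioms.intro)
    show "\<exists>r\<in>R. \<forall>x\<in>carrier E. j x b = j x r" if "b \<in> nz_ideals" for b using R(3) that jm by blast
  qed (fact R L | rule ghost_algD(1)[OF jm] ghost_algD(3)[OF jm]; assumption)+
  then interpret F: finite_ghost_hom E j R L .
  have "rooted_ghost (E, F.base_point) x = j x" if x: "x \<in> carrier E" for x
  proof (rule ghost_eqI[of _ UNIV])
    fix a :: "'k set" assume a: "a \<in> nz_ideals"
    have "a \<odot> alg_ints = a" using idl_prod_unit[of a a] idl_prod_commute[of a alg_ints] a int_ideal_alg_ints
      by (simp add: nz_ideals_iff)
    then show "rooted_ghost (E, F.base_point) x a = j x a"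
      using F.h_psi_ideal[OF a x] a by (simp add: rooted_ghost_def F.base_point_def)
  qed (use F.h_closed[OF x] in \<open>auto simp: rooted_ghost_def ghost_ring_simps restrict_PiE_iff\<close>)
  then have "rooted_ghost (E, F.base_point) ` carrier E = j ` carrier E" by (rule image_cong[OF HOL.refl])
  also have "\<dots> = ghost_alg Z L" unfolding Es by (auto simp: j\<iota> image_image)
  finally show ?thesis using F.galois_object by (intro bexI[of _ "(E, F.base_point)"]) auto
qed

end

section \<open>The directed system\<close>

context finite_ghost_hom
begin

text \<open>\<open>Z\<close> is the union of stable sets for the finitely many generators of the
  maximal model. A positive multiple of any element is a combination of these, so the element takes
  equal values at ideals not separated by \<open>Z\<close>.\<close>

lemma image_subset_ghost_alg: "\<exists>Z. orbit_set Z \<and> h ` carrier E \<subseteq> ghost_alg Z L"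
proof -
  obtain B where B: "B \<subseteq> max_model" "finite B" "\<forall>x\<in>max_model. \<exists>c\<in>B \<rightarrow> alg_ints. x = (\<Oplus>b\<in>B. scal E (c b) \<otimes> b)"
    using max_model_finitely_generated by (elim exE conjE)
  have BE: "B \<subseteq> carrier E" using B(1) unfolding max_model_def by blast
  have "\<forall>b\<in>B. \<exists>Z. orbit_set Z \<and> h b \<in> Z"
  proof
    fix b assume "b \<in> B"
    then have "h b \<in> iwitt" using B(1) unfolding max_model_def by blast
    then show "\<exists>Z. orbit_set Z \<and> h b \<in> Z" by (rule iwitt_orbit_set)
  qed
  from bchoice[OF this] obtain Z where Z: "\<forall>b\<in>B. orbit_set (Z b) \<and> h b \<in> Z b" ..
  have "orbit_set (\<Union>b\<in>B. Z b)" using B(2) Z by (intro orbit_set_UN) auto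
  moreover have "h x \<in> ghost_alg (\<Union>b\<in>B. Z b) L" if x: "x \<in> carrier E" for x
    unfolding ghost_alg_def
  proof (intro CollectI conjI ballI impI)
    show "h x \<in> ghost.saturation iwitt" by (rule h_sat[OF x])
    show "h x a \<in> L" if "a \<in> nz_ideals" for a by (rule L(2)[OF x that])
    fix a a' :: "'k set" assume a: "a \<in> nz_ideals" "a' \<in> nz_ideals" and eq: "\<forall>\<eta>\<in>\<Union>b\<in>B. Z b. \<eta> a = \<eta> a'"
    have eqB: "h b a = h b a'" if "b \<in> B" for b using eq Z that by blast
    obtain n :: nat where n: "n > 0" "scal E (of_nat n) \<otimes> x \<in> max_model"
      using x max_model_saturation unfolding saturation_def by blast
    obtain c where c: "scal E (of_nat n) \<otimes> x = (\<Oplus>b\<in>B. scal E (c b) \<otimes> b)" using B(3) n(2) by blast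
    have "of_nat n * h x a = of_nat n * h x a'"
      using h_finsum[OF B(2) BE a(1), of c] h_finsum[OF B(2) BE a(2), of c] x a eqB unfolding c[symmetric] by (simp add: h_val)
    then show "h x a = h x a'" using n(1) by simp
  qed
  ultimately show ?thesis by blast
qed

end

lemma galois_object_ghost_hom:
  fixes P :: "('k::number_field, 'u) rooted"
  assumes "P \<in> galois_objects"
  shows "ghost_hom (fst P) (rooted_ghost P)" "\<exists>R L. finite_ghost_hom (fst P) (rooted_ghost P) R L"
    "x \<in> carrier (fst P) \<Longrightarrow> rooted_ghost P x alg_ints = snd P x"
proof -
  interpret galois_object "fst P" "snd P" by standard (use assms in simp)
  show "ghost_hom (fst P) (rooted_ghost P)" "\<exists>R L. finite_ghost_hom (fst P) (rooted_ghost P) R L"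
    "x \<in> carrier (fst P) \<Longrightarrow> rooted_ghost P x alg_ints = snd P x"
    using h_is_ghost_hom finite_ghost_hom h_unit by auto
qed

lemma galois_object_maximal_integral_model:
  fixes P :: "('k::number_field, 'u) rooted"
  assumes "P \<in> galois_objects"
  shows "maximal_integral_model (fst P) =
    (fst P)\<lparr>carrier := {x \<in> carrier (fst P). rooted_ghost P x \<in> iwitt}\<rparr>"
proof -
  obtain R L where "finite_ghost_hom (fst P) (rooted_ghost P) R L" using galois_object_ghost_hom(2)[OF assms] by blast
  then interpret finite_ghost_hom "fst P" "rooted_ghost P" R L .
  show ?thesis unfolding maximal_integral_model_eq max_model_def ..
qed

lemma galois_object_ghost_alg:
  fixes P :: "('k::number_field, 'u) rooted"
  assumes "P \<in> galois_objects"
  shows "\<exists>Z L. orbit_set Z \<and> finite_field L \<and> rooted_ghost P ` carrier (fst P) \<subseteq> ghost_alg Z L"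
proof -
  obtain R L where "finite_ghost_hom (fst P) (rooted_ghost P) R L" using galois_object_ghost_hom(2)[OF assms] by blast
  then interpret finite_ghost_hom "fst P" "rooted_ghost P" R L .
  show ?thesis using image_subset_ghost_alg L(1) by blast
qed

text \<open>Commuting with all \<psi>_a and with the roots amounts to commuting with the ghost maps.
  As the ghost map of \<open>Q\<close> is injective, at most one such homomorphism exists.\<close>

lemma rooted_hom_ghost:
  fixes P Q :: "('k::number_field, 'u) rooted"
  assumes P: "P \<in> galois_objects" and f: "f \<in> rooted_hom P Q" and x: "x \<in> carrier (fst P)"
  shows "f x \<in> carrier (fst Q)" "rooted_ghost Q (f x) = rooted_ghost P x"
proof -
  interpret ghost_hom "fst P" "rooted_ghost P" by (rule galois_object_ghost_hom(1)[OF P])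
  have fl: "f \<in> lambda_hom UNIV (fst P) (fst Q)" and fs: "\<And>y. y \<in> carrier (fst P) \<Longrightarrow> snd Q (f y) = snd P y"
    using f unfolding rooted_hom_def by auto
  then show "f x \<in> carrier (fst Q)" using x by (auto simp: lambda_hom_def intro: ring_hom_closed)
  have "snd Q (psi_ideal (fst Q) a (f x)) = snd P (psi_ideal (fst P) a x)" if a: "a \<in> nz_ideals" for a
    using psi_ideal_lambda_hom[OF fl x a psi_closed] fs[OF h_psi_ideal(1)[OF a x]] by simp
  then show "rooted_ghost Q (f x) = rooted_ghost P x" unfolding rooted_ghost_def by (rule restrict_ext)
qed

lemma rooted_map_hom:
  fixes P Q :: "('k::number_field, 'u) rooted"
  assumes P: "P \<in> galois_objects" and Q: "Q \<in> galois_objects" and le: "rooted_le P Q"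
  shows "rooted_map P Q \<in> rooted_hom P Q"
proof -
  interpret ghost_hom "fst Q" "rooted_ghost Q" by (rule galois_object_ghost_hom(1)[OF Q])
  obtain f where f: "f \<in> rooted_hom P Q" using le unfolding rooted_le_def by blast
  have "g = f" if g: "g \<in> rooted_hom P Q" for g
  proof (rule extensionalityI[of _ "carrier (fst P)"])
    show "g \<in> extensional (carrier (fst P))" "f \<in> extensional (carrier (fst P))"
      using f g unfolding rooted_hom_def lambda_hom_def by auto
    fix x assume x: "x \<in> carrier (fst P)"
    show "g x = f x"
      by (rule inj_onD[OF h_inj]) (simp_all add: rooted_hom_ghost[OF P _ x] f g)
  qed
  then show ?thesis unfolding rooted_map_def using f by (rule theI[of "\<lambda>f. f \<in> rooted_hom P Q", rotated])
qed

lemma rooted_leI: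
  fixes P Q :: "('k::number_field, 'u) rooted"
  assumes P: "P \<in> galois_objects" and Q: "Q \<in> galois_objects"
    and sub: "rooted_ghost P ` carrier (fst P) \<subseteq> rooted_ghost Q ` carrier (fst Q)"
  shows "rooted_le P Q"
proof -
  interpret P: ghost_hom "fst P" "rooted_ghost P" by (rule galois_object_ghost_hom(1)[OF P])
  interpret Q: ghost_hom "fst Q" "rooted_ghost Q" by (rule galois_object_ghost_hom(1)[OF Q])
  define f where "f = (\<lambda>x\<in>carrier (fst P). inv_into (carrier (fst Q)) (rooted_ghost Q) (rooted_ghost P x))"
  have f: "f x \<in> carrier (fst Q)" "rooted_ghost Q (f x) = rooted_ghost P x" if x: "x \<in> carrier (fst P)" for x
  proof -
    have "rooted_ghost P x \<in> rooted_ghost Q ` carrier (fst Q)" using sub x by blast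
    then show "f x \<in> carrier (fst Q)" "rooted_ghost Q (f x) = rooted_ghost P x"
      using x by (simp_all add: f_def inv_into_into f_inv_into_f)
  qed
  have eqI: "u = v" if "rooted_ghost Q u = rooted_ghost Q v" "u \<in> carrier (fst Q)" "v \<in> carrier (fst Q)" for u v
    by (rule inj_onD[OF Q.h_inj that])
  have "f \<in> rooted_hom P Q"
    unfolding rooted_hom_def lambda_hom_def
  proof (intro CollectI conjI IntI ballI ring_hom_memI)
    show "f \<in> extensional (carrier (fst P))" by (simp add: f_def)
    show sc: "f (scal (fst P) k) = scal (fst Q) k" for k
      by (rule eqI) (simp_all add: f P.h_scal Q.h_scal)
    show "f \<one>\<^bsub>fst P\<^esub> = \<one>\<^bsub>fst Q\<^esub>" using sc[of 1] by simp
    fix x assume x: "x \<in> carrier (fst P)"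
    show "f x \<in> carrier (fst Q)" by (rule f(1)[OF x])
    show "snd Q (f x) = snd P x"
      using galois_object_ghost_hom(3)[OF P x] galois_object_ghost_hom(3)[OF Q f(1)[OF x]] by (simp add: f(2)[OF x])
    show "f (psi (fst P) p x) = psi (fst Q) p (f x)" if "p \<in> nz_primes" for p
    proof -
      have p: "int_prime p" using that by (simp add: nz_primes_iff)
      show ?thesis
        by (rule eqI) (simp_all add: f x P.psi_closed[OF p] Q.psi_closed[OF p] P.h_psi[OF p] Q.h_psi[OF p])
    qed
    fix y assume y: "y \<in> carrier (fst P)"
    show "f (x \<otimes>\<^bsub>fst P\<^esub> y) = f x \<otimes>\<^bsub>fst Q\<^esub> f y" "f (x \<oplus>\<^bsub>fst P\<^esub> y) = f x \<oplus>\<^bsub>fst Q\<^esub> f y"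
      by (rule eqI; simp add: f x y P.h_mult Q.h_mult P.h_add Q.h_add)+
  qed
  then show ?thesis unfolding rooted_le_def by blast
qed

text \<open>Each image lies in some \<open>ghost_alg\<close>; uniting the stable sets and joining
  the fields gives a subalgebra containing both, which a galois object in the same type
  realizes.\<close>

lemma rooted_directed:
  fixes P Q :: "('k::number_field, 'u) rooted"
  assumes P: "P \<in> galois_objects" and Q: "Q \<in> galois_objects" and u: "infinite (UNIV :: 'u set)"
  shows "\<exists>T\<in>galois_objects. rooted_le P T \<and> rooted_le Q T"
proof -
  obtain Z1 L1 where 1: "orbit_set Z1" "finite_field L1" "rooted_ghost P ` carrier (fst P) \<subseteq> ghost_alg Z1 L1"
    using galois_object_ghost_alg[OF P] by blast
  obtain Z2 L2 where 2: "orbit_set Z2" "finite_field L2" "rooted_ghost Q ` carrier (fst Q) \<subseteq> ghost_alg Z2 L2"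
    using galois_object_ghost_alg[OF Q] by blast
  obtain L where L: "finite_field L" "L1 \<subseteq> L" "L2 \<subseteq> L" by (rule finite_field_join[OF 1(2) 2(2)])
  have Z: "orbit_set (Z1 \<union> Z2)" using 1(1) 2(1) unfolding orbit_set_def by blast
  obtain T :: "('k, 'u) rooted" where T: "T \<in> galois_objects" "rooted_ghost T ` carrier (fst T) = ghost_alg (Z1 \<union> Z2) L"
    using exists_galois_object[OF Z L(1) u] by blast
  have "ghost_alg Z1 L1 \<subseteq> ghost_alg (Z1 \<union> Z2) L" "ghost_alg Z2 L2 \<subseteq> ghost_alg (Z1 \<union> Z2) L"
    by (rule ghost_alg_mono; use L in blast)+
  then have "rooted_ghost P ` carrier (fst P) \<subseteq> rooted_ghost T ` carrier (fst T)"
    "rooted_ghost Q ` carrier (fst Q) \<subseteq> rooted_ghost T ` carrier (fst T)"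
    using 1(3) 2(3) unfolding T(2) by (simp_all only: subset_trans)
  then show ?thesis using rooted_leI[OF P T(1)] rooted_leI[OF Q T(1)] T(1) by (intro bexI[of _ T] conjI)
qed

text \<open>A positive multiple \<eta> of a given element is in W^a. A stable set through \<eta> and
  a finite extension containing its values define a subalgebra that contains the element too, as
  division by an integer preserves both conditions.\<close>

lemma union_of_ghost_images:
  assumes u: "infinite (UNIV :: 'u set)"
  shows "(\<Union>P\<in>(galois_objects :: ('k::number_field, 'u) rooted set). rooted_ghost P ` carrier (fst P)) = ghost.saturation iwitt"
proof (intro equalityI subsetI)
  fix \<xi> assume "\<xi> \<in> (\<Union>P\<in>(galois_objects :: ('k, 'u) rooted set). rooted_ghost P ` carrier (fst P))"
  then obtain P :: "('k, 'u) rooted" where P: "P \<in> galois_objects" "\<xi> \<in> rooted_ghost P ` carrier (fst P)" by blast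
  then show "\<xi> \<in> ghost.saturation iwitt" using galois_object_ghost_alg[OF P(1)] unfolding ghost_alg_def by blast
next
  fix \<xi> :: "'k set \<Rightarrow> 'k alg_closure" assume \<xi>: "\<xi> \<in> ghost.saturation iwitt"
  then obtain n :: nat where n: "n > 0" "scal ghost (of_nat n) \<otimes>\<^bsub>ghost\<^esub> \<xi> \<in> iwitt"
    unfolding ghost.saturation_def by blast
  define \<eta> where "\<eta> = scal ghost (of_nat n) \<otimes>\<^bsub>ghost\<^esub> \<xi>"
  have val: "\<eta> a = of_nat n * \<xi> a" if "a \<in> nz_ideals" for a using that by (simp add: \<eta>_def ghost_ring_simps)
  obtain Z where Z: "orbit_set Z" "\<eta> \<in> Z" using iwitt_orbit_set n(2) \<eta>_def by blast
  have "finite (\<eta> ` nz_ideals)" using Z unfolding orbit_set_def by blast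
  then obtain L where L: "finite_field L" "\<eta> ` nz_ideals \<subseteq> L" by (rule finite_field_containing)
  obtain P :: "('k, 'u) rooted" where P: "P \<in> galois_objects" "rooted_ghost P ` carrier (fst P) = ghost_alg Z L"
    using exists_galois_object[OF Z(1) L(1) u] by blast
  have "\<xi> \<in> ghost_alg Z L"
    unfolding ghost_alg_def
  proof (intro CollectI conjI ballI impI \<xi>)
    fix a :: "'k set" assume a: "a \<in> nz_ideals"
    have "inverse (to_ac (of_nat n)) * \<eta> a \<in> L" using L(2) a by (intro finite_fieldD(1,2,4)[OF L(1)]) blast
    then show "\<xi> a \<in> L" using n(1) by (simp add: val[OF a] mult.assoc[symmetric])
  next
    fix a a' :: "'k set" assume a: "a \<in> nz_ideals" "a' \<in> nz_ideals" "\<forall>\<eta>\<in>Z. \<eta> a = \<eta> a'"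
    then have "\<eta> a = \<eta> a'" using Z(2) by blast
    then show "\<xi> a = \<xi> a'" using n(1) by (simp add: val[OF a(1)] val[OF a(2)])
  qed
  then show "\<xi> \<in> (\<Union>P\<in>(galois_objects :: ('k, 'u) rooted set). rooted_ghost P ` carrier (fst P))" using P by blast
qed

theorem theorem3p1p4:
  fixes W :: "('k::number_field, 'k set \<Rightarrow> 'k alg_closure) lring"
  defines "W \<equiv> integral_witt_ring (carrier ring_of_integers)"
  assumes "infinite (UNIV :: 'u set)"
  shows "(\<exists>\<phi> \<in> lambda_iso UNIV (galois_limit :: ('k, (('k, 'u) rooted \<times> 'u) set) lring) (base_change W).
            \<forall>(E, s)\<in>galois_objects. \<forall>x\<in>carrier E.
              scalar_mult_map (ghost_ring UNIV) (\<phi> (galois_inj (E, s) x)) =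
                (\<lambda>\<aa>\<in>nz_ideals. s (psi_ideal E \<aa> x)))
       \<and> lambda_iso (carrier ring_of_integers)
            (galois_model_limit :: ('k, (('k, 'u) rooted \<times> 'u) set) lring) W \<noteq> {}"
proof
  let ?I = "galois_objects :: ('k, 'u) rooted set"
  note u = assms(2)
  note IA = iwitt_int_subalg
  note union = union_of_ghost_images[OF u]
  have W: "W = ghost\<lparr>carrier := iwitt\<rparr>" unfolding W_def by (rule integral_witt_ring_eq)
  have ne: "?I \<noteq> {}" using union ghost.saturation_closed(1)[OF IA] by blast
  have dir: "\<exists>k\<in>?I. rooted_le i k \<and> rooted_le j k" if "i \<in> ?I" "j \<in> ?I" for i j
    by (rule rooted_directed[OF that u])
  have hom: "ghost_hom (fst i) (rooted_ghost i)" if "i \<in> ?I" for i by (rule galois_object_ghost_hom(1)[OF that])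
  have sat: "rooted_ghost i x \<in> ghost.saturation iwitt" if "i \<in> ?I" "x \<in> carrier (fst i)" for i x
    using union that by blast
  have tr: "rooted_map i j x \<in> carrier (fst j) \<and> rooted_ghost j (rooted_map i j x) = rooted_ghost i x"
    if "i \<in> ?I" "j \<in> ?I" "rooted_le i j" "x \<in> carrier (fst i)" for i j x
    using rooted_hom_ghost[OF that(1) rooted_map_hom[OF that(1-3)] that(4)] by blast
  have hom_facts: "inj_on (rooted_ghost i) (carrier (fst i))"
    "x \<in> carrier (fst i) \<Longrightarrow> y \<in> carrier (fst i) \<Longrightarrow> x \<otimes>\<^bsub>fst i\<^esub> y \<in> carrier (fst i) \<and> rooted_ghost i (x \<otimes>\<^bsub>fst i\<^esub> y) = rooted_ghost i x \<otimes>\<^bsub>ghost\<^esub> rooted_ghost i y"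
    "x \<in> carrier (fst i) \<Longrightarrow> y \<in> carrier (fst i) \<Longrightarrow> x \<oplus>\<^bsub>fst i\<^esub> y \<in> carrier (fst i) \<and> rooted_ghost i (x \<oplus>\<^bsub>fst i\<^esub> y) = rooted_ghost i x \<oplus>\<^bsub>ghost\<^esub> rooted_ghost i y"
    "\<one>\<^bsub>fst i\<^esub> \<in> carrier (fst i) \<and> rooted_ghost i \<one>\<^bsub>fst i\<^esub> = \<one>\<^bsub>ghost\<^esub>"
    "scal (fst i) k \<in> carrier (fst i) \<and> rooted_ghost i (scal (fst i) k) = scal ghost k"
    "p \<in> nz_primes \<Longrightarrow> x \<in> carrier (fst i) \<Longrightarrow> psi (fst i) p x \<in> carrier (fst i) \<and> rooted_ghost i (psi (fst i) p x) = psi ghost p (rooted_ghost i x)"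
    if i: "i \<in> ?I" for i x y k p
  proof -
    interpret ghost_hom "fst i" "rooted_ghost i" by (rule hom[OF i])
    show "\<one>\<^bsub>fst i\<^esub> \<in> carrier (fst i) \<and> rooted_ghost i \<one>\<^bsub>fst i\<^esub> = \<one>\<^bsub>ghost\<^esub>"
      using h_scal[of 1] by (simp add: ghost.scal_simps(4))
    show "p \<in> nz_primes \<Longrightarrow> x \<in> carrier (fst i) \<Longrightarrow> psi (fst i) p x \<in> carrier (fst i) \<and> rooted_ghost i (psi (fst i) p x) = psi ghost p (rooted_ghost i x)"
      by (simp add: nz_primes_iff psi_closed h_psi)
  qed (use ghost_hom.h_inj[OF hom[OF i]] in \<open>auto simp: ghost_hom.h_mult[OF hom[OF i]] ghost_hom.h_add[OF hom[OF i]] ghost_hom.h_scal[OF hom[OF i]]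
      intro!: k_algebra.scal_simps(1)[OF ghost_hom.axioms(1)[OF hom[OF i]]] ring.ring_simprules(1,5)[OF cring.axioms(1)[OF k_algebra.axioms(1)[OF ghost_hom.axioms(1)[OF hom[OF i]]]]]\<close>)
  \<comment> \<open>An element of the limit is to be sent to the tensor whose value is its ghost
    image, which gives the explicit formula for the isomorphism.\<close>
  let ?c = "ghost.tcls iwitt"
  have psi_tcls: "psi (base_change W) p (?c v) = ?c (psi ghost p v)" if "p \<in> nz_primes" "v \<in> ghost.saturation iwitt" for p v
  proof -
    have p: "int_prime p" using that(1) by (simp add: nz_primes_iff)
    show ?thesis
      unfolding W
    proof (rule ghost.tcls_psi[OF IA _ _ _ _ that(2)])
      show "psi ghost p x \<in> iwitt" if "x \<in> iwitt" for x by (rule iwitt_psi[OF p that])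
      show "psi ghost p \<zero>\<^bsub>ghost\<^esub> = \<zero>\<^bsub>ghost\<^esub>"
        by (rule ghost_eqI[of _ UNIV _ UNIV]) (use p in \<open>auto simp: ghost_ring_simps restrict_PiE_iff\<close>)
      show "psi ghost p (x \<oplus>\<^bsub>ghost\<^esub> y) = psi ghost p x \<oplus>\<^bsub>ghost\<^esub> psi ghost p y" for x y
        by (rule ghost_eqI[of _ UNIV _ UNIV]) (use p in \<open>auto simp: ghost_ring_simps restrict_PiE_iff\<close>)
      show "psi ghost p (scal ghost k \<otimes>\<^bsub>ghost\<^esub> x) = scal ghost k \<otimes>\<^bsub>ghost\<^esub> psi ghost p x" for x k
        by (rule ghost_eqI[of _ UNIV _ UNIV]) (use p in \<open>auto simp: ghost_ring_simps restrict_PiE_iff\<close>)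
    qed
  qed
  have c_inj: "v = w" if "?c v = ?c w" "v \<in> ghost.saturation iwitt" "w \<in> ghost.saturation iwitt" for v w
    using arg_cong[OF that(1), of "scalar_mult_map ghost"]
    unfolding ghost.scalar_mult_map_tcls[OF IA that(2)] ghost.scalar_mult_map_tcls[OF IA that(3)] .
  have "\<exists>f\<in>lambda_iso UNIV (direct_limit ?I rooted_le fst rooted_map) (base_change W).
    \<forall>i\<in>?I. \<forall>x\<in>carrier (fst i). f (limit_rel ?I rooted_le fst rooted_map `` {(i, x)}) = ?c (rooted_ghost i x)"
  proof (rule direct_limit_embedding)
    show "(\<Union>i\<in>?I. (\<lambda>x. ?c (rooted_ghost i x)) ` carrier (fst i)) = carrier (base_change W)"
      unfolding W ghost.base_change_carrier[OF IA] union[symmetric] by (simp only: image_UN image_image)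
    show "inj_on (\<lambda>x. ?c (rooted_ghost i x)) (carrier (fst i))" if "i \<in> ?I" for i
    proof (rule inj_onI)
      fix x y assume xy: "x \<in> carrier (fst i)" "y \<in> carrier (fst i)" "?c (rooted_ghost i x) = ?c (rooted_ghost i y)"
      have "rooted_ghost i x = rooted_ghost i y" by (rule c_inj[OF xy(3) sat[OF that xy(1)] sat[OF that xy(2)]])
      then show "x = y" by (rule inj_onD[OF hom_facts(1)[OF that] _ xy(1,2)])
    qed
  qed (use ne dir tr hom_facts(2-) sat psi_tcls in
      \<open>simp_all add: W ghost.tcls_mult[OF IA] ghost.tcls_add[OF IA] ghost.tcls_scal[OF IA]\<close>)
  then obtain f where f: "f \<in> lambda_iso UNIV (galois_limit :: ('k, (('k, 'u) rooted \<times> 'u) set) lring) (base_change W)"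
    "\<And>i x. i \<in> ?I \<Longrightarrow> x \<in> carrier (fst i) \<Longrightarrow> f (galois_inj i x) = ?c (rooted_ghost i x)"
    unfolding galois_limit_def galois_inj_def by blast
  have "scalar_mult_map ghost (f (galois_inj (E, s) x)) = (\<lambda>\<aa>\<in>nz_ideals. s (psi_ideal E \<aa> x))"
    if "(E, s) \<in> ?I" "x \<in> carrier E" for E s x
  proof -
    have x: "x \<in> carrier (fst (E, s))" using that(2) by simp
    have "scalar_mult_map ghost (f (galois_inj (E, s) x)) = rooted_ghost (E, s) x"
      unfolding f(2)[OF that(1) x] by (rule ghost.scalar_mult_map_tcls[OF IA sat[OF that(1) x]])
    then show ?thesis by (simp add: rooted_ghost_def)
  qed
  with f(1) show "\<exists>\<phi> \<in> lambda_iso UNIV (galois_limit :: ('k, (('k, 'u) rooted \<times> 'u) set) lring) (base_change W).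
      \<forall>(E, s)\<in>galois_objects. \<forall>x\<in>carrier E.
        scalar_mult_map (ghost_ring UNIV) (\<phi> (galois_inj (E, s) x)) = (\<lambda>\<aa>\<in>nz_ideals. s (psi_ideal E \<aa> x))"
    by blast
  note AD = ghost.int_subalgD[OF IA]
  let ?M = "\<lambda>i :: ('k, 'u) rooted. maximal_integral_model (fst i)"
  have M: "x \<in> carrier (?M i) \<longleftrightarrow> x \<in> carrier (fst i) \<and> rooted_ghost i x \<in> iwitt"
    "x \<otimes>\<^bsub>?M i\<^esub> y = x \<otimes>\<^bsub>fst i\<^esub> y" "x \<oplus>\<^bsub>?M i\<^esub> y = x \<oplus>\<^bsub>fst i\<^esub> y" "\<one>\<^bsub>?M i\<^esub> = \<one>\<^bsub>fst i\<^esub>"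
    "scal (?M i) k = scal (fst i) k" "psi (?M i) p x = psi (fst i) p x" if "i \<in> ?I" for i x y k p
    unfolding galois_object_maximal_integral_model[OF that] by simp_all
  have Ws: "x \<otimes>\<^bsub>W\<^esub> y = x \<otimes>\<^bsub>ghost\<^esub> y" "x \<oplus>\<^bsub>W\<^esub> y = x \<oplus>\<^bsub>ghost\<^esub> y" "\<one>\<^bsub>W\<^esub> = \<one>\<^bsub>ghost\<^esub>"
    "scal W k = scal ghost k" "psi W p x = psi ghost p x" "carrier W = iwitt" for x y k p
    unfolding W by simp_all
  \<comment> \<open>The transition maps restrict to the maximal models because they preserve ghost
    images.\<close>
  have "\<exists>f\<in>lambda_iso (carrier ring_of_integers) (direct_limit ?I rooted_le ?M rooted_map) W.
    \<forall>i\<in>?I. \<forall>x\<in>carrier (?M i). f (limit_rel ?I rooted_le ?M rooted_map `` {(i, x)}) = rooted_ghost i x"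
  proof (rule direct_limit_embedding)
    show "(\<Union>i\<in>?I. rooted_ghost i ` carrier (?M i)) = carrier W"
    proof -
      have "iwitt \<subseteq> ghost.saturation (iwitt :: ('k set \<Rightarrow> 'k alg_closure) set)"
      proof
        fix x :: "'k set \<Rightarrow> 'k alg_closure" assume x: "x \<in> iwitt"
        then have "scal ghost (of_nat (Suc 0)) \<otimes>\<^bsub>ghost\<^esub> x \<in> iwitt" using AD(1)[OF x] by (simp add: ghost.scal_simps(4))
        then show "x \<in> ghost.saturation iwitt" using AD(1)[OF x] zero_less_Suc[of 0] unfolding ghost.saturation_def by blast
      qed
      note sub = this
      \<comment> \<open>Maximal models are preimages of W^a, so their images are cut out by W^a from
        the images of the full objects.\<close>
      have "rooted_ghost i ` carrier (?M i) = rooted_ghost i ` carrier (fst i) \<inter> iwitt" if "i \<in> ?I" for i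
        using M(1)[OF that] by (simp only: set_eq_iff Int_iff image_iff) blast
      then have "(\<Union>i\<in>?I. rooted_ghost i ` carrier (?M i)) = (\<Union>i\<in>?I. rooted_ghost i ` carrier (fst i) \<inter> iwitt)"
        by (rule SUP_cong[OF HOL.refl])
      also have "\<dots> = (\<Union>i\<in>?I. rooted_ghost i ` carrier (fst i)) \<inter> iwitt" by (simp only: UN_simps)
      also have "\<dots> = iwitt" unfolding union using sub by (rule Int_absorb1)
      finally show ?thesis unfolding Ws .
    qed
    show "inj_on (rooted_ghost i) (carrier (?M i))" if "i \<in> ?I" for i
      using hom_facts(1)[OF that] M(1)[OF that] by (meson inj_on_subset subsetI)
    show "scal (?M i) k \<in> carrier (?M i) \<and> rooted_ghost i (scal (?M i) k) = scal W k"
      if "i \<in> ?I" "k \<in> carrier ring_of_integers" for i k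
      using hom_facts(5)[OF that(1)] AD(2) that(2) by (simp add: M[OF that(1)] Ws)
    show "psi (?M i) p x \<in> carrier (?M i) \<and> rooted_ghost i (psi (?M i) p x) = psi W p (rooted_ghost i x)"
      if "i \<in> ?I" "p \<in> nz_primes" "x \<in> carrier (?M i)" for i p x
    proof -
      have x: "x \<in> carrier (fst i)" "rooted_ghost i x \<in> iwitt" using that(3) M(1)[OF that(1)] by auto
      have "psi ghost p (rooted_ghost i x) \<in> iwitt" by (rule iwitt_psi[OF _ x(2)]) (use that(2) in \<open>simp add: nz_primes_iff\<close>)
      then show ?thesis using hom_facts(6)[OF that(1,2) x(1)] by (simp add: M[OF that(1)] Ws)
    qed
    show "x \<otimes>\<^bsub>?M i\<^esub> y \<in> carrier (?M i) \<and> rooted_ghost i (x \<otimes>\<^bsub>?M i\<^esub> y) = rooted_ghost i x \<otimes>\<^bsub>W\<^esub> rooted_ghost i y"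
      if i: "i \<in> ?I" and xy: "x \<in> carrier (?M i)" "y \<in> carrier (?M i)" for i x y
    proof -
      have x: "x \<in> carrier (fst i)" "rooted_ghost i x \<in> iwitt" and y: "y \<in> carrier (fst i)" "rooted_ghost i y \<in> iwitt"
        using xy M(1)[OF i] by auto
      show ?thesis using hom_facts(2)[OF i x(1) y(1)] AD(4)[OF x(2) y(2)] by (simp add: M[OF i] Ws)
    qed
    show "x \<oplus>\<^bsub>?M i\<^esub> y \<in> carrier (?M i) \<and> rooted_ghost i (x \<oplus>\<^bsub>?M i\<^esub> y) = rooted_ghost i x \<oplus>\<^bsub>W\<^esub> rooted_ghost i y"
      if i: "i \<in> ?I" and xy: "x \<in> carrier (?M i)" "y \<in> carrier (?M i)" for i x y
    proof -
      have x: "x \<in> carrier (fst i)" "rooted_ghost i x \<in> iwitt" and y: "y \<in> carrier (fst i)" "rooted_ghost i y \<in> iwitt"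
        using xy M(1)[OF i] by auto
      show ?thesis using hom_facts(3)[OF i x(1) y(1)] AD(3)[OF x(2) y(2)] by (simp add: M[OF i] Ws)
    qed
  qed (use ne dir tr hom_facts(4) AD(6) in \<open>simp_all add: M Ws\<close>)
  then show "lambda_iso (carrier ring_of_integers) (galois_model_limit :: ('k, (('k, 'u) rooted \<times> 'u) set) lring) W \<noteq> {}"
    unfolding galois_model_limit_def by blast
qed

end
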